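(* (Module form.) Let $R$ be a commutative noetherian ring and let $a: F_\bullet \rightarrow \widetilde{F}_\bullet$ be a quasi-isomorphism of bounded above complexes of free $R$-modules of finite rank. Then $\mathrm{Fitt}_k^i(F_\bullet) = \mathrm{Fitt}_k^i(\widetilde{F}_\bullet)$ for all $i,k\in\mathbb{Z}$. (Sheaf form.) Let $X$ be a projective variety and let $\mathcal{E}^\bullet \rightarrow \mathcal{W}^\bullet$ be a quasi-isomorphism of bounded above cochain complexes of locally free sheaves of finite rank on $X$. Then $\mathrm{Fitt}_k^i(\mathcal{E}^\bullet) = \mathrm{Fitt}_k^i(\mathcal{W}^\bullet)$ for all $i,k \in \mathbb{Z}$.
   Context: For a map $\phi$ between free modules of finite rank and an integer $m$, $I_m(\phi)$ is the ideal generated by the $m\times m$ minors of a matrix of $\phi$, with $I_m(\phi)=(1)$ for $m\le 0$ and $I_m(\phi)=0$ if $m$ exceeds the rank of the source or of the target. For a map of locally free sheaves of finite rank, $I_m$ is the ideal sheaf obtained by gluing these ideals over local trivializations. Module form (chain complex notation). "Bounded above" means $F_\bullet$ has the form $\cdots\to F_{N+2}\xrightarrow{d_{N+2}} F_{N+1}\xrightarrow{d_{N+1}} F_N\to 0$, i.e. $F_j=0$ for $j<N$ for some $N$, with $d_i:F_i\to F_{i-1}$. Put $r_j=\mathrm{rank}\,F_j$, $\chi_i=\sum_{j=N}^{i-1}(-1)^{i-j-1}r_j = r_{i-1}-r_{i-2}+\cdots$, and $\mathrm{Fitt}_k^i(F_\bullet)=I_{\chi_i-k}(d_i)$. Sheaf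 form (cochain complex notation). $\mathcal E^j=0$ for $j\gg 0$, $d^i:\mathcal E^i\to\mathcal E^{i+1}$, $\chi_i=\sum_{j>i}(-1)^{j-i-1}\mathrm{rank}\,\mathcal E^j$, and $\mathrm{Fitt}_k^i(\mathcal E^\bullet)=I_{\chi_i-k}(d^i)$. A variety is an integral scheme of finite type over an algebraically closed field. *)

theory Defs
  imports
    "HOL-Algebra.Algebra"
    "HOL-Combinatorics.Permutations"
    "HOL-Analysis.Abstract_Topology"
begin

section \<open>Free modules and determinantal ideals\<close>

definition linear_maps ::
  "'r ring \<Rightarrow> ('r, 'b) module \<Rightarrow> ('r, 'c) module \<Rightarrow> ('b \<Rightarrow> 'c) set" where
  "linear_maps R M N = {\<phi>. \<phi> \<in> carrier M \<rightarrow> carrier N \<and>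
     (\<forall>x\<in>carrier M. \<forall>y\<in>carrier M. \<phi> (x \<oplus>\<^bsub>M\<^esub> y) = \<phi> x \<oplus>\<^bsub>N\<^esub> \<phi> y) \<and>
     (\<forall>r\<in>carrier R. \<forall>x\<in>carrier M. \<phi> (r \<odot>\<^bsub>M\<^esub> x) = r \<odot>\<^bsub>N\<^esub> \<phi> x)}"

definition module_basis :: "'r ring \<Rightarrow> ('r, 'b) module \<Rightarrow> nat \<Rightarrow> (nat \<Rightarrow> 'b) \<Rightarrow> bool" where
  "module_basis R M n b \<longleftrightarrow> (\<forall>i<n. b i \<in> carrier M) \<and>
     (\<forall>x\<in>carrier M. \<exists>!c. c \<in> {..<n} \<rightarrow>\<^sub>E carrier R \<and> x = (\<Oplus>\<^bsub>M\<^esub>i\<in>{..<n}. c i \<odot>\<^bsub>M\<^esub> b i))"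

definition free_finite_rank :: "'r ring \<Rightarrow> ('r, 'b) module \<Rightarrow> bool" where
  "free_finite_rank R M \<longleftrightarrow> module R M \<and> (\<exists>n b. module_basis R M n b)"

text \<open>All finite bases have the same length unless \<open>R\<close> is the zero ring, over which \<open>LEAST\<close>
  selects rank 0.\<close>

definition free_rank :: "'r ring \<Rightarrow> ('r, 'b) module \<Rightarrow> nat" where
  "free_rank R M = (LEAST n. \<exists>b. module_basis R M n b)"

definition is_matrix_of ::
  "'r ring \<Rightarrow> ('r, 'b) module \<Rightarrow> ('r, 'c) module \<Rightarrow> ('b \<Rightarrow> 'c) \<Rightarrow> (nat \<Rightarrow> nat \<Rightarrow> 'r) \<Rightarrow> bool" where
  "is_matrix_of R M N \<phi> A \<longleftrightarrow> (\<exists>b c.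
     module_basis R M (free_rank R M) b \<and> module_basis R N (free_rank R N) c \<and>
     (\<forall>i<free_rank R N. \<forall>j<free_rank R M. A i j \<in> carrier R) \<and>
     (\<forall>j<free_rank R M. \<phi> (b j) = (\<Oplus>\<^bsub>N\<^esub>i\<in>{..<free_rank R N}. A i j \<odot>\<^bsub>N\<^esub> c i)))"

definition ring_det :: "'r ring \<Rightarrow> nat \<Rightarrow> (nat \<Rightarrow> nat \<Rightarrow> 'r) \<Rightarrow> 'r" where
  "ring_det R t A = (\<Oplus>\<^bsub>R\<^esub>\<sigma>\<in>{\<sigma>. \<sigma> permutes {..<t}}.
     if evenperm \<sigma> then (\<Otimes>\<^bsub>R\<^esub>i\<in>{..<t}. A i (\<sigma> i)) else \<ominus>\<^bsub>R\<^esub> (\<Otimes>\<^bsub>R\<^esub>i\<in>{..<t}. A i (\<sigma> i)))"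

text \<open>The \<open>t \<times> t\<close> minors of a \<open>p \<times> q\<close> matrix; \<open>r\<close> and \<open>c\<close> enumerate the chosen rows and columns.\<close>

definition minors :: "'r ring \<Rightarrow> nat \<Rightarrow> nat \<Rightarrow> (nat \<Rightarrow> nat \<Rightarrow> 'r) \<Rightarrow> nat \<Rightarrow> 'r set" where
  "minors R p q A t = {ring_det R t (\<lambda>i j. A (r i) (c j)) | r c.
     strict_mono_on {..<t} r \<and> r ` {..<t} \<subseteq> {..<p} \<and>
     strict_mono_on {..<t} c \<and> c ` {..<t} \<subseteq> {..<q}}"

definition minor_ideal ::
  "'r ring \<Rightarrow> ('r, 'b) module \<Rightarrow> ('r, 'c) module \<Rightarrow> ('b \<Rightarrow> 'c) \<Rightarrow> int \<Rightarrow> 'r set" where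
  "minor_ideal R M N \<phi> m =
     (if m \<le> 0 then carrier R
      else if m > int (free_rank R M) \<or> m > int (free_rank R N) then {\<zero>\<^bsub>R\<^esub>}
      else Idl\<^bsub>R\<^esub> (minors R (free_rank R N) (free_rank R M) (SOME A. is_matrix_of R M N \<phi> A) (nat m)))"

section \<open>Homology\<close>

text \<open>The homology of \<open>L \<rightarrow> M \<rightarrow> N\<close> at \<open>M\<close>, as an abelian group of cosets, and the map it receives from
  a map \<open>a\<close> of such sequences into one with middle term \<open>M\<close> and boundaries \<open>B\<close>: the class of \<open>z\<close> goes
  to the class of \<open>a z\<close>. When \<open>a\<close> is linear, so is the induced map; hence being an isomorphism of
  groups is the same as being an isomorphism of modules.\<close>

definition homology ::
  "('r, 'b) module \<Rightarrow> ('b \<Rightarrow> 'b) \<Rightarrow> ('r, 'b) module \<Rightarrow> ('b \<Rightarrow> 'b) \<Rightarrow> ('r, 'b) module \<Rightarrow> 'b set monoid" where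
  "homology L f M g N =
     add_monoid (M\<lparr>carrier := {z \<in> carrier M. g z = \<zero>\<^bsub>N\<^esub>}\<rparr>) Mod (f ` carrier L)"

definition induced_on_classes :: "('r, 'c) module \<Rightarrow> 'c set \<Rightarrow> ('b \<Rightarrow> 'c) \<Rightarrow> 'b set \<Rightarrow> 'c set" where
  "induced_on_classes M B a C = B <+>\<^bsub>M\<^esub> a ` C"

section \<open>Complexes of free modules (chain notation)\<close>

definition free_chain_complex ::
  "'r ring \<Rightarrow> (int \<Rightarrow> ('r, 'b) module) \<Rightarrow> (int \<Rightarrow> 'b \<Rightarrow> 'b) \<Rightarrow> bool" where
  "free_chain_complex R F d \<longleftrightarrow>
     (\<forall>i. free_finite_rank R (F i)) \<and>
     (\<forall>i. d i \<in> linear_maps R (F i) (F (i - 1))) \<and>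
     (\<forall>i. \<forall>x\<in>carrier (F i). d (i - 1) (d i x) = \<zero>\<^bsub>F (i - 2)\<^esub>)"

definition chain_bounded_above :: "(int \<Rightarrow> ('r, 'b) module) \<Rightarrow> bool" where
  "chain_bounded_above F \<longleftrightarrow> (\<exists>N. \<forall>j<N. carrier (F j) = {\<zero>\<^bsub>F j\<^esub>})"

definition chain_map ::
  "'r ring \<Rightarrow> (int \<Rightarrow> ('r, 'b) module) \<Rightarrow> (int \<Rightarrow> 'b \<Rightarrow> 'b) \<Rightarrow>
   (int \<Rightarrow> ('r, 'c) module) \<Rightarrow> (int \<Rightarrow> 'c \<Rightarrow> 'c) \<Rightarrow> (int \<Rightarrow> 'b \<Rightarrow> 'c) \<Rightarrow> bool" where
  "chain_map R F d F' d' a \<longleftrightarrow>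
     (\<forall>i. a i \<in> linear_maps R (F i) (F' i)) \<and>
     (\<forall>i. \<forall>x\<in>carrier (F i). a (i - 1) (d i x) = d' i (a i x))"

definition chain_homology ::
  "(int \<Rightarrow> ('r, 'b) module) \<Rightarrow> (int \<Rightarrow> 'b \<Rightarrow> 'b) \<Rightarrow> int \<Rightarrow> 'b set monoid" where
  "chain_homology F d i = homology (F (i + 1)) (d (i + 1)) (F i) (d i) (F (i - 1))"

definition chain_quasi_iso ::
  "'r ring \<Rightarrow> (int \<Rightarrow> ('r, 'b) module) \<Rightarrow> (int \<Rightarrow> 'b \<Rightarrow> 'b) \<Rightarrow>
   (int \<Rightarrow> ('r, 'c) module) \<Rightarrow> (int \<Rightarrow> 'c \<Rightarrow> 'c) \<Rightarrow> (int \<Rightarrow> 'b \<Rightarrow> 'c) \<Rightarrow> bool" where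
  "chain_quasi_iso R F d F' d' a \<longleftrightarrow> chain_map R F d F' d' a \<and>
     (\<forall>i. induced_on_classes (F' i) (d' (i + 1) ` carrier (F' (i + 1))) (a i)
            \<in> iso (chain_homology F d i) (chain_homology F' d' i))"

text \<open>Indices with rank 0 are left out of the alternating sums below so that, for complexes bounded
  on the relevant side, the sums are finite without reference to a particular bound.\<close>

definition chain_chi :: "'r ring \<Rightarrow> (int \<Rightarrow> ('r, 'b) module) \<Rightarrow> int \<Rightarrow> int" where
  "chain_chi R F i = (\<Sum>j\<in>{j. j < i \<and> free_rank R (F j) \<noteq> 0}.
     (- 1) ^ nat (i - j - 1) * int (free_rank R (F j)))"

definition chain_Fitt ::
  "'r ring \<Rightarrow> (int \<Rightarrow> ('r, 'b) module) \<Rightarrow> (int \<Rightarrow> 'b \<Rightarrow> 'b) \<Rightarrow> int \<Rightarrow> int \<Rightarrow> 'r set" where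
  "chain_Fitt R F d k i = minor_ideal R (F i) (F (i - 1)) (d i) (chain_chi R F i - k)"

section \<open>Sheaves and sheafification\<close>

text \<open>Presheaves of sets on a topology \<open>T\<close>: \<open>F U\<close> is the set of sections over \<open>U\<close> and \<open>\<rho> U V\<close> the
  restriction from \<open>U\<close> to \<open>V\<close>. Values at sets that are not open are irrelevant.\<close>

definition is_presheaf ::
  "'p topology \<Rightarrow> ('p set \<Rightarrow> 's set) \<Rightarrow> ('p set \<Rightarrow> 'p set \<Rightarrow> 's \<Rightarrow> 's) \<Rightarrow> bool" where
  "is_presheaf T F \<rho> \<longleftrightarrow>
     (\<forall>U V. openin T U \<and> openin T V \<and> V \<subseteq> U \<longrightarrow> \<rho> U V \<in> F U \<rightarrow> F V) \<and>
     (\<forall>U. openin T U \<longrightarrow> (\<forall>s\<in>F U. \<rho> U U s = s)) \<and>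
     (\<forall>U V W. openin T U \<and> openin T V \<and> openin T W \<and> W \<subseteq> V \<and> V \<subseteq> U \<longrightarrow>
        (\<forall>s\<in>F U. \<rho> V W (\<rho> U V s) = \<rho> U W s))"

definition is_sheaf ::
  "'p topology \<Rightarrow> ('p set \<Rightarrow> 's set) \<Rightarrow> ('p set \<Rightarrow> 'p set \<Rightarrow> 's \<Rightarrow> 's) \<Rightarrow> bool" where
  "is_sheaf T F \<rho> \<longleftrightarrow> is_presheaf T F \<rho> \<and>
     (\<forall>\<U> s. (\<forall>U\<in>\<U>. openin T U \<and> s U \<in> F U) \<and>
             (\<forall>U\<in>\<U>. \<forall>V\<in>\<U>. \<rho> U (U \<inter> V) (s U) = \<rho> V (U \<inter> V) (s V)) \<longrightarrow>
        (\<exists>!t. t \<in> F (\<Union>\<U>) \<and> (\<forall>U\<in>\<U>. \<rho> (\<Union>\<U>) U t = s U)))"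

definition germ ::
  "'p topology \<Rightarrow> ('p set \<Rightarrow> 's set) \<Rightarrow> ('p set \<Rightarrow> 'p set \<Rightarrow> 's \<Rightarrow> 's) \<Rightarrow>
   'p \<Rightarrow> 'p set \<Rightarrow> 's \<Rightarrow> ('p set \<times> 's) set" where
  "germ T F \<rho> x U s = {(V, t). openin T V \<and> x \<in> V \<and> t \<in> F V \<and>
     (\<exists>W. openin T W \<and> x \<in> W \<and> W \<subseteq> U \<inter> V \<and> \<rho> U W s = \<rho> V W t)}"

definition sheafification ::
  "'p topology \<Rightarrow> ('p set \<Rightarrow> 's set) \<Rightarrow> ('p set \<Rightarrow> 'p set \<Rightarrow> 's \<Rightarrow> 's) \<Rightarrow>
   'p set \<Rightarrow> ('p \<Rightarrow> ('p set \<times> 's) set) set" where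
  "sheafification T F \<rho> U = {\<sigma> \<in> extensional U. \<forall>x\<in>U. \<exists>V s.
     openin T V \<and> x \<in> V \<and> V \<subseteq> U \<and> s \<in> F V \<and> (\<forall>y\<in>V. \<sigma> y = germ T F \<rho> y V s)}"

text \<open>The map on sheafifications induced by a map \<open>\<phi>\<close> of presheaves into \<open>(F, \<rho>)\<close>. The sets in the
  union all coincide.\<close>

definition sheafification_map ::
  "'p topology \<Rightarrow> ('p set \<Rightarrow> 't set) \<Rightarrow> ('p set \<Rightarrow> 'p set \<Rightarrow> 't \<Rightarrow> 't) \<Rightarrow> ('p set \<Rightarrow> 's \<Rightarrow> 't) \<Rightarrow>
   'p set \<Rightarrow> ('p \<Rightarrow> ('p set \<times> 's) set) \<Rightarrow> ('p \<Rightarrow> ('p set \<times> 't) set)" where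
  "sheafification_map T F \<rho> \<phi> U \<sigma> = (\<lambda>x\<in>U. \<Union>(V, s)\<in>\<sigma> x. germ T F \<rho> x V (\<phi> V s))"

section \<open>Ringed spaces\<close>

record ('p, 'a) ringed_space =
  base :: "'p topology"
  sections :: "'p set \<Rightarrow> 'a ring"
  res :: "'p set \<Rightarrow> 'p set \<Rightarrow> 'a \<Rightarrow> 'a"

abbreviation open_in :: "('p, 'a) ringed_space \<Rightarrow> 'p set \<Rightarrow> bool" where
  "open_in Z U \<equiv> openin (base Z) U"

abbreviation points :: "('p, 'a) ringed_space \<Rightarrow> 'p set" where
  "points Z \<equiv> topspace (base Z)"

definition is_ringed_space :: "('p, 'a) ringed_space \<Rightarrow> bool" where
  "is_ringed_space Z \<longleftrightarrow>
     is_sheaf (base Z) (\<lambda>U. carrier (sections Z U)) (res Z) \<and>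
     (\<forall>U. open_in Z U \<longrightarrow> cring (sections Z U)) \<and>
     (\<forall>U V. open_in Z U \<and> open_in Z V \<and> V \<subseteq> U \<longrightarrow>
        res Z U V \<in> ring_hom (sections Z U) (sections Z V))"

definition open_subspace :: "('p, 'a) ringed_space \<Rightarrow> 'p set \<Rightarrow> ('p, 'a) ringed_space" where
  "open_subspace Z U = Z\<lparr>base := subtopology (base Z) U\<rparr>"

definition preimage :: "('p, 'a) ringed_space \<Rightarrow> ('p \<Rightarrow> 'q) \<Rightarrow> 'q set \<Rightarrow> 'p set" where
  "preimage Z f V = {x \<in> points Z. f x \<in> V}"

text \<open>A morphism \<open>Z \<rightarrow> Y\<close> is a continuous map \<open>f\<close> together with ring homomorphisms
  \<open>h V\<close> from the sections of \<open>Y\<close> over \<open>V\<close> to the sections of \<open>Z\<close> over the preimage of \<open>V\<close>.\<close>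

definition ringed_morphism ::
  "('p, 'a) ringed_space \<Rightarrow> ('q, 'b) ringed_space \<Rightarrow> ('p \<Rightarrow> 'q) \<Rightarrow> ('q set \<Rightarrow> 'b \<Rightarrow> 'a) \<Rightarrow> bool" where
  "ringed_morphism Z Y f h \<longleftrightarrow>
     continuous_map (base Z) (base Y) f \<and>
     (\<forall>V. open_in Y V \<longrightarrow> h V \<in> ring_hom (sections Y V) (sections Z (preimage Z f V))) \<and>
     (\<forall>V W. open_in Y V \<and> open_in Y W \<and> W \<subseteq> V \<longrightarrow> (\<forall>s\<in>carrier (sections Y V).
        h W (res Y V W s) = res Z (preimage Z f V) (preimage Z f W) (h V s)))"

text \<open>A germ is a unit of the stalk iff it is represented by a unit on some neighbourhood; the second
  conjunct says in these terms that the homomorphisms of stalks reflect units, i.e. are local.\<close>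

definition local_morphism ::
  "('p, 'a) ringed_space \<Rightarrow> ('q, 'b) ringed_space \<Rightarrow> ('p \<Rightarrow> 'q) \<Rightarrow> ('q set \<Rightarrow> 'b \<Rightarrow> 'a) \<Rightarrow> bool" where
  "local_morphism Z Y f h \<longleftrightarrow> ringed_morphism Z Y f h \<and>
     (\<forall>V s x. open_in Y V \<and> s \<in> carrier (sections Y V) \<and> x \<in> preimage Z f V \<and>
        (\<exists>U. open_in Z U \<and> x \<in> U \<and> U \<subseteq> preimage Z f V \<and>
             res Z (preimage Z f V) U (h V s) \<in> Units (sections Z U)) \<longrightarrow>
        (\<exists>W. open_in Y W \<and> f x \<in> W \<and> W \<subseteq> V \<and> res Y V W s \<in> Units (sections Y W)))"

definition ringed_iso ::
  "('p, 'a) ringed_space \<Rightarrow> ('q, 'b) ringed_space \<Rightarrow> ('p \<Rightarrow> 'q) \<Rightarrow> ('q set \<Rightarrow> 'b \<Rightarrow> 'a) \<Rightarrow> bool" where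
  "ringed_iso Z Y f h \<longleftrightarrow> ringed_morphism Z Y f h \<and>
     homeomorphic_map (base Z) (base Y) f \<and>
     (\<forall>V. open_in Y V \<longrightarrow>
        bij_betw (h V) (carrier (sections Y V)) (carrier (sections Z (preimage Z f V))))"

definition closed_immersion ::
  "('p, 'a) ringed_space \<Rightarrow> ('q, 'b) ringed_space \<Rightarrow> ('p \<Rightarrow> 'q) \<Rightarrow> ('q set \<Rightarrow> 'b \<Rightarrow> 'a) \<Rightarrow> bool" where
  "closed_immersion Z Y f h \<longleftrightarrow> local_morphism Z Y f h \<and>
     embedding_map (base Z) (base Y) f \<and> closedin (base Y) (f ` points Z) \<and>
     (\<forall>V. open_in Y V \<longrightarrow> (\<forall>s\<in>carrier (sections Z (preimage Z f V)). \<forall>y\<in>V.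
        \<exists>W. open_in Y W \<and> y \<in> W \<and> W \<subseteq> V \<and>
          (\<exists>t\<in>carrier (sections Y W). h W t = res Z (preimage Z f V) (preimage Z f W) s)))"

section \<open>Spec and Proj\<close>

text \<open>The class of the fraction \<open>a / s\<close> in the localization of \<open>A\<close> at a multiplicative set \<open>S\<close>.\<close>

definition fraction :: "'a ring \<Rightarrow> 'a set \<Rightarrow> 'a \<Rightarrow> 'a \<Rightarrow> ('a \<times> 'a) set" where
  "fraction A S a s = {(b, t). b \<in> carrier A \<and> t \<in> S \<and>
     (\<exists>u\<in>S. u \<otimes>\<^bsub>A\<^esub> (t \<otimes>\<^bsub>A\<^esub> a) = u \<otimes>\<^bsub>A\<^esub> (s \<otimes>\<^bsub>A\<^esub> b))}"

definition fraction_add ::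
  "'a ring \<Rightarrow> 'a set \<Rightarrow> ('a \<times> 'a) set \<Rightarrow> ('a \<times> 'a) set \<Rightarrow> ('a \<times> 'a) set" where
  "fraction_add A S C D = (\<Union>(a, s)\<in>C. \<Union>(b, t)\<in>D.
     fraction A S (a \<otimes>\<^bsub>A\<^esub> t \<oplus>\<^bsub>A\<^esub> b \<otimes>\<^bsub>A\<^esub> s) (s \<otimes>\<^bsub>A\<^esub> t))"

definition fraction_mult ::
  "'a ring \<Rightarrow> 'a set \<Rightarrow> ('a \<times> 'a) set \<Rightarrow> ('a \<times> 'a) set \<Rightarrow> ('a \<times> 'a) set" where
  "fraction_mult A S C D = (\<Union>(a, s)\<in>C. \<Union>(b, t)\<in>D. fraction A S (a \<otimes>\<^bsub>A\<^esub> b) (s \<otimes>\<^bsub>A\<^esub> t))"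

text \<open>The ringed space on \<open>T\<close> whose sections over \<open>U\<close> are the functions on \<open>U\<close> with value at \<open>p\<close> in
  the localization of \<open>A\<close> at \<open>S p\<close> that are locally given by a fraction \<open>a / s\<close> with \<open>Q a s\<close>.
  Operations are pointwise.\<close>

definition fraction_space ::
  "'q topology \<Rightarrow> 'a ring \<Rightarrow> ('q \<Rightarrow> 'a set) \<Rightarrow> ('a \<Rightarrow> 'a \<Rightarrow> bool) \<Rightarrow>
   ('q, 'q \<Rightarrow> ('a \<times> 'a) set) ringed_space" where
  "fraction_space T A S Q = \<lparr>
     base = T,
     sections = (\<lambda>U. \<lparr>
       carrier = {g \<in> extensional U. \<forall>p\<in>U. \<exists>V a s. openin T V \<and> p \<in> V \<and> V \<subseteq> U \<and> Q a s \<and>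
                    (\<forall>q\<in>V. s \<in> S q \<and> g q = fraction A (S q) a s)},
       monoid.mult = (\<lambda>g g'. \<lambda>p\<in>U. fraction_mult A (S p) (g p) (g' p)),
       one = (\<lambda>p\<in>U. fraction A (S p) \<one>\<^bsub>A\<^esub> \<one>\<^bsub>A\<^esub>),
       ring.zero = (\<lambda>p\<in>U. fraction A (S p) \<zero>\<^bsub>A\<^esub> \<one>\<^bsub>A\<^esub>),
       ring.add = (\<lambda>g g'. \<lambda>p\<in>U. fraction_add A (S p) (g p) (g' p))\<rparr>),
     res = (\<lambda>U V g. restrict g V)\<rparr>"

definition Spec :: "'a ring \<Rightarrow> ('a set, 'a set \<Rightarrow> ('a \<times> 'a) set) ringed_space" where
  "Spec A = fraction_space
     (topology_generated_by {{p. primeideal p A \<and> a \<notin> p} | a. a \<in> carrier A})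
     A (\<lambda>p. carrier A - p) (\<lambda>a s. a \<in> carrier A \<and> s \<in> carrier A)"

text \<open>\<open>Proj\<close> of the graded ring \<open>A\<close> with graded pieces \<open>G d\<close>: the points are the homogeneous prime
  ideals not containing the irrelevant ideal, and sections are locally fractions of homogeneous
  elements of the same degree.\<close>

definition Proj_points :: "'a ring \<Rightarrow> (nat \<Rightarrow> 'a set) \<Rightarrow> 'a set set" where
  "Proj_points A G = {p. primeideal p A \<and> p = Idl\<^bsub>A\<^esub> (p \<inter> (\<Union>d. G d)) \<and> \<not> (\<Union>d\<in>{0<..}. G d) \<subseteq> p}"

definition Proj :: "'a ring \<Rightarrow> (nat \<Rightarrow> 'a set) \<Rightarrow> ('a set, 'a set \<Rightarrow> ('a \<times> 'a) set) ringed_space" where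
  "Proj A G = fraction_space
     (topology_generated_by {{p \<in> Proj_points A G. a \<notin> p} | a. a \<in> (\<Union>d. G d)})
     A (\<lambda>p. (\<Union>d. G d) - p) (\<lambda>a s. \<exists>d. a \<in> G d \<and> s \<in> G d)"

text \<open>The polynomial ring in \<open>x\<^sub>0, \<dots>, x\<^sub>n\<close>: a polynomial is its coefficient function on monomials, and
  monomials are multisets of variable indices.\<close>

definition poly_ring_upto :: "'k ring \<Rightarrow> nat \<Rightarrow> (nat multiset \<Rightarrow> 'k) ring" where
  "poly_ring_upto k n = \<lparr>
     carrier = ring.indexed_pset k {..n} (carrier k),
     monoid.mult = (\<lambda>P Q m. \<Oplus>\<^bsub>k\<^esub>l\<in>{l. l \<subseteq># m}. P l \<otimes>\<^bsub>k\<^esub> Q (m - l)),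
     one = ring.indexed_const k \<one>\<^bsub>k\<^esub>,
     ring.zero = ring.indexed_const k \<zero>\<^bsub>k\<^esub>,
     ring.add = ring.indexed_padd k\<rparr>"

definition homogeneous_polys :: "'k ring \<Rightarrow> nat \<Rightarrow> nat \<Rightarrow> (nat multiset \<Rightarrow> 'k) set" where
  "homogeneous_polys k n d = {P \<in> carrier (poly_ring_upto k n). \<forall>m. P m \<noteq> \<zero>\<^bsub>k\<^esub> \<longrightarrow> size m = d}"

definition projective_space ::
  "'k ring \<Rightarrow> nat \<Rightarrow> ((nat multiset \<Rightarrow> 'k) set,
     (nat multiset \<Rightarrow> 'k) set \<Rightarrow> ((nat multiset \<Rightarrow> 'k) \<times> (nat multiset \<Rightarrow> 'k)) set) ringed_space" where
  "projective_space k n = Proj (poly_ring_upto k n) (homogeneous_polys k n)"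

text \<open>Elements of \<open>k\<close> as global functions on \<open>Spec k\<close> and on projective space over \<open>k\<close>.\<close>

definition Spec_const :: "'k ring \<Rightarrow> 'k \<Rightarrow> 'k set \<Rightarrow> ('k \<times> 'k) set" where
  "Spec_const k c = (\<lambda>p\<in>points (Spec k). fraction k (carrier k - p) c \<one>\<^bsub>k\<^esub>)"

definition projective_space_const ::
  "'k ring \<Rightarrow> nat \<Rightarrow> 'k \<Rightarrow> (nat multiset \<Rightarrow> 'k) set \<Rightarrow>
     ((nat multiset \<Rightarrow> 'k) \<times> (nat multiset \<Rightarrow> 'k)) set" where
  "projective_space_const k n c = (\<lambda>p\<in>points (projective_space k n).
     fraction (poly_ring_upto k n) ((\<Union>d. homogeneous_polys k n d) - p)
       (ring.indexed_const k c) \<one>\<^bsub>poly_ring_upto k n\<^esub>)"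

section \<open>Schemes and projective varieties\<close>

text \<open>The ring may be taken with elements in \<open>'a\<close>, since an affine open \<open>U\<close> is isomorphic to the
  spectrum of the ring of sections over \<open>U\<close>.\<close>

definition affine_open :: "('p, 'a) ringed_space \<Rightarrow> 'p set \<Rightarrow> bool" where
  "affine_open Z U \<longleftrightarrow> open_in Z U \<and>
     (\<exists>A :: 'a ring. cring A \<and> (\<exists>f h. ringed_iso (open_subspace Z U) (Spec A) f h))"

text \<open>Locality of the stalks need not be demanded separately: it is inherited from the spectra.\<close>

definition is_scheme :: "('p, 'a) ringed_space \<Rightarrow> bool" where
  "is_scheme Z \<longleftrightarrow> is_ringed_space Z \<and> (\<forall>x\<in>points Z. \<exists>U. affine_open Z U \<and> x \<in> U)"

definition integral_scheme :: "('p, 'a) ringed_space \<Rightarrow> bool" where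
  "integral_scheme Z \<longleftrightarrow> is_scheme Z \<and> points Z \<noteq> {} \<and>
     (\<forall>U. open_in Z U \<and> U \<noteq> {} \<longrightarrow> domain (sections Z U))"

text \<open>The structure map of a scheme \<open>Z\<close> over \<open>k\<close> is a morphism \<open>(f, h)\<close> to \<open>Spec k\<close>.\<close>

definition of_finite_type ::
  "'k ring \<Rightarrow> ('p, 'a) ringed_space \<Rightarrow> ('k set set \<Rightarrow> ('k set \<Rightarrow> ('k \<times> 'k) set) \<Rightarrow> 'a) \<Rightarrow> bool" where
  "of_finite_type k Z h \<longleftrightarrow> (\<exists>\<U>. finite \<U> \<and> \<Union>\<U> = points Z \<and> (\<forall>U\<in>\<U>. affine_open Z U \<and>
     (\<exists>S. finite S \<and> S \<subseteq> carrier (sections Z U) \<and>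
        carrier (sections Z U) = generate_ring (sections Z U)
          ((\<lambda>c. res Z (points Z) U (h (points (Spec k)) (Spec_const k c))) ` carrier k \<union> S))))"

definition variety ::
  "'k ring \<Rightarrow> ('p, 'a) ringed_space \<Rightarrow> ('p \<Rightarrow> 'k set) \<Rightarrow>
   ('k set set \<Rightarrow> ('k set \<Rightarrow> ('k \<times> 'k) set) \<Rightarrow> 'a) \<Rightarrow> bool" where
  "variety k Z f h \<longleftrightarrow> algebraically_closed k \<and> integral_scheme Z \<and>
     local_morphism Z (Spec k) f h \<and> of_finite_type k Z h"

text \<open>Compatibility of the embedding with the structure maps is expressed on constants, because a
  morphism to an affine scheme is determined by its effect on global sections.\<close>

definition projective_variety ::
  "'k ring \<Rightarrow> ('p, 'a) ringed_space \<Rightarrow> ('p \<Rightarrow> 'k set) \<Rightarrow>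
   ('k set set \<Rightarrow> ('k set \<Rightarrow> ('k \<times> 'k) set) \<Rightarrow> 'a) \<Rightarrow> bool" where
  "projective_variety k Z f h \<longleftrightarrow> variety k Z f h \<and>
     (\<exists>n i j. closed_immersion Z (projective_space k n) i j \<and>
        (\<forall>c\<in>carrier k. h (points (Spec k)) (Spec_const k c) =
           j (points (projective_space k n)) (projective_space_const k n c)))"

section \<open>Locally free sheaves\<close>

record ('p, 'a, 'b) module_sheaf =
  msections :: "'p set \<Rightarrow> ('a, 'b) module"
  mres :: "'p set \<Rightarrow> 'p set \<Rightarrow> 'b \<Rightarrow> 'b"

definition sheaf_of_modules :: "('p, 'a) ringed_space \<Rightarrow> ('p, 'a, 'b) module_sheaf \<Rightarrow> bool" where
  "sheaf_of_modules Z E \<longleftrightarrow>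
     is_sheaf (base Z) (\<lambda>U. carrier (msections E U)) (mres E) \<and>
     (\<forall>U. open_in Z U \<longrightarrow> module (sections Z U) (msections E U)) \<and>
     (\<forall>U V. open_in Z U \<and> open_in Z V \<and> V \<subseteq> U \<longrightarrow>
        (\<forall>x\<in>carrier (msections E U). \<forall>y\<in>carrier (msections E U).
           mres E U V (x \<oplus>\<^bsub>msections E U\<^esub> y) = mres E U V x \<oplus>\<^bsub>msections E V\<^esub> mres E U V y) \<and>
        (\<forall>r\<in>carrier (sections Z U). \<forall>x\<in>carrier (msections E U).
           mres E U V (r \<odot>\<^bsub>msections E U\<^esub> x) = res Z U V r \<odot>\<^bsub>msections E V\<^esub> mres E U V x))"

definition sheaf_morphism ::
  "('p, 'a) ringed_space \<Rightarrow> ('p, 'a, 'b) module_sheaf \<Rightarrow> ('p, 'a, 'c) module_sheaf \<Rightarrow>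
   ('p set \<Rightarrow> 'b \<Rightarrow> 'c) \<Rightarrow> bool" where
  "sheaf_morphism Z E W \<phi> \<longleftrightarrow>
     (\<forall>U. open_in Z U \<longrightarrow> \<phi> U \<in> linear_maps (sections Z U) (msections E U) (msections W U)) \<and>
     (\<forall>U V. open_in Z U \<and> open_in Z V \<and> V \<subseteq> U \<longrightarrow>
        (\<forall>x\<in>carrier (msections E U). \<phi> V (mres E U V x) = mres W U V (\<phi> U x)))"

text \<open>A trivialization of rank \<open>n\<close> over \<open>V\<close>, i.e. an isomorphism of the \<open>n\<close>-th power of the structure
  sheaf of \<open>V\<close> with \<open>E\<close> restricted to \<open>V\<close>, is given by sections over \<open>V\<close> that restrict to a basis over
  every smaller open set.\<close>

definition trivialized_on ::
  "('p, 'a) ringed_space \<Rightarrow> ('p, 'a, 'b) module_sheaf \<Rightarrow> 'p set \<Rightarrow> nat \<Rightarrow> bool" where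
  "trivialized_on Z E V n \<longleftrightarrow> open_in Z V \<and>
     (\<exists>b. (\<forall>i<n. b i \<in> carrier (msections E V)) \<and>
        (\<forall>W. open_in Z W \<and> W \<subseteq> V \<longrightarrow>
           module_basis (sections Z W) (msections E W) n (\<lambda>i. mres E V W (b i))))"

definition locally_free :: "('p, 'a) ringed_space \<Rightarrow> ('p, 'a, 'b) module_sheaf \<Rightarrow> bool" where
  "locally_free Z E \<longleftrightarrow> sheaf_of_modules Z E \<and>
     (\<forall>x\<in>points Z. \<exists>V n. x \<in> V \<and> trivialized_on Z E V n)"

text \<open>The rank of a locally free sheaf is constant on a variety, which is nonempty and connected.\<close>

definition sheaf_rank :: "('p, 'a) ringed_space \<Rightarrow> ('p, 'a, 'b) module_sheaf \<Rightarrow> nat" where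
  "sheaf_rank Z E = (THE n. \<forall>x\<in>points Z. \<exists>V. x \<in> V \<and> trivialized_on Z E V n)"

text \<open>The sections over \<open>U\<close> of the ideal sheaf glued from the ideals \<open>I\<^sub>m\<close> of the maps of free modules
  over the open sets that trivialize both sheaves.\<close>

definition minor_ideal_sheaf ::
  "('p, 'a) ringed_space \<Rightarrow> ('p, 'a, 'b) module_sheaf \<Rightarrow> ('p, 'a, 'c) module_sheaf \<Rightarrow>
   ('p set \<Rightarrow> 'b \<Rightarrow> 'c) \<Rightarrow> int \<Rightarrow> 'p set \<Rightarrow> 'a set" where
  "minor_ideal_sheaf Z E W \<phi> m U = {s \<in> carrier (sections Z U). \<forall>x\<in>U. \<exists>V.
     x \<in> V \<and> V \<subseteq> U \<and> (\<exists>n. trivialized_on Z E V n) \<and> (\<exists>n. trivialized_on Z W V n) \<and>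
     res Z U V s \<in> minor_ideal (sections Z V) (msections E V) (msections W V) (\<phi> V) m}"

section \<open>Complexes of locally free sheaves (cochain notation)\<close>

definition locally_free_complex ::
  "('p, 'a) ringed_space \<Rightarrow> (int \<Rightarrow> ('p, 'a, 'b) module_sheaf) \<Rightarrow> (int \<Rightarrow> 'p set \<Rightarrow> 'b \<Rightarrow> 'b) \<Rightarrow> bool" where
  "locally_free_complex Z E d \<longleftrightarrow>
     (\<forall>i. locally_free Z (E i)) \<and>
     (\<forall>i. sheaf_morphism Z (E i) (E (i + 1)) (d i)) \<and>
     (\<forall>i U. open_in Z U \<longrightarrow> (\<forall>x\<in>carrier (msections (E i) U).
        d (i + 1) U (d i U x) = \<zero>\<^bsub>msections (E (i + 2)) U\<^esub>))"

definition cochain_bounded_above ::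
  "('p, 'a) ringed_space \<Rightarrow> (int \<Rightarrow> ('p, 'a, 'b) module_sheaf) \<Rightarrow> bool" where
  "cochain_bounded_above Z E \<longleftrightarrow> (\<exists>N. \<forall>j>N. \<forall>U. open_in Z U \<longrightarrow>
     carrier (msections (E j) U) = {\<zero>\<^bsub>msections (E j) U\<^esub>})"

definition cochain_map ::
  "('p, 'a) ringed_space \<Rightarrow>
   (int \<Rightarrow> ('p, 'a, 'b) module_sheaf) \<Rightarrow> (int \<Rightarrow> 'p set \<Rightarrow> 'b \<Rightarrow> 'b) \<Rightarrow>
   (int \<Rightarrow> ('p, 'a, 'c) module_sheaf) \<Rightarrow> (int \<Rightarrow> 'p set \<Rightarrow> 'c \<Rightarrow> 'c) \<Rightarrow>
   (int \<Rightarrow> 'p set \<Rightarrow> 'b \<Rightarrow> 'c) \<Rightarrow> bool" where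
  "cochain_map Z E d E' d' a \<longleftrightarrow>
     (\<forall>i. sheaf_morphism Z (E i) (E' i) (a i)) \<and>
     (\<forall>i U. open_in Z U \<longrightarrow> (\<forall>x\<in>carrier (msections (E i) U).
        a (i + 1) U (d i U x) = d' i U (a i U x)))"

text \<open>The presheaf \<open>U \<mapsto> ker (d\<^sup>i on U) / im (d\<^sup>i\<^sup>-\<^sup>1 on U)\<close>, whose sheafification is the cohomology sheaf,
  and its restriction maps.\<close>

definition coboundaries ::
  "(int \<Rightarrow> ('p, 'a, 'b) module_sheaf) \<Rightarrow> (int \<Rightarrow> 'p set \<Rightarrow> 'b \<Rightarrow> 'b) \<Rightarrow> int \<Rightarrow> 'p set \<Rightarrow> 'b set" where
  "coboundaries E d i U = d (i - 1) U ` carrier (msections (E (i - 1)) U)"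

definition cohomology_presheaf ::
  "(int \<Rightarrow> ('p, 'a, 'b) module_sheaf) \<Rightarrow> (int \<Rightarrow> 'p set \<Rightarrow> 'b \<Rightarrow> 'b) \<Rightarrow> int \<Rightarrow> 'p set \<Rightarrow> 'b set set" where
  "cohomology_presheaf E d i U = carrier (homology
     (msections (E (i - 1)) U) (d (i - 1) U) (msections (E i) U) (d i U) (msections (E (i + 1)) U))"

definition cohomology_res ::
  "(int \<Rightarrow> ('p, 'a, 'b) module_sheaf) \<Rightarrow> (int \<Rightarrow> 'p set \<Rightarrow> 'b \<Rightarrow> 'b) \<Rightarrow> int \<Rightarrow>
   'p set \<Rightarrow> 'p set \<Rightarrow> 'b set \<Rightarrow> 'b set" where
  "cohomology_res E d i U V =
     induced_on_classes (msections (E i) V) (coboundaries E d i V) (mres (E i) U V)"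

text \<open>The induced morphism of cohomology sheaves respects the module structures automatically, so it
  is an isomorphism iff it is bijective on sections over every open set.\<close>

definition cochain_quasi_iso ::
  "('p, 'a) ringed_space \<Rightarrow>
   (int \<Rightarrow> ('p, 'a, 'b) module_sheaf) \<Rightarrow> (int \<Rightarrow> 'p set \<Rightarrow> 'b \<Rightarrow> 'b) \<Rightarrow>
   (int \<Rightarrow> ('p, 'a, 'c) module_sheaf) \<Rightarrow> (int \<Rightarrow> 'p set \<Rightarrow> 'c \<Rightarrow> 'c) \<Rightarrow>
   (int \<Rightarrow> 'p set \<Rightarrow> 'b \<Rightarrow> 'c) \<Rightarrow> bool" where
  "cochain_quasi_iso Z E d E' d' a \<longleftrightarrow> cochain_map Z E d E' d' a \<and>
     (\<forall>i U. open_in Z U \<longrightarrow>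
        bij_betw
          (sheafification_map (base Z) (cohomology_presheaf E' d' i) (cohomology_res E' d' i)
             (\<lambda>V. induced_on_classes (msections (E' i) V) (coboundaries E' d' i V) (a i V)) U)
          (sheafification (base Z) (cohomology_presheaf E d i) (cohomology_res E d i) U)
          (sheafification (base Z) (cohomology_presheaf E' d' i) (cohomology_res E' d' i) U))"

definition cochain_chi ::
  "('p, 'a) ringed_space \<Rightarrow> (int \<Rightarrow> ('p, 'a, 'b) module_sheaf) \<Rightarrow> int \<Rightarrow> int" where
  "cochain_chi Z E i = (\<Sum>j\<in>{j. j > i \<and> sheaf_rank Z (E j) \<noteq> 0}.
     (- 1) ^ nat (j - i - 1) * int (sheaf_rank Z (E j)))"

definition cochain_Fitt ::
  "('p, 'a) ringed_space \<Rightarrow> (int \<Rightarrow> ('p, 'a, 'b) module_sheaf) \<Rightarrow> (int \<Rightarrow> 'p set \<Rightarrow> 'b \<Rightarrow> 'b) \<Rightarrow>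
   int \<Rightarrow> int \<Rightarrow> 'p set \<Rightarrow> 'a set" where
  "cochain_Fitt Z E d k i = minor_ideal_sheaf Z (E i) (E (i + 1)) (d i) (cochain_chi Z E i - k)"

end

theory Submission
  imports Defs
begin

text \<open>
  For a submodule \<open>S\<close> of \<open>N\<close>, let \<open>I\<^sub>m(S \<subseteq> N)\<close> be the ideal generated by the determinants
  \<open>det (\<xi>\<^sub>i s\<^sub>j)\<close> of size \<open>m\<close>, with \<open>\<xi>\<^sub>i\<close> linear functionals on \<open>N\<close> and \<open>s\<^sub>j \<in> S\<close>. If \<open>N\<close> is free and
  \<open>S\<close> is the image of a map \<open>d\<close> between free modules, this is \<open>I\<^sub>m(d)\<close>; it is visibly independent of
  bases, and adding a free summand of rank \<open>u\<close> to both \<open>S\<close> and \<open>N\<close> replaces \<open>m\<close> by \<open>m + u\<close>.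

  The cone of a quasi-isomorphism of bounded complexes of free modules is contractible, so its cycles
  are stably free of a rank that is an alternating sum of ranks. The contraction yields an isomorphism
  between \<open>F\<^sub>n\<close> and \<open>F'\<^sub>n\<close>, each enlarged by a module built from such cycles, which matches the
  enlarged images of the differentials. The two shifts of \<open>m\<close> differ exactly by \<open>\<chi> - \<chi>'\<close>.

  Over a scheme, a contraction exists only near each point: in every degree only the finitely many
  elements of a basis have to be lifted. A section is in the ideal sheaf iff it is so locally.
\<close>

section \<open>Determinants over commutative rings\<close>

text \<open>Images and cycles of the differentials need not be free, so they have no matrices of
  their own. This shapes three choices. Functionals live on the ambient module only, and a linear
  map of ambient modules under which the image of one subset covers the other gives one inclusion of
  ideals; a map in each direction then replaces an isomorphism of pairs. Since functionals are
  pulled back along such maps, the splitting of the cycles is recorded by maps defined on the whole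
  cone. And the cycles become free only after adding a coordinate module; its rank may be arbitrary,
  because only a difference of two ranks enters the size of the minors.

  Determinants are treated through membership in a given ideal instead of product formulas: signs
  then disappear, and linearity in the rows together with one Laplace step suffices.

  The obstruction to extending a contraction to the next degree is the cycle
  \<open>t - S D t\<close> for each basis element \<open>t\<close>. This is where the
  quasi-isomorphism enters, directly for modules and after shrinking the open set for
  sheaves.\<close>

locale comm_base_ring = cring R for R :: "'a ring" (structure)
begin

definition det_term :: "nat \<Rightarrow> (nat \<Rightarrow> nat \<Rightarrow> 'a) \<Rightarrow> (nat \<Rightarrow> nat) \<Rightarrow> 'a" where
  "det_term t A \<pi> = (if evenperm \<pi> then (\<Otimes>i\<in>{..<t}. A i (\<pi> i)) else \<ominus> (\<Otimes>i\<in>{..<t}. A i (\<pi> i)))"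

lemma ring_det_alt: "ring_det R t A = (\<Oplus>\<pi>\<in>{\<pi>. \<pi> permutes {..<t}}. det_term t A \<pi>)"
  by (simp add: ring_det_def det_term_def)

lemma finite_perms: "finite {\<pi>. \<pi> permutes {..<t::nat}}"
  by (simp add: finite_permutations)

lemma det_term_closed:
  assumes "\<And>i j. i < t \<Longrightarrow> j < t \<Longrightarrow> A i j \<in> carrier R" "\<pi> permutes {..<t}"
  shows "det_term t A \<pi> \<in> carrier R"
proof -
  have "A i (\<pi> i) \<in> carrier R" if "i < t" for i
    using assms that permutes_in_image[OF assms(2), of i] by auto
  then have "(\<Otimes>i\<in>{..<t}. A i (\<pi> i)) \<in> carrier R"
    by (intro finprod_closed) auto
  then show ?thesis by (simp add: det_term_def)
qed

lemma ring_det_closed: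
  assumes "\<And>i j. i < t \<Longrightarrow> j < t \<Longrightarrow> A i j \<in> carrier R"
  shows "ring_det R t A \<in> carrier R"
  unfolding ring_det_alt by (rule finsum_closed) (auto intro: det_term_closed assms)

lemma ring_det_cong:
  assumes "\<And>i j. i < t \<Longrightarrow> j < t \<Longrightarrow> A i j = B i j"
    and "\<And>i j. i < t \<Longrightarrow> j < t \<Longrightarrow> B i j \<in> carrier R"
  shows "ring_det R t A = ring_det R t B"
proof -
  have "det_term t A \<pi> = det_term t B \<pi>" if "\<pi> permutes {..<t}" for \<pi>
  proof -
    have "A i (\<pi> i) = B i (\<pi> i)" "B i (\<pi> i) \<in> carrier R" if "i < t" for i
      using assms that permutes_in_image[OF \<open>\<pi> permutes _\<close>, of i] by auto
    then have "(\<Otimes>i\<in>{..<t}. A i (\<pi> i)) = (\<Otimes>i\<in>{..<t}. B i (\<pi> i))"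
      by (intro finprod_cong') auto
    then show ?thesis by (simp add: det_term_def)
  qed
  then show ?thesis unfolding ring_det_alt
    by (intro finsum_cong') (auto intro: det_term_closed assms)
qed

lemma finprod_perm:
  assumes "\<And>i. i < t \<Longrightarrow> f i \<in> carrier R" "\<tau> permutes {..<t::nat}"
  shows "(\<Otimes>i\<in>{..<t}. f (\<tau> i)) = (\<Otimes>i\<in>{..<t}. f i)"
proof -
  have "(\<Otimes>i\<in>\<tau> ` {..<t}. f i) = (\<Otimes>i\<in>{..<t}. f (\<tau> i))"
    by (rule finprod_reindex)
      (use assms in \<open>auto simp: permutes_image permutes_inj_on\<close>)
  then show ?thesis using permutes_image[OF assms(2)] by simp
qed

text \<open>Inversion of permutations keeps the parity and permutes the index set of the sum, and
  reindexing the product by the permutation exchanges the roles of rows and columns.\<close>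

lemma ring_det_transpose:
  assumes A: "\<And>i j. i < t \<Longrightarrow> j < t \<Longrightarrow> A i j \<in> carrier R"
  shows "ring_det R t (\<lambda>i j. A j i) = ring_det R t A"
proof -
  let ?P = "{\<pi>. \<pi> permutes {..<t}}"
  have eq: "det_term t (\<lambda>i j. A j i) \<pi> = det_term t A (Hilbert_Choice.inv \<pi>)" if p: "\<pi> permutes {..<t}" for \<pi>
  proof -
    have in': "Hilbert_Choice.inv \<pi> k < t" if "k < t" for k
      using that permutes_in_image[OF permutes_inv[OF p], of k] by auto
    have "(\<Otimes>i\<in>{..<t}. A (\<pi> i) i) = (\<Otimes>i\<in>{..<t}. (\<lambda>k. A k (Hilbert_Choice.inv \<pi> k)) (\<pi> i))"
      using permutes_inverses(2)[OF p] by simp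
    also have "\<dots> = (\<Otimes>k\<in>{..<t}. A k (Hilbert_Choice.inv \<pi> k))"
      by (rule finprod_perm[OF _ p]) (use A in' in auto)
    finally show ?thesis
      using evenperm_inv[OF permutes_imp_permutation[OF _ p]] by (simp add: det_term_def)
  qed
  have img: "(\<lambda>\<pi>. Hilbert_Choice.inv \<pi>) ` ?P = ?P"
    by (auto simp: image_iff permutes_inv) (metis permutes_inv permutes_inv_inv)
  have inj: "inj_on (\<lambda>\<pi>. Hilbert_Choice.inv \<pi>) ?P"
    by (metis (mono_tags, lifting) inj_onI mem_Collect_eq permutes_inv_inv)
  have "(\<Oplus>\<pi>\<in>?P. det_term t A (Hilbert_Choice.inv \<pi>)) = (\<Oplus>\<pi>\<in>(\<lambda>\<pi>. Hilbert_Choice.inv \<pi>) ` ?P. det_term t A \<pi>)"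
    by (rule finsum_reindex[symmetric]) (auto simp: inj intro!: det_term_closed A permutes_inv)
  then show ?thesis
    unfolding ring_det_alt img
    by (subst finsum_cong'[OF refl _ eq]) (auto intro!: det_term_closed A permutes_inv)
qed

lemma finsum_a_inv:
  assumes "finite I" "\<And>i. i \<in> I \<Longrightarrow> f i \<in> carrier R"
  shows "(\<Oplus>i\<in>I. \<ominus> f i) = \<ominus> (\<Oplus>i\<in>I. f i)"
  using assms
proof (induction rule: finite_induct)
  case (insert x F)
  then have "(\<Oplus>i\<in>F. f i) \<in> carrier R" by (intro finsum_closed) auto
  with insert show ?case by (simp add: Pi_iff minus_add)
qed simp

text \<open>Reindexing the product by \<tau> turns the term of \<pi> into the term of \<pi> composed
  with the inverse of \<tau>. This composition permutes the summands and changes every sign by the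
  sign of \<tau>.\<close>

lemma ring_det_permute_rows:
  assumes A: "\<And>i j. i < t \<Longrightarrow> j < t \<Longrightarrow> A i j \<in> carrier R" and \<tau>: "\<tau> permutes {..<t}"
  shows "ring_det R t (\<lambda>i j. A (\<tau> i) j) = (if evenperm \<tau> then ring_det R t A else \<ominus> ring_det R t A)"
proof -
  let ?P = "{\<pi>. \<pi> permutes {..<t}}"
  let ?g = "\<lambda>\<pi>. if evenperm \<tau> then det_term t A \<pi> else \<ominus> det_term t A \<pi>"
  have eq: "det_term t (\<lambda>i j. A (\<tau> i) j) \<pi> = ?g (\<pi> \<circ> Hilbert_Choice.inv \<tau>)" if p: "\<pi> permutes {..<t}" for \<pi>
  proof -
    have in': "\<pi> (Hilbert_Choice.inv \<tau> k) < t" if "k < t" for k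
      using that permutes_in_image[OF permutes_inv[OF \<tau>], of k] permutes_in_image[OF p] by auto
    have "(\<Otimes>i\<in>{..<t}. A (\<tau> i) (\<pi> i)) = (\<Otimes>i\<in>{..<t}. (\<lambda>k. A k ((\<pi> \<circ> Hilbert_Choice.inv \<tau>) k)) (\<tau> i))"
      using permutes_inverses(2)[OF \<tau>] by simp
    also have "\<dots> = (\<Otimes>k\<in>{..<t}. A k ((\<pi> \<circ> Hilbert_Choice.inv \<tau>) k))"
      by (rule finprod_perm[OF _ \<tau>]) (use A in' in auto)
    finally have 1: "(\<Otimes>i\<in>{..<t}. A (\<tau> i) (\<pi> i)) = (\<Otimes>k\<in>{..<t}. A k ((\<pi> \<circ> Hilbert_Choice.inv \<tau>) k))" .
    have 2: "(\<Otimes>k\<in>{..<t}. A k ((\<pi> \<circ> Hilbert_Choice.inv \<tau>) k)) \<in> carrier R"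
      by (intro finprod_closed) (use A in' in auto)
    have "permutation \<tau>" "permutation \<pi>" using p \<tau> permutes_imp_permutation by auto
    then have "evenperm (\<pi> \<circ> Hilbert_Choice.inv \<tau>) = (evenperm \<pi> = evenperm \<tau>)"
      by (simp add: evenperm_comp evenperm_inv permutation_inverse)
    then show ?thesis using 1 2 by (auto simp: det_term_def)
  qed
  have cl: "?g \<pi> \<in> carrier R" if "\<pi> permutes {..<t}" for \<pi>
    using det_term_closed[OF A that] by auto
  have img: "(\<lambda>\<pi>. \<pi> \<circ> Hilbert_Choice.inv \<tau>) ` ?P = ?P"
  proof -
    have "\<pi> \<in> (\<lambda>\<pi>. \<pi> \<circ> Hilbert_Choice.inv \<tau>) ` ?P" if "\<pi> permutes {..<t}" for \<pi>
    proof (rule image_eqI[of _ _ "\<pi> \<circ> \<tau>"])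
      show "\<pi> = \<pi> \<circ> \<tau> \<circ> Hilbert_Choice.inv \<tau>" using permutes_inverses(1)[OF \<tau>] by (auto simp: fun_eq_iff)
    qed (use that \<tau> in \<open>auto intro: permutes_compose\<close>)
    then show ?thesis using \<tau> by (auto intro!: permutes_compose permutes_inv)
  qed
  have inj: "inj_on (\<lambda>\<pi>. \<pi> \<circ> Hilbert_Choice.inv \<tau>) ?P"
    by (rule inj_onI) (metis \<tau> comp_assoc comp_id permutes_inv_o(2))
  have pc: "\<pi> \<circ> Hilbert_Choice.inv \<tau> permutes {..<t}" if "\<pi> permutes {..<t}" for \<pi>
    using that \<tau> by (intro permutes_compose permutes_inv)
  have "ring_det R t (\<lambda>i j. A (\<tau> i) j) = (\<Oplus>\<pi>\<in>?P. ?g (\<pi> \<circ> Hilbert_Choice.inv \<tau>))"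
    unfolding ring_det_alt by (rule finsum_cong') (use eq cl pc in auto)
  also have "\<dots> = (\<Oplus>\<pi>\<in>(\<lambda>\<pi>. \<pi> \<circ> Hilbert_Choice.inv \<tau>) ` ?P. ?g \<pi>)"
  proof (rule finsum_reindex[symmetric, OF _ inj])
    show "?g \<in> (\<lambda>\<pi>. \<pi> \<circ> Hilbert_Choice.inv \<tau>) ` ?P \<rightarrow> carrier R"
      unfolding img using cl by blast
  qed
  also have "\<dots> = (\<Oplus>\<pi>\<in>?P. ?g \<pi>)" unfolding img ..
  finally show ?thesis
    using finsum_a_inv[OF finite_perms, of t "det_term t A"] det_term_closed[OF A]
    by (auto simp: ring_det_alt)
qed

text \<open>The sign rule alone only gives twice the determinant equal to zero, which is too weak
  when 2 is a zero divisor. Instead, composition with the transposition of the two rows pairs even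
  with odd permutations and negates each term, so the two halves of the sum cancel.\<close>

lemma ring_det_equal_rows:
  assumes A: "\<And>i j. i < t \<Longrightarrow> j < t \<Longrightarrow> A i j \<in> carrier R"
    and pq: "p < t" "q < t" "p \<noteq> q" and eq: "\<And>j. j < t \<Longrightarrow> A p j = A q j"
  shows "ring_det R t A = \<zero>"
proof -
  let ?\<tau> = "Transposition.transpose p q"
  let ?P = "{\<pi>. \<pi> permutes {..<t}}"
  let ?E = "{\<pi>. \<pi> permutes {..<t} \<and> evenperm \<pi>}"
  let ?O = "{\<pi>. \<pi> permutes {..<t} \<and> \<not> evenperm \<pi>}"
  have \<tau>: "?\<tau> permutes {..<t}" using pq by (intro permutes_swap_id) auto
  have ev: "evenperm (\<pi> \<circ> ?\<tau>) \<longleftrightarrow> \<not> evenperm \<pi>" if "\<pi> permutes {..<t}" for \<pi>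
    using evenperm_comp[OF permutes_imp_permutation[OF _ that] permutation_swap_id, of p q] pq(3)
    by (simp add: evenperm_swap)
  have tt: "\<pi> \<circ> ?\<tau> \<circ> ?\<tau> = \<pi>" for \<pi> :: "nat \<Rightarrow> nat" by (simp add: comp_assoc)
  have neg: "det_term t A (\<pi> \<circ> ?\<tau>) = \<ominus> det_term t A \<pi>" if p: "\<pi> permutes {..<t}" for \<pi>
  proof -
    have in': "\<pi> k < t" if "k < t" for k using that permutes_in_image[OF p] by auto
    have rows: "A (?\<tau> i) j = A i j" if "i < t" "j < t" for i j
      using that eq by (auto simp: Transposition.transpose_def)
    have \<tau>in: "?\<tau> i < t" if "i < t" for i using that permutes_in_image[OF \<tau>] by auto
    have "(\<Otimes>i\<in>{..<t}. A i ((\<pi> \<circ> ?\<tau>) i)) = (\<Otimes>i\<in>{..<t}. (\<lambda>k. A k (\<pi> k)) (?\<tau> i))"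
      by (rule finprod_cong') (use A in' \<tau>in rows in auto)
    also have "\<dots> = (\<Otimes>i\<in>{..<t}. A i (\<pi> i))"
      by (rule finprod_perm[OF _ \<tau>]) (use A in' in auto)
    finally have 1: "(\<Otimes>i\<in>{..<t}. A i ((\<pi> \<circ> ?\<tau>) i)) = (\<Otimes>i\<in>{..<t}. A i (\<pi> i))" .
    moreover have "(\<Otimes>i\<in>{..<t}. A i (\<pi> i)) \<in> carrier R"
      by (intro finprod_closed) (use A in' in auto)
    ultimately show ?thesis using ev[OF p] by (auto simp: det_term_def)
  qed
  have fin: "finite ?E" "finite ?O"
    by (auto intro: finite_subset[OF _ finite_perms[of t]])
  have img: "(\<lambda>\<pi>. \<pi> \<circ> ?\<tau>) ` ?E = ?O"
  proof -
    have c: "\<pi> \<circ> ?\<tau> permutes {..<t}" if "\<pi> permutes {..<t}" for \<pi>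
      using permutes_compose[OF \<tau> that] .
    have "\<pi> \<in> (\<lambda>\<pi>. \<pi> \<circ> ?\<tau>) ` ?E" if "\<pi> \<in> ?O" for \<pi>
    proof (rule image_eqI)
      show "\<pi> = \<pi> \<circ> ?\<tau> \<circ> ?\<tau>" by (simp only: tt)
      show "\<pi> \<circ> ?\<tau> \<in> ?E" using that ev[of \<pi>] c[of \<pi>] by blast
    qed
    then show ?thesis using ev c by blast
  qed
  have inj: "inj_on (\<lambda>\<pi>. \<pi> \<circ> ?\<tau>) ?E" by (rule inj_onI) (metis tt)
  have clE: "(\<Oplus>\<pi>\<in>?E. det_term t A \<pi>) \<in> carrier R"
    by (rule finsum_closed) (auto intro: det_term_closed A)
  have "(\<Oplus>\<pi>\<in>?O. det_term t A \<pi>) = (\<Oplus>\<pi>\<in>?E. det_term t A (\<pi> \<circ> ?\<tau>))"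
    unfolding img[symmetric]
  proof (rule finsum_reindex[OF _ inj])
    show "det_term t A \<in> (\<lambda>\<pi>. \<pi> \<circ> ?\<tau>) ` ?E \<rightarrow> carrier R"
      unfolding img by (auto intro: det_term_closed A)
  qed
  also have "\<dots> = (\<Oplus>\<pi>\<in>?E. \<ominus> det_term t A \<pi>)"
    by (rule finsum_cong') (auto simp: neg intro!: det_term_closed A)
  also have "\<dots> = \<ominus> (\<Oplus>\<pi>\<in>?E. det_term t A \<pi>)"
    by (rule finsum_a_inv) (auto simp: fin intro!: det_term_closed A)
  finally have O: "(\<Oplus>\<pi>\<in>?O. det_term t A \<pi>) = \<ominus> (\<Oplus>\<pi>\<in>?E. det_term t A \<pi>)" .
  have "?P = ?E \<union> ?O" by auto
  then have "ring_det R t A = (\<Oplus>\<pi>\<in>?E \<union> ?O. det_term t A \<pi>)"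
    unfolding ring_det_alt by (rule arg_cong)
  also have "\<dots> = (\<Oplus>\<pi>\<in>?E. det_term t A \<pi>) \<oplus> (\<Oplus>\<pi>\<in>?O. det_term t A \<pi>)"
    by (rule finsum_Un_disjoint) (auto simp: fin intro!: det_term_closed A)
  also have "\<dots> = \<zero>" unfolding O using clE by (rule r_neg)
  finally show ?thesis .
qed

text \<open>Isolates the single factor of a term that depends on row \<open>p\<close>; additivity
  and homogeneity in that row then hold term by term.\<close>

lemma finprod_row_split:
  fixes t p :: nat
  assumes p: "p < t" and s: "\<pi> permutes {..<t}"
    and A: "\<And>i j. i < t \<Longrightarrow> j < t \<Longrightarrow> A i j \<in> carrier R" and w: "\<And>j. j < t \<Longrightarrow> w j \<in> carrier R"
  shows "(\<Otimes>i\<in>{..<t}. (A(p := w)) i (\<pi> i)) = w (\<pi> p) \<otimes> (\<Otimes>i\<in>{..<t} - {p}. A i (\<pi> i))"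
    "(\<Otimes>i\<in>{..<t} - {p}. A i (\<pi> i)) \<in> carrier R" "\<pi> p < t"
proof -
  have in': "\<pi> k < t" if "k < t" for k using that permutes_in_image[OF s] by auto
  then show "\<pi> p < t" using p by simp
  show "(\<Otimes>i\<in>{..<t} - {p}. A i (\<pi> i)) \<in> carrier R"
    by (intro finprod_closed) (use A in' in auto)
  have "(\<Otimes>i\<in>insert p ({..<t} - {p}). (A(p := w)) i (\<pi> i)) =
      w (\<pi> p) \<otimes> (\<Otimes>i\<in>{..<t} - {p}. (A(p := w)) i (\<pi> i))"
    by (subst finprod_insert) (use A in' p w in auto)
  also have "(\<Otimes>i\<in>{..<t} - {p}. (A(p := w)) i (\<pi> i)) = (\<Otimes>i\<in>{..<t} - {p}. A i (\<pi> i))"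
    by (rule finprod_cong') (use A in' in auto)
  finally show "(\<Otimes>i\<in>{..<t}. (A(p := w)) i (\<pi> i)) = w (\<pi> p) \<otimes> (\<Otimes>i\<in>{..<t} - {p}. A i (\<pi> i))"
    using p by (simp add: insert_absorb)
qed

lemma ring_det_row_add:
  assumes A: "\<And>i j. i < t \<Longrightarrow> j < t \<Longrightarrow> A i j \<in> carrier R"
    and uv: "\<And>j. j < t \<Longrightarrow> u j \<in> carrier R" "\<And>j. j < t \<Longrightarrow> v j \<in> carrier R"
    and p: "p < t"
  shows "ring_det R t (A(p := \<lambda>j. u j \<oplus> v j)) = ring_det R t (A(p := u)) \<oplus> ring_det R t (A(p := v))"
proof -
  note split = finprod_row_split[where A = A, OF p]
  have eq: "det_term t (A(p := \<lambda>j. u j \<oplus> v j)) \<pi> = det_term t (A(p := u)) \<pi> \<oplus> det_term t (A(p := v)) \<pi>"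
    if s: "\<pi> permutes {..<t}" for \<pi>
    unfolding det_term_def
    using split[OF s, of u] split[OF s, of v] split[OF s, of "\<lambda>j. u j \<oplus> v j"] uv A
    by (auto simp: l_distr minus_add)
  have cl: "det_term t (A(p := w)) \<pi> \<in> carrier R"
    if "\<pi> permutes {..<t}" "\<And>j. j < t \<Longrightarrow> w j \<in> carrier R" for w \<pi>
    by (rule det_term_closed) (use that A in auto)
  show ?thesis unfolding ring_det_alt
    by (subst finsum_cong'[OF refl _ eq]) (use cl uv in \<open>auto simp: finsum_addf\<close>)
qed

lemma ring_det_row_smult:
  assumes A: "\<And>i j. i < t \<Longrightarrow> j < t \<Longrightarrow> A i j \<in> carrier R"
    and u: "\<And>j. j < t \<Longrightarrow> u j \<in> carrier R" and r: "r \<in> carrier R"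
    and p: "p < t"
  shows "ring_det R t (A(p := \<lambda>j. r \<otimes> u j)) = r \<otimes> ring_det R t (A(p := u))"
proof -
  note split = finprod_row_split[where A = A, OF p]
  have eq: "det_term t (A(p := \<lambda>j. r \<otimes> u j)) \<pi> = r \<otimes> det_term t (A(p := u)) \<pi>"
    if s: "\<pi> permutes {..<t}" for \<pi>
    unfolding det_term_def
    using split[OF s, of u] split[OF s, of "\<lambda>j. r \<otimes> u j"] u r A
    by (auto simp: m_assoc r_minus)
  have cl: "det_term t (A(p := w)) \<pi> \<in> carrier R"
    if "\<pi> permutes {..<t}" "\<And>j. j < t \<Longrightarrow> w j \<in> carrier R" for w \<pi>
    by (rule det_term_closed) (use that A in auto)
  show ?thesis unfolding ring_det_alt
    by (subst finsum_cong'[OF refl _ eq])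
      (use cl u r in \<open>auto simp: finsum_rdistr finite_perms\<close>)
qed

text \<open>A permutation that moves \<open>t\<close> sends some \<open>i < t\<close> to
  \<open>t\<close> and so picks up the factor \<open>A i t\<close>, which is zero. Those fixing
  \<open>t\<close> are exactly the permutations of \<open>{..<t}\<close>, and their extra factor is
  one.\<close>

lemma ring_det_last_column:
  assumes A: "\<And>i j. i < Suc t \<Longrightarrow> j < Suc t \<Longrightarrow> A i j \<in> carrier R"
    and z: "\<And>i. i < t \<Longrightarrow> A i t = \<zero>" and o: "A t t = \<one>"
  shows "ring_det R (Suc t) A = ring_det R t A"
proof -
  let ?P = "{\<pi>. \<pi> permutes {..<t}}" and ?Q = "{\<pi>. \<pi> permutes {..<Suc t}}"
  have sub: "?P \<subseteq> ?Q" by (auto intro: permutes_subset)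
  have 0: "det_term (Suc t) A \<pi> = \<zero>" if s: "\<pi> permutes {..<Suc t}" "\<not> \<pi> permutes {..<t}" for \<pi>
  proof -
    have in': "\<pi> k < Suc t" if "k < Suc t" for k using that permutes_in_image[OF s(1)] by auto
    have "\<pi> t \<noteq> t"
    proof
      assume "\<pi> t = t"
      then have "\<pi> permutes {..<t}"
        by (intro permutes_superset[OF s(1)]) (auto simp: less_Suc_eq)
      with s(2) show False ..
    qed
    obtain i where i: "\<pi> i = t" using permutes_surj[OF s(1)] by (metis surjD)
    have "i < Suc t" using i s(1) permutes_not_in[OF s(1)] by (metis lessI lessThan_iff)
    with i \<open>\<pi> t \<noteq> t\<close> have it: "i < t" by (cases "i = t") auto
    have "(\<Otimes>i\<in>insert i ({..<Suc t} - {i}). A i (\<pi> i)) = A i (\<pi> i) \<otimes> (\<Otimes>i\<in>{..<Suc t} - {i}. A i (\<pi> i))"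
      by (rule finprod_insert) (use A in' \<open>i < Suc t\<close> in auto)
    also have "\<dots> = \<zero>" using i it z
      by (simp, intro l_null finprod_closed) (use A in' in auto)
    finally have "(\<Otimes>i\<in>{..<Suc t}. A i (\<pi> i)) = \<zero>" using \<open>i < Suc t\<close> by (simp add: insert_absorb)
    then show ?thesis by (simp add: det_term_def)
  qed
  have 1: "det_term (Suc t) A \<pi> = det_term t A \<pi>" if s: "\<pi> permutes {..<t}" for \<pi>
  proof -
    have in': "\<pi> k < t" if "k < t" for k using that permutes_in_image[OF s] by auto
    have "\<pi> t = t" using permutes_not_in[OF s] by simp
    have "(\<Otimes>i\<in>{..<t}. A i (\<pi> i)) \<in> carrier R" by (intro finprod_closed) (use A in' in \<open>auto simp: less_SucI\<close>)
    moreover have "(\<Otimes>i\<in>{..<Suc t}. A i (\<pi> i)) = A t (\<pi> t) \<otimes> (\<Otimes>i\<in>{..<t}. A i (\<pi> i))"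
      unfolding lessThan_Suc
      by (rule finprod_insert) (use A in' \<open>\<pi> t = t\<close> in \<open>auto simp: less_SucI\<close>)
    ultimately show ?thesis by (simp add: det_term_def \<open>\<pi> t = t\<close> o)
  qed
  have "ring_det R (Suc t) A = (\<Oplus>\<pi>\<in>?P. det_term (Suc t) A \<pi>)"
    unfolding ring_det_alt
    by (rule add.finprod_mono_neutral_cong_right[OF finite_perms sub])
      (auto simp: 0 intro: det_term_closed A)
  also have "\<dots> = ring_det R t A" unfolding ring_det_alt
    by (rule finsum_cong') (auto simp: 1 less_Suc_eq intro!: det_term_closed A)
  finally show ?thesis .
qed

end

context comm_base_ring
begin

lemma ring_det_last_row:
  assumes A: "\<And>i j. i < Suc t \<Longrightarrow> j < Suc t \<Longrightarrow> A i j \<in> carrier R"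
    and z: "\<And>j. j < t \<Longrightarrow> A t j = \<zero>" and o: "A t t = \<one>"
  shows "ring_det R (Suc t) A = ring_det R t A"
  using ring_det_last_column[of t "\<lambda>i j. A j i"] ring_det_transpose[of "Suc t" A]
    ring_det_transpose[of t A] assms by simp

lemma ring_det_permute_cols:
  assumes A: "\<And>i j. i < t \<Longrightarrow> j < t \<Longrightarrow> A i j \<in> carrier R" and \<tau>: "\<tau> permutes {..<t}"
  shows "ring_det R t (\<lambda>i j. A i (\<tau> j)) = (if evenperm \<tau> then ring_det R t A else \<ominus> ring_det R t A)"
proof -
  have \<tau>in: "\<tau> i < t" if "i < t" for i using that permutes_in_image[OF \<tau>] by auto
  show ?thesis
    using ring_det_permute_rows[of t "\<lambda>i j. A j i" \<tau>] ring_det_transpose[of t A]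
      ring_det_transpose[of t "\<lambda>i j. A i (\<tau> j)"] assms \<tau>in by simp
qed

lemma ring_det_equal_cols:
  assumes A: "\<And>i j. i < t \<Longrightarrow> j < t \<Longrightarrow> A i j \<in> carrier R"
    and pq: "p < t" "q < t" "p \<noteq> q" and eq: "\<And>i. i < t \<Longrightarrow> A i p = A i q"
  shows "ring_det R t A = \<zero>"
  using ring_det_equal_rows[of t "\<lambda>i j. A j i" p q] ring_det_transpose[of t A] assms by simp

section \<open>Membership of determinants in an ideal\<close>

lemma ring_det_permute_rows_mem:
  assumes J: "ideal J R" and A: "\<And>i j. i < t \<Longrightarrow> j < t \<Longrightarrow> A i j \<in> carrier R"
    and \<tau>: "\<tau> permutes {..<t}"
  shows "ring_det R t (\<lambda>i j. A (\<tau> i) j) \<in> J \<longleftrightarrow> ring_det R t A \<in> J"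
proof -
  interpret J: ideal J R by fact
  have d: "ring_det R t A \<in> carrier R" by (rule ring_det_closed) (rule A)
  have "(\<ominus> x \<in> J) = (x \<in> J)" if "x \<in> carrier R" for x
    using that J.a_inv_closed[of x] J.a_inv_closed[of "\<ominus> x"] by auto
  then show ?thesis using ring_det_permute_rows[of t A \<tau>] A \<tau> d by auto
qed

lemma ring_det_permute_cols_mem:
  assumes J: "ideal J R" and A: "\<And>i j. i < t \<Longrightarrow> j < t \<Longrightarrow> A i j \<in> carrier R"
    and \<tau>: "\<tau> permutes {..<t}"
  shows "ring_det R t (\<lambda>i j. A i (\<tau> j)) \<in> J \<longleftrightarrow> ring_det R t A \<in> J"
proof -
  interpret J: ideal J R by fact
  have d: "ring_det R t A \<in> carrier R" by (rule ring_det_closed) (rule A)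
  have "(\<ominus> x \<in> J) = (x \<in> J)" if "x \<in> carrier R" for x
    using that J.a_inv_closed[of x] J.a_inv_closed[of "\<ominus> x"] by auto
  then show ?thesis using ring_det_permute_cols[of t A \<tau>] A \<tau> d by auto
qed

lemma ring_det_zero_row:
  assumes A: "\<And>i j. i < t \<Longrightarrow> j < t \<Longrightarrow> A i j \<in> carrier R" and p: "p < t"
  shows "ring_det R t (A(p := \<lambda>j. \<zero>)) = \<zero>"
proof -
  have "ring_det R t (A(p := \<lambda>j. \<zero> \<otimes> \<zero>)) = \<zero> \<otimes> ring_det R t (A(p := \<lambda>j. \<zero>))"
    by (rule ring_det_row_smult) (use A p in auto)
  moreover have "ring_det R t (A(p := \<lambda>j. \<zero>)) \<in> carrier R"
    by (rule ring_det_closed) (use A in auto)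
  ultimately show ?thesis by simp
qed

text \<open>Linearity in one row, phrased as membership: it is enough to know the determinants in
  which row \<open>p\<close> is a single \<open>v k\<close>, and the coefficients are absorbed by
  the ideal.\<close>

lemma ring_det_row_finsum_mem:
  assumes J: "ideal J R" and A: "\<And>i j. i < t \<Longrightarrow> j < t \<Longrightarrow> A i j \<in> carrier R" and p: "p < t"
    and K: "finite K" and y: "\<And>k. k \<in> K \<Longrightarrow> y k \<in> carrier R"
    and v: "\<And>k j. k \<in> K \<Longrightarrow> j < t \<Longrightarrow> v k j \<in> carrier R"
    and mem: "\<And>k. k \<in> K \<Longrightarrow> ring_det R t (A(p := v k)) \<in> J"
  shows "ring_det R t (A(p := \<lambda>j. \<Oplus>k\<in>K. y k \<otimes> v k j)) \<in> J"
proof -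
  interpret J: ideal J R by fact
  show ?thesis using K y v mem
  proof (induction K rule: finite_induct)
    case empty
    have "ring_det R t (A(p := \<lambda>j. \<zero>)) \<in> J"
      using ring_det_zero_row[of t A p] A p J.zero_closed by metis
    then show ?case by (simp only: finsum_empty)
  next
    case (insert x K)
    have yx: "y x \<in> carrier R" and vx: "\<And>j. j < t \<Longrightarrow> v x j \<in> carrier R" using insert by auto
    have s: "(\<Oplus>k\<in>K. y k \<otimes> v k j) \<in> carrier R" if "j < t" for j
      by (rule finsum_closed) (use insert that in auto)
    have "ring_det R t (A(p := \<lambda>j. \<Oplus>k\<in>insert x K. y k \<otimes> v k j)) =
        ring_det R t (A(p := \<lambda>j. y x \<otimes> v x j \<oplus> (\<Oplus>k\<in>K. y k \<otimes> v k j)))"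
    proof (rule ring_det_cong)
      fix i j assume ij: "i < t" "j < t"
      show "(A(p := \<lambda>j. y x \<otimes> v x j \<oplus> (\<Oplus>k\<in>K. y k \<otimes> v k j))) i j \<in> carrier R"
        using A ij yx vx s by auto
      show "(A(p := \<lambda>j. \<Oplus>k\<in>insert x K. y k \<otimes> v k j)) i j =
          (A(p := \<lambda>j. y x \<otimes> v x j \<oplus> (\<Oplus>k\<in>K. y k \<otimes> v k j))) i j"
        using insert ij by (auto simp: Pi_iff)
    qed
    also have "\<dots> = ring_det R t (A(p := \<lambda>j. y x \<otimes> v x j)) \<oplus>
        ring_det R t (A(p := \<lambda>j. \<Oplus>k\<in>K. y k \<otimes> v k j))"
      by (rule ring_det_row_add) (use A p yx vx s in auto)
    also have "ring_det R t (A(p := \<lambda>j. y x \<otimes> v x j)) = y x \<otimes> ring_det R t (A(p := v x))"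
      by (rule ring_det_row_smult) (use A p yx vx in auto)
    finally have eq: "ring_det R t (A(p := \<lambda>j. \<Oplus>k\<in>insert x K. y k \<otimes> v k j)) =
        y x \<otimes> ring_det R t (A(p := v x)) \<oplus> ring_det R t (A(p := \<lambda>j. \<Oplus>k\<in>K. y k \<otimes> v k j))" .
    have "ring_det R t (A(p := v x)) \<in> J" using insert.prems(3)[of x] by blast
    moreover have "ring_det R t (A(p := \<lambda>j. \<Oplus>k\<in>K. y k \<otimes> v k j)) \<in> J"
      by (rule insert.IH) (use insert.prems in blast)+
    ultimately show ?case unfolding eq using yx by (intro J.a_closed J.I_l_closed)
  qed
qed

lemma ring_det_row_span_mem:
  assumes J: "ideal J R" and K: "finite K"
    and y: "\<And>i k. i < t \<Longrightarrow> k \<in> K \<Longrightarrow> y i k \<in> carrier R"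
    and v: "\<And>k j. k \<in> K \<Longrightarrow> j < t \<Longrightarrow> v k j \<in> carrier R"
    and A: "\<And>i j. i < t \<Longrightarrow> j < t \<Longrightarrow> A i j = (\<Oplus>k\<in>K. y i k \<otimes> v k j)"
    and mem: "\<And>c. c \<in> {..<t} \<rightarrow> K \<Longrightarrow> ring_det R t (\<lambda>i j. v (c i) j) \<in> J"
  shows "ring_det R t A \<in> J"
proof -
  have cl: "(\<Oplus>k\<in>K. y i k \<otimes> v k j) \<in> carrier R" if "i < t" "j < t" for i j
    by (rule finsum_closed) (use y v that in auto)
  \<comment> \<open>Induction on the number \<open>s\<close> of rows that are still linear
    combinations; the other rows are already members of the family. At \<open>s = 0\<close> this is
    the assumption, at \<open>s = t\<close> the claim.\<close>
  have *: "ring_det R t (\<lambda>i j. if i < s then (\<Oplus>k\<in>K. y i k \<otimes> v k j) else v (c i) j) \<in> J"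
    if "s \<le> t" "c \<in> {..<t} \<rightarrow> K" for s c
    using that
  proof (induction s arbitrary: c)
    case 0
    then show ?case using mem[of c] by simp
  next
    case (Suc s)
    let ?A = "\<lambda>i j. if i < s then (\<Oplus>k\<in>K. y i k \<otimes> v k j) else v (c i) j"
    have A': "?A i j \<in> carrier R" if "i < t" "j < t" for i j
      using that cl v[of "c i" j] Suc.prems by (auto simp: Pi_iff)
    have eq: "(\<lambda>i j. if i < Suc s then (\<Oplus>k\<in>K. y i k \<otimes> v k j) else v (c i) j) =
        ?A(s := \<lambda>j. \<Oplus>k\<in>K. y s k \<otimes> v k j)"
      by (auto simp: fun_eq_iff less_Suc_eq)
    show ?case unfolding eq
    proof (rule ring_det_row_finsum_mem[OF J _ _ K])
      fix k assume k: "k \<in> K"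
      have *: "?A(s := v k) = (\<lambda>i j. if i < s then (\<Oplus>k\<in>K. y i k \<otimes> v k j) else v ((c(s := k)) i) j)"
        by (auto simp: fun_eq_iff)
      have "c(s := k) \<in> {..<t} \<rightarrow> K" using Suc.prems(2) k by auto
      then show "ring_det R t (?A(s := v k)) \<in> J"
        unfolding * by (intro Suc.IH) (use Suc.prems in auto)
    qed (use A' Suc.prems y v in auto)
  qed
  have eq: "ring_det R t A = ring_det R t (\<lambda>i j. \<Oplus>k\<in>K. y i k \<otimes> v k j)"
    by (rule ring_det_cong) (use A cl in auto)
  show ?thesis
  \<comment> \<open>Over an empty family with \<open>t\<close> positive there is no choice function,
    but then every row is an empty sum and the determinant vanishes.\<close>
  proof (cases "K = {} \<and> t \<noteq> 0")
    case True
    then have "ring_det R t A = ring_det R t ((\<lambda>i j. \<zero>)(0 := \<lambda>j. \<zero>))"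
      unfolding eq by (intro ring_det_cong) auto
    also have "\<dots> = \<zero>" using True by (intro ring_det_zero_row) auto
    finally show ?thesis using additive_subgroup.zero_closed[OF ideal.axioms(1)[OF J]] by simp
  next
    case False
    then have "(\<lambda>_. SOME k. k \<in> K) \<in> {..<t} \<rightarrow> K" by (auto simp: some_in_eq)
    then obtain c where "c \<in> {..<t} \<rightarrow> K" by blast
    from *[OF order_refl this] have "ring_det R t (\<lambda>i j. if i < t then (\<Oplus>k\<in>K. y i k \<otimes> v k j) else v (c i) j) \<in> J" .
    also have "ring_det R t (\<lambda>i j. if i < t then (\<Oplus>k\<in>K. y i k \<otimes> v k j) else v (c i) j) = ring_det R t A"
      unfolding eq by (rule ring_det_cong) (use cl in auto)
    finally show ?thesis .
  qed
qed

text \<open>The last row is expanded in unit vectors. Swapping column \<open>l\<close> with the last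
  column moves the entry one into the corner, so the determinant shrinks by one row and column; the
  sign of the swap is absorbed by the ideal.\<close>

lemma ring_det_laplace_last_mem:
  assumes J: "ideal J R" and A: "\<And>i j. i < Suc t \<Longrightarrow> j < Suc t \<Longrightarrow> A i j \<in> carrier R"
    and mem: "\<And>c. c \<in> {..<t} \<rightarrow> {..<Suc t} \<Longrightarrow> ring_det R t (\<lambda>i j. A i (c j)) \<in> J"
  shows "ring_det R (Suc t) A \<in> J"
proof -
  let ?d = "\<lambda>l j. if j = l then \<one> else \<zero>"
  have "ring_det R (Suc t) (A(t := \<lambda>j. \<Oplus>l\<in>{..<Suc t}. A t l \<otimes> ?d l j)) \<in> J"
  proof (rule ring_det_row_finsum_mem[OF J])
    fix l assume "l \<in> {..<Suc t}"
    let ?\<tau> = "Transposition.transpose l t"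
    have \<tau>: "?\<tau> permutes {..<Suc t}" using \<open>l \<in> _\<close> by (intro permutes_swap_id) auto
    have \<tau>in: "?\<tau> i < Suc t" if "i < Suc t" for i using that permutes_in_image[OF \<tau>] by auto
    let ?B = "\<lambda>i j. (A(t := ?d l)) i (?\<tau> j)"
    have "ring_det R (Suc t) ?B = ring_det R t ?B"
    proof (rule ring_det_last_row)
      fix j assume "j < t"
      then have "?\<tau> j \<noteq> l" by (auto simp: Transposition.transpose_def)
      then show "?B t j = \<zero>" by simp
    qed (use A \<tau>in in auto)
    also have "\<dots> = ring_det R t (\<lambda>i j. A i (?\<tau> j))"
      by (rule ring_det_cong) (use A \<tau>in in \<open>auto simp: less_SucI\<close>)
    also have "\<dots> \<in> J" by (rule mem) (use \<tau>in in \<open>auto simp: less_SucI\<close>)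
    finally have "ring_det R (Suc t) ?B \<in> J" .
    then show "ring_det R (Suc t) (A(t := ?d l)) \<in> J"
      using ring_det_permute_cols_mem[OF J _ \<tau>, of "A(t := ?d l)"] A by auto
  qed (use A in auto)
  also have "ring_det R (Suc t) (A(t := \<lambda>j. \<Oplus>l\<in>{..<Suc t}. A t l \<otimes> ?d l j)) = ring_det R (Suc t) A"
  proof (rule ring_det_cong)
    fix i j assume ij: "i < Suc t" "j < Suc t"
    have "(\<Oplus>l\<in>{..<Suc t}. A t l \<otimes> ?d l j) = (\<Oplus>l\<in>{..<Suc t}. if j = l then A t l else \<zero>)"
      by (rule finsum_cong') (use A in auto)
    also have "\<dots> = A t j"
      by (rule finsum_singleton) (use A ij in auto)
    finally show "(A(t := \<lambda>j. \<Oplus>l\<in>{..<Suc t}. A t l \<otimes> ?d l j)) i j = A i j" by simp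
  qed (use A in auto)
  finally show ?thesis .
qed

text \<open>That the selections \<open>r\<close> avoid \<open>p\<close> is the point: when row
  \<open>p\<close> is the only foreign row of a matrix, the smaller determinants no longer see
  it.\<close>

lemma ring_det_laplace_mem:
  assumes J: "ideal J R" and A: "\<And>i j. i < Suc t \<Longrightarrow> j < Suc t \<Longrightarrow> A i j \<in> carrier R"
    and p: "p < Suc t"
    and mem: "\<And>r c. r \<in> {..<t} \<rightarrow> {..<Suc t} - {p} \<Longrightarrow> c \<in> {..<t} \<rightarrow> {..<Suc t} \<Longrightarrow>
      ring_det R t (\<lambda>i j. A (r i) (c j)) \<in> J"
  shows "ring_det R (Suc t) A \<in> J"
proof -
  let ?\<tau> = "Transposition.transpose p t"
  have \<tau>: "?\<tau> permutes {..<Suc t}" using p by (intro permutes_swap_id) auto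
  have \<tau>in: "?\<tau> i < Suc t" if "i < Suc t" for i using that permutes_in_image[OF \<tau>] by auto
  have "?\<tau> i \<noteq> p" if "i < t" for i using that by (auto simp: Transposition.transpose_def)
  then have "ring_det R (Suc t) (\<lambda>i j. A (?\<tau> i) j) \<in> J"
    by (intro ring_det_laplace_last_mem[OF J] mem) (use A \<tau>in in \<open>auto simp: less_SucI\<close>)
  then show ?thesis using ring_det_permute_rows_mem[OF J _ \<tau>, of A] A by simp
qed

text \<open>Every row is \<open>M i\<close> plus a multiple of \<open>v\<close>, so multilinearity
  leaves matrices whose rows are rows of \<open>M\<close> or copies of \<open>v\<close>, the index
  \<open>Suc t\<close> standing for \<open>v\<close>. Two copies of \<open>v\<close> give zero; with
  at most one copy, expansion along it leaves determinants of submatrices of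
  \<open>M\<close>.\<close>

lemma ring_det_rank_one_update_mem:
  assumes J: "ideal J R" and M: "\<And>i j. i < Suc t \<Longrightarrow> j < Suc t \<Longrightarrow> M i j \<in> carrier R"
    and u: "\<And>i. i < Suc t \<Longrightarrow> u i \<in> carrier R" and v: "\<And>i. i < Suc t \<Longrightarrow> v i \<in> carrier R"
    and mem: "\<And>r c. r \<in> {..<t} \<rightarrow> {..<Suc t} \<Longrightarrow> c \<in> {..<t} \<rightarrow> {..<Suc t} \<Longrightarrow>
      ring_det R t (\<lambda>i j. M (r i) (c j)) \<in> J"
  shows "ring_det R (Suc t) (\<lambda>i j. M i j \<oplus> u i \<otimes> v j) \<in> J"
proof (rule ring_det_row_span_mem[OF J, of "{..Suc t}" _ "\<lambda>i k. if k = i then \<one> else if k = Suc t then u i else \<zero>"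
      "\<lambda>k. if k < Suc t then M k else v"])
  let ?y = "\<lambda>i k. if k = i then \<one> else if k = Suc t then u i else \<zero>"
  let ?w = "\<lambda>k. if k < Suc t then M k else v"
  interpret J: ideal J R by fact
  fix i j assume ij: "i < Suc t" "j < Suc t"
  have "(\<Oplus>k\<in>{..Suc t}. ?y i k \<otimes> ?w k j) = (\<Oplus>k\<in>insert (Suc t) {..<Suc t}. ?y i k \<otimes> ?w k j)"
    by (rule arg_cong[of _ _ "\<lambda>K. finsum R _ K"]) auto
  also have "\<dots> = ?y i (Suc t) \<otimes> ?w (Suc t) j \<oplus> (\<Oplus>k\<in>{..<Suc t}. ?y i k \<otimes> ?w k j)"
    by (rule finsum_insert) (use ij M u v in auto)
  also have "(\<Oplus>k\<in>{..<Suc t}. ?y i k \<otimes> ?w k j) = (\<Oplus>k\<in>{..<Suc t}. if i = k then M k j else \<zero>)"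
    by (rule finsum_cong') (use ij M u v in auto)
  also have "\<dots> = M i j" by (rule finsum_singleton) (use ij M in auto)
  finally show "M i j \<oplus> u i \<otimes> v j = (\<Oplus>k\<in>{..Suc t}. ?y i k \<otimes> ?w k j)"
    using ij M u v by (simp add: a_comm)
next
  let ?w = "\<lambda>k. if k < Suc t then M k else v"
  interpret J: ideal J R by fact
  fix c assume c: "c \<in> {..<Suc t} \<rightarrow> {..Suc t}"
  have cl: "?w (c i) j \<in> carrier R" if "i < Suc t" "j < Suc t" for i j
    using that M v c by auto
  show "ring_det R (Suc t) (\<lambda>i j. ?w (c i) j) \<in> J"
  proof (cases "\<exists>p q. p < Suc t \<and> q < Suc t \<and> p \<noteq> q \<and> c p = Suc t \<and> c q = Suc t")
    case True
    then obtain p q where "p < Suc t" "q < Suc t" "p \<noteq> q" "c p = Suc t" "c q = Suc t" by blast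
    then have "ring_det R (Suc t) (\<lambda>i j. ?w (c i) j) = \<zero>"
      by (intro ring_det_equal_rows[of _ _ p q] cl) auto
    then show ?thesis using J.zero_closed by simp
  next
    case False
    obtain p where p: "p < Suc t" "\<And>q. q < Suc t \<Longrightarrow> q \<noteq> p \<Longrightarrow> c q \<noteq> Suc t"
    proof (cases "\<exists>p<Suc t. c p = Suc t")
      case True
      then show ?thesis using False that by metis
    next
      case False
      \<comment> \<open>If \<open>v\<close> does not occur, any row may be chosen for the
        expansion.\<close>
      then show ?thesis using that[of t] by auto
    qed
    show ?thesis
    proof (rule ring_det_laplace_mem[OF J _ p(1)])
      fix r d assume r: "r \<in> {..<t} \<rightarrow> {..<Suc t} - {p}" and d: "d \<in> {..<t} \<rightarrow> {..<Suc t}"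
      have *: "c (r i) < Suc t" if "i < t" for i
      proof -
        have "r i < Suc t" "r i \<noteq> p" using r that by auto
        then show ?thesis using p(2)[of "r i"] c by (auto simp: Pi_iff le_less)
      qed
      have "ring_det R t (\<lambda>i j. ?w (c (r i)) (d j)) = ring_det R t (\<lambda>i j. M ((\<lambda>i. c (r i)) i) (d j))"
        by (rule ring_det_cong) (use * d M in auto)
      also have "\<dots> \<in> J" by (rule mem) (use * d in auto)
      finally show "ring_det R t (\<lambda>i j. ?w (c (r i)) (d j)) \<in> J" .
    qed (rule cl)
  qed
qed (use M u v in auto)

text \<open>Minors are defined by increasing selections only. An injective selection is the
  increasing enumeration of its image preceded by a permutation.\<close>

lemma increasing_factorization:
  fixes c :: "nat \<Rightarrow> nat"
  assumes inj: "inj_on c {..<t}" and c: "c \<in> {..<t} \<rightarrow> {..<q}"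
  obtains c' \<tau> where "strict_mono_on {..<t} c'" "c' ` {..<t} \<subseteq> {..<q}" "\<tau> permutes {..<t}"
    "\<And>i. i < t \<Longrightarrow> c i = c' (\<tau> i)"
proof -
  define S where "S = c ` {..<t}"
  have S: "finite S" "card S = t" unfolding S_def using inj by (auto simp: card_image)
  define c' where "c' = (\<lambda>i. sorted_list_of_set S ! i)"
  have mono: "strict_mono_on {..<t} c'"
    unfolding c'_def using S
    by (auto simp: strict_mono_on_def intro!: sorted_wrt_nth_less[OF strict_sorted_list_of_set])
  have bij: "bij_betw c' {..<t} S"
    using bij_betw_nth[of "sorted_list_of_set S" "{..<t}" S] S unfolding c'_def by simp
  define \<tau> where "\<tau> = (\<lambda>i. if i < t then inv_into {..<t} c' (c i) else i)"
  have "bij_betw (\<lambda>i. inv_into {..<t} c' (c i)) {..<t} {..<t}"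
    using bij_betw_trans[OF inj_on_imp_bij_betw[OF inj] bij_betw_inv_into[OF bij[unfolded S_def]]]
    by (simp add: o_def)
  then have "bij_betw \<tau> {..<t} {..<t}"
    by (rule bij_betw_cong[THEN iffD1, rotated]) (auto simp: \<tau>_def)
  then have "\<tau> permutes {..<t}" by (rule bij_imp_permutes) (auto simp: \<tau>_def)
  moreover have "c i = c' (\<tau> i)" if "i < t" for i
    using that bij_betw_inv_into_right[OF bij, of "c i"] by (auto simp: \<tau>_def S_def)
  moreover have "c' ` {..<t} \<subseteq> {..<q}" using bij c by (auto simp: bij_betw_def S_def)
  ultimately show ?thesis using mono that by blast
qed

text \<open>A repeated row or column makes the determinant zero, and an injective selection differs
  from an increasing one by a permutation, hence by a sign. Afterwards selections may be arbitrary
  functions.\<close>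

lemma ring_det_submatrix_mem:
  assumes J: "ideal J R" and A: "\<And>i j. i < p \<Longrightarrow> j < q \<Longrightarrow> A i j \<in> carrier R"
    and minors: "minors R p q A t \<subseteq> J"
    and r: "r \<in> {..<t} \<rightarrow> {..<p}" and c: "c \<in> {..<t} \<rightarrow> {..<q}"
  shows "ring_det R t (\<lambda>i j. A (r i) (c j)) \<in> J"
proof -
  interpret J: ideal J R by fact
  have cl: "A (r i) (c j) \<in> carrier R" if "i < t" "j < t" for i j using that A r c by auto
  consider "\<not> inj_on r {..<t}" | "\<not> inj_on c {..<t}" | "inj_on r {..<t}" "inj_on c {..<t}" by blast
  then show ?thesis
  proof cases
    case 1
    then obtain a b where "a < t" "b < t" "a \<noteq> b" "r a = r b" by (auto simp: inj_on_def)
    then have "ring_det R t (\<lambda>i j. A (r i) (c j)) = \<zero>"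
      by (intro ring_det_equal_rows[of _ _ a b] cl) auto
    then show ?thesis using J.zero_closed by simp
  next
    case 2
    then obtain a b where "a < t" "b < t" "a \<noteq> b" "c a = c b" by (auto simp: inj_on_def)
    then have "ring_det R t (\<lambda>i j. A (r i) (c j)) = \<zero>"
      by (intro ring_det_equal_cols[of _ _ a b] cl) auto
    then show ?thesis using J.zero_closed by simp
  next
    case 3
    obtain r' \<sigma>' where r': "strict_mono_on {..<t} r'" "r' ` {..<t} \<subseteq> {..<p}" "\<sigma>' permutes {..<t}"
      "\<And>i. i < t \<Longrightarrow> r i = r' (\<sigma>' i)" using increasing_factorization[OF 3(1) r] by metis
    obtain c' \<tau> where c': "strict_mono_on {..<t} c'" "c' ` {..<t} \<subseteq> {..<q}" "\<tau> permutes {..<t}"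
      "\<And>i. i < t \<Longrightarrow> c i = c' (\<tau> i)" using increasing_factorization[OF 3(2) c] by metis
    have in\<sigma>: "\<sigma>' i < t" if "i < t" for i using that permutes_in_image[OF r'(3)] by auto
    have in\<tau>: "\<tau> i < t" if "i < t" for i using that permutes_in_image[OF c'(3)] by auto
    have cl': "A (r' i) (c' j) \<in> carrier R" if "i < t" "j < t" for i j using that A[of "r' i" "c' j"] r'(2) c'(2) by (simp add: image_subset_iff)
    have "ring_det R t (\<lambda>i j. A (r' i) (c' j)) \<in> minors R p q A t"
      unfolding minors_def using r' c' by blast
    then have "ring_det R t (\<lambda>i j. A (r' i) (c' j)) \<in> J" using minors by blast
    then have "ring_det R t (\<lambda>i j. A (r' (\<sigma>' i)) (c' j)) \<in> J"
      using ring_det_permute_rows_mem[OF J _ r'(3), of "\<lambda>i j. A (r' i) (c' j)"] cl' by simp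
    then have "ring_det R t (\<lambda>i j. A (r' (\<sigma>' i)) (c' (\<tau> j))) \<in> J"
      using ring_det_permute_cols_mem[OF J _ c'(3), of "\<lambda>i j. A (r' (\<sigma>' i)) (c' j)"] cl' in\<sigma> by simp
    also have "ring_det R t (\<lambda>i j. A (r' (\<sigma>' i)) (c' (\<tau> j))) = ring_det R t (\<lambda>i j. A (r i) (c j))"
      by (rule ring_det_cong) (use r'(4) c'(4) cl in auto)
    finally show ?thesis .
  qed
qed

text \<open>There is no increasing selection of this size, so the set of minors is empty and is
  contained in the zero ideal; arbitrary selections follow from
  \<open>ring_det_submatrix_mem\<close> for that ideal.\<close>

lemma ring_det_submatrix_large:
  assumes A: "\<And>i j. i < p \<Longrightarrow> j < q \<Longrightarrow> A i j \<in> carrier R" and t: "p < t \<or> q < t"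
    and r: "r \<in> {..<t} \<rightarrow> {..<p}" and c: "c \<in> {..<t} \<rightarrow> {..<q}"
  shows "ring_det R t (\<lambda>i j. A (r i) (c j)) = \<zero>"
proof -
  have "minors R p q A t = {}"
  proof -
    have "\<not> (strict_mono_on {..<t} f \<and> f ` {..<t} \<subseteq> {..<n})" if "n < t" for f :: "nat \<Rightarrow> nat" and n
      using card_inj_on_le[OF strict_mono_on_imp_inj_on, of "{..<t}" f "{..<n}"] that by auto
    then show ?thesis using t unfolding minors_def by blast
  qed
  then have "ring_det R t (\<lambda>i j. A (r i) (c j)) \<in> {\<zero>}"
    using ring_det_submatrix_mem[OF zeroideal _ _ r c, of A] A by auto
  then show ?thesis by simp
qed

end

section \<open>Linear maps, products and dual bases\<close>

definition self_module :: "'r ring \<Rightarrow> ('r, 'r) module" where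
  "self_module R = \<lparr>carrier = carrier R, monoid.mult = monoid.mult R, one = one R,
     ring.zero = ring.zero R, ring.add = ring.add R, smult = monoid.mult R\<rparr>"

definition prod_module :: "('r, 'b) module \<Rightarrow> ('r, 'c) module \<Rightarrow> ('r, 'b \<times> 'c) module" where
  "prod_module M N = \<lparr>carrier = carrier M \<times> carrier N, monoid.mult = undefined, one = undefined,
     ring.zero = (\<zero>\<^bsub>M\<^esub>, \<zero>\<^bsub>N\<^esub>),
     ring.add = (\<lambda>x y. (fst x \<oplus>\<^bsub>M\<^esub> fst y, snd x \<oplus>\<^bsub>N\<^esub> snd y)),
     smult = (\<lambda>r x. (r \<odot>\<^bsub>M\<^esub> fst x, r \<odot>\<^bsub>N\<^esub> snd x))\<rparr>"

text \<open>The type does not depend on \<open>n\<close>. Free complements whose ranks change from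
  degree to degree can therefore be handled in one induction.\<close>

definition coord_module :: "'r ring \<Rightarrow> nat \<Rightarrow> ('r, nat \<Rightarrow> 'r) module" where
  "coord_module R n = \<lparr>carrier = {..<n} \<rightarrow>\<^sub>E carrier R, monoid.mult = undefined, one = undefined,
     ring.zero = (\<lambda>k\<in>{..<n}. \<zero>\<^bsub>R\<^esub>),
     ring.add = (\<lambda>x y. \<lambda>k\<in>{..<n}. x k \<oplus>\<^bsub>R\<^esub> y k),
     smult = (\<lambda>r x. \<lambda>k\<in>{..<n}. r \<otimes>\<^bsub>R\<^esub> x k)\<rparr>"

lemma self_module_simps [simp]:
  "carrier (self_module R) = carrier R" "\<zero>\<^bsub>self_module R\<^esub> = \<zero>\<^bsub>R\<^esub>"
  "x \<oplus>\<^bsub>self_module R\<^esub> y = x \<oplus>\<^bsub>R\<^esub> y" "x \<odot>\<^bsub>self_module R\<^esub> y = x \<otimes>\<^bsub>R\<^esub> y"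
  by (auto simp: self_module_def)

lemma prod_module_simps [simp]:
  "carrier (prod_module M N) = carrier M \<times> carrier N"
  "\<zero>\<^bsub>prod_module M N\<^esub> = (\<zero>\<^bsub>M\<^esub>, \<zero>\<^bsub>N\<^esub>)"
  "x \<oplus>\<^bsub>prod_module M N\<^esub> y = (fst x \<oplus>\<^bsub>M\<^esub> fst y, snd x \<oplus>\<^bsub>N\<^esub> snd y)"
  "r \<odot>\<^bsub>prod_module M N\<^esub> x = (r \<odot>\<^bsub>M\<^esub> fst x, r \<odot>\<^bsub>N\<^esub> snd x)"
  by (auto simp: prod_module_def)

lemma coord_module_simps [simp]:
  "carrier (coord_module R n) = {..<n} \<rightarrow>\<^sub>E carrier R"
  "\<zero>\<^bsub>coord_module R n\<^esub> = (\<lambda>k\<in>{..<n}. \<zero>\<^bsub>R\<^esub>)"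
  "x \<oplus>\<^bsub>coord_module R n\<^esub> y = (\<lambda>k\<in>{..<n}. x k \<oplus>\<^bsub>R\<^esub> y k)"
  "r \<odot>\<^bsub>coord_module R n\<^esub> x = (\<lambda>k\<in>{..<n}. r \<otimes>\<^bsub>R\<^esub> x k)"
  by (auto simp: coord_module_def)

lemma linear_mapsI:
  assumes "\<And>x. x \<in> carrier M \<Longrightarrow> \<phi> x \<in> carrier N"
    and "\<And>x y. x \<in> carrier M \<Longrightarrow> y \<in> carrier M \<Longrightarrow> \<phi> (x \<oplus>\<^bsub>M\<^esub> y) = \<phi> x \<oplus>\<^bsub>N\<^esub> \<phi> y"
    and "\<And>r x. r \<in> carrier R \<Longrightarrow> x \<in> carrier M \<Longrightarrow> \<phi> (r \<odot>\<^bsub>M\<^esub> x) = r \<odot>\<^bsub>N\<^esub> \<phi> x"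
  shows "\<phi> \<in> linear_maps R M N"
  using assms by (auto simp: linear_maps_def)

lemma linear_maps_closed: "\<phi> \<in> linear_maps R M N \<Longrightarrow> x \<in> carrier M \<Longrightarrow> \<phi> x \<in> carrier N"
  and linear_maps_add: "\<phi> \<in> linear_maps R M N \<Longrightarrow> x \<in> carrier M \<Longrightarrow> y \<in> carrier M \<Longrightarrow>
    \<phi> (x \<oplus>\<^bsub>M\<^esub> y) = \<phi> x \<oplus>\<^bsub>N\<^esub> \<phi> y"
  and linear_maps_smult: "\<phi> \<in> linear_maps R M N \<Longrightarrow> r \<in> carrier R \<Longrightarrow> x \<in> carrier M \<Longrightarrow>
    \<phi> (r \<odot>\<^bsub>M\<^esub> x) = r \<odot>\<^bsub>N\<^esub> \<phi> x"
  by (auto simp: linear_maps_def)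

lemma linear_maps_zero:
  assumes "module R M" "module R N" "\<phi> \<in> linear_maps R M N"
  shows "\<phi> \<zero>\<^bsub>M\<^esub> = \<zero>\<^bsub>N\<^esub>"
proof -
  interpret M: module R M by fact
  interpret N: module R N by fact
  have "\<phi> (\<zero>\<^bsub>R\<^esub> \<odot>\<^bsub>M\<^esub> \<zero>\<^bsub>M\<^esub>) = \<zero>\<^bsub>R\<^esub> \<odot>\<^bsub>N\<^esub> \<phi> \<zero>\<^bsub>M\<^esub>"
    using assms(3) by (rule linear_maps_smult) auto
  then show ?thesis using linear_maps_closed[OF assms(3), of "\<zero>\<^bsub>M\<^esub>"] by simp
qed

lemma linear_maps_a_inv:
  assumes "module R M" "module R N" "\<phi> \<in> linear_maps R M N" "x \<in> carrier M"
  shows "\<phi> (\<ominus>\<^bsub>M\<^esub> x) = \<ominus>\<^bsub>N\<^esub> \<phi> x"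
proof -
  interpret M: module R M by fact
  interpret N: module R N by fact
  have "\<phi> ((\<ominus>\<^bsub>R\<^esub> \<one>\<^bsub>R\<^esub>) \<odot>\<^bsub>M\<^esub> x) = (\<ominus>\<^bsub>R\<^esub> \<one>\<^bsub>R\<^esub>) \<odot>\<^bsub>N\<^esub> \<phi> x"
    using assms(3) by (rule linear_maps_smult) (auto simp: assms)
  then show ?thesis using linear_maps_closed[OF assms(3,4)] assms(4)
    by (simp add: M.smult_l_minus N.smult_l_minus)
qed

lemma linear_maps_finsum:
  assumes "module R M" "module R N" "\<phi> \<in> linear_maps R M N"
    and "finite I" "\<And>i. i \<in> I \<Longrightarrow> g i \<in> carrier M"
  shows "\<phi> (\<Oplus>\<^bsub>M\<^esub>i\<in>I. g i) = (\<Oplus>\<^bsub>N\<^esub>i\<in>I. \<phi> (g i))"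
  using assms(4,5)
proof (induction rule: finite_induct)
  case empty
  interpret M: module R M by fact
  interpret N: module R N by fact
  show ?case using linear_maps_zero[OF assms(1-3)] by simp
next
  case (insert x F)
  interpret M: module R M by fact
  interpret N: module R N by fact
  have "(\<Oplus>\<^bsub>M\<^esub>i\<in>F. g i) \<in> carrier M" by (rule M.finsum_closed) (use insert in auto)
  moreover have "\<phi> (g i) \<in> carrier N" if "i \<in> insert x F" for i
    using linear_maps_closed[OF assms(3)] insert that by blast
  ultimately show ?case using insert linear_maps_add[OF assms(3)] by (simp add: Pi_iff)
qed

lemma linear_maps_comp:
  assumes "\<phi> \<in> linear_maps R M N" "\<psi> \<in> linear_maps R N P"
  shows "(\<lambda>x. \<psi> (\<phi> x)) \<in> linear_maps R M P"
  using assms by (auto simp: linear_maps_def Pi_iff)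

lemma linear_maps_id: "(\<lambda>x. x) \<in> linear_maps R M M"
  by (auto simp: linear_maps_def)

lemma linear_maps_const_zero:
  assumes "module R N" shows "(\<lambda>x. \<zero>\<^bsub>N\<^esub>) \<in> linear_maps R M N"
proof -
  interpret N: module R N by fact
  show ?thesis by (rule linear_mapsI) auto
qed

lemma linear_maps_plus:
  assumes "module R N" "\<phi> \<in> linear_maps R M N" "\<psi> \<in> linear_maps R M N"
  shows "(\<lambda>x. \<phi> x \<oplus>\<^bsub>N\<^esub> \<psi> x) \<in> linear_maps R M N"
proof -
  interpret N: module R N by fact
  show ?thesis
    by (rule linear_mapsI)
      (use assms(2,3) in \<open>auto simp: linear_maps_def Pi_iff N.smult_r_distr N.add.m_ac\<close>)
qed

lemma linear_maps_neg:
  assumes "module R N" "\<phi> \<in> linear_maps R M N"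
  shows "(\<lambda>x. \<ominus>\<^bsub>N\<^esub> \<phi> x) \<in> linear_maps R M N"
proof -
  interpret N: module R N by fact
  show ?thesis
    by (rule linear_mapsI)
      (use assms(2) in \<open>auto simp: linear_maps_def Pi_iff N.smult_r_minus N.minus_add\<close>)
qed

lemma linear_maps_pair:
  assumes "\<phi> \<in> linear_maps R M N" "\<psi> \<in> linear_maps R M P"
  shows "(\<lambda>x. (\<phi> x, \<psi> x)) \<in> linear_maps R M (prod_module N P)"
  using assms by (auto simp: linear_maps_def Pi_iff)

lemma linear_maps_fst: "fst \<in> linear_maps R (prod_module M N) M"
  and linear_maps_snd: "snd \<in> linear_maps R (prod_module M N) N"
  by (auto simp: linear_maps_def)

lemma linear_maps_scaled:
  assumes "module R N" "\<xi> \<in> linear_maps R M (self_module R)" "z \<in> carrier N"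
  shows "(\<lambda>x. \<xi> x \<odot>\<^bsub>N\<^esub> z) \<in> linear_maps R M N"
proof -
  interpret N: module R N by fact
  show ?thesis
    by (rule linear_mapsI)
      (use assms(2,3) in \<open>auto simp: linear_maps_def Pi_iff N.smult_l_distr N.smult_assoc1\<close>)
qed

lemma linear_maps_sum:
  assumes N: "module R N" and "finite I" "\<And>i. i \<in> I \<Longrightarrow> \<phi> i \<in> linear_maps R M N"
  shows "(\<lambda>x. \<Oplus>\<^bsub>N\<^esub>i\<in>I. \<phi> i x) \<in> linear_maps R M N"
  using assms(2,3)
proof (induction rule: finite_induct)
  case empty
  interpret N: module R N by fact
  show ?case using linear_maps_const_zero[OF N] by simp
next
  case (insert x F)
  interpret N: module R N by fact
  have *: "(\<lambda>y. \<phi> x y \<oplus>\<^bsub>N\<^esub> (\<Oplus>\<^bsub>N\<^esub>i\<in>F. \<phi> i y)) \<in> linear_maps R M N"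
    by (rule linear_maps_plus[OF N]) (use insert in auto)
  have eq: "(\<Oplus>\<^bsub>N\<^esub>i\<in>insert x F. \<phi> i y) = \<phi> x y \<oplus>\<^bsub>N\<^esub> (\<Oplus>\<^bsub>N\<^esub>i\<in>F. \<phi> i y)"
    if "y \<in> carrier M" for y
    using insert that by (intro N.finsum_insert) (auto intro: linear_maps_closed)
  show ?case
  proof (rule linear_mapsI)
    fix y assume "y \<in> carrier M"
    then show "(\<Oplus>\<^bsub>N\<^esub>i\<in>insert x F. \<phi> i y) \<in> carrier N"
      using linear_maps_closed[OF *] eq by simp
  next
    fix y z assume yz: "y \<in> carrier M" "z \<in> carrier M"
    show "(\<Oplus>\<^bsub>N\<^esub>i\<in>insert x F. \<phi> i (y \<oplus>\<^bsub>M\<^esub> z)) =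
        (\<Oplus>\<^bsub>N\<^esub>i\<in>insert x F. \<phi> i y) \<oplus>\<^bsub>N\<^esub> (\<Oplus>\<^bsub>N\<^esub>i\<in>insert x F. \<phi> i z)"
    proof -
      have "(\<Oplus>\<^bsub>N\<^esub>i\<in>insert x F. \<phi> i (y \<oplus>\<^bsub>M\<^esub> z)) = (\<Oplus>\<^bsub>N\<^esub>i\<in>insert x F. \<phi> i y \<oplus>\<^bsub>N\<^esub> \<phi> i z)"
        by (rule N.finsum_cong')
          (use insert.prems yz in \<open>auto intro!: linear_maps_add N.a_closed intro: linear_maps_closed\<close>)
      also have "\<dots> = (\<Oplus>\<^bsub>N\<^esub>i\<in>insert x F. \<phi> i y) \<oplus>\<^bsub>N\<^esub> (\<Oplus>\<^bsub>N\<^esub>i\<in>insert x F. \<phi> i z)"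
        by (rule N.finsum_addf) (use insert.prems yz in \<open>auto intro: linear_maps_closed\<close>)
      finally show ?thesis .
    qed
  next
    fix r y assume ry: "r \<in> carrier R" "y \<in> carrier M"
    have "(\<Oplus>\<^bsub>N\<^esub>i\<in>insert x F. \<phi> i (r \<odot>\<^bsub>M\<^esub> y)) = (\<Oplus>\<^bsub>N\<^esub>i\<in>insert x F. r \<odot>\<^bsub>N\<^esub> \<phi> i y)"
      by (rule N.finsum_cong')
        (use insert.prems ry in \<open>auto intro!: linear_maps_smult N.smult_closed intro: linear_maps_closed\<close>)
    also have "\<dots> = r \<odot>\<^bsub>N\<^esub> (\<Oplus>\<^bsub>N\<^esub>i\<in>insert x F. \<phi> i y)"
      by (rule N.finsum_smult_ldistr[symmetric])
        (use insert ry in \<open>auto intro: linear_maps_closed\<close>)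
    finally show "(\<Oplus>\<^bsub>N\<^esub>i\<in>insert x F. \<phi> i (r \<odot>\<^bsub>M\<^esub> y)) = r \<odot>\<^bsub>N\<^esub> (\<Oplus>\<^bsub>N\<^esub>i\<in>insert x F. \<phi> i y)" .
  qed
qed

lemma module_prod:
  assumes "module R M" "module R N" shows "module R (prod_module M N)"
proof -
  interpret M: module R M by fact
  interpret N: module R N by fact
  show ?thesis
  proof (rule moduleI)
    show "abelian_group (prod_module M N)"
    proof (rule abelian_groupI)
      fix x assume x: "x \<in> carrier (prod_module M N)"
      show "\<exists>y\<in>carrier (prod_module M N). y \<oplus>\<^bsub>prod_module M N\<^esub> x = \<zero>\<^bsub>prod_module M N\<^esub>"
        by (rule bexI[of _ "(\<ominus>\<^bsub>M\<^esub> fst x, \<ominus>\<^bsub>N\<^esub> snd x)"])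
          (use x in \<open>auto simp: M.l_neg N.l_neg\<close>)
    qed (auto simp: M.add.m_ac N.add.m_ac)
  qed (auto simp: M.is_cring M.smult_l_distr N.smult_l_distr M.smult_r_distr N.smult_r_distr
      M.smult_assoc1 N.smult_assoc1)
qed

section \<open>Functionals and dual bases\<close>

context comm_base_ring
begin

lemma module_self: "module R (self_module R)"
proof (rule moduleI)
  show "abelian_group (self_module R)"
  proof (rule abelian_groupI)
    fix x assume x: "x \<in> carrier (self_module R)"
    then show "\<exists>y\<in>carrier (self_module R). y \<oplus>\<^bsub>self_module R\<^esub> x = \<zero>\<^bsub>self_module R\<^esub>"
      by (intro bexI[of _ "\<ominus> x"]) (auto simp: l_neg)
  qed (auto simp: a_ac)
qed (auto simp: is_cring l_distr r_distr m_assoc)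

lemma module_coord: "module R (coord_module R n)"
proof (rule moduleI)
  have cl: "x k \<in> carrier R" if "x \<in> {..<n} \<rightarrow>\<^sub>E carrier R" "k < n" for x k using that by (auto simp: PiE_iff)
  have ext: "x = y" if "x \<in> extensional {..<n}" "y \<in> extensional {..<n}" "\<And>k. k < n \<Longrightarrow> x k = y k"
    for x y :: "nat \<Rightarrow> 'a"
    using that by (intro extensionalityI) auto
  show "abelian_group (coord_module R n)"
  proof (rule abelian_groupI)
    fix x assume x: "x \<in> carrier (coord_module R n)"
    show "\<exists>y\<in>carrier (coord_module R n). y \<oplus>\<^bsub>coord_module R n\<^esub> x = \<zero>\<^bsub>coord_module R n\<^esub>"
      by (rule bexI[of _ "\<lambda>k\<in>{..<n}. \<ominus> x k"]) (use x cl[of x] in \<open>auto intro!: ext simp: l_neg\<close>)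
  next
    fix x y assume "x \<in> carrier (coord_module R n)" "y \<in> carrier (coord_module R n)"
    then show "x \<oplus>\<^bsub>coord_module R n\<^esub> y = y \<oplus>\<^bsub>coord_module R n\<^esub> x"
      using cl[of x] cl[of y] by (auto intro!: ext simp: a_comm)
  next
    fix x y z assume "x \<in> carrier (coord_module R n)" "y \<in> carrier (coord_module R n)"
      "z \<in> carrier (coord_module R n)"
    then show "x \<oplus>\<^bsub>coord_module R n\<^esub> y \<oplus>\<^bsub>coord_module R n\<^esub> z =
        x \<oplus>\<^bsub>coord_module R n\<^esub> (y \<oplus>\<^bsub>coord_module R n\<^esub> z)"
      using cl[of x] cl[of y] cl[of z] by (auto intro!: ext simp: a_assoc)
  qed (use cl in \<open>auto intro!: ext simp: PiE_iff\<close>)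
qed (auto intro!: is_cring extensionalityI[of _ "{..<n}"] simp: l_distr r_distr m_assoc PiE_iff)

definition functionals :: "('a, 'm) module \<Rightarrow> ('m \<Rightarrow> 'a) set" where
  "functionals M = linear_maps R M (self_module R)"

text \<open>A basis recorded together with its coordinate functionals, because determinants are
  evaluated on functionals and linear maps are constructed from coordinates.\<close>

definition dual_basis :: "('a, 'm) module \<Rightarrow> nat \<Rightarrow> (nat \<Rightarrow> 'm) \<Rightarrow> (nat \<Rightarrow> 'm \<Rightarrow> 'a) \<Rightarrow> bool" where
  "dual_basis M n e \<epsilon> \<longleftrightarrow> (\<forall>k<n. e k \<in> carrier M \<and> \<epsilon> k \<in> functionals M) \<and>
     (\<forall>k<n. \<forall>l<n. \<epsilon> k (e l) = (if k = l then \<one> else \<zero>)) \<and>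
     (\<forall>x\<in>carrier M. x = (\<Oplus>\<^bsub>M\<^esub>k\<in>{..<n}. \<epsilon> k x \<odot>\<^bsub>M\<^esub> e k))"

lemma functional_closed: "\<xi> \<in> functionals M \<Longrightarrow> x \<in> carrier M \<Longrightarrow> \<xi> x \<in> carrier R"
  unfolding functionals_def using linear_maps_closed by fastforce

lemma functional_add: "\<xi> \<in> functionals M \<Longrightarrow> x \<in> carrier M \<Longrightarrow> y \<in> carrier M \<Longrightarrow>
    \<xi> (x \<oplus>\<^bsub>M\<^esub> y) = \<xi> x \<oplus> \<xi> y"
  unfolding functionals_def using linear_maps_add by fastforce

lemma functional_smult: "\<xi> \<in> functionals M \<Longrightarrow> r \<in> carrier R \<Longrightarrow> x \<in> carrier M \<Longrightarrow>
    \<xi> (r \<odot>\<^bsub>M\<^esub> x) = r \<otimes> \<xi> x"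
  unfolding functionals_def using linear_maps_smult by fastforce

lemma functional_comp: "\<phi> \<in> linear_maps R M N \<Longrightarrow> \<xi> \<in> functionals N \<Longrightarrow> (\<lambda>x. \<xi> (\<phi> x)) \<in> functionals M"
  unfolding functionals_def by (rule linear_maps_comp)

lemma self_module_finsum: "finsum (self_module R) f I = finsum R f I"
  by (simp add: finsum_def finprod_def self_module_def)

lemma dual_basis_expand:
  "dual_basis M n e \<epsilon> \<Longrightarrow> x \<in> carrier M \<Longrightarrow> x = (\<Oplus>\<^bsub>M\<^esub>k\<in>{..<n}. \<epsilon> k x \<odot>\<^bsub>M\<^esub> e k)"
  unfolding dual_basis_def by blast

text \<open>The coordinate maps are linear because sums and multiples of coefficient vectors again
  represent the sum and the multiple, and coefficients are unique.\<close>

lemma dual_basis_of_module_basis: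
  assumes M: "module R M" and b: "module_basis R M n b"
  obtains \<epsilon> where "dual_basis M n b \<epsilon>"
proof -
  interpret M: module R M by fact
  have bc: "\<And>k. k < n \<Longrightarrow> b k \<in> carrier M" using b by (auto simp: module_basis_def)
  let ?P = "\<lambda>x c. c \<in> {..<n} \<rightarrow>\<^sub>E carrier R \<and> x = (\<Oplus>\<^bsub>M\<^esub>i\<in>{..<n}. c i \<odot>\<^bsub>M\<^esub> b i)"
  have ex: "\<exists>!c. ?P x c" if "x \<in> carrier M" for x using b that by (auto simp: module_basis_def)
  define \<epsilon> where "\<epsilon> k x = (THE c. ?P x c) k" for k x
  have P: "?P x (THE c. ?P x c)" if "x \<in> carrier M" for x using theI'[OF ex[OF that]] .
  \<comment> \<open>Uniqueness in \<open>module_basis\<close> concerns extensional coefficient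
    functions, so \<open>c\<close> is restricted to \<open>{..<n}\<close> before it can be
    compared.\<close>
  have uniq: "\<epsilon> k x = c k" if "x \<in> carrier M" "\<And>k. k < n \<Longrightarrow> c k \<in> carrier R"
    "x = (\<Oplus>\<^bsub>M\<^esub>i\<in>{..<n}. c i \<odot>\<^bsub>M\<^esub> b i)" "k < n" for x c k
  proof -
    have "x = (\<Oplus>\<^bsub>M\<^esub>i\<in>{..<n}. restrict c {..<n} i \<odot>\<^bsub>M\<^esub> b i)"
      unfolding that(3) by (rule M.finsum_cong') (use that(2) bc in auto)
    then have "?P x (restrict c {..<n})" using that(2) by auto
    then have "(THE c. ?P x c) = restrict c {..<n}" using ex[OF that(1)] P[OF that(1)] by blast
    then show ?thesis using that(4) by (simp add: \<epsilon>_def)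
  qed
  have cl: "\<epsilon> k x \<in> carrier R" if "x \<in> carrier M" "k < n" for x k
    using P[OF that(1)] that(2) by (auto simp: \<epsilon>_def PiE_mem)
  have rep: "x = (\<Oplus>\<^bsub>M\<^esub>k\<in>{..<n}. \<epsilon> k x \<odot>\<^bsub>M\<^esub> b k)" if "x \<in> carrier M" for x
    using P[OF that] by (simp add: \<epsilon>_def)
  have "\<epsilon> k \<in> functionals M" if k: "k < n" for k
    unfolding functionals_def
  proof (rule linear_mapsI)
    fix x y assume xy: "x \<in> carrier M" "y \<in> carrier M"
    have "x \<oplus>\<^bsub>M\<^esub> y = (\<Oplus>\<^bsub>M\<^esub>k\<in>{..<n}. \<epsilon> k x \<odot>\<^bsub>M\<^esub> b k) \<oplus>\<^bsub>M\<^esub> (\<Oplus>\<^bsub>M\<^esub>k\<in>{..<n}. \<epsilon> k y \<odot>\<^bsub>M\<^esub> b k)"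
      using rep xy by simp
    also have "\<dots> = (\<Oplus>\<^bsub>M\<^esub>k\<in>{..<n}. \<epsilon> k x \<odot>\<^bsub>M\<^esub> b k \<oplus>\<^bsub>M\<^esub> \<epsilon> k y \<odot>\<^bsub>M\<^esub> b k)"
      by (rule M.finsum_addf[symmetric]) (use cl xy bc in auto)
    also have "\<dots> = (\<Oplus>\<^bsub>M\<^esub>k\<in>{..<n}. (\<epsilon> k x \<oplus> \<epsilon> k y) \<odot>\<^bsub>M\<^esub> b k)"
      by (rule M.finsum_cong') (use cl xy bc in \<open>auto simp: M.smult_l_distr\<close>)
    finally have eq: "x \<oplus>\<^bsub>M\<^esub> y = (\<Oplus>\<^bsub>M\<^esub>k\<in>{..<n}. (\<epsilon> k x \<oplus> \<epsilon> k y) \<odot>\<^bsub>M\<^esub> b k)" .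
    have "\<epsilon> k (x \<oplus>\<^bsub>M\<^esub> y) = \<epsilon> k x \<oplus> \<epsilon> k y"
      by (rule uniq[OF _ _ eq k]) (use cl xy in auto)
    then show "\<epsilon> k (x \<oplus>\<^bsub>M\<^esub> y) = \<epsilon> k x \<oplus>\<^bsub>self_module R\<^esub> \<epsilon> k y" by simp
  next
    fix r x assume rx: "r \<in> carrier R" "x \<in> carrier M"
    have "r \<odot>\<^bsub>M\<^esub> x = r \<odot>\<^bsub>M\<^esub> (\<Oplus>\<^bsub>M\<^esub>k\<in>{..<n}. \<epsilon> k x \<odot>\<^bsub>M\<^esub> b k)"
      using rep rx by simp
    also have "\<dots> = (\<Oplus>\<^bsub>M\<^esub>k\<in>{..<n}. r \<odot>\<^bsub>M\<^esub> (\<epsilon> k x \<odot>\<^bsub>M\<^esub> b k))"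
      by (rule M.finsum_smult_ldistr) (use cl rx bc in auto)
    also have "\<dots> = (\<Oplus>\<^bsub>M\<^esub>k\<in>{..<n}. (r \<otimes> \<epsilon> k x) \<odot>\<^bsub>M\<^esub> b k)"
      by (rule M.finsum_cong') (use cl rx bc in \<open>auto simp: M.smult_assoc1\<close>)
    finally have eq: "r \<odot>\<^bsub>M\<^esub> x = (\<Oplus>\<^bsub>M\<^esub>k\<in>{..<n}. (r \<otimes> \<epsilon> k x) \<odot>\<^bsub>M\<^esub> b k)" .
    have "\<epsilon> k (r \<odot>\<^bsub>M\<^esub> x) = r \<otimes> \<epsilon> k x"
      by (rule uniq[OF _ _ eq k]) (use cl rx in auto)
    then show "\<epsilon> k (r \<odot>\<^bsub>M\<^esub> x) = r \<odot>\<^bsub>self_module R\<^esub> \<epsilon> k x" by simp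
  qed (use cl k in auto)
  moreover have "\<epsilon> k (b l) = (if k = l then \<one> else \<zero>)" if "k < n" "l < n" for k l
  proof (rule uniq)
    have "(\<Oplus>\<^bsub>M\<^esub>k\<in>{..<n}. (if k = l then \<one> else \<zero>) \<odot>\<^bsub>M\<^esub> b k) =
        (\<Oplus>\<^bsub>M\<^esub>k\<in>{..<n}. if l = k then b k else \<zero>\<^bsub>M\<^esub>)"
      by (rule M.finsum_cong') (use bc in auto)
    also have "\<dots> = b l" by (rule M.finsum_singleton) (use that bc in auto)
    finally show "b l = (\<Oplus>\<^bsub>M\<^esub>k\<in>{..<n}. (if k = l then \<one> else \<zero>) \<odot>\<^bsub>M\<^esub> b k)" ..
  qed (use bc that in auto)
  ultimately show ?thesis using that[of \<epsilon>] bc rep unfolding dual_basis_def by blast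
qed

lemma dual_basis_eqI:
  assumes M: "module R M" and N: "module R N" and b: "dual_basis M n b \<epsilon>"
    and \<phi>: "\<phi> \<in> linear_maps R M N" and \<psi>: "\<psi> \<in> linear_maps R M N"
    and eq: "\<And>k. k < n \<Longrightarrow> \<phi> (b k) = \<psi> (b k)" and x: "x \<in> carrier M"
  shows "\<phi> x = \<psi> x"
proof -
  interpret M: module R M by fact
  interpret N: module R N by fact
  have cl: "b k \<in> carrier M" "\<epsilon> k x \<in> carrier R" if "k < n" for k
    using b that x by (auto simp: dual_basis_def functional_closed)
  have *: "\<chi> x = (\<Oplus>\<^bsub>N\<^esub>k\<in>{..<n}. \<epsilon> k x \<odot>\<^bsub>N\<^esub> \<chi> (b k))" if \<chi>: "\<chi> \<in> linear_maps R M N" for \<chi>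
  proof -
    have "\<chi> x = \<chi> (\<Oplus>\<^bsub>M\<^esub>k\<in>{..<n}. \<epsilon> k x \<odot>\<^bsub>M\<^esub> b k)"
    using dual_basis_expand[OF b x] by (rule arg_cong)
    also have "\<dots> = (\<Oplus>\<^bsub>N\<^esub>k\<in>{..<n}. \<chi> (\<epsilon> k x \<odot>\<^bsub>M\<^esub> b k))"
      by (rule linear_maps_finsum[OF M N \<chi>]) (use cl in auto)
    also have "\<dots> = (\<Oplus>\<^bsub>N\<^esub>k\<in>{..<n}. \<epsilon> k x \<odot>\<^bsub>N\<^esub> \<chi> (b k))"
      by (rule N.finsum_cong') (use cl linear_maps_smult[OF \<chi>] linear_maps_closed[OF \<chi>] in auto)
    finally show ?thesis .
  qed
  have "(\<Oplus>\<^bsub>N\<^esub>k\<in>{..<n}. \<epsilon> k x \<odot>\<^bsub>N\<^esub> \<phi> (b k)) = (\<Oplus>\<^bsub>N\<^esub>k\<in>{..<n}. \<epsilon> k x \<odot>\<^bsub>N\<^esub> \<psi> (b k))"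
    by (rule N.finsum_cong') (use cl eq linear_maps_closed[OF \<psi>] in auto)
  then show ?thesis using *[OF \<phi>] *[OF \<psi>] by simp
qed

lemma dual_basis_extension:
  assumes M: "module R M" and N: "module R N" and b: "dual_basis M n b \<epsilon>"
    and z: "\<And>k. k < n \<Longrightarrow> z k \<in> carrier N"
  obtains \<phi> where "\<phi> \<in> linear_maps R M N" "\<And>k. k < n \<Longrightarrow> \<phi> (b k) = z k"
proof
  interpret M: module R M by fact
  interpret N: module R N by fact
  let ?\<phi> = "\<lambda>x. \<Oplus>\<^bsub>N\<^esub>k\<in>{..<n}. \<epsilon> k x \<odot>\<^bsub>N\<^esub> z k"
  show "?\<phi> \<in> linear_maps R M N"
    by (intro linear_maps_sum[OF N] linear_maps_scaled[OF N])
      (use b z in \<open>auto simp: dual_basis_def functionals_def\<close>)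
  fix l assume l: "l < n"
  have "?\<phi> (b l) = (\<Oplus>\<^bsub>N\<^esub>k\<in>{..<n}. if l = k then z k else \<zero>\<^bsub>N\<^esub>)"
    by (rule N.finsum_cong') (use b z l in \<open>auto simp: dual_basis_def\<close>)
  also have "\<dots> = z l" by (rule N.finsum_singleton) (use l z in auto)
  finally show "?\<phi> (b l) = z l" .
qed

lemma functional_expand:
  assumes M: "module R M" and b: "dual_basis M n b \<epsilon>" and \<xi>: "\<xi> \<in> functionals M" and x: "x \<in> carrier M"
  shows "\<xi> x = (\<Oplus>k\<in>{..<n}. \<xi> (b k) \<otimes> \<epsilon> k x)"
proof -
  interpret M: module R M by fact
  have cl: "b k \<in> carrier M" "\<epsilon> k x \<in> carrier R" if "k < n" for k
    using b that x by (auto simp: dual_basis_def functional_closed)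
  have "\<xi> x = \<xi> (\<Oplus>\<^bsub>M\<^esub>k\<in>{..<n}. \<epsilon> k x \<odot>\<^bsub>M\<^esub> b k)"
    using dual_basis_expand[OF b x] by (rule arg_cong)
  also have "\<dots> = (\<Oplus>\<^bsub>self_module R\<^esub>k\<in>{..<n}. \<xi> (\<epsilon> k x \<odot>\<^bsub>M\<^esub> b k))"
    by (rule linear_maps_finsum[OF M module_self \<xi>[unfolded functionals_def]]) (use cl in auto)
  also have "\<dots> = (\<Oplus>k\<in>{..<n}. \<xi> (b k) \<otimes> \<epsilon> k x)"
    unfolding self_module_finsum
  proof (rule finsum_cong')
    fix k assume "k \<in> {..<n}"
    then have k: "k < n" by simp
    show "\<xi> (\<epsilon> k x \<odot>\<^bsub>M\<^esub> b k) = \<xi> (b k) \<otimes> \<epsilon> k x"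
      using functional_smult[OF \<xi> cl(2)[OF k] cl(1)[OF k]]
        m_comm[OF cl(2)[OF k] functional_closed[OF \<xi> cl(1)[OF k]]] by simp
  qed (use cl functional_closed[OF \<xi>] in auto)
  finally show ?thesis .
qed

end

section \<open>Determinantal ideals without bases\<close>

context comm_base_ring
begin

lemma dual_basis_mem: "dual_basis M n e \<epsilon> \<Longrightarrow> k < n \<Longrightarrow> e k \<in> carrier M"
  and dual_basis_functional: "dual_basis M n e \<epsilon> \<Longrightarrow> k < n \<Longrightarrow> \<epsilon> k \<in> functionals M"
  and dual_basis_dual: "dual_basis M n e \<epsilon> \<Longrightarrow> k < n \<Longrightarrow> l < n \<Longrightarrow> \<epsilon> k (e l) = (if k = l then \<one> else \<zero>)"
  by (auto simp: dual_basis_def)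

definition det_values :: "('a, 'm) module \<Rightarrow> 'm set \<Rightarrow> nat \<Rightarrow> 'a set" where
  "det_values N S t = {ring_det R t (\<lambda>i j. \<xi> i (s j)) | \<xi> s.
     (\<forall>i<t. \<xi> i \<in> functionals N) \<and> (\<forall>j<t. s j \<in> S)}"

definition det_ideal :: "('a, 'm) module \<Rightarrow> 'm set \<Rightarrow> int \<Rightarrow> 'a set" where
  "det_ideal N S t = (if t \<le> 0 then carrier R else Idl (det_values N S (nat t)))"

lemma det_values_closed: "S \<subseteq> carrier N \<Longrightarrow> det_values N S t \<subseteq> carrier R"
  unfolding det_values_def by (auto intro!: ring_det_closed dest: functional_closed)

lemma ring_det_0: "ring_det R 0 A = \<one>"
proof -
  have "{\<pi>. \<pi> permutes {..<0::nat}} = {id}" by auto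
  then show ?thesis by (simp add: ring_det_def evenperm_id)
qed

text \<open>The empty determinant is one, so the generated ideal at size zero agrees with the
  convention for nonpositive sizes. Splitting off summands can thus run down to size zero without a
  separate case.\<close>

lemma det_ideal_of_nat:
  assumes "S \<subseteq> carrier N" shows "det_ideal N S (int t) = Idl (det_values N S t)"
proof (cases t)
  case 0
  have "\<one> \<in> det_values N S 0" unfolding det_values_def by (auto simp: ring_det_0)
  then have "\<one> \<in> Idl (det_values N S 0)"
    using genideal_self[OF det_values_closed[OF assms]] by blast
  then have "Idl (det_values N S 0) = carrier R"
    using ideal.one_imp_carrier[OF genideal_ideal[OF det_values_closed[OF assms]]] by blast
  then show ?thesis using 0 by (simp add: det_ideal_def)
qed (simp add: det_ideal_def del: of_nat_Suc)

lemma det_ideal_ideal: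
  assumes "S \<subseteq> carrier N" shows "ideal (det_ideal N S t) R"
  using genideal_ideal[OF det_values_closed[OF assms]] oneideal by (auto simp: det_ideal_def)

text \<open>Functionals on \<open>N'\<close> pull back along \<phi> and elements of
  \<open>S'\<close> lift to \<open>S\<close>, so each determinant for \<open>S'\<close> already
  occurs for \<open>S\<close>. All comparisons between different ambient modules rest on this
  one-sided statement.\<close>

lemma det_ideal_map_subset:
  assumes \<phi>: "\<phi> \<in> linear_maps R N N'" and S: "S \<subseteq> carrier N" and S': "S' \<subseteq> \<phi> ` S"
  shows "det_ideal N' S' t \<subseteq> det_ideal N S t"
proof -
  have "det_values N' S' n \<subseteq> det_values N S n" for n
  proof
    fix x assume "x \<in> det_values N' S' n"
    then obtain \<xi> s where x: "x = ring_det R n (\<lambda>i j. \<xi> i (s j))"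
      and \<xi>: "\<forall>i<n. \<xi> i \<in> functionals N'" and s: "\<forall>j<n. s j \<in> S'"
      unfolding det_values_def by blast
    have "\<forall>j. \<exists>u. j < n \<longrightarrow> u \<in> S \<and> s j = \<phi> u" using s S' by blast
    then obtain u where u: "\<And>j. j < n \<Longrightarrow> u j \<in> S \<and> s j = \<phi> (u j)" by metis
    have f: "(\<lambda>y. \<xi> i (\<phi> y)) \<in> functionals N" if "i < n" for i
      using functional_comp[OF \<phi>] \<xi> that by blast
    have "x = ring_det R n (\<lambda>i j. \<xi> i (\<phi> (u j)))" unfolding x
      by (rule ring_det_cong) (use u functional_closed[OF f] S in auto)
    then show "x \<in> det_values N S n" unfolding det_values_def using f u by fast
  qed
  then have "Idl (det_values N' S' n) \<subseteq> Idl (det_values N S n)" for n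
    by (intro genideal_minimal[OF genideal_ideal[OF det_values_closed[OF S]]]
        order.trans[OF _ genideal_self[OF det_values_closed[OF S]]])
  then show ?thesis by (simp add: det_ideal_def)
qed

text \<open>Corrects a functional by a multiple of \<epsilon>; with \<open>q\<close> its value at an
  element where \<epsilon> is one, the result vanishes there.\<close>

lemma functional_minus_scaled:
  assumes \<xi>: "\<xi> \<in> functionals N" and \<epsilon>: "\<epsilon> \<in> functionals N" and q: "q \<in> carrier R"
  shows "(\<lambda>y. \<xi> y \<oplus> \<ominus> (\<epsilon> y \<otimes> q)) \<in> functionals N"
proof -
  have add: "a \<oplus> b \<oplus> \<ominus> ((c \<oplus> d) \<otimes> q) = a \<oplus> \<ominus> (c \<otimes> q) \<oplus> (b \<oplus> \<ominus> (d \<otimes> q))"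
    if "a \<in> carrier R" "b \<in> carrier R" "c \<in> carrier R" "d \<in> carrier R" for a b c d
    using that q by (simp add: l_distr minus_add a_ac)
  have smult: "r \<otimes> a \<oplus> \<ominus> (r \<otimes> c \<otimes> q) = r \<otimes> (a \<oplus> \<ominus> (c \<otimes> q))"
    if "a \<in> carrier R" "r \<in> carrier R" "c \<in> carrier R" for a r c
    using that q by (simp add: r_distr r_minus m_assoc)
  show ?thesis
    unfolding functionals_def
    by (rule linear_mapsI)
      (simp_all add: functional_closed[OF \<xi>] functional_closed[OF \<epsilon>] q functional_add[OF \<xi>]
        functional_add[OF \<epsilon>] functional_smult[OF \<xi>] functional_smult[OF \<epsilon>] add smult)
qed

text \<open>If \<open>e \<in> S\<close> and \<open>\<epsilon> e = \<one>\<close>, then \<open>N\<close> and \<open>S\<close> both split off the summand generated by \<open>e\<close>; the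
  complements are the kernels of \<open>\<epsilon>\<close>.\<close>

lemma det_ideal_split_step:
  assumes N: "module R N" and S: "S \<subseteq> carrier N"
    and e: "e \<in> S" and \<epsilon>: "\<epsilon> \<in> functionals N" and one: "\<epsilon> e = \<one>"
    and cl: "\<And>s r. s \<in> S \<Longrightarrow> r \<in> carrier R \<Longrightarrow> s \<oplus>\<^bsub>N\<^esub> r \<odot>\<^bsub>N\<^esub> e \<in> S"
  shows "det_ideal N S (t + 1) = det_ideal N {s \<in> S. \<epsilon> s = \<zero>} t"
proof (cases "t < 0")
  case False
  then obtain n where t: "t = int n" by (metis int_nat_eq linorder_not_less)
  let ?S = "{s \<in> S. \<epsilon> s = \<zero>}"
  interpret N: module R N by fact
  have eN: "e \<in> carrier N" using e S by blast
  have S': "?S \<subseteq> carrier N" using S by blast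
  have "det_values N ?S n \<subseteq> det_values N S (Suc n)"
  proof
    fix x assume "x \<in> det_values N ?S n"
    then obtain \<xi> s where x: "x = ring_det R n (\<lambda>i j. \<xi> i (s j))"
      and \<xi>: "\<And>i. i < n \<Longrightarrow> \<xi> i \<in> functionals N" and s: "\<And>j. j < n \<Longrightarrow> s j \<in> ?S"
      unfolding det_values_def by blast
    \<comment> \<open>The determinant is bordered by \<epsilon> and \<open>e\<close>. Subtracting
      \<open>\<xi> i e\<close> times \<epsilon> makes the first \<open>n\<close> functionals vanish
      at \<open>e\<close>, so the last column becomes a unit vector; on the kernel of \<epsilon> the
      correction is invisible.\<close>
    define \<eta> where "\<eta> i = (if i < n then (\<lambda>y. \<xi> i y \<oplus> \<ominus> (\<epsilon> y \<otimes> \<xi> i e)) else \<epsilon>)" for i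
    define u where "u j = (if j < n then s j else e)" for j
    have \<eta>f: "\<eta> i \<in> functionals N" for i
    proof (cases "i < n")
      case True
      then have "\<eta> i = (\<lambda>y. \<xi> i y \<oplus> \<ominus> (\<epsilon> y \<otimes> \<xi> i e))" by (simp add: \<eta>_def)
      then show ?thesis
        using functional_minus_scaled[OF \<xi>[OF True] \<epsilon> functional_closed[OF \<xi>[OF True] eN]] by simp
    qed (simp add: \<eta>_def \<epsilon>)
    have uS: "u j \<in> S" for j using s e by (auto simp: u_def)
    have cl': "\<eta> i (u j) \<in> carrier R" for i j using functional_closed[OF \<eta>f] uS S by blast
    have "ring_det R (Suc n) (\<lambda>i j. \<eta> i (u j)) = ring_det R n (\<lambda>i j. \<eta> i (u j))"
    proof (rule ring_det_last_column)
      fix i assume "i < n"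
      then show "\<eta> i (u n) = \<zero>" using functional_closed[OF \<xi> eN] by (simp add: \<eta>_def u_def one r_neg)
    qed (auto simp: cl', simp add: \<eta>_def u_def one)
    also have "\<dots> = x" unfolding x
    proof (rule ring_det_cong)
      fix i j assume ij: "i < n" "j < n"
      then have "s j \<in> carrier N" "\<epsilon> (s j) = \<zero>" using s S by auto
      then show "\<eta> i (u j) = \<xi> i (s j)" "\<xi> i (s j) \<in> carrier R"
        using ij functional_closed[OF \<xi>] eN by (auto simp: \<eta>_def u_def)
    qed
    finally show "x \<in> det_values N S (Suc n)" unfolding det_values_def using \<eta>f uS by blast
  qed
  moreover have "det_values N S (Suc n) \<subseteq> Idl (det_values N ?S n)"
  proof
    fix x assume "x \<in> det_values N S (Suc n)"
    then obtain \<xi> s where x: "x = ring_det R (Suc n) (\<lambda>i j. \<xi> i (s j))"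
      and \<xi>: "\<And>i. i < Suc n \<Longrightarrow> \<xi> i \<in> functionals N" and s: "\<And>j. j < Suc n \<Longrightarrow> s j \<in> S"
      unfolding det_values_def by blast
    \<comment> \<open>\<open>u j\<close> is the projection of \<open>s j\<close> to the kernel of
      \<epsilon> along \<open>e\<close>. The parts along \<open>e\<close> contribute the matrix with
      entries \<open>\<xi> i e\<close> times \<open>\<epsilon> (s j)\<close>, which has rank
      one.\<close>
    define u where "u j = s j \<oplus>\<^bsub>N\<^esub> (\<ominus> \<epsilon> (s j)) \<odot>\<^bsub>N\<^esub> e" for j
    have sN: "s j \<in> carrier N" if "j < Suc n" for j using s S that by blast
    have \<epsilon>s: "\<epsilon> (s j) \<in> carrier R" if "j < Suc n" for j using functional_closed[OF \<epsilon> sN[OF that]] .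
    have \<xi>e: "\<xi> i e \<in> carrier R" if "i < Suc n" for i using functional_closed[OF \<xi>[OF that] eN] .
    have \<xi>s: "\<xi> i (s j) \<in> carrier R" if "i < Suc n" "j < Suc n" for i j
      using functional_closed[OF \<xi> sN] that by blast
    have \<xi>u: "\<xi> i (u j) = \<xi> i (s j) \<oplus> \<ominus> (\<epsilon> (s j) \<otimes> \<xi> i e)" if "i < Suc n" "j < Suc n" for i j
      using functional_add[OF \<xi>[OF that(1)] sN[OF that(2)], of "(\<ominus> \<epsilon> (s j)) \<odot>\<^bsub>N\<^esub> e"]
        functional_smult[OF \<xi>[OF that(1)] _ eN, of "\<ominus> \<epsilon> (s j)"] \<epsilon>s[OF that(2)] eN \<xi>e[OF that(1)]
      by (simp add: u_def l_minus)
    have uS: "u j \<in> ?S" if j: "j < Suc n" for j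
    proof -
      have "\<epsilon> (u j) = \<epsilon> (s j) \<oplus> (\<ominus> \<epsilon> (s j)) \<otimes> \<one>"
        using functional_add[OF \<epsilon> sN[OF j], of "(\<ominus> \<epsilon> (s j)) \<odot>\<^bsub>N\<^esub> e"]
          functional_smult[OF \<epsilon> _ eN, of "\<ominus> \<epsilon> (s j)"] \<epsilon>s[OF j] eN
        by (simp add: u_def one)
      then show ?thesis using cl[OF s[OF j], of "\<ominus> \<epsilon> (s j)"] \<epsilon>s[OF j]
        by (simp add: u_def r_neg)
    qed
    have uN: "u j \<in> carrier N" if "j < Suc n" for j using uS[OF that] S by blast
    have \<xi>uc: "\<xi> i (u j) \<in> carrier R" if "i < Suc n" "j < Suc n" for i j
      using functional_closed[OF \<xi> uN] that by blast
    have id: "ideal (Idl (det_values N ?S n)) R"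
      by (rule genideal_ideal[OF det_values_closed[OF S']])
    have "x = ring_det R (Suc n) (\<lambda>i j. \<xi> i (u j) \<oplus> \<xi> i e \<otimes> \<epsilon> (s j))"
      unfolding x
    proof (rule ring_det_cong)
      fix i j assume ij: "i < Suc n" "j < Suc n"
      show "\<xi> i (u j) \<oplus> \<xi> i e \<otimes> \<epsilon> (s j) \<in> carrier R" using ij \<xi>uc \<xi>e \<epsilon>s by simp
      show "\<xi> i (s j) = \<xi> i (u j) \<oplus> \<xi> i e \<otimes> \<epsilon> (s j)"
        using \<xi>u[OF ij] \<xi>e[OF ij(1)] \<epsilon>s[OF ij(2)] \<xi>s[OF ij] m_comm[OF \<xi>e[OF ij(1)] \<epsilon>s[OF ij(2)]]
        by (simp add: a_assoc l_neg)
    qed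
    also have "\<dots> \<in> Idl (det_values N ?S n)"
    proof (rule ring_det_rank_one_update_mem[OF id])
      fix r c assume rc: "r \<in> {..<n} \<rightarrow> {..<Suc n}" "c \<in> {..<n} \<rightarrow> {..<Suc n}"
      have "\<forall>i<n. \<xi> (r i) \<in> functionals N" "\<forall>j<n. u (c j) \<in> ?S"
        using rc \<xi> uS by (blast dest: funcset_mem)+
      then have "ring_det R n (\<lambda>i j. \<xi> (r i) (u (c j))) \<in> det_values N ?S n"
        unfolding det_values_def
        by (intro CollectI exI[of _ "\<lambda>i. \<xi> (r i)"] exI[of _ "\<lambda>j. u (c j)"]) simp
      then show "ring_det R n (\<lambda>i j. \<xi> (r i) (u (c j))) \<in> Idl (det_values N ?S n)"
        using genideal_self[OF det_values_closed[OF S']] by blast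
    qed (use \<xi>uc \<xi>e \<epsilon>s in auto)
    finally show "x \<in> Idl (det_values N ?S n)" .
  qed
  ultimately have "Idl (det_values N S (Suc n)) = Idl (det_values N ?S n)"
    using genideal_minimal[OF genideal_ideal[OF det_values_closed[OF S]]]
      genideal_minimal[OF genideal_ideal[OF det_values_closed[OF S']]]
      genideal_self[OF det_values_closed[OF S]] by (meson order.trans subset_antisym)
  then show ?thesis
    using det_ideal_of_nat[OF S, of "Suc n"] det_ideal_of_nat[OF S', of n] by (simp add: t add.commute)
qed (simp add: det_ideal_def)

text \<open>One summand at a time. Duality puts the next \<open>e q\<close> into the common kernel
  of the functionals already split off, so the single step applies to that kernel.\<close>

lemma det_ideal_split:
  assumes N: "module R N" and S: "S \<subseteq> carrier N"
    and e: "\<And>k. k < p \<Longrightarrow> e k \<in> S" and \<epsilon>: "\<And>k. k < p \<Longrightarrow> \<epsilon> k \<in> functionals N"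
    and dual: "\<And>k l. k < p \<Longrightarrow> l < p \<Longrightarrow> \<epsilon> k (e l) = (if k = l then \<one> else \<zero>)"
    and cl: "\<And>s r k. s \<in> S \<Longrightarrow> r \<in> carrier R \<Longrightarrow> k < p \<Longrightarrow> s \<oplus>\<^bsub>N\<^esub> r \<odot>\<^bsub>N\<^esub> e k \<in> S"
  shows "det_ideal N S (t + int p) = det_ideal N {s \<in> S. \<forall>k<p. \<epsilon> k s = \<zero>} t"
proof -
  have "det_ideal N S (t + int q) = det_ideal N {s \<in> S. \<forall>k<q. \<epsilon> k s = \<zero>} t" if "q \<le> p" for q
    using that
  proof (induction q arbitrary: t)
    case (Suc q)
    let ?S = "{s \<in> S. \<forall>k<q. \<epsilon> k s = \<zero>}"
    have "det_ideal N S (t + int (Suc q)) = det_ideal N ?S (t + 1)"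
      using Suc.IH[of "t + 1"] Suc.prems by (simp add: algebra_simps)
    also have "\<dots> = det_ideal N {s \<in> ?S. \<epsilon> q s = \<zero>} t"
    proof (rule det_ideal_split_step[OF N, of _ "e q"])
      fix s r assume s: "s \<in> ?S" and r: "r \<in> carrier R"
      have sN: "s \<in> carrier N" using s S by blast
      have eq: "e q \<in> carrier N" using e[of q] S Suc.prems by auto
      interpret N: module R N by fact
      have "\<epsilon> k (s \<oplus>\<^bsub>N\<^esub> r \<odot>\<^bsub>N\<^esub> e q) = \<zero>" if k: "k < q" for k
      proof -
        have f: "\<epsilon> k \<in> functionals N" using \<epsilon> k Suc.prems by simp
        have "\<epsilon> k (s \<oplus>\<^bsub>N\<^esub> r \<odot>\<^bsub>N\<^esub> e q) = \<epsilon> k s \<oplus> r \<otimes> \<epsilon> k (e q)"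
          using functional_add[OF f sN] functional_smult[OF f r eq] eq r by simp
        then show ?thesis using s k r dual[of k q] Suc.prems by simp
      qed
      then show "s \<oplus>\<^bsub>N\<^esub> r \<odot>\<^bsub>N\<^esub> e q \<in> ?S" using cl[of s r q] s r Suc.prems by simp
    qed (use S e \<epsilon> dual Suc.prems in auto)
    also have "{s \<in> ?S. \<epsilon> q s = \<zero>} = {s \<in> S. \<forall>k<Suc q. \<epsilon> k s = \<zero>}"
      by (auto simp: less_Suc_eq)
    finally show ?case .
  qed simp
  then show ?thesis by simp
qed

lemma det_ideal_prod_free:
  assumes N: "module R N" and K: "module R K" and b: "dual_basis K p b \<beta>"
    and S: "S \<subseteq> carrier N" and 0: "\<zero>\<^bsub>N\<^esub> \<in> S"
  shows "det_ideal (prod_module N K) (S \<times> carrier K) (t + int p) = det_ideal N S t"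
proof -
  interpret N: module R N by fact
  interpret K: module R K by fact
  have bc: "b k \<in> carrier K" "\<beta> k \<in> functionals K" if "k < p" for k using dual_basis_mem[OF b] dual_basis_functional[OF b] dual_basis_dual[OF b] that by auto
  let ?T = "prod_module N K"
  have T: "module R ?T" by (rule module_prod[OF N K])
  have "det_ideal ?T (S \<times> carrier K) (t + int p) =
      det_ideal ?T {s \<in> S \<times> carrier K. \<forall>k<p. \<beta> k (snd s) = \<zero>} t"
  proof (rule det_ideal_split[OF T, where e = "\<lambda>k. (\<zero>\<^bsub>N\<^esub>, b k)" and \<epsilon> = "\<lambda>k s. \<beta> k (snd s)"])
    show "(\<lambda>s. \<beta> k (snd s)) \<in> functionals ?T" if "k < p" for k
      using functional_comp[OF linear_maps_snd bc(2)[OF that]] .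
    show "\<beta> k (snd (\<zero>\<^bsub>N\<^esub>, b l)) = (if k = l then \<one> else \<zero>)" if "k < p" "l < p" for k l
      using dual_basis_mem[OF b] dual_basis_functional[OF b] dual_basis_dual[OF b] that by auto
    show "s \<oplus>\<^bsub>?T\<^esub> r \<odot>\<^bsub>?T\<^esub> (\<zero>\<^bsub>N\<^esub>, b k) \<in> S \<times> carrier K"
      if "s \<in> S \<times> carrier K" "r \<in> carrier R" "k < p" for s r k
    proof -
      have "fst s \<in> S" "fst s \<in> carrier N" "snd s \<in> carrier K" using that(1) S by auto
      then show ?thesis using that(2) bc(1)[OF that(3)] by simp
    qed
  qed (use S 0 bc in auto)
  also have "{s \<in> S \<times> carrier K. \<forall>k<p. \<beta> k (snd s) = \<zero>} = S \<times> {\<zero>\<^bsub>K\<^esub>}"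
  proof -
    have "x = \<zero>\<^bsub>K\<^esub>" if x: "x \<in> carrier K" and z: "\<forall>k<p. \<beta> k x = \<zero>" for x
    proof -
      have "x = (\<Oplus>\<^bsub>K\<^esub>k\<in>{..<p}. \<beta> k x \<odot>\<^bsub>K\<^esub> b k)" by (rule dual_basis_expand[OF b x])
      also have "\<dots> = (\<Oplus>\<^bsub>K\<^esub>k\<in>{..<p}. \<zero>\<^bsub>K\<^esub>)" by (rule K.finsum_cong') (use z bc in auto)
      finally show ?thesis by simp
    qed
    moreover have "\<beta> k \<zero>\<^bsub>K\<^esub> = \<zero>" if "k < p" for k
      using linear_maps_zero[OF K module_self, of "\<beta> k"] bc(2)[OF that] by (simp add: functionals_def)
    moreover have "\<zero>\<^bsub>K\<^esub> \<in> carrier K" by simp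
    ultimately have "{x \<in> carrier K. \<forall>k<p. \<beta> k x = \<zero>} = {\<zero>\<^bsub>K\<^esub>}" by blast
    moreover have "{s \<in> S \<times> carrier K. \<forall>k<p. \<beta> k (snd s) = \<zero>} =
        S \<times> {x \<in> carrier K. \<forall>k<p. \<beta> k x = \<zero>}" by auto
    ultimately show ?thesis by simp
  qed
  also have "det_ideal ?T (S \<times> {\<zero>\<^bsub>K\<^esub>}) t = det_ideal N S t"
  proof
    show "det_ideal ?T (S \<times> {\<zero>\<^bsub>K\<^esub>}) t \<subseteq> det_ideal N S t"
      by (rule det_ideal_map_subset[OF linear_maps_pair[OF linear_maps_id linear_maps_const_zero[OF K]] S]) auto
    show "det_ideal N S t \<subseteq> det_ideal ?T (S \<times> {\<zero>\<^bsub>K\<^esub>}) t"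
      by (rule det_ideal_map_subset[OF linear_maps_fst]) (use S in auto)
  qed
  finally show ?thesis .
qed

text \<open>In coordinates the matrix of a determinant for the image of \<phi> is a product
  \<open>X A Y\<close>. Its rows are expanded through the basis of \<open>N\<close> and its columns
  through the basis of \<open>M\<close>, which leaves submatrices of \<open>A\<close> with arbitrary
  selections.\<close>

lemma det_values_subset_ideal:
  assumes M: "module R M" and N: "module R N" and \<phi>: "\<phi> \<in> linear_maps R M N"
    and b: "dual_basis M q b \<beta>" and c: "dual_basis N p c \<gamma>" and J: "ideal J R"
    and A: "\<And>i j. i < p \<Longrightarrow> j < q \<Longrightarrow> A i j = \<gamma> i (\<phi> (b j))"
    and mem: "\<And>r d. r \<in> {..<t} \<rightarrow> {..<p} \<Longrightarrow> d \<in> {..<t} \<rightarrow> {..<q} \<Longrightarrow>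
      ring_det R t (\<lambda>i j. A (r i) (d j)) \<in> J"
  shows "det_values N (\<phi> ` carrier M) t \<subseteq> J"
proof
  fix x assume "x \<in> det_values N (\<phi> ` carrier M) t"
  then obtain \<xi> s where x: "x = ring_det R t (\<lambda>i j. \<xi> i (s j))"
    and \<xi>: "\<And>i. i < t \<Longrightarrow> \<xi> i \<in> functionals N" and s: "\<And>j. j < t \<Longrightarrow> s j \<in> \<phi> ` carrier M"
    unfolding det_values_def by blast
  have "\<forall>j. \<exists>y. j < t \<longrightarrow> y \<in> carrier M \<and> s j = \<phi> y" using s by blast
  then obtain y where y: "\<And>j. j < t \<Longrightarrow> y j \<in> carrier M" "\<And>j. j < t \<Longrightarrow> s j = \<phi> (y j)" by metis
  have sN: "s j \<in> carrier N" if "j < t" for j using y[OF that] linear_maps_closed[OF \<phi>] by simp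
  have bc: "b k \<in> carrier M" "\<beta> k \<in> functionals M" if "k < q" for k using dual_basis_mem[OF b] dual_basis_functional[OF b] dual_basis_dual[OF b] that by auto
  have cc: "c k \<in> carrier N" "\<gamma> k \<in> functionals N" if "k < p" for k using dual_basis_mem[OF c] dual_basis_functional[OF c] dual_basis_dual[OF c] that by auto
  have Ac: "A i j \<in> carrier R" if "i < p" "j < q" for i j
    using A[OF that] functional_closed[OF cc(2)[OF that(1)] linear_maps_closed[OF \<phi> bc(1)[OF that(2)]]] by simp
  show "x \<in> J" unfolding x
  proof (rule ring_det_row_span_mem[OF J, where K = "{..<p}" and y = "\<lambda>i l. \<xi> i (c l)" and v = "\<lambda>l j. \<gamma> l (s j)"])
    show "\<xi> i (s j) = (\<Oplus>l\<in>{..<p}. \<xi> i (c l) \<otimes> \<gamma> l (s j))" if "i < t" "j < t" for i j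
      using functional_expand[OF N c \<xi>[OF that(1)] sN[OF that(2)]] .
    fix r assume r: "r \<in> {..<t} \<rightarrow> {..<p}"
    have rp: "r i < p" if "i < t" for i using r that by auto
    have cl: "\<gamma> (r i) (s j) \<in> carrier R" if "i < t" "j < t" for i j
      using functional_closed[OF cc(2)[OF rp] sN] that by blast
    \<comment> \<open>The expansion lemma speaks of rows, so the transposed matrix is used to expand
      the columns through the basis of \<open>M\<close>.\<close>
    have "ring_det R t (\<lambda>j i. \<gamma> (r i) (s j)) \<in> J"
    proof (rule ring_det_row_span_mem[OF J, where K = "{..<q}" and y = "\<lambda>j k. \<beta> k (y j)" and v = "\<lambda>k i. A (r i) k"])
      fix j i assume ij: "j < t" "i < t"
      have f: "(\<lambda>z. \<gamma> (r i) (\<phi> z)) \<in> functionals M" using functional_comp[OF \<phi> cc(2)[OF rp[OF ij(2)]]] .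
      have "\<gamma> (r i) (s j) = (\<Oplus>k\<in>{..<q}. \<gamma> (r i) (\<phi> (b k)) \<otimes> \<beta> k (y j))"
        using functional_expand[OF M b f y(1)[OF ij(1)]] y(2)[OF ij(1)] by simp
      also have "\<dots> = (\<Oplus>k\<in>{..<q}. \<beta> k (y j) \<otimes> A (r i) k)"
      proof (rule finsum_cong')
        fix k assume "k \<in> {..<q}"
        then have k: "k < q" by simp
        show "\<gamma> (r i) (\<phi> (b k)) \<otimes> \<beta> k (y j) = \<beta> k (y j) \<otimes> A (r i) k"
          using m_comm[OF Ac[OF rp[OF ij(2)] k] functional_closed[OF bc(2)[OF k] y(1)[OF ij(1)]]]
            A[OF rp[OF ij(2)] k] by simp
      next
        show "(\<lambda>k. \<beta> k (y j) \<otimes> A (r i) k) \<in> {..<q} \<rightarrow> carrier R"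
          using Ac[OF rp[OF ij(2)]] functional_closed[OF bc(2) y(1)[OF ij(1)]] by auto
      qed simp
      finally show "\<gamma> (r i) (s j) = (\<Oplus>k\<in>{..<q}. \<beta> k (y j) \<otimes> A (r i) k)" .
    next
      fix d assume d: "d \<in> {..<t} \<rightarrow> {..<q}"
      have "A (r i) (d j) \<in> carrier R" if "i < t" "j < t" for i j using Ac rp d that by auto
      then have "ring_det R t (\<lambda>i j. A (r j) (d i)) = ring_det R t (\<lambda>i j. A (r i) (d j))"
        by (intro ring_det_transpose)
      then show "ring_det R t (\<lambda>i j. A (r j) (d i)) \<in> J" using mem[OF r d] by simp
    next
      show "\<beta> k (y j) \<in> carrier R" if "j < t" "k \<in> {..<q}" for j k
        using functional_closed[OF bc(2) y(1)] that by blast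
      show "A (r i) k \<in> carrier R" if "k \<in> {..<q}" "i < t" for k i
        using Ac[OF rp] that by blast
    qed simp
    then show "ring_det R t (\<lambda>i j. \<gamma> (r i) (s j)) \<in> J"
      using ring_det_transpose[of t "\<lambda>i j. \<gamma> (r i) (s j)"] cl by simp
  next
    show "\<xi> i (c l) \<in> carrier R" if "i < t" "l \<in> {..<p}" for i l
      using functional_closed[OF \<xi> cc(1)] that by blast
    show "\<gamma> l (s j) \<in> carrier R" if "l \<in> {..<p}" "j < t" for l j
      using functional_closed[OF cc(2) sN] that by blast
  qed simp
qed

lemma submatrix_det_in_det_values:
  assumes b: "dual_basis M q b \<beta>" and c: "dual_basis N p c \<gamma>"
    and \<phi>: "\<phi> \<in> linear_maps R M N"
    and A: "\<And>i j. i < p \<Longrightarrow> j < q \<Longrightarrow> A i j = \<gamma> i (\<phi> (b j))"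
    and rd: "r \<in> {..<t} \<rightarrow> {..<p}" "d \<in> {..<t} \<rightarrow> {..<q}"
  shows "ring_det R t (\<lambda>i j. A (r i) (d j)) \<in> det_values N (\<phi> ` carrier M) t"
proof -
  have 1: "\<gamma> (r i) \<in> functionals N" if "i < t" for i
    using dual_basis_functional[OF c, of "r i"] rd that by auto
  have 2: "b (d j) \<in> carrier M" if "j < t" for j
    using dual_basis_mem[OF b, of "d j"] rd that by auto
  have "ring_det R t (\<lambda>i j. A (r i) (d j)) = ring_det R t (\<lambda>i j. \<gamma> (r i) (\<phi> (b (d j))))"
    by (rule ring_det_cong)
      (use A rd functional_closed[OF 1] linear_maps_closed[OF \<phi> 2] in auto)
  also have "\<dots> \<in> det_values N (\<phi> ` carrier M) t"
    unfolding det_values_def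
    by (intro CollectI exI[of _ "\<lambda>i. \<gamma> (r i)"] exI[of _ "\<lambda>j. \<phi> (b (d j))"]) (use 1 2 in auto)
  finally show ?thesis .
qed

text \<open>\<open>free_rank\<close> is the least length of a basis, so a basis of exactly this
  length exists; this covers the zero ring, where lengths are not unique.\<close>

lemma free_dual_basis:
  assumes "free_finite_rank R M"
  obtains b \<epsilon> where "module_basis R M (free_rank R M) b" "dual_basis M (free_rank R M) b \<epsilon>"
proof -
  have M: "module R M" using assms by (simp add: free_finite_rank_def)
  have "\<exists>b. module_basis R M (free_rank R M) b"
  proof -
    obtain n where "\<exists>b. module_basis R M n b" using assms by (auto simp: free_finite_rank_def)
    then show ?thesis unfolding free_rank_def by (rule LeastI)
  qed
  then obtain b where b: "module_basis R M (free_rank R M) b" ..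
  obtain \<epsilon> where "dual_basis M (free_rank R M) b \<epsilon>" by (rule dual_basis_of_module_basis[OF M b])
  then show ?thesis using b that by blast
qed

text \<open>The right-hand side mentions no matrix, so the arbitrary matrix chosen by
  \<open>SOME\<close> drops out. Its minors are determinants of coordinate functionals at images of
  basis elements, and conversely they generate all determinants.\<close>

lemma minor_ideal_eq_det_ideal:
  assumes M: "free_finite_rank R M" and N: "free_finite_rank R N" and \<phi>: "\<phi> \<in> linear_maps R M N"
  shows "minor_ideal R M N \<phi> m = det_ideal N (\<phi> ` carrier M) m"
proof (cases "m \<le> 0")
  case False
  let ?q = "free_rank R M" and ?p = "free_rank R N"
  let ?V = "det_values N (\<phi> ` carrier M) (nat m)"
  have mM: "module R M" and mN: "module R N" using M N by (auto simp: free_finite_rank_def)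
  interpret N: module R N by fact
  have S: "\<phi> ` carrier M \<subseteq> carrier N" using linear_maps_closed[OF \<phi>] by blast
  note Vc = det_values_closed[OF S]
  obtain b0 \<beta>0 where b0: "module_basis R M ?q b0" "dual_basis M ?q b0 \<beta>0" by (rule free_dual_basis[OF M])
  obtain c0 \<gamma>0 where c0: "module_basis R N ?p c0" "dual_basis N ?p c0 \<gamma>0" by (rule free_dual_basis[OF N])
  have b0c: "\<phi> (b0 j) \<in> carrier N" if "j < ?q" for j
    by (rule linear_maps_closed[OF \<phi> dual_basis_mem[OF b0(2) that]])
  have \<gamma>0c: "\<gamma>0 i (\<phi> (b0 j)) \<in> carrier R" if "i < ?p" "j < ?q" for i j
    by (rule functional_closed[OF dual_basis_functional[OF c0(2) that(1)] b0c[OF that(2)]])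
  have ex: "\<exists>A. is_matrix_of R M N \<phi> A"
  proof (rule exI)
    show "is_matrix_of R M N \<phi> (\<lambda>i j. \<gamma>0 i (\<phi> (b0 j)))"
      unfolding is_matrix_of_def
    proof (intro exI conjI allI impI)
      fix j assume "j < ?q"
      show "\<phi> (b0 j) = (\<Oplus>\<^bsub>N\<^esub>i\<in>{..<?p}. \<gamma>0 i (\<phi> (b0 j)) \<odot>\<^bsub>N\<^esub> c0 i)"
        by (rule dual_basis_expand[OF c0(2) b0c[OF \<open>j < ?q\<close>]])
    qed (fact b0 c0, fact b0 c0, rule \<gamma>0c)
  qed
  define A where "A = (SOME A. is_matrix_of R M N \<phi> A)"
  have "is_matrix_of R M N \<phi> A" unfolding A_def using ex by (rule someI_ex)
  then obtain b c where b: "module_basis R M ?q b" and c: "module_basis R N ?p c"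
    and Ac: "\<And>i j. i < ?p \<Longrightarrow> j < ?q \<Longrightarrow> A i j \<in> carrier R"
    and A: "\<And>j. j < ?q \<Longrightarrow> \<phi> (b j) = (\<Oplus>\<^bsub>N\<^esub>i\<in>{..<?p}. A i j \<odot>\<^bsub>N\<^esub> c i)"
    unfolding is_matrix_of_def by blast
  obtain \<beta> where \<beta>: "dual_basis M ?q b \<beta>" by (rule dual_basis_of_module_basis[OF mM b])
  obtain \<gamma> where \<gamma>: "dual_basis N ?p c \<gamma>" by (rule dual_basis_of_module_basis[OF mN c])
  have cc: "c i \<in> carrier N" "\<gamma> i \<in> functionals N" if "i < ?p" for i
    using dual_basis_mem[OF \<gamma> that] dual_basis_functional[OF \<gamma> that] by auto
  have A\<gamma>: "A i j = \<gamma> i (\<phi> (b j))" if ij: "i < ?p" "j < ?q" for i j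
  proof -
    have "\<gamma> i (\<phi> (b j)) = (\<Oplus>\<^bsub>self_module R\<^esub>k\<in>{..<?p}. \<gamma> i (A k j \<odot>\<^bsub>N\<^esub> c k))"
      unfolding A[OF ij(2)]
      by (rule linear_maps_finsum[OF mN module_self cc(2)[OF ij(1), unfolded functionals_def]])
        (use Ac ij cc in auto)
    also have "\<dots> = (\<Oplus>k\<in>{..<?p}. if i = k then A k j else \<zero>)"
      unfolding self_module_finsum
    proof (rule finsum_cong')
      fix k assume "k \<in> {..<?p}"
      then have k: "k < ?p" by simp
      show "\<gamma> i (A k j \<odot>\<^bsub>N\<^esub> c k) = (if i = k then A k j else \<zero>)"
        using functional_smult[OF cc(2)[OF ij(1)] Ac[OF k ij(2)] cc(1)[OF k]] Ac[OF k ij(2)]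
          dual_basis_dual[OF \<gamma> ij(1) k] by simp
    qed (use Ac ij in auto)
    also have "\<dots> = A i j" by (rule finsum_singleton) (use ij Ac in auto)
    finally show ?thesis ..
  qed
  \<comment> \<open>Stated for every ideal because it is used twice: with the zero ideal when
    \<open>m\<close> exceeds a rank, and with the ideal of minors otherwise.\<close>
  have J: "ideal J R \<Longrightarrow> (\<And>r d. r \<in> {..<nat m} \<rightarrow> {..<?p} \<Longrightarrow> d \<in> {..<nat m} \<rightarrow> {..<?q} \<Longrightarrow>
      ring_det R (nat m) (\<lambda>i j. A (r i) (d j)) \<in> J) \<Longrightarrow> ?V \<subseteq> J" for J
    by (rule det_values_subset_ideal[OF mM mN \<phi> \<beta> \<gamma> _ A\<gamma>])
  show ?thesis
  proof (cases "m > int ?q \<or> m > int ?p")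
    case True
    then have large: "?p < nat m \<or> ?q < nat m" by linarith
    have "?V \<subseteq> {\<zero>}"
      by (rule J[OF zeroideal])
        (simp add: ring_det_submatrix_large[of ?p ?q A "nat m", OF Ac large])
    then have "Idl ?V \<subseteq> {\<zero>}" by (rule genideal_minimal[OF zeroideal])
    then have "Idl ?V = {\<zero>}"
      using additive_subgroup.zero_closed[OF ideal.axioms(1)[OF genideal_ideal[OF Vc]]] by blast
    then show ?thesis using True False by (simp add: minor_ideal_def det_ideal_def)
  next
    case small: False
    let ?M = "minors R ?p ?q A (nat m)"
    have MV: "?M \<subseteq> ?V"
    proof
      fix x assume "x \<in> ?M"
      then obtain r d where x: "x = ring_det R (nat m) (\<lambda>i j. A (r i) (d j))"
        and rd: "r ` {..<nat m} \<subseteq> {..<?p}" "d ` {..<nat m} \<subseteq> {..<?q}"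
        unfolding minors_def by blast
      show "x \<in> ?V"
        unfolding x by (rule submatrix_det_in_det_values[OF \<beta> \<gamma> \<phi> A\<gamma>]) (use rd in auto)
    qed
    then have Mc: "?M \<subseteq> carrier R" using Vc by blast
    have "?V \<subseteq> Idl ?M"
      by (rule J[OF genideal_ideal[OF Mc]], rule ring_det_submatrix_mem[OF genideal_ideal[OF Mc] Ac genideal_self[OF Mc]])
    then have "Idl ?V = Idl ?M"
      using MV genideal_minimal[OF genideal_ideal[OF Mc]] genideal_minimal[OF genideal_ideal[OF Vc]]
        genideal_self[OF Vc] by (meson order.trans subset_antisym)
    then show ?thesis using small False by (simp add: minor_ideal_def det_ideal_def A_def)
  qed
qed (simp add: minor_ideal_def det_ideal_def)

end

section \<open>Cones of maps of complexes\<close>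

context comm_base_ring
begin

lemma coord_dual_basis:
  "dual_basis (coord_module R n) n (\<lambda>k. \<lambda>l\<in>{..<n}. if l = k then \<one> else \<zero>) (\<lambda>k x. x k)"
proof -
  let ?N = "coord_module R n"
  let ?e = "\<lambda>k. \<lambda>l\<in>{..<n}. if l = k then \<one> else \<zero>"
  interpret N: module R ?N by (rule module_coord)
  have f: "(\<lambda>x. x k) \<in> functionals ?N" if "k < n" for k
    unfolding functionals_def by (rule linear_mapsI) (use that in \<open>auto simp: PiE_iff\<close>)
  have "x = (\<Oplus>\<^bsub>?N\<^esub>k\<in>{..<n}. x k \<odot>\<^bsub>?N\<^esub> ?e k)" if x: "x \<in> carrier ?N" for x
  proof -
    have xc: "x k \<in> carrier R" if "k < n" for k using x that by auto
    have cl: "x k \<odot>\<^bsub>?N\<^esub> ?e k \<in> carrier ?N" if "k < n" for k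
      by (rule N.smult_closed) (use xc that in auto)
    let ?y = "\<Oplus>\<^bsub>?N\<^esub>k\<in>{..<n}. x k \<odot>\<^bsub>?N\<^esub> ?e k"
    have y: "?y \<in> carrier ?N" by (rule N.finsum_closed) (use cl in auto)
    have "x l = ?y l" if l: "l < n" for l
    proof -
      have "?y l = (\<Oplus>\<^bsub>self_module R\<^esub>k\<in>{..<n}. (x k \<odot>\<^bsub>?N\<^esub> ?e k) l)"
        by (rule linear_maps_finsum[OF module_coord module_self f[OF l, unfolded functionals_def]])
          (use cl in auto)
      also have "\<dots> = (\<Oplus>k\<in>{..<n}. if l = k then x k else \<zero>)"
        unfolding self_module_finsum by (rule finsum_cong') (use xc l in auto)
      also have "\<dots> = x l" by (rule finsum_singleton) (use l xc in auto)
      finally show ?thesis ..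
    qed
    moreover have "x \<in> extensional {..<n}" "?y \<in> extensional {..<n}"
      using x y by (simp_all only: coord_module_simps PiE_iff)
    ultimately show ?thesis by (intro extensionalityI[of x "{..<n}" ?y]) (simp_all only: lessThan_iff)
  qed
  then have "\<forall>x\<in>carrier ?N. x = (\<Oplus>\<^bsub>?N\<^esub>k\<in>{..<n}. x k \<odot>\<^bsub>?N\<^esub> ?e k)" by blast
  moreover have "?e k \<in> carrier ?N" for k by auto
  moreover have "?e l k = (if k = l then \<one> else \<zero>)" if "k < n" for k l using that by simp
  ultimately show ?thesis unfolding dual_basis_def using f by (intro conjI) blast+
qed

section \<open>Free modules absorbed into coordinate modules\<close>

definition mutually_inverse ::
  "('a, 'm) module \<Rightarrow> ('a, 'n) module \<Rightarrow> ('m \<Rightarrow> 'n) \<Rightarrow> ('n \<Rightarrow> 'm) \<Rightarrow> bool" where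
  "mutually_inverse M N \<iota> \<kappa> \<longleftrightarrow> \<iota> \<in> linear_maps R M N \<and> \<kappa> \<in> linear_maps R N M \<and>
     (\<forall>w\<in>carrier N. \<iota> (\<kappa> w) = w) \<and> (\<forall>x\<in>carrier M. \<kappa> (\<iota> x) = x)"

lemma mutually_inverseD:
  assumes "mutually_inverse M N \<iota> \<kappa>"
  shows "\<iota> \<in> linear_maps R M N" "\<kappa> \<in> linear_maps R N M"
    "\<And>w. w \<in> carrier N \<Longrightarrow> \<iota> (\<kappa> w) = w" "\<And>x. x \<in> carrier M \<Longrightarrow> \<kappa> (\<iota> x) = x"
  using assms by (simp_all add: mutually_inverse_def)

text \<open>Freeness of rank \<open>n\<close> in a form that can be iterated: since \<open>u\<close>
  is arbitrary, the result of absorbing one module can absorb the next.\<close>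

definition coord_absorbs :: "('a, 'm) module \<Rightarrow> nat \<Rightarrow> bool" where
  "coord_absorbs M n \<longleftrightarrow>
     (\<forall>u. \<exists>\<iota> \<kappa>. mutually_inverse (prod_module M (coord_module R u)) (coord_module R (n + u)) \<iota> \<kappa>)"

lemma coord_absorbs_free:
  assumes M: "module R M" and b: "dual_basis M n b \<beta>"
  shows "coord_absorbs M n"
  unfolding coord_absorbs_def
proof
  fix u
  interpret M: module R M by fact
  let ?U = "coord_module R u" and ?W = "coord_module R (n + u)"
  let ?T = "prod_module M ?U"
  note bc = dual_basis_mem[OF b] and \<beta>f = dual_basis_functional[OF b]
  note \<beta>c = functional_closed[OF \<beta>f]
  let ?\<iota> = "\<lambda>x. \<lambda>k\<in>{..<n + u}. if k < n then \<beta> k (fst x) else snd x (k - n)"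
  let ?s = "\<lambda>w. \<Oplus>\<^bsub>M\<^esub>k\<in>{..<n}. w k \<odot>\<^bsub>M\<^esub> b k"
  let ?\<kappa> = "\<lambda>w. (?s w, \<lambda>k\<in>{..<u}. w (k + n))"
  have lt: "k - n < u" if "k < n + u" "\<not> k < n" for k using that by linarith
  have sl: "?s \<in> linear_maps R ?W M"
  proof (rule linear_maps_sum[OF M])
    fix k assume "k \<in> {..<n}"
    then have k: "k < n" by simp
    have "(\<lambda>w. w k) \<in> linear_maps R ?W (self_module R)"
      by (rule linear_mapsI) (use k in \<open>auto simp: PiE_iff\<close>)
    then show "(\<lambda>w. w k \<odot>\<^bsub>M\<^esub> b k) \<in> linear_maps R ?W M"
      by (rule linear_maps_scaled[OF M _ bc[OF k]])
  qed simp
  have \<kappa>: "?\<kappa> \<in> linear_maps R ?W ?T"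
  proof (rule linear_maps_pair[OF sl])
    show "(\<lambda>w. \<lambda>k\<in>{..<u}. w (k + n)) \<in> linear_maps R ?W ?U"
    proof (rule linear_mapsI)
      show "(\<lambda>k\<in>{..<u}. w (k + n)) \<in> carrier ?U" if "w \<in> carrier ?W" for w
        unfolding coord_module_simps restrict_PiE_iff
        using PiE_mem[OF that[unfolded coord_module_simps]] by simp
      show "(\<lambda>k\<in>{..<u}. (x \<oplus>\<^bsub>?W\<^esub> y) (k + n)) =
          (\<lambda>k\<in>{..<u}. x (k + n)) \<oplus>\<^bsub>?U\<^esub> (\<lambda>k\<in>{..<u}. y (k + n))" for x y
        by (simp only: coord_module_simps, rule restrict_ext) simp
      show "(\<lambda>k\<in>{..<u}. (r \<odot>\<^bsub>?W\<^esub> x) (k + n)) = r \<odot>\<^bsub>?U\<^esub> (\<lambda>k\<in>{..<u}. x (k + n))" for r x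
        by (simp only: coord_module_simps, rule restrict_ext) simp
    qed
  qed
  have \<iota>: "?\<iota> \<in> linear_maps R ?T ?W"
  proof (rule linear_mapsI)
    fix x assume "x \<in> carrier ?T"
    then have x: "fst x \<in> carrier M" "snd x \<in> {..<u} \<rightarrow>\<^sub>E carrier R" by (simp_all add: mem_Times_iff)
    have "snd x (k - n) \<in> carrier R" if "k < n + u" "\<not> k < n" for k
      using PiE_mem[OF x(2)] lt[OF that] by simp
    then show "?\<iota> x \<in> carrier ?W"
      unfolding coord_module_simps restrict_PiE_iff by (simp add: \<beta>c[OF _ x(1)])
  next
    fix x y assume "x \<in> carrier ?T" "y \<in> carrier ?T"
    then have xy: "fst x \<in> carrier M" "fst y \<in> carrier M" by (simp_all add: mem_Times_iff)
    show "?\<iota> (x \<oplus>\<^bsub>?T\<^esub> y) = ?\<iota> x \<oplus>\<^bsub>?W\<^esub> ?\<iota> y"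
      by (simp only: coord_module_simps prod_module_simps, rule restrict_ext)
        (simp add: functional_add[OF \<beta>f xy] lt)
  next
    fix r x assume r: "r \<in> carrier R" and "x \<in> carrier ?T"
    then have x: "fst x \<in> carrier M" by (simp add: mem_Times_iff)
    show "?\<iota> (r \<odot>\<^bsub>?T\<^esub> x) = r \<odot>\<^bsub>?W\<^esub> ?\<iota> x"
      by (simp only: coord_module_simps prod_module_simps, rule restrict_ext)
        (simp add: functional_smult[OF \<beta>f r x] lt)
  qed
  have \<iota>\<kappa>: "?\<iota> (?\<kappa> w) = w" if w: "w \<in> carrier ?W" for w
  proof -
    have wc: "w k \<in> carrier R" if "k < n + u" for k
      using PiE_mem[OF w[unfolded coord_module_simps]] that by simp
    have "\<beta> l (?s w) = w l" if l: "l < n" for l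
    proof -
      have "\<beta> l (?s w) = (\<Oplus>\<^bsub>self_module R\<^esub>k\<in>{..<n}. \<beta> l (w k \<odot>\<^bsub>M\<^esub> b k))"
        by (rule linear_maps_finsum[OF M module_self \<beta>f[OF l, unfolded functionals_def]])
          (use wc bc in auto)
      also have "\<dots> = (\<Oplus>k\<in>{..<n}. if l = k then w k else \<zero>)"
        unfolding self_module_finsum
      proof (rule finsum_cong')
        fix k assume "k \<in> {..<n}"
        then have k: "k < n" by simp
        then have "w k \<in> carrier R" by (simp add: wc)
        then show "\<beta> l (w k \<odot>\<^bsub>M\<^esub> b k) = (if l = k then w k else \<zero>)"
          using functional_smult[OF \<beta>f[OF l] _ bc[OF k], of "w k"] dual_basis_dual[OF b l k] by auto
      qed (use wc in auto)
      also have "\<dots> = w l" by (rule finsum_singleton) (use l wc in auto)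
      finally show ?thesis .
    qed
    then have "?\<iota> (?\<kappa> w) k = w k" if "k < n + u" for k using that lt by simp
    moreover have "w \<in> extensional {..<n + u}" using w by (simp only: coord_module_simps PiE_iff)
    ultimately show ?thesis
      by (intro extensionalityI[of _ "{..<n + u}"] restrict_extensional) (simp_all only: lessThan_iff)
  qed
  have \<kappa>\<iota>: "?\<kappa> (?\<iota> x) = x" if x: "x \<in> carrier ?T" for x
  proof -
    obtain y z where xyz: "x = (y, z)" "y \<in> carrier M" "z \<in> carrier ?U"
      using x by (cases x) (auto simp del: coord_module_simps)
    have "?s (?\<iota> x) = (\<Oplus>\<^bsub>M\<^esub>k\<in>{..<n}. \<beta> k y \<odot>\<^bsub>M\<^esub> b k)"
      by (rule M.finsum_cong') (use bc \<beta>c[OF _ xyz(2)] xyz(1) in auto)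
    also have "\<dots> = y" by (rule dual_basis_expand[OF b xyz(2), symmetric])
    finally have 1: "?s (?\<iota> x) = y" .
    have "(\<lambda>k\<in>{..<u}. ?\<iota> x (k + n)) = z"
    proof (rule extensionalityI[of _ "{..<u}"])
      show "z \<in> extensional {..<u}" using xyz(3) by (simp only: coord_module_simps PiE_iff)
      show "(\<lambda>k\<in>{..<u}. ?\<iota> x (k + n)) k = z k" if "k \<in> {..<u}" for k using that xyz(1) by simp
    qed (rule restrict_extensional)
    with 1 have "?\<kappa> (?\<iota> x) = (y, z)" by (simp only:)
    then show ?thesis unfolding xyz(1) .
  qed
  have "mutually_inverse ?T ?W ?\<iota> ?\<kappa>"
    unfolding mutually_inverse_def by (intro conjI ballI \<iota> \<kappa> \<iota>\<kappa> \<kappa>\<iota>)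
  then show "\<exists>\<iota> \<kappa>. mutually_inverse ?T ?W \<iota> \<kappa>" by (intro exI)
qed

lemma coord_absorbs_free_rank:
  assumes "free_finite_rank R M" shows "coord_absorbs M (free_rank R M)"
proof -
  have M: "module R M" using assms by (simp add: free_finite_rank_def)
  obtain b \<beta> where "dual_basis M (free_rank R M) b \<beta>" by (rule free_dual_basis[OF assms])
  then show ?thesis by (rule coord_absorbs_free[OF M])
qed

text \<open>\<open>N\<close> is absorbed first, into the given coordinate module, and
  \<open>M\<close> into the result; ranks add up.\<close>

lemma coord_absorbs_prod:
  assumes M: "coord_absorbs M m" and N: "coord_absorbs N n"
  shows "coord_absorbs (prod_module M N) (m + n)"
  unfolding coord_absorbs_def
proof
  fix u
  let ?U = "coord_module R u" and ?V = "coord_module R (n + u)" and ?W = "coord_module R (m + (n + u))"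
  let ?T = "prod_module (prod_module M N) ?U"
  obtain \<iota>1 \<kappa>1 where "mutually_inverse (prod_module N ?U) ?V \<iota>1 \<kappa>1"
    using N unfolding coord_absorbs_def by blast
  note 1 = mutually_inverseD[OF this]
  obtain \<iota>2 \<kappa>2 where "mutually_inverse (prod_module M ?V) ?W \<iota>2 \<kappa>2"
    using M unfolding coord_absorbs_def by blast
  note 2 = mutually_inverseD[OF this]
  let ?\<iota> = "\<lambda>x. \<iota>2 (fst (fst x), \<iota>1 (snd (fst x), snd x))"
  let ?\<kappa> = "\<lambda>w. ((fst (\<kappa>2 w), fst (\<kappa>1 (snd (\<kappa>2 w)))), snd (\<kappa>1 (snd (\<kappa>2 w))))"
  have ff: "(\<lambda>x. fst (fst x)) \<in> linear_maps R ?T M" "(\<lambda>x. snd (fst x)) \<in> linear_maps R ?T N"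
    by (rule linear_maps_comp[OF linear_maps_fst linear_maps_fst],
      rule linear_maps_comp[OF linear_maps_fst linear_maps_snd])
  have \<iota>: "?\<iota> \<in> linear_maps R ?T ?W"
    by (rule linear_maps_comp[OF linear_maps_pair[OF ff(1)
      linear_maps_comp[OF linear_maps_pair[OF ff(2) linear_maps_snd] 1(1)]] 2(1)])
  have k2: "(\<lambda>w. \<kappa>1 (snd (\<kappa>2 w))) \<in> linear_maps R ?W (prod_module N ?U)"
    by (rule linear_maps_comp[OF linear_maps_comp[OF 2(2) linear_maps_snd] 1(2)])
  have \<kappa>: "?\<kappa> \<in> linear_maps R ?W ?T"
    by (rule linear_maps_pair[OF linear_maps_pair[OF linear_maps_comp[OF 2(2) linear_maps_fst]
      linear_maps_comp[OF k2 linear_maps_fst]] linear_maps_comp[OF k2 linear_maps_snd]])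
  have \<iota>\<kappa>: "?\<iota> (?\<kappa> w) = w" if w: "w \<in> carrier ?W" for w
  proof -
    have "\<kappa>2 w \<in> carrier (prod_module M ?V)" by (rule linear_maps_closed[OF 2(2) w])
    then have "snd (\<kappa>2 w) \<in> carrier ?V" by (simp only: prod_module_simps mem_Times_iff)
    from 1(3)[OF this] show ?thesis using 2(3)[OF w] by simp
  qed
  have \<kappa>\<iota>: "?\<kappa> (?\<iota> x) = x" if x: "x \<in> carrier ?T" for x
  proof -
    obtain a b c where abc: "x = ((a, b), c)" "a \<in> carrier M" "b \<in> carrier N" "c \<in> carrier ?U"
      using x by (cases x) (auto simp del: coord_module_simps)
    have bc: "(b, c) \<in> carrier (prod_module N ?U)" using abc by simp
    have "(a, \<iota>1 (b, c)) \<in> carrier (prod_module M ?V)" using abc linear_maps_closed[OF 1(1) bc] by simp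
    from 2(4)[OF this] show ?thesis using 1(4)[OF bc] abc(1) by simp
  qed
  have "mutually_inverse ?T ?W ?\<iota> ?\<kappa>"
    unfolding mutually_inverse_def by (intro conjI ballI \<iota> \<kappa> \<iota>\<kappa> \<kappa>\<iota>)
  then show "\<exists>\<iota> \<kappa>. mutually_inverse ?T (coord_module R (m + n + u)) \<iota> \<kappa>"
    unfolding add.assoc by (intro exI)
qed

end

text \<open>A finite stretch of two complexes, counted upwards from a degree where both vanish;
  \<open>d n\<close> starts in degree \<open>Suc n\<close>. The cone in degree \<open>n\<close>
  involves \<open>F' (Suc n)\<close>, so \<open>F'\<close> is required to vanish in degree one as
  well, and the cone then starts with the zero module.\<close>

locale complex_map = comm_base_ring R for R :: "'r ring" (structure) +
  fixes F :: "nat \<Rightarrow> ('r, 'b) module" and d :: "nat \<Rightarrow> 'b \<Rightarrow> 'b"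
    and F' :: "nat \<Rightarrow> ('r, 'c) module" and d' :: "nat \<Rightarrow> 'c \<Rightarrow> 'c"
    and a :: "nat \<Rightarrow> 'b \<Rightarrow> 'c" and L :: nat
  assumes free: "n \<le> Suc L \<Longrightarrow> free_finite_rank R (F n)"
    and free': "n \<le> Suc L \<Longrightarrow> free_finite_rank R (F' n)"
    and d: "n \<le> L \<Longrightarrow> d n \<in> linear_maps R (F (Suc n)) (F n)"
    and d': "n \<le> L \<Longrightarrow> d' n \<in> linear_maps R (F' (Suc n)) (F' n)"
    and a: "n \<le> Suc L \<Longrightarrow> a n \<in> linear_maps R (F n) (F' n)"
    and dd: "Suc n \<le> L \<Longrightarrow> x \<in> carrier (F (Suc (Suc n))) \<Longrightarrow> d n (d (Suc n) x) = \<zero>\<^bsub>F n\<^esub>"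
    and dd': "Suc n \<le> L \<Longrightarrow> y \<in> carrier (F' (Suc (Suc n))) \<Longrightarrow> d' n (d' (Suc n) y) = \<zero>\<^bsub>F' n\<^esub>"
    and ad: "n \<le> L \<Longrightarrow> x \<in> carrier (F (Suc n)) \<Longrightarrow> a n (d n x) = d' n (a (Suc n) x)"
    and trivial: "carrier (F 0) = {\<zero>\<^bsub>F 0\<^esub>}" "carrier (F' 0) = {\<zero>\<^bsub>F' 0\<^esub>}"
      "carrier (F' (Suc 0)) = {\<zero>\<^bsub>F' (Suc 0)\<^esub>}"
begin

definition cone :: "nat \<Rightarrow> ('r, 'b \<times> 'c) module" where
  "cone n = prod_module (F n) (F' (Suc n))"

text \<open>In the square, the sign on \<open>d\<close> lets the terms coming from
  \<open>a d\<close> and from \<open>d' a\<close> cancel.\<close>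

definition cone_d :: "nat \<Rightarrow> 'b \<times> 'c \<Rightarrow> 'b \<times> 'c" where
  "cone_d n z = (\<ominus>\<^bsub>F n\<^esub> d n (fst z), a (Suc n) (fst z) \<oplus>\<^bsub>F' (Suc n)\<^esub> d' (Suc n) (snd z))"

text \<open>Truncated: the maps are \<open>S 0\<close> up to \<open>S (n - 1)\<close>, and the
  homotopy identity is asked in degrees 1 to \<open>n - 1\<close>. In degree zero the cone vanishes
  and nothing has to be said.\<close>

definition contraction :: "(nat \<Rightarrow> 'b \<times> 'c \<Rightarrow> 'b \<times> 'c) \<Rightarrow> nat \<Rightarrow> bool" where
  "contraction S n \<longleftrightarrow> (\<forall>m<n. S m \<in> linear_maps R (cone m) (cone (Suc m))) \<and>
     (\<forall>m. Suc m < n \<longrightarrow> (\<forall>x\<in>carrier (cone (Suc m)).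
        cone_d (Suc m) (S (Suc m) x) \<oplus>\<^bsub>cone (Suc m)\<^esub> S m (cone_d m x) = x))"

lemma mod: "n \<le> Suc L \<Longrightarrow> module R (F n)" and mod': "n \<le> Suc L \<Longrightarrow> module R (F' n)"
  using free free' by (auto simp: free_finite_rank_def)

lemma cone_mod: "n \<le> L \<Longrightarrow> module R (cone n)"
  unfolding cone_def by (rule module_prod) (auto intro: mod mod')

lemma carrier_cone: "carrier (cone n) = carrier (F n) \<times> carrier (F' (Suc n))"
  by (simp add: cone_def)

lemma cone_d_linear:
  assumes "n < L" shows "cone_d n \<in> linear_maps R (cone (Suc n)) (cone n)"
  unfolding cone_d_def[abs_def] cone_def
  by (intro linear_maps_pair linear_maps_neg linear_maps_plus mod mod'
      linear_maps_comp[OF linear_maps_fst] linear_maps_comp[OF linear_maps_snd] d d' a)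
    (use assms in auto)

lemma cone_dd:
  assumes n: "Suc n < L" and z: "z \<in> carrier (cone (Suc (Suc n)))"
  shows "cone_d n (cone_d (Suc n) z) = \<zero>\<^bsub>cone n\<^esub>"
proof -
  interpret F0: module R "F n" using n by (intro mod) simp
  interpret F1: module R "F (Suc n)" using n by (intro mod) simp
  interpret G1: module R "F' (Suc n)" using n by (intro mod') simp
  interpret G2: module R "F' (Suc (Suc n))" using n by (intro mod') simp
  obtain x y where xy: "z = (x, y)" "x \<in> carrier (F (Suc (Suc n)))" "y \<in> carrier (F' (Suc (Suc (Suc n))))"
    using z by (auto simp: carrier_cone)
  have dn: "d n \<in> linear_maps R (F (Suc n)) (F n)" using n by (intro d) simp
  have dx: "d (Suc n) x \<in> carrier (F (Suc n))" by (rule linear_maps_closed[OF d xy(2)]) (use n in simp)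
  have ax: "a (Suc (Suc n)) x \<in> carrier (F' (Suc (Suc n)))" by (rule linear_maps_closed[OF a xy(2)]) (use n in simp)
  have dy: "d' (Suc (Suc n)) y \<in> carrier (F' (Suc (Suc n)))" by (rule linear_maps_closed[OF d' xy(3)]) (use n in simp)
  have a1: "a (Suc n) \<in> linear_maps R (F (Suc n)) (F' (Suc n))" using n by (intro a) simp
  have d1: "d' (Suc n) \<in> linear_maps R (F' (Suc (Suc n))) (F' (Suc n))" using n by (intro d') simp
  have adx: "a (Suc n) (d (Suc n) x) = d' (Suc n) (a (Suc (Suc n)) x)" using ad[OF _ xy(2)] n by simp
  have "d n (\<ominus>\<^bsub>F (Suc n)\<^esub> d (Suc n) x) = \<zero>\<^bsub>F n\<^esub>"
    using linear_maps_a_inv[OF F1.module_axioms F0.module_axioms dn dx] dd[OF _ xy(2)] n by simp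
  moreover have "a (Suc n) (\<ominus>\<^bsub>F (Suc n)\<^esub> d (Suc n) x) = \<ominus>\<^bsub>F' (Suc n)\<^esub> d' (Suc n) (a (Suc (Suc n)) x)"
    using linear_maps_a_inv[OF F1.module_axioms G1.module_axioms a1 dx] adx by simp
  moreover have "d' (Suc n) (a (Suc (Suc n)) x \<oplus>\<^bsub>F' (Suc (Suc n))\<^esub> d' (Suc (Suc n)) y) = d' (Suc n) (a (Suc (Suc n)) x)"
    using linear_maps_add[OF d1 ax dy] dd'[OF _ xy(3)] n linear_maps_closed[OF d1 ax] by simp
  ultimately show ?thesis
    using linear_maps_closed[OF d1 ax] by (simp add: cone_d_def xy(1) cone_def G1.l_neg)
qed

text \<open>Below degree zero there is no cone, hence the special case, in which every element is a
  cycle.\<close>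

definition cone_cycle :: "nat \<Rightarrow> 'b \<times> 'c \<Rightarrow> bool" where
  "cone_cycle n z \<longleftrightarrow> z \<in> carrier (cone n) \<and> (n = 0 \<or> cone_d (n - 1) z = \<zero>\<^bsub>cone (n - 1)\<^esub>)"

lemma cone_cycle_d: "n < L \<Longrightarrow> z \<in> carrier (cone (Suc n)) \<Longrightarrow> cone_cycle n (cone_d n z)"
  unfolding cone_cycle_def using linear_maps_closed[OF cone_d_linear, of n z] cone_dd[of "n - 1" z]
  by (cases n) auto

lemma carrier_cone_0: "carrier (cone 0) = {\<zero>\<^bsub>cone 0\<^esub>}"
  using trivial by (simp add: cone_def)

text \<open>On a cycle the summand \<open>S (n - 1)\<close> after the differential drops out of the
  homotopy identity, so \<open>S n\<close> gives a primitive. In degree zero everything is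
  zero.\<close>

lemma cone_d_contraction:
  assumes S: "contraction S (Suc n)" and n: "n < L" and z: "cone_cycle n z"
  shows "cone_d n (S n z) = z"
proof (cases n)
  case 0
  then have z0: "z = \<zero>\<^bsub>cone 0\<^esub>" using z carrier_cone_0 by (auto simp: cone_cycle_def)
  have S0: "S 0 \<in> linear_maps R (cone 0) (cone (Suc 0))" using S 0 by (auto simp: contraction_def)
  have "cone_d 0 (S 0 z) \<in> carrier (cone 0)"
    using linear_maps_closed[OF cone_d_linear linear_maps_closed[OF S0]] n 0 z by (auto simp: cone_cycle_def)
  then show ?thesis using carrier_cone_0 z0 0 by simp
next
  case (Suc m)
  interpret C: module R "cone n" using n by (intro cone_mod) simp
  have zc: "z \<in> carrier (cone n)" and zm: "cone_d m z = \<zero>\<^bsub>cone m\<^esub>" using z Suc by (auto simp: cone_cycle_def)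
  have Sm: "S m \<in> linear_maps R (cone m) (cone n)" and Sn: "S n \<in> linear_maps R (cone n) (cone (Suc n))"
    using S Suc by (auto simp: contraction_def)
  have "cone_d n (S n z) \<oplus>\<^bsub>cone n\<^esub> S m (cone_d m z) = z"
    using S Suc zc by (auto simp: contraction_def)
  moreover have "S m (cone_d m z) = \<zero>\<^bsub>cone n\<^esub>"
    unfolding zm using n Suc by (intro linear_maps_zero[OF cone_mod cone_mod Sm]) auto
  moreover have "cone_d n (S n z) \<in> carrier (cone n)"
    using linear_maps_closed[OF cone_d_linear[OF n] linear_maps_closed[OF Sn zc]] .
  ultimately show ?thesis by simp
qed

section \<open>Stable freeness of the cycles of the cone\<close>

abbreviation rk :: "nat \<Rightarrow> nat" where "rk n \<equiv> free_rank R (F n)"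
abbreviation rk' :: "nat \<Rightarrow> nat" where "rk' n \<equiv> free_rank R (F' n)"

lemma cone_absorbs: "n \<le> L \<Longrightarrow> coord_absorbs (cone n) (rk n + rk' (Suc n))"
  unfolding cone_def
  by (rule coord_absorbs_prod)
    (simp_all add: coord_absorbs_free_rank free free')

text \<open>The cycles \<open>B\<close> of the cone in degree \<open>n\<close> are stably free: \<open>G\<close> restricts to an isomorphism from
  \<open>B \<times> R\<^sup>u\<close> to \<open>R\<^sup>v\<close> with inverse \<open>(\<beta>, \<gamma>)\<close>.\<close>

definition stably_free_cycles ::
  "nat \<Rightarrow> nat \<Rightarrow> nat \<Rightarrow> (('b \<times> 'c) \<times> (nat \<Rightarrow> 'r) \<Rightarrow> nat \<Rightarrow> 'r) \<Rightarrow> ((nat \<Rightarrow> 'r) \<Rightarrow> 'b \<times> 'c) \<Rightarrow>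
   ((nat \<Rightarrow> 'r) \<Rightarrow> nat \<Rightarrow> 'r) \<Rightarrow> bool" where
  "stably_free_cycles n u v G \<beta> \<gamma> \<longleftrightarrow>
     G \<in> linear_maps R (prod_module (cone n) (coord_module R u)) (coord_module R v) \<and>
     \<beta> \<in> linear_maps R (coord_module R v) (cone n) \<and>
     \<gamma> \<in> linear_maps R (coord_module R v) (coord_module R u) \<and>
     (\<forall>w\<in>carrier (coord_module R v). cone_cycle n (\<beta> w) \<and> G (\<beta> w, \<gamma> w) = w) \<and>
     (\<forall>x. cone_cycle n x \<longrightarrow> (\<forall>z\<in>carrier (coord_module R u). \<beta> (G (x, z)) = x \<and> \<gamma> (G (x, z)) = z))"

end

context complex_map
begin

lemma stably_free_cycles_zero:
  "stably_free_cycles 0 0 0 (\<lambda>x. \<zero>\<^bsub>coord_module R 0\<^esub>) (\<lambda>w. \<zero>\<^bsub>cone 0\<^esub>) (\<lambda>w. \<zero>\<^bsub>coord_module R 0\<^esub>)"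
proof -
  interpret C: module R "cone 0" by (rule cone_mod) simp
  have 0: "w = \<zero>\<^bsub>coord_module R 0\<^esub>" if "w \<in> carrier (coord_module R 0)" for w
    using that by (simp add: fun_eq_iff)
  have 1: "x = \<zero>\<^bsub>cone 0\<^esub>" if "cone_cycle 0 x" for x
    using that carrier_cone_0 unfolding cone_cycle_def by blast
  have 2: "cone_cycle 0 \<zero>\<^bsub>cone 0\<^esub>" by (simp add: cone_cycle_def)
  show ?thesis
    unfolding stably_free_cycles_def
    by (intro conjI linear_maps_const_zero module_coord cone_mod ballI allI impI 2)
      (auto simp del: coord_module_simps dest: 0 1)
qed

text \<open>Write \<open>B\<close> and \<open>B'\<close> for the cycles in degrees \<open>n\<close>
  and \<open>Suc n\<close>, and \<open>C'\<close> for the cone in degree \<open>Suc n\<close>. The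
  differential maps \<open>C'\<close> onto \<open>B\<close> with kernel \<open>B'\<close>, and
  \<open>S n\<close> splits it. Hence adding the free module of rank \<open>v\<close> to
  \<open>B'\<close> amounts to adding \<open>B\<close> and the free module of rank \<open>u\<close>,
  which gives \<open>C'\<close> plus rank \<open>u\<close>. So the old \<open>v\<close> becomes the
  new \<open>u\<close>.\<close>

lemma stably_free_cycles_Suc:
  assumes n: "Suc n \<le> L" and S: "contraction S (Suc n)" and sf: "stably_free_cycles n u v G \<beta> \<gamma>"
  shows "\<exists>G \<beta> \<gamma>. stably_free_cycles (Suc n) v (rk (Suc n) + rk' (Suc (Suc n)) + u) G \<beta> \<gamma>"
proof -
  let ?C = "cone n" and ?C' = "cone (Suc n)" and ?U = "coord_module R u" and ?V = "coord_module R v"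
  let ?W = "coord_module R (rk (Suc n) + rk' (Suc (Suc n)) + u)"
  interpret C': module R ?C' using n by (rule cone_mod)
  have mC: "module R ?C" using n by (intro cone_mod) simp
  interpret C: module R ?C by (rule mC)
  note D = cone_d_linear[of n, OF Suc_le_lessD[OF n]]
  have Sn: "S n \<in> linear_maps R ?C ?C'" using S by (simp add: contraction_def)
  note DS = cone_d_contraction[OF S Suc_le_lessD[OF n]]
  have G: "G \<in> linear_maps R (prod_module ?C ?U) ?V" and \<beta>: "\<beta> \<in> linear_maps R ?V ?C"
    and \<gamma>: "\<gamma> \<in> linear_maps R ?V ?U"
    and cyc: "\<And>w. w \<in> carrier ?V \<Longrightarrow> cone_cycle n (\<beta> w)"
    and GB: "\<And>w. w \<in> carrier ?V \<Longrightarrow> G (\<beta> w, \<gamma> w) = w"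
    and BG: "\<And>x z. cone_cycle n x \<Longrightarrow> z \<in> carrier ?U \<Longrightarrow> \<beta> (G (x, z)) = x"
    and CG: "\<And>x z. cone_cycle n x \<Longrightarrow> z \<in> carrier ?U \<Longrightarrow> \<gamma> (G (x, z)) = z"
    using sf unfolding stably_free_cycles_def by auto
  have "coord_absorbs ?C' (rk (Suc n) + rk' (Suc (Suc n)))" using n by (intro cone_absorbs)
  then obtain \<iota> \<kappa> where "mutually_inverse (prod_module ?C' ?U) ?W \<iota> \<kappa>"
    unfolding coord_absorbs_def by blast
  note \<iota> = mutually_inverseD(1)[OF this] and \<kappa> = mutually_inverseD(2)[OF this]
    and \<iota>\<kappa> = mutually_inverseD(3)[OF this] and \<kappa>\<iota> = mutually_inverseD(4)[OF this]
  \<comment> \<open>A vector of length \<open>v\<close> encodes a cycle and a vector of length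
    \<open>u\<close>; \<open>S n\<close> lifts that cycle to the next degree, and the lift is added
    to the first argument. Conversely \<beta>' subtracts the lift of the boundary, which is the
    projection to the cycles.\<close>
  define G' where "G' x = \<iota> (fst x \<oplus>\<^bsub>?C'\<^esub> S n (\<beta> (snd x)), \<gamma> (snd x))" for x
  define \<beta>' where "\<beta>' w = fst (\<kappa> w) \<oplus>\<^bsub>?C'\<^esub> (\<ominus>\<^bsub>?C'\<^esub> S n (cone_d n (fst (\<kappa> w))))" for w
  define \<gamma>' where "\<gamma>' w = G (cone_d n (fst (\<kappa> w)), snd (\<kappa> w))" for w
  have G': "G' \<in> linear_maps R (prod_module ?C' ?V) ?W"
    unfolding G'_def[abs_def]
    by (rule linear_maps_comp[OF linear_maps_pair \<iota>])
      (intro linear_maps_plus C'.module_axioms linear_maps_fst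
        linear_maps_comp[OF linear_maps_comp[OF linear_maps_snd \<beta>] Sn] linear_maps_comp[OF linear_maps_snd \<gamma>])+
  have \<kappa>1: "(\<lambda>w. fst (\<kappa> w)) \<in> linear_maps R ?W ?C'" by (rule linear_maps_comp[OF \<kappa> linear_maps_fst])
  have \<kappa>2: "(\<lambda>w. snd (\<kappa> w)) \<in> linear_maps R ?W ?U" by (rule linear_maps_comp[OF \<kappa> linear_maps_snd])
  have D\<kappa>: "(\<lambda>w. cone_d n (fst (\<kappa> w))) \<in> linear_maps R ?W ?C" by (rule linear_maps_comp[OF \<kappa>1 D])
  have \<beta>': "\<beta>' \<in> linear_maps R ?W ?C'"
    unfolding \<beta>'_def[abs_def]
    by (rule linear_maps_plus[OF C'.module_axioms \<kappa>1 linear_maps_neg[OF C'.module_axioms linear_maps_comp[OF D\<kappa> Sn]]])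
  have \<gamma>': "\<gamma>' \<in> linear_maps R ?W ?V"
    unfolding \<gamma>'_def[abs_def] by (rule linear_maps_comp[OF linear_maps_pair[OF D\<kappa> \<kappa>2] G])
  have 1: "cone_cycle (Suc n) (\<beta>' w)" "G' (\<beta>' w, \<gamma>' w) = w" if w: "w \<in> carrier ?W" for w
  proof -
    let ?x = "fst (\<kappa> w)" and ?y = "snd (\<kappa> w)"
    have x: "?x \<in> carrier ?C'" and y: "?y \<in> carrier ?U"
      using linear_maps_closed[OF \<kappa>1 w] linear_maps_closed[OF \<kappa>2 w] by auto
    have Dx: "cone_d n ?x \<in> carrier ?C" by (rule linear_maps_closed[OF D x])
    have Dxc: "cone_cycle n (cone_d n ?x)" by (rule cone_cycle_d[OF Suc_le_lessD[OF n] x])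
    have SDx: "S n (cone_d n ?x) \<in> carrier ?C'" by (rule linear_maps_closed[OF Sn Dx])
    have "cone_d n (\<beta>' w) = cone_d n ?x \<oplus>\<^bsub>?C\<^esub> (\<ominus>\<^bsub>?C\<^esub> cone_d n (S n (cone_d n ?x)))"
      unfolding \<beta>'_def
      using linear_maps_add[OF D x C'.a_inv_closed[OF SDx]] linear_maps_a_inv[OF C'.module_axioms mC D SDx] by simp
    also have "\<dots> = \<zero>\<^bsub>?C\<^esub>" unfolding DS[OF Dxc] by (rule C.r_neg[OF Dx])
    finally show "cone_cycle (Suc n) (\<beta>' w)"
      using linear_maps_closed[OF \<beta>' w] by (simp add: cone_cycle_def)
    have "G' (\<beta>' w, \<gamma>' w) = \<iota> (\<beta>' w \<oplus>\<^bsub>?C'\<^esub> S n (cone_d n ?x), ?y)"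
      unfolding G'_def \<gamma>'_def using BG[OF Dxc y] CG[OF Dxc y] by simp
    also have "\<beta>' w \<oplus>\<^bsub>?C'\<^esub> S n (cone_d n ?x) = ?x"
      unfolding \<beta>'_def using x SDx by (simp add: C'.a_assoc C'.l_neg)
    finally show "G' (\<beta>' w, \<gamma>' w) = w" using \<iota>\<kappa>[OF w] by simp
  qed
  have 2: "\<beta>' (G' (x, z)) = x" "\<gamma>' (G' (x, z)) = z" if x: "cone_cycle (Suc n) x" and z: "z \<in> carrier ?V" for x z
  proof -
    have xc: "x \<in> carrier ?C'" and Dx: "cone_d n x = \<zero>\<^bsub>?C\<^esub>" using x by (auto simp: cone_cycle_def)
    have bz: "\<beta> z \<in> carrier ?C" and gz: "\<gamma> z \<in> carrier ?U"
      using linear_maps_closed[OF \<beta> z] linear_maps_closed[OF \<gamma> z] by auto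
    have Sbz: "S n (\<beta> z) \<in> carrier ?C'" by (rule linear_maps_closed[OF Sn bz])
    have "(x \<oplus>\<^bsub>?C'\<^esub> S n (\<beta> z), \<gamma> z) \<in> carrier (prod_module ?C' ?U)" using xc Sbz gz by (simp del: coord_module_simps)
    from \<kappa>\<iota>[OF this] have k: "\<kappa> (G' (x, z)) = (x \<oplus>\<^bsub>?C'\<^esub> S n (\<beta> z), \<gamma> z)" by (simp add: G'_def)
    have Dxs: "cone_d n (x \<oplus>\<^bsub>?C'\<^esub> S n (\<beta> z)) = \<beta> z"
      using linear_maps_add[OF D xc Sbz] Dx DS[OF cyc[OF z]] bz by simp
    show "\<beta>' (G' (x, z)) = x"
      unfolding \<beta>'_def k fst_conv Dxs using xc Sbz by (simp add: C'.a_assoc C'.r_neg)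
    show "\<gamma>' (G' (x, z)) = z"
      unfolding \<gamma>'_def k fst_conv snd_conv Dxs by (rule GB[OF z])
  qed
  have "stably_free_cycles (Suc n) v (rk (Suc n) + rk' (Suc (Suc n)) + u) G' \<beta>' \<gamma>'"
    unfolding stably_free_cycles_def using G' \<beta>' \<gamma>' 1 2 by blast
  then show ?thesis by blast
qed

lemma contraction_mono: "contraction S n \<Longrightarrow> m \<le> n \<Longrightarrow> contraction S m"
  unfolding contraction_def by auto

text \<open>The difference of ranks is the alternating sum of the ranks of the cone. It separates
  into a sum for \<open>F\<close> and a sum for \<open>F'\<close>, the latter one degree ahead
  because of the shift in the cone.\<close>

lemma stably_free_cycles_exists:
  assumes S: "contraction S n" and n: "n \<le> L"
    and \<chi>: "\<chi> 0 = 0" "\<And>m. \<chi> (Suc m) = int (rk m) - \<chi> m"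
    and \<chi>': "\<chi>' 0 = 0" "\<And>m. \<chi>' (Suc m) = int (rk' m) - \<chi>' m"
  shows "\<exists>u v G \<beta> \<gamma>. int v - int u = \<chi> (Suc n) + \<chi>' (Suc (Suc n)) \<and> stably_free_cycles n u v G \<beta> \<gamma>"
  using S n
proof (induction n)
  case 0
  have rk0: "free_rank R M = 0" if "module R M" "carrier M = {\<zero>\<^bsub>M\<^esub>}" for M :: "('r, 'm) module"
  proof -
    interpret M: module R M by fact
    have "module_basis R M 0 b" for b unfolding module_basis_def using that(2) by (auto simp: PiE_empty_domain)
    then have "\<exists>b. module_basis R M 0 b" by blast
    then show ?thesis unfolding free_rank_def by (rule Least_eq_0)
  qed
  \<comment> \<open>With these three ranks zero, \<open>\<chi>\<close> at 1 and
    \<open>\<chi>'\<close> at 2 vanish, which matches \<open>u = v = 0\<close>.\<close>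
  have "rk 0 = 0" "rk' 0 = 0" "rk' (Suc 0) = 0"
    using trivial by (auto intro!: rk0 mod mod')
  then show ?case using stably_free_cycles_zero \<chi> \<chi>' by (intro exI[of _ 0] exI conjI) auto
next
  case (Suc n)
  have "contraction S n" using Suc.prems(1) by (rule contraction_mono) simp
  then obtain u v G \<beta> \<gamma> where 1: "int v - int u = \<chi> (Suc n) + \<chi>' (Suc (Suc n))" "stably_free_cycles n u v G \<beta> \<gamma>"
    using Suc.IH Suc.prems by auto
  obtain G' \<beta>' \<gamma>' where 2: "stably_free_cycles (Suc n) v (rk (Suc n) + rk' (Suc (Suc n)) + u) G' \<beta>' \<gamma>'"
    using stably_free_cycles_Suc[OF Suc.prems(2,1) 1(2)] by blast
  have "int (rk (Suc n) + rk' (Suc (Suc n)) + u) - int v = \<chi> (Suc (Suc n)) + \<chi>' (Suc (Suc (Suc n)))"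
    using 1(1) \<chi>(2)[of "Suc n"] \<chi>'(2)[of "Suc (Suc n)"] by simp
  with 2 show ?case by blast
qed

text \<open>Let \<open>B\<close> be the cycles of the cone in degree \<open>q\<close>. The
  contraction matches the image of \<open>d n\<close> times \<open>B\<close> with the image of
  \<open>d' n\<close> times \<open>F n\<close>, and \<open>B\<close> enlarged by rank
  \<open>u\<close> is free of rank \<open>v\<close>. Both matchings come from linear maps
  \<open>P\<close> and \<open>Q\<close> on the ambient modules, and it is enough that each subset is
  covered by the image of the other.\<close>

lemma det_ideal_compare:
  assumes n: "n = Suc q" "n < L" and S: "contraction S (Suc n)" and sf: "stably_free_cycles q u v G \<beta> \<gamma>"
  shows "det_ideal (F n) (d n ` carrier (F (Suc n))) t =
    det_ideal (F' n) (d' n ` carrier (F' (Suc n))) (t + int v - int u - int (rk n))"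
proof -
  let ?U = "coord_module R u" and ?V = "coord_module R v" and ?C = "cone q"
  let ?T1 = "prod_module (F n) ?V" and ?S1 = "d n ` carrier (F (Suc n)) \<times> carrier ?V"
  let ?T2 = "prod_module (prod_module (F' n) (F n)) ?U"
  let ?S2 = "(d' n ` carrier (F' (Suc n)) \<times> carrier (F n)) \<times> carrier ?U"
  have mF: "module R (F m)" if "m \<le> Suc L" for m using that by (rule mod)
  have mF': "module R (F' m)" if "m \<le> Suc L" for m using that by (rule mod')
  interpret Fn: module R "F n" using n by (intro mF) simp
  interpret Fs: module R "F (Suc n)" using n by (intro mF) simp
  interpret Fq: module R "F q" using n by (intro mF) simp
  interpret Gn: module R "F' n" using n by (intro mF') simp
  interpret Gs: module R "F' (Suc n)" using n by (intro mF') simp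
  have mC: "module R ?C" using n by (intro cone_mod) simp
  interpret C: module R ?C by (rule mC)
  interpret C': module R "cone n" using n by (intro cone_mod) simp
  interpret V: module R ?V by (rule module_coord)
  interpret U: module R ?U by (rule module_coord)
  have mFG: "module R (prod_module (F' n) (F n))" by (rule module_prod) unfold_locales
  have cC: "carrier ?C = carrier (F q) \<times> carrier (F' n)" using n by (simp add: carrier_cone)
  have dn: "d n \<in> linear_maps R (F (Suc n)) (F n)" using n by (intro d) simp
  have dn': "d' n \<in> linear_maps R (F' (Suc n)) (F' n)" using n by (intro d') simp
  have an: "a n \<in> linear_maps R (F n) (F' n)" using n by (intro a) simp
  have dq: "d q \<in> linear_maps R (F n) (F q)" using d[of q] n by simp
  have S1: "d n ` carrier (F (Suc n)) \<subseteq> carrier (F n)" using linear_maps_closed[OF dn] by blast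
  have S2: "d' n ` carrier (F' (Suc n)) \<subseteq> carrier (F' n)" using linear_maps_closed[OF dn'] by blast
  have z1: "\<zero>\<^bsub>F n\<^esub> \<in> d n ` carrier (F (Suc n))"
    using linear_maps_zero[OF Fs.module_axioms Fn.module_axioms dn] by (metis Fs.zero_closed imageI)
  have z2: "\<zero>\<^bsub>F' n\<^esub> \<in> d' n ` carrier (F' (Suc n))"
    using linear_maps_zero[OF Gs.module_axioms Gn.module_axioms dn'] by (metis Gs.zero_closed imageI)
  have D: "cone_d q \<in> linear_maps R (cone n) ?C" using cone_d_linear[of q] n by simp
  have Sq: "S q \<in> linear_maps R ?C (cone n)" using S n by (simp add: contraction_def)
  have Sn: "S n \<in> linear_maps R (cone n) (cone (Suc n))" using S by (simp add: contraction_def)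
  have Dn: "cone_d n \<in> linear_maps R (cone (Suc n)) (cone n)" by (rule cone_d_linear[OF n(2)])
  have DSq: "cone_d q (S q z) = z" if "cone_cycle q z" for z
    using cone_d_contraction[of S q z] contraction_mono[OF S, of "Suc q"] n that by simp
  have DSn: "cone_d n (S n x) \<oplus>\<^bsub>cone n\<^esub> S q (cone_d q x) = x" if "x \<in> carrier (cone n)" for x
    using S n that by (simp add: contraction_def)
  have G: "G \<in> linear_maps R (prod_module ?C ?U) ?V" and \<beta>: "\<beta> \<in> linear_maps R ?V ?C"
    and \<gamma>: "\<gamma> \<in> linear_maps R ?V ?U"
    and cyc: "\<And>w. w \<in> carrier ?V \<Longrightarrow> cone_cycle q (\<beta> w)"
    and GB: "\<And>w. w \<in> carrier ?V \<Longrightarrow> G (\<beta> w, \<gamma> w) = w"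
    and BG: "\<And>x z. cone_cycle q x \<Longrightarrow> z \<in> carrier ?U \<Longrightarrow> \<beta> (G (x, z)) = x"
    and CG: "\<And>x z. cone_cycle q x \<Longrightarrow> z \<in> carrier ?U \<Longrightarrow> \<gamma> (G (x, z)) = z"
    using sf unfolding stably_free_cycles_def by auto
  have fstS: "(\<lambda>z. fst (S q z)) \<in> linear_maps R ?C (F n)"
    by (rule linear_maps_comp[OF Sq linear_maps_fst[of R "F n" "F' (Suc n)", folded cone_def]])
  have sndS: "(\<lambda>z. snd (S q z)) \<in> linear_maps R ?C (F' (Suc n))"
    by (rule linear_maps_comp[OF Sq linear_maps_snd[of R "F n" "F' (Suc n)", folded cone_def]])

  \<comment> \<open>At first argument \<open>d' n y\<close> and second argument \<open>x\<close>
    this is the cone differential of \<open>(x, y)\<close>. Letting the first argument range over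
    all of \<open>F' n\<close> extends the formula to the ambient module; there its values need not
    be cycles, but \<open>S q\<close> and \<open>G\<close> are defined on the whole cone.\<close>
  define e where "e x = (\<ominus>\<^bsub>F q\<^esub> d q (snd x), a n (snd x) \<oplus>\<^bsub>F' n\<^esub> fst x)" for x
  have e: "e \<in> linear_maps R (prod_module (F' n) (F n)) ?C"
    unfolding e_def[abs_def] cone_def n(1)[symmetric]
    by (intro linear_maps_pair linear_maps_neg linear_maps_plus Fq.module_axioms Gn.module_axioms
        linear_maps_comp[OF linear_maps_snd dq] linear_maps_comp[OF linear_maps_snd an] linear_maps_fst)
  \<comment> \<open>The first component of the homotopy identity at \<open>(x, y)\<close> reads
    \<open>- d g + h = x\<close>, with \<open>h\<close> the first component of \<open>S q\<close> at
    the cone boundary of \<open>(x, y)\<close>. So \<open>- x + h\<close> is the boundary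
    \<open>d g\<close>, and the cone boundary itself is stored by \<open>G\<close>.\<close>
  define P where "P x = (\<ominus>\<^bsub>F n\<^esub> snd (fst x) \<oplus>\<^bsub>F n\<^esub> fst (S q (e (fst x))), G (e (fst x), snd x))" for x
  have eF: "(\<lambda>x. e (fst x)) \<in> linear_maps R ?T2 ?C" by (rule linear_maps_comp[OF linear_maps_fst e])
  have P: "P \<in> linear_maps R ?T2 ?T1"
    unfolding P_def[abs_def]
    by (intro linear_maps_pair linear_maps_plus[OF Fn.module_axioms] linear_maps_neg[OF Fn.module_axioms]
        linear_maps_comp[OF linear_maps_fst linear_maps_snd]
        linear_maps_comp[OF eF fstS] linear_maps_comp[OF linear_maps_pair[OF eF linear_maps_snd] G])
  \<comment> \<open>The reverse map: with \<open>S q (\<beta> w) = (h, k)\<close> and a boundary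
    \<open>f\<close>, the pair of \<open>a f + d' k\<close> and \<open>- f + h\<close> is sent by
    \<open>e\<close> to the cycle \<open>\<beta> w\<close>.\<close>
  define Q where "Q x = ((a n (fst x) \<oplus>\<^bsub>F' n\<^esub> d' n (snd (S q (\<beta> (snd x)))),
      \<ominus>\<^bsub>F n\<^esub> fst x \<oplus>\<^bsub>F n\<^esub> fst (S q (\<beta> (snd x)))), \<gamma> (snd x))" for x
  have bF: "(\<lambda>x. \<beta> (snd x)) \<in> linear_maps R ?T1 ?C" by (rule linear_maps_comp[OF linear_maps_snd \<beta>])
  have Q: "Q \<in> linear_maps R ?T1 ?T2"
    unfolding Q_def[abs_def]
    by (intro linear_maps_pair linear_maps_plus[OF Fn.module_axioms] linear_maps_neg[OF Fn.module_axioms]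
        linear_maps_plus[OF Gn.module_axioms] linear_maps_comp[OF linear_maps_fst an] linear_maps_fst
        linear_maps_comp[OF linear_maps_comp[OF bF sndS] dn'] linear_maps_comp[OF bF fstS]
        linear_maps_comp[OF linear_maps_snd \<gamma>])

  have "?S1 \<subseteq> P ` ?S2"
  proof
    fix s assume "s \<in> ?S1"
    then obtain x w where s: "s = (d n x, w)" and x: "x \<in> carrier (F (Suc n))" and w: "w \<in> carrier ?V" by auto
    let ?b = "\<beta> w" and ?z = "\<gamma> w"
    have b: "?b \<in> carrier ?C" and z: "?z \<in> carrier ?U"
      using linear_maps_closed[OF \<beta> w] linear_maps_closed[OF \<gamma> w] by auto
    define f g where "f = fst (S q ?b)" and "g = snd (S q ?b)"
    have f: "f \<in> carrier (F n)" and g: "g \<in> carrier (F' (Suc n))"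
      using linear_maps_closed[OF fstS b] linear_maps_closed[OF sndS b] by (auto simp: f_def g_def)
    have dx: "d n x \<in> carrier (F n)" and ax: "a (Suc n) x \<in> carrier (F' (Suc n))"
      using linear_maps_closed[OF dn x] linear_maps_closed[OF a x] n by auto
    have dg: "d' n g \<in> carrier (F' n)" and dax: "d' n (a (Suc n) x) \<in> carrier (F' n)"
      using linear_maps_closed[OF dn' g] linear_maps_closed[OF dn' ax] by auto
    have adx: "a n (d n x) = d' n (a (Suc n) x)" using ad[OF _ x] n by simp
    have ddx: "d q (d n x) = \<zero>\<^bsub>F q\<^esub>" using dd[of q x] x n by simp
    \<comment> \<open>The preimage will be \<open>Q\<close> of the given element, with
      \<open>a d x\<close> rewritten as \<open>d' a x\<close> so that the first entry lies in the
      image of \<open>d' n\<close>. It is a sum of a part killed by \<open>e\<close> and a part that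
      \<open>e\<close> sends to the cycle.\<close>
    let ?y1 = "(d' n (a (Suc n) x), \<ominus>\<^bsub>F n\<^esub> d n x)" and ?y2 = "(d' n g, f)"
    have y1: "?y1 \<in> carrier (prod_module (F' n) (F n))" and y2: "?y2 \<in> carrier (prod_module (F' n) (F n))"
      using dax dx dg f by auto
    have e1: "e ?y1 = \<zero>\<^bsub>?C\<^esub>"
      using linear_maps_a_inv[OF Fn.module_axioms Fq.module_axioms dq dx]
        linear_maps_a_inv[OF Fn.module_axioms Gn.module_axioms an dx] ddx adx dax
      by (simp add: e_def cone_def n(1)[symmetric] Gn.l_neg)
    have e2: "e ?y2 = ?b"
    proof -
      have "cone_d q (S q ?b) = ?b" by (rule DSq[OF cyc[OF w]])
      then show ?thesis by (simp add: e_def cone_d_def f_def g_def n(1)[symmetric])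
    qed
    let ?y = "(d' n (a (Suc n) x \<oplus>\<^bsub>F' (Suc n)\<^esub> g), \<ominus>\<^bsub>F n\<^esub> d n x \<oplus>\<^bsub>F n\<^esub> f)"
    have ey: "e ?y = ?b"
    proof -
      have "?y = ?y1 \<oplus>\<^bsub>prod_module (F' n) (F n)\<^esub> ?y2" using linear_maps_add[OF dn' ax g] by simp
      then have "e ?y = e ?y1 \<oplus>\<^bsub>?C\<^esub> e ?y2" using linear_maps_add[OF e y1 y2] by simp
      then show ?thesis using e1 e2 b by simp
    qed
    have "P (?y, ?z) = (\<ominus>\<^bsub>F n\<^esub> (\<ominus>\<^bsub>F n\<^esub> d n x \<oplus>\<^bsub>F n\<^esub> f) \<oplus>\<^bsub>F n\<^esub> f, w)"
      unfolding P_def fst_conv snd_conv ey f_def[symmetric] GB[OF w] ..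
    also have "\<ominus>\<^bsub>F n\<^esub> (\<ominus>\<^bsub>F n\<^esub> d n x \<oplus>\<^bsub>F n\<^esub> f) \<oplus>\<^bsub>F n\<^esub> f = d n x"
      using dx f by (simp add: Fn.minus_add Fn.a_assoc Fn.l_neg)
    finally have "s = P (?y, ?z)" using s by simp
    moreover have "(?y, ?z) \<in> ?S2" using ax g dx f z by (simp del: coord_module_simps)
    ultimately show "s \<in> P ` ?S2" by blast
  qed
  then have 1: "det_ideal ?T1 ?S1 m \<subseteq> det_ideal ?T2 ?S2 m" for m
    by (rule det_ideal_map_subset[OF P, rotated]) (use S2 in \<open>auto simp del: coord_module_simps\<close>)

  have "?S2 \<subseteq> Q ` ?S1"
  proof
    fix s assume "s \<in> ?S2"
    then obtain y f z where s: "s = ((d' n y, f), z)" and y: "y \<in> carrier (F' (Suc n))"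
      and f: "f \<in> carrier (F n)" and z: "z \<in> carrier ?U" by auto
    let ?x = "(f, y)"
    have x: "?x \<in> carrier (cone n)" using f y by (simp add: carrier_cone)
    let ?b = "cone_d q ?x"
    have b: "?b \<in> carrier ?C" by (rule linear_maps_closed[OF D x])
    have bc: "cone_cycle q ?b" using cone_cycle_d[of q ?x] x n by simp
    define w where "w = G (?b, z)"
    have w: "w \<in> carrier ?V"
      unfolding w_def by (rule linear_maps_closed[OF G]) (use b z in \<open>simp del: coord_module_simps\<close>)
    \<comment> \<open>The two components of the homotopy identity at \<open>(f, y)\<close> express
      \<open>f\<close> through \<open>d n g\<close> and \<open>y\<close> through \<open>a g\<close>,
      \<open>d' g'\<close> and \<open>k\<close>. Applying \<open>d' n\<close> to the latter removes
      \<open>g'\<close> and leaves exactly the first entry of \<open>Q\<close>.\<close>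
    define g g' where "g = fst (S n ?x)" and "g' = snd (S n ?x)"
    have "S n ?x \<in> carrier (cone (Suc n))" by (rule linear_maps_closed[OF Sn x])
    then have g: "g \<in> carrier (F (Suc n))" and g': "g' \<in> carrier (F' (Suc (Suc n)))"
      by (auto simp: carrier_cone g_def g'_def)
    have dg: "d n g \<in> carrier (F n)" by (rule linear_maps_closed[OF dn g])
    have as: "a (Suc n) \<in> linear_maps R (F (Suc n)) (F' (Suc n))" using n by (intro a) simp
    have ds': "d' (Suc n) \<in> linear_maps R (F' (Suc (Suc n))) (F' (Suc n))" using n by (intro d') simp
    have ag: "a (Suc n) g \<in> carrier (F' (Suc n))" and dg': "d' (Suc n) g' \<in> carrier (F' (Suc n))"
      using linear_maps_closed[OF as g] linear_maps_closed[OF ds' g'] by auto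
    define h k where "h = fst (S q ?b)" and "k = snd (S q ?b)"
    have h: "h \<in> carrier (F n)" and k: "k \<in> carrier (F' (Suc n))"
      using linear_maps_closed[OF fstS b] linear_maps_closed[OF sndS b] by (auto simp: h_def k_def)
    have "cone_d n (S n ?x) \<oplus>\<^bsub>cone n\<^esub> S q ?b = ?x" by (rule DSn[OF x])
    then have f_eq: "\<ominus>\<^bsub>F n\<^esub> d n g \<oplus>\<^bsub>F n\<^esub> h = f"
      and y_eq: "a (Suc n) g \<oplus>\<^bsub>F' (Suc n)\<^esub> d' (Suc n) g' \<oplus>\<^bsub>F' (Suc n)\<^esub> k = y"
      by (simp_all add: cone_d_def cone_def g_def g'_def h_def k_def)
    have dk: "d' n k \<in> carrier (F' n)" by (rule linear_maps_closed[OF dn' k])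
    have dag: "d' n (a (Suc n) g) \<in> carrier (F' n)" by (rule linear_maps_closed[OF dn' ag])
    have "d' n y = d' n (a (Suc n) g \<oplus>\<^bsub>F' (Suc n)\<^esub> d' (Suc n) g') \<oplus>\<^bsub>F' n\<^esub> d' n k"
      unfolding y_eq[symmetric] using linear_maps_add[OF dn' Gs.a_closed[OF ag dg'] k] .
    also have "d' n (a (Suc n) g \<oplus>\<^bsub>F' (Suc n)\<^esub> d' (Suc n) g') = d' n (a (Suc n) g)"
      using linear_maps_add[OF dn' ag dg'] dd'[OF _ g'] n(2) dag by simp
    also have "d' n (a (Suc n) g) = a n (d n g)" using ad[OF _ g] n by simp
    finally have "d' n y = a n (d n g) \<oplus>\<^bsub>F' n\<^esub> d' n k" .
    then have "Q (d n g, w) = s"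
      using BG[OF bc z] CG[OF bc z] f_eq by (simp add: Q_def s w_def[symmetric] h_def k_def)
    moreover have "(d n g, w) \<in> ?S1" using g w by blast
    ultimately show "s \<in> Q ` ?S1" by blast
  qed
  then have 2: "det_ideal ?T2 ?S2 m \<subseteq> det_ideal ?T1 ?S1 m" for m
    by (rule det_ideal_map_subset[OF Q, rotated]) (use S1 in \<open>auto simp del: coord_module_simps\<close>)

  have "free_finite_rank R (F n)" using n(2) by (intro free) simp
  then obtain b \<epsilon> where b: "dual_basis (F n) (rk n) b \<epsilon>" by (rule free_dual_basis)
  \<comment> \<open>Passing to the first enlarged pair raises the size by \<open>v\<close>; leaving
    the second one lowers it by \<open>u\<close> and by the rank of \<open>F n\<close>.\<close>
  have "det_ideal (F n) (d n ` carrier (F (Suc n))) t = det_ideal ?T1 ?S1 (t + int v)"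
    by (rule det_ideal_prod_free[OF Fn.module_axioms module_coord coord_dual_basis S1 z1, symmetric])
  also have "\<dots> = det_ideal ?T2 ?S2 (t + int v)" using 1 2 by blast
  also have "\<dots> = det_ideal (prod_module (F' n) (F n)) (d' n ` carrier (F' (Suc n)) \<times> carrier (F n)) (t + int v - int u)"
  proof -
    have "d' n ` carrier (F' (Suc n)) \<times> carrier (F n) \<subseteq> carrier (prod_module (F' n) (F n))"
      "\<zero>\<^bsub>prod_module (F' n) (F n)\<^esub> \<in> d' n ` carrier (F' (Suc n)) \<times> carrier (F n)"
      using S2 z2 by auto
    from det_ideal_prod_free[OF mFG module_coord coord_dual_basis[of u] this, of "t + int v - int u"]
    show ?thesis by simp
  qed
  also have "\<dots> = det_ideal (F' n) (d' n ` carrier (F' (Suc n))) (t + int v - int u - int (rk n))"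
    using det_ideal_prod_free[OF Gn.module_axioms Fn.module_axioms b S2 z2, of "t + int v - int u - int (rk n)"] by simp
  finally show ?thesis .
qed

text \<open>The characteristics enter only through their recursion and initial value, so that
  alternating sums of ranks of modules and of sheaves can be inserted alike.\<close>

theorem minor_ideal_eq:
  assumes n: "n \<noteq> 0" "n < L" and S: "contraction S (Suc n)"
    and \<chi>: "\<chi> 0 = 0" "\<And>m. \<chi> (Suc m) = int (rk m) - \<chi> m"
    and \<chi>': "\<chi>' 0 = 0" "\<And>m. \<chi>' (Suc m) = int (rk' m) - \<chi>' m"
  shows "minor_ideal R (F (Suc n)) (F n) (d n) (\<chi> (Suc n) - k) =
    minor_ideal R (F' (Suc n)) (F' n) (d' n) (\<chi>' (Suc n) - k)"
proof -
  obtain q where q: "n = Suc q" using n by (cases n) auto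
  obtain u v G \<beta> \<gamma> where uv: "int v - int u = \<chi> n + \<chi>' (Suc n)" and sf: "stably_free_cycles q u v G \<beta> \<gamma>"
    using stably_free_cycles_exists[of S q \<chi> \<chi>'] contraction_mono[OF S, of q] q n \<chi> \<chi>' by auto
  \<comment> \<open>Since \<open>\<chi> (Suc n) = rk n - \<chi> n\<close>, the shift by
    \<open>v - u = \<chi> n + \<chi>' (Suc n)\<close> and by the rank of \<open>F n\<close> leaves
    exactly \<open>\<chi>' (Suc n)\<close>.\<close>
  have eq: "\<chi> (Suc n) - k + int v - int u - int (rk n) = \<chi>' (Suc n) - k" using uv \<chi>(2)[of n] by simp
  have "det_ideal (F n) (d n ` carrier (F (Suc n))) (\<chi> (Suc n) - k) =
      det_ideal (F' n) (d' n ` carrier (F' (Suc n))) (\<chi>' (Suc n) - k)"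
    using det_ideal_compare[OF q n(2) S sf, of "\<chi> (Suc n) - k"] unfolding eq .
  moreover have "minor_ideal R (F (Suc n)) (F n) (d n) m = det_ideal (F n) (d n ` carrier (F (Suc n))) m" for m
    by (rule minor_ideal_eq_det_ideal) (use n in \<open>auto intro: free d\<close>)
  moreover have "minor_ideal R (F' (Suc n)) (F' n) (d' n) m = det_ideal (F' n) (d' n ` carrier (F' (Suc n))) m" for m
    by (rule minor_ideal_eq_det_ideal) (use n in \<open>auto intro: free' d'\<close>)
  ultimately show ?thesis by simp
qed

end

section \<open>Extending a contraction by one degree\<close>

context comm_base_ring
begin

lemma prod_dual_basis_eqI:
  assumes M: "module R M" and N: "module R N" and P: "module R P"
    and b: "dual_basis M m b \<beta>" and c: "dual_basis N n c \<gamma>"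
    and \<phi>: "\<phi> \<in> linear_maps R (prod_module M N) P" and \<psi>: "\<psi> \<in> linear_maps R (prod_module M N) P"
    and eq1: "\<And>k. k < m \<Longrightarrow> \<phi> (b k, \<zero>\<^bsub>N\<^esub>) = \<psi> (b k, \<zero>\<^bsub>N\<^esub>)"
    and eq2: "\<And>k. k < n \<Longrightarrow> \<phi> (\<zero>\<^bsub>M\<^esub>, c k) = \<psi> (\<zero>\<^bsub>M\<^esub>, c k)"
    and x: "x \<in> carrier (prod_module M N)"
  shows "\<phi> x = \<psi> x"
proof -
  interpret M: module R M by fact
  interpret N: module R N by fact
  obtain y z where xyz: "x = (y, z)" "y \<in> carrier M" "z \<in> carrier N" using x by auto
  have i1: "(\<lambda>y. (y, \<zero>\<^bsub>N\<^esub>)) \<in> linear_maps R M (prod_module M N)"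
    by (rule linear_maps_pair[OF linear_maps_id linear_maps_const_zero[OF N]])
  have i2: "(\<lambda>z. (\<zero>\<^bsub>M\<^esub>, z)) \<in> linear_maps R N (prod_module M N)"
    by (rule linear_maps_pair[OF linear_maps_const_zero[OF M] linear_maps_id])
  have 1: "\<phi> (y, \<zero>\<^bsub>N\<^esub>) = \<psi> (y, \<zero>\<^bsub>N\<^esub>)"
    by (rule dual_basis_eqI[OF M P b linear_maps_comp[OF i1 \<phi>] linear_maps_comp[OF i1 \<psi>] eq1 xyz(2)])
  have 2: "\<phi> (\<zero>\<^bsub>M\<^esub>, z) = \<psi> (\<zero>\<^bsub>M\<^esub>, z)"
    by (rule dual_basis_eqI[OF N P c linear_maps_comp[OF i2 \<phi>] linear_maps_comp[OF i2 \<psi>] eq2 xyz(3)])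
  have "\<chi> x = \<chi> (y, \<zero>\<^bsub>N\<^esub>) \<oplus>\<^bsub>P\<^esub> \<chi> (\<zero>\<^bsub>M\<^esub>, z)" if "\<chi> \<in> linear_maps R (prod_module M N) P" for \<chi>
    using linear_maps_add[OF that, of "(y, \<zero>\<^bsub>N\<^esub>)" "(\<zero>\<^bsub>M\<^esub>, z)"] xyz by simp
  from this[OF \<phi>] this[OF \<psi>] show ?thesis by (simp only: 1 2)
qed

lemma prod_dual_basis_extension:
  assumes M: "module R M" and N: "module R N" and P: "module R P"
    and b: "dual_basis M m b \<beta>" and c: "dual_basis N n c \<gamma>"
    and u: "\<And>k. k < m \<Longrightarrow> u k \<in> carrier P" and v: "\<And>k. k < n \<Longrightarrow> v k \<in> carrier P"
  obtains \<phi> where "\<phi> \<in> linear_maps R (prod_module M N) P"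
    "\<And>k. k < m \<Longrightarrow> \<phi> (b k, \<zero>\<^bsub>N\<^esub>) = u k" "\<And>k. k < n \<Longrightarrow> \<phi> (\<zero>\<^bsub>M\<^esub>, c k) = v k"
proof -
  interpret P: module R P by fact
  obtain \<phi> where \<phi>: "\<phi> \<in> linear_maps R M P" "\<And>k. k < m \<Longrightarrow> \<phi> (b k) = u k"
    by (rule dual_basis_extension[OF M P b, of u]) (use u in auto)
  obtain \<psi> where \<psi>: "\<psi> \<in> linear_maps R N P" "\<And>k. k < n \<Longrightarrow> \<psi> (c k) = v k"
    by (rule dual_basis_extension[OF N P c, of v]) (use v in auto)
  show ?thesis
  proof
    show "(\<lambda>x. \<phi> (fst x) \<oplus>\<^bsub>P\<^esub> \<psi> (snd x)) \<in> linear_maps R (prod_module M N) P"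
      by (rule linear_maps_plus[OF P linear_maps_comp[OF linear_maps_fst \<phi>(1)] linear_maps_comp[OF linear_maps_snd \<psi>(1)]])
    show "\<phi> (fst (b k, \<zero>\<^bsub>N\<^esub>)) \<oplus>\<^bsub>P\<^esub> \<psi> (snd (b k, \<zero>\<^bsub>N\<^esub>)) = u k" if "k < m" for k
      using linear_maps_zero[OF N P \<psi>(1)] \<phi>(2)[OF that] u[OF that] by simp
    show "\<phi> (fst (\<zero>\<^bsub>M\<^esub>, c k)) \<oplus>\<^bsub>P\<^esub> \<psi> (snd (\<zero>\<^bsub>M\<^esub>, c k)) = v k" if "k < n" for k
      using linear_maps_zero[OF M P \<phi>(1)] \<psi>(2)[OF that] v[OF that] by simp
  qed
qed

end

context complex_map
begin

lemma contraction_base: "1 \<le> L \<Longrightarrow> contraction (\<lambda>m x. \<zero>\<^bsub>cone (Suc m)\<^esub>) (Suc 0)"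
  by (auto simp: contraction_def intro!: linear_maps_const_zero cone_mod)

text \<open>The next map must lift \<open>t - S D t\<close> through the differential for every
  \<open>t\<close>. It is chosen on the two bases and extended linearly, and the homotopy identity
  is then an equation of linear maps that holds on the bases.\<close>

lemma contraction_extend:
  assumes S: "contraction S (Suc n)" and n: "Suc n < L"
    and b: "dual_basis (F (Suc n)) p b \<beta>" and c: "dual_basis (F' (Suc (Suc n))) p' c \<gamma>"
    and ex: "\<And>t. t \<in> (\<lambda>k. (b k, \<zero>\<^bsub>F' (Suc (Suc n))\<^esub>)) ` {..<p} \<union> (\<lambda>k. (\<zero>\<^bsub>F (Suc n)\<^esub>, c k)) ` {..<p'} \<Longrightarrow>
      \<exists>w\<in>carrier (cone (Suc (Suc n))).
        cone_d (Suc n) w = t \<oplus>\<^bsub>cone (Suc n)\<^esub> (\<ominus>\<^bsub>cone (Suc n)\<^esub> S n (cone_d n t))"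
  shows "\<exists>T. contraction (S(Suc n := T)) (Suc (Suc n))"
proof -
  let ?C = "cone (Suc n)" and ?C' = "cone (Suc (Suc n))"
  interpret C: module R ?C using n by (intro cone_mod) simp
  have mC': "module R ?C'" using n by (intro cone_mod) simp
  interpret C': module R ?C' by (rule mC')
  have M: "module R (F (Suc n))" "module R (F' (Suc (Suc n)))" using n by (auto intro!: mod mod')
  interpret M: module R "F (Suc n)" by (rule M)
  interpret N: module R "F' (Suc (Suc n))" by (rule M)
  obtain u where u: "\<And>k. k < p \<Longrightarrow> u k \<in> carrier ?C' \<and> cone_d (Suc n) (u k) =
      (b k, \<zero>\<^bsub>F' (Suc (Suc n))\<^esub>) \<oplus>\<^bsub>?C\<^esub> (\<ominus>\<^bsub>?C\<^esub> S n (cone_d n (b k, \<zero>\<^bsub>F' (Suc (Suc n))\<^esub>)))"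
  proof -
    have "\<forall>k. \<exists>w. k < p \<longrightarrow> w \<in> carrier ?C' \<and> cone_d (Suc n) w =
      (b k, \<zero>\<^bsub>F' (Suc (Suc n))\<^esub>) \<oplus>\<^bsub>?C\<^esub> (\<ominus>\<^bsub>?C\<^esub> S n (cone_d n (b k, \<zero>\<^bsub>F' (Suc (Suc n))\<^esub>)))"
      using ex by blast
    then show ?thesis using that by metis
  qed
  obtain v where v: "\<And>k. k < p' \<Longrightarrow> v k \<in> carrier ?C' \<and> cone_d (Suc n) (v k) =
      (\<zero>\<^bsub>F (Suc n)\<^esub>, c k) \<oplus>\<^bsub>?C\<^esub> (\<ominus>\<^bsub>?C\<^esub> S n (cone_d n (\<zero>\<^bsub>F (Suc n)\<^esub>, c k)))"
  proof -
    have "\<forall>k. \<exists>w. k < p' \<longrightarrow> w \<in> carrier ?C' \<and> cone_d (Suc n) w =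
      (\<zero>\<^bsub>F (Suc n)\<^esub>, c k) \<oplus>\<^bsub>?C\<^esub> (\<ominus>\<^bsub>?C\<^esub> S n (cone_d n (\<zero>\<^bsub>F (Suc n)\<^esub>, c k)))"
      using ex by blast
    then show ?thesis using that by metis
  qed
  obtain T where T: "T \<in> linear_maps R ?C ?C'"
    and Tb: "\<And>k. k < p \<Longrightarrow> T (b k, \<zero>\<^bsub>F' (Suc (Suc n))\<^esub>) = u k"
    and Tc: "\<And>k. k < p' \<Longrightarrow> T (\<zero>\<^bsub>F (Suc n)\<^esub>, c k) = v k"
    using prod_dual_basis_extension[OF M mC' b c, of u v] u v unfolding cone_def[of "Suc n"] by blast
  note D = cone_d_linear[of n, OF Suc_lessD[OF n]] and D' = cone_d_linear[OF n]
  have Sn: "S n \<in> linear_maps R (cone n) ?C" using S by (simp add: contraction_def)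
  have SD: "(\<lambda>x. S n (cone_d n x)) \<in> linear_maps R ?C ?C" by (rule linear_maps_comp[OF D Sn])
  have lin: "(\<lambda>x. cone_d (Suc n) (T x) \<oplus>\<^bsub>?C\<^esub> S n (cone_d n x)) \<in> linear_maps R ?C ?C"
    by (rule linear_maps_plus[OF C.module_axioms linear_maps_comp[OF T D'] SD])
  have canc: "t \<oplus>\<^bsub>?C\<^esub> (\<ominus>\<^bsub>?C\<^esub> S n (cone_d n t)) \<oplus>\<^bsub>?C\<^esub> S n (cone_d n t) = t" if "t \<in> carrier ?C" for t
    using that linear_maps_closed[OF SD that] by (simp add: C.a_assoc C.l_neg)
  have C_def: "?C = prod_module (F (Suc n)) (F' (Suc (Suc n)))" by (simp add: cone_def)
  have lin': "(\<lambda>x. cone_d (Suc n) (T x) \<oplus>\<^bsub>?C\<^esub> S n (cone_d n x)) \<in>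
      linear_maps R (prod_module (F (Suc n)) (F' (Suc (Suc n)))) ?C"
    using lin unfolding C_def .
  have id': "(\<lambda>x. x) \<in> linear_maps R (prod_module (F (Suc n)) (F' (Suc (Suc n)))) ?C"
    unfolding C_def by (rule linear_maps_id)
  have bc: "(b k, \<zero>\<^bsub>F' (Suc (Suc n))\<^esub>) \<in> carrier ?C" if "k < p" for k
    using dual_basis_mem[OF b that] by (simp add: carrier_cone)
  have cc: "(\<zero>\<^bsub>F (Suc n)\<^esub>, c k) \<in> carrier ?C" if "k < p'" for k
    using dual_basis_mem[OF c that] by (simp add: carrier_cone)
  have fin: "cone_d (Suc n) (T x) \<oplus>\<^bsub>?C\<^esub> S n (cone_d n x) = x" if x: "x \<in> carrier ?C" for x
  proof (rule prod_dual_basis_eqI[OF M C.module_axioms b c lin' id'])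
    show "cone_d (Suc n) (T (b k, \<zero>\<^bsub>F' (Suc (Suc n))\<^esub>)) \<oplus>\<^bsub>?C\<^esub> S n (cone_d n (b k, \<zero>\<^bsub>F' (Suc (Suc n))\<^esub>)) =
        (b k, \<zero>\<^bsub>F' (Suc (Suc n))\<^esub>)" if "k < p" for k
      unfolding Tb[OF that] conjunct2[OF u[OF that]] by (rule canc[OF bc[OF that]])
    show "cone_d (Suc n) (T (\<zero>\<^bsub>F (Suc n)\<^esub>, c k)) \<oplus>\<^bsub>?C\<^esub> S n (cone_d n (\<zero>\<^bsub>F (Suc n)\<^esub>, c k)) =
        (\<zero>\<^bsub>F (Suc n)\<^esub>, c k)" if "k < p'" for k
      unfolding Tc[OF that] conjunct2[OF v[OF that]] by (rule canc[OF cc[OF that]])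
  qed (use x in \<open>simp add: carrier_cone\<close>)
  have "contraction (S(Suc n := T)) (Suc (Suc n))"
    using S T fin by (auto simp: contraction_def less_Suc_eq)
  then show ?thesis by blast
qed

text \<open>The boundary of \<open>t\<close> is a cycle, so the contraction reproduces it:
  \<open>D S D t = D t\<close>, and the two terms cancel.\<close>

lemma cone_defect_cycle:
  assumes S: "contraction S (Suc n)" and n: "n < L" and t: "t \<in> carrier (cone (Suc n))"
  defines "z \<equiv> t \<oplus>\<^bsub>cone (Suc n)\<^esub> (\<ominus>\<^bsub>cone (Suc n)\<^esub> S n (cone_d n t))"
  shows "z \<in> carrier (cone (Suc n))" "cone_d n z = \<zero>\<^bsub>cone n\<^esub>"
proof -
  let ?C = "cone n" and ?C' = "cone (Suc n)"
  have mC: "module R ?C" and mC': "module R ?C'" using n by (auto intro!: cone_mod)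
  interpret C: module R ?C by (rule mC)
  interpret C': module R ?C' by (rule mC')
  note D = cone_d_linear[OF n]
  have Sn: "S n \<in> linear_maps R ?C ?C'" using S by (simp add: contraction_def)
  have Dt: "cone_d n t \<in> carrier ?C" by (rule linear_maps_closed[OF D t])
  have SDt: "S n (cone_d n t) \<in> carrier ?C'" by (rule linear_maps_closed[OF Sn Dt])
  show "z \<in> carrier ?C'" unfolding z_def using t SDt by simp
  have "cone_d n z = cone_d n t \<oplus>\<^bsub>?C\<^esub> (\<ominus>\<^bsub>?C\<^esub> cone_d n (S n (cone_d n t)))"
    unfolding z_def
    using linear_maps_add[OF D t C'.a_inv_closed[OF SDt]] linear_maps_a_inv[OF mC' mC D SDt] by simp
  also have "\<dots> = \<zero>\<^bsub>?C\<^esub>"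
    unfolding cone_d_contraction[OF S n cone_cycle_d[OF n t]] by (rule C.r_neg[OF Dt])
  finally show "cone_d n z = \<zero>\<^bsub>?C\<^esub>" .
qed

text \<open>Translates a cone cycle \<open>(x, y)\<close> into the inputs for homology:
  \<open>x\<close> is a cycle whose image bounds, and after a choice of \<open>w\<close> with
  \<open>d w = x\<close> the element \<open>y + a w\<close> is a cycle.\<close>

lemma cone_d_eq_zeroD:
  assumes n: "n < L" and x: "x \<in> carrier (F (Suc n))" and y: "y \<in> carrier (F' (Suc (Suc n)))"
    and z: "cone_d n (x, y) = \<zero>\<^bsub>cone n\<^esub>"
  shows "d n x = \<zero>\<^bsub>F n\<^esub>" "a (Suc n) x = d' (Suc n) (\<ominus>\<^bsub>F' (Suc (Suc n))\<^esub> y)"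
    "\<And>w. w \<in> carrier (F (Suc (Suc n))) \<Longrightarrow> d (Suc n) w = x \<Longrightarrow>
      d' (Suc n) (y \<oplus>\<^bsub>F' (Suc (Suc n))\<^esub> a (Suc (Suc n)) w) = \<zero>\<^bsub>F' (Suc n)\<^esub>"
proof -
  have mods: "module R (F n)" "module R (F' (Suc n))" "module R (F' (Suc (Suc n)))"
    using n by (auto intro!: mod mod')
  interpret F: module R "F n" by (rule mods)
  interpret G: module R "F' (Suc n)" by (rule mods)
  interpret H: module R "F' (Suc (Suc n))" by (rule mods)
  have dn: "d n \<in> linear_maps R (F (Suc n)) (F n)" using n by (intro d) simp
  have dn': "d' (Suc n) \<in> linear_maps R (F' (Suc (Suc n))) (F' (Suc n))" using n by (intro d') simp
  have an: "a (Suc n) \<in> linear_maps R (F (Suc n)) (F' (Suc n))" using n by (intro a) simp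
  have an': "a (Suc (Suc n)) \<in> linear_maps R (F (Suc (Suc n))) (F' (Suc (Suc n)))" using n by (intro a) simp
  have dx: "d n x \<in> carrier (F n)" and ax: "a (Suc n) x \<in> carrier (F' (Suc n))"
    and dy: "d' (Suc n) y \<in> carrier (F' (Suc n))"
    using linear_maps_closed[OF dn x] linear_maps_closed[OF an x] linear_maps_closed[OF dn' y] by auto
  have 1: "\<ominus>\<^bsub>F n\<^esub> d n x = \<zero>\<^bsub>F n\<^esub>" and 2: "a (Suc n) x \<oplus>\<^bsub>F' (Suc n)\<^esub> d' (Suc n) y = \<zero>\<^bsub>F' (Suc n)\<^esub>"
    using z by (auto simp: cone_d_def cone_def)
  show "d n x = \<zero>\<^bsub>F n\<^esub>" using F.r_neg[OF dx] dx by (simp add: 1)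
  show "a (Suc n) x = d' (Suc n) (\<ominus>\<^bsub>F' (Suc (Suc n))\<^esub> y)"
    using linear_maps_a_inv[OF mods(3,2) dn' y] G.minus_equality[OF 2 dy ax] by simp
  show "d' (Suc n) (y \<oplus>\<^bsub>F' (Suc (Suc n))\<^esub> a (Suc (Suc n)) w) = \<zero>\<^bsub>F' (Suc n)\<^esub>"
    if w: "w \<in> carrier (F (Suc (Suc n)))" and dw: "d (Suc n) w = x" for w
  proof -
    have "d' (Suc n) (a (Suc (Suc n)) w) = a (Suc n) x" using ad[OF _ w] n dw by simp
    then show ?thesis
      using linear_maps_add[OF dn' y linear_maps_closed[OF an' w]] 2 ax dy by (simp add: G.a_comm)
  qed
qed

text \<open>The second half of the acyclicity argument, shared by modules and sheaves:
  \<open>w\<close> stems from injectivity, \<open>z\<close> and \<open>v\<close> from surjectivity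
  on homology, and \<open>(z - w, v)\<close> is the primitive.\<close>

lemma cone_d_eqI:
  assumes n: "Suc n < L" and y: "y \<in> carrier (F' (Suc (Suc n)))"
    and w: "w \<in> carrier (F (Suc (Suc n)))" "d (Suc n) w = x"
    and z: "z \<in> carrier (F (Suc (Suc n)))" "d (Suc n) z = \<zero>\<^bsub>F (Suc n)\<^esub>"
    and v: "v \<in> carrier (F' (Suc (Suc (Suc n))))"
    and eq: "y \<oplus>\<^bsub>F' (Suc (Suc n))\<^esub> a (Suc (Suc n)) w = a (Suc (Suc n)) z \<oplus>\<^bsub>F' (Suc (Suc n))\<^esub> d' (Suc (Suc n)) v"
  shows "\<exists>t\<in>carrier (cone (Suc (Suc n))). cone_d (Suc n) t = (x, y)"
proof (rule bexI)
  have mods: "module R (F (Suc n))" "module R (F (Suc (Suc n)))" "module R (F' (Suc (Suc n)))"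
    using n by (auto intro!: mod mod')
  interpret F: module R "F (Suc n)" by (rule mods)
  interpret G: module R "F (Suc (Suc n))" by (rule mods)
  interpret H: module R "F' (Suc (Suc n))" by (rule mods)
  have dn: "d (Suc n) \<in> linear_maps R (F (Suc (Suc n))) (F (Suc n))" using n by (intro d) simp
  have dn': "d' (Suc (Suc n)) \<in> linear_maps R (F' (Suc (Suc (Suc n)))) (F' (Suc (Suc n)))" using n by (intro d') simp
  have an: "a (Suc (Suc n)) \<in> linear_maps R (F (Suc (Suc n))) (F' (Suc (Suc n)))" using n by (intro a) simp
  have aw: "a (Suc (Suc n)) w \<in> carrier (F' (Suc (Suc n)))" and az: "a (Suc (Suc n)) z \<in> carrier (F' (Suc (Suc n)))"
    and dv: "d' (Suc (Suc n)) v \<in> carrier (F' (Suc (Suc n)))" and dw: "d (Suc n) w \<in> carrier (F (Suc n))"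
    using linear_maps_closed[OF an w(1)] linear_maps_closed[OF an z(1)] linear_maps_closed[OF dn' v]
      linear_maps_closed[OF dn w(1)] by auto
  let ?t = "(z \<oplus>\<^bsub>F (Suc (Suc n))\<^esub> (\<ominus>\<^bsub>F (Suc (Suc n))\<^esub> w), v)"
  show "?t \<in> carrier (cone (Suc (Suc n)))" using z w v by (simp add: carrier_cone)
  have 1: "d (Suc n) (z \<oplus>\<^bsub>F (Suc (Suc n))\<^esub> (\<ominus>\<^bsub>F (Suc (Suc n))\<^esub> w)) = \<ominus>\<^bsub>F (Suc n)\<^esub> x"
    using linear_maps_add[OF dn z(1) G.a_inv_closed[OF w(1)]] linear_maps_a_inv[OF mods(2,1) dn w(1)] z(2) w(2) dw by simp
  have 2: "a (Suc (Suc n)) (z \<oplus>\<^bsub>F (Suc (Suc n))\<^esub> (\<ominus>\<^bsub>F (Suc (Suc n))\<^esub> w)) =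
      a (Suc (Suc n)) z \<oplus>\<^bsub>F' (Suc (Suc n))\<^esub> (\<ominus>\<^bsub>F' (Suc (Suc n))\<^esub> a (Suc (Suc n)) w)"
    using linear_maps_add[OF an z(1) G.a_inv_closed[OF w(1)]] linear_maps_a_inv[OF mods(2,3) an w(1)] by simp
  have "a (Suc (Suc n)) z \<oplus>\<^bsub>F' (Suc (Suc n))\<^esub> (\<ominus>\<^bsub>F' (Suc (Suc n))\<^esub> a (Suc (Suc n)) w) \<oplus>\<^bsub>F' (Suc (Suc n))\<^esub> d' (Suc (Suc n)) v
      = (a (Suc (Suc n)) z \<oplus>\<^bsub>F' (Suc (Suc n))\<^esub> d' (Suc (Suc n)) v) \<oplus>\<^bsub>F' (Suc (Suc n))\<^esub> (\<ominus>\<^bsub>F' (Suc (Suc n))\<^esub> a (Suc (Suc n)) w)"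
    using aw az dv by (simp add: H.a_ac)
  also have "\<dots> = y" unfolding eq[symmetric] using y aw by (simp add: H.a_assoc H.r_neg)
  finally show "cone_d (Suc n) ?t = (x, y)" using 1 2 w(2) dw by (auto simp: cone_d_def)
qed

end

section \<open>Homology as cosets\<close>

definition shift :: "('r, 'b) module \<Rightarrow> 'b set \<Rightarrow> 'b \<Rightarrow> 'b set" where
  "shift M B z = (\<lambda>b. b \<oplus>\<^bsub>M\<^esub> z) ` B"

lemma carrier_homology:
  "carrier (homology L f M g N) = shift M (f ` carrier L) ` {z \<in> carrier M. g z = \<zero>\<^bsub>N\<^esub>}"
  by (auto simp: homology_def FactGroup_def RCOSETS_def r_coset_def shift_def)

lemma linear_image_subgroup:
  assumes "module R L" "module R M" "f \<in> linear_maps R L M"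
  shows "additive_subgroup (f ` carrier L) M"
proof -
  interpret L: module R L by fact
  interpret M: module R M by fact
  show ?thesis
  proof (intro additive_subgroup.intro subgroup.intro)
    show "\<one>\<^bsub>add_monoid M\<^esub> \<in> f ` carrier L"
      using linear_maps_zero[OF assms] by (metis L.zero_closed imageI monoid.simps(2))
    fix x assume "x \<in> f ` carrier L"
    then obtain u where u: "x = f u" "u \<in> carrier L" by blast
    then have "inv\<^bsub>add_monoid M\<^esub> x = f (\<ominus>\<^bsub>L\<^esub> u)" using linear_maps_a_inv[OF assms u(2)] by (simp add: a_inv_def)
    then show "inv\<^bsub>add_monoid M\<^esub> x \<in> f ` carrier L" using u by simp
    fix y assume "y \<in> f ` carrier L"
    then obtain v where v: "y = f v" "v \<in> carrier L" by blast
    then have "x \<oplus>\<^bsub>M\<^esub> y = f (u \<oplus>\<^bsub>L\<^esub> v)" using linear_maps_add[OF assms(3) u(2) v(2)] u by simp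
    then show "x \<otimes>\<^bsub>add_monoid M\<^esub> y \<in> f ` carrier L" using u v by simp
  qed (use linear_maps_closed[OF assms(3)] in \<open>simp add: image_subset_iff\<close>)
qed

lemma shift_eqD:
  assumes M: "abelian_group M" and B: "additive_subgroup B M" and z: "z \<in> carrier M" and eq: "shift M B z = shift M B z'"
  shows "\<exists>b\<in>B. z = b \<oplus>\<^bsub>M\<^esub> z'"
proof -
  interpret M: abelian_group M by fact
  interpret B: additive_subgroup B M by fact
  have "z \<in> shift M B z" unfolding shift_def using z B.zero_closed by (intro image_eqI[of _ _ "\<zero>\<^bsub>M\<^esub>"]) auto
  then have "z \<in> shift M B z'" by (simp only: eq)
  then show ?thesis unfolding shift_def by blast
qed

lemma shift_absorb:
  assumes M: "abelian_group M" and B: "additive_subgroup B M" and z: "z \<in> carrier M" and b: "b \<in> B"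
  shows "shift M B (b \<oplus>\<^bsub>M\<^esub> z) = shift M B z"
proof -
  interpret M: abelian_group M by fact
  interpret B: additive_subgroup B M by fact
  have bc: "b \<in> carrier M" using b B.a_subset by blast
  have 1: "c \<oplus>\<^bsub>M\<^esub> (b \<oplus>\<^bsub>M\<^esub> z) = (c \<oplus>\<^bsub>M\<^esub> b) \<oplus>\<^bsub>M\<^esub> z" if "c \<in> B" for c
    using that B.a_subset bc z by (intro M.a_assoc[symmetric]) auto
  have 2: "c \<oplus>\<^bsub>M\<^esub> z = (c \<oplus>\<^bsub>M\<^esub> (\<ominus>\<^bsub>M\<^esub> b)) \<oplus>\<^bsub>M\<^esub> (b \<oplus>\<^bsub>M\<^esub> z)" if "c \<in> B" for c
  proof -
    have "c \<in> carrier M" using that B.a_subset by blast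
    then show ?thesis
      using bc z M.a_assoc[of "c" "\<ominus>\<^bsub>M\<^esub> b" "b \<oplus>\<^bsub>M\<^esub> z"] M.a_assoc[of "\<ominus>\<^bsub>M\<^esub> b" b z] by (simp add: M.l_neg)
  qed
  show ?thesis
    unfolding shift_def
  proof (intro equalityI subsetI; elim imageE)
    fix x c assume c: "x = c \<oplus>\<^bsub>M\<^esub> (b \<oplus>\<^bsub>M\<^esub> z)" "c \<in> B"
    show "x \<in> (\<lambda>c. c \<oplus>\<^bsub>M\<^esub> z) ` B"
      using 1[OF c(2)] B.a_closed[OF c(2) b] unfolding c(1) by (rule image_eqI)
  next
    fix x c assume c: "x = c \<oplus>\<^bsub>M\<^esub> z" "c \<in> B"
    show "x \<in> (\<lambda>c. c \<oplus>\<^bsub>M\<^esub> (b \<oplus>\<^bsub>M\<^esub> z)) ` B"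
      using 2[OF c(2)] B.a_closed[OF c(2) B.a_inv_closed[OF b]] unfolding c(1) by (rule image_eqI)
  qed
qed

text \<open>The class map adds \<open>B'\<close> to the image of a whole coset; as \<open>a\<close>
  carries \<open>B\<close> into \<open>B'\<close>, the result is a single coset. The map is taken
  additive so that the lemma applies both to linear maps and to restrictions of sections, which
  change the ring.\<close>

lemma induced_on_classes_shift:
  assumes M: "abelian_group M" and N: "abelian_group N" and B: "additive_subgroup B M" and B': "additive_subgroup B' N"
    and cl: "\<And>x. x \<in> carrier M \<Longrightarrow> a x \<in> carrier N"
    and add: "\<And>x y. x \<in> carrier M \<Longrightarrow> y \<in> carrier M \<Longrightarrow> a (x \<oplus>\<^bsub>M\<^esub> y) = a x \<oplus>\<^bsub>N\<^esub> a y"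
    and aB: "a ` B \<subseteq> B'" and z: "z \<in> carrier M"
  shows "induced_on_classes N B' a (shift M B z) = shift N B' (a z)"
proof -
  interpret M: abelian_group M by fact
  interpret N: abelian_group N by fact
  interpret B: additive_subgroup B M by fact
  interpret B': additive_subgroup B' N by fact
  have ind: "induced_on_classes N B' a (shift M B z) = {b' \<oplus>\<^bsub>N\<^esub> a (b \<oplus>\<^bsub>M\<^esub> z) | b' b. b' \<in> B' \<and> b \<in> B}"
    by (auto simp: induced_on_classes_def shift_def set_add_def set_mult_def)
  have 1: "b' \<oplus>\<^bsub>N\<^esub> a (b \<oplus>\<^bsub>M\<^esub> z) \<in> shift N B' (a z)" if "b' \<in> B'" "b \<in> B" for b' b
  proof -
    have b: "b \<in> carrier M" "b' \<in> carrier N" using that B.a_subset B'.a_subset by auto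
    then have "b' \<oplus>\<^bsub>N\<^esub> a (b \<oplus>\<^bsub>M\<^esub> z) = (b' \<oplus>\<^bsub>N\<^esub> a b) \<oplus>\<^bsub>N\<^esub> a z"
      using add[OF b(1) z] cl[OF b(1)] cl[OF z] by (simp add: N.a_assoc)
    moreover have "b' \<oplus>\<^bsub>N\<^esub> a b \<in> B'" by (rule B'.a_closed[OF that(1)]) (use that aB in blast)
    ultimately show ?thesis unfolding shift_def by (rule image_eqI)
  qed
  have 2: "\<exists>b\<in>B. b' \<oplus>\<^bsub>N\<^esub> a z = b' \<oplus>\<^bsub>N\<^esub> a (b \<oplus>\<^bsub>M\<^esub> z)" for b'
    by (rule bexI[of _ "\<zero>\<^bsub>M\<^esub>"]) (use z in simp_all)
  show ?thesis
  proof
    show "induced_on_classes N B' a (shift M B z) \<subseteq> shift N B' (a z)" unfolding ind using 1 by blast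
    show "shift N B' (a z) \<subseteq> induced_on_classes N B' a (shift M B z)"
      unfolding ind using 2 by (fastforce simp: shift_def)
  qed
qed


lemma homology_iso_injD:
  assumes mods: "module R L" "module R M" "module R L'" "module R M'"
    and f: "f \<in> linear_maps R L M" and f': "f' \<in> linear_maps R L' M'" and a: "a \<in> linear_maps R M M'"
    and aB: "a ` f ` carrier L \<subseteq> f' ` carrier L'"
    and iso: "induced_on_classes M' (f' ` carrier L') a \<in> iso (homology L f M g N) (homology L' f' M' g' N')"
    and z: "z \<in> carrier M" "g z = \<zero>\<^bsub>N\<^esub>" and g0: "g \<zero>\<^bsub>M\<^esub> = \<zero>\<^bsub>N\<^esub>" and az: "a z \<in> f' ` carrier L'"
  shows "z \<in> f ` carrier L"
proof -
  interpret M: module R M by fact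
  interpret M': module R M' by fact
  note B = linear_image_subgroup[OF mods(1,2) f] and B' = linear_image_subgroup[OF mods(3,4) f']
  interpret B: additive_subgroup "f ` carrier L" M by (rule B)
  have ind: "induced_on_classes M' (f' ` carrier L') a (shift M (f ` carrier L) x) = shift M' (f' ` carrier L') (a x)"
    if "x \<in> carrier M" for x
    by (rule induced_on_classes_shift[OF M.abelian_group_axioms M'.abelian_group_axioms B B' _ _ aB that])
      (auto intro: linear_maps_closed[OF a] linear_maps_add[OF a])
  have a0: "a \<zero>\<^bsub>M\<^esub> = \<zero>\<^bsub>M'\<^esub>" by (rule linear_maps_zero[OF mods(2,4) a])
  have "shift M' (f' ` carrier L') (a z) = shift M' (f' ` carrier L') (a z \<oplus>\<^bsub>M'\<^esub> \<zero>\<^bsub>M'\<^esub>)"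
    using linear_maps_closed[OF a z(1)] by simp
  also have "\<dots> = shift M' (f' ` carrier L') (a \<zero>\<^bsub>M\<^esub>)"
    unfolding a0 by (rule shift_absorb[OF M'.abelian_group_axioms B' _ az]) simp
  finally have "induced_on_classes M' (f' ` carrier L') a (shift M (f ` carrier L) z) =
      induced_on_classes M' (f' ` carrier L') a (shift M (f ` carrier L) \<zero>\<^bsub>M\<^esub>)"
    using ind[OF z(1)] ind[OF M.zero_closed] by simp
  moreover have "inj_on (induced_on_classes M' (f' ` carrier L') a) (carrier (homology L f M g N))"
    using iso by (simp add: iso_def bij_betw_def)
  ultimately have "shift M (f ` carrier L) z = shift M (f ` carrier L) \<zero>\<^bsub>M\<^esub>"
    unfolding carrier_homology inj_on_def using z g0 M.zero_closed by blast
  from shift_eqD[OF M.abelian_group_axioms B z(1) this] obtain b where "b \<in> f ` carrier L" "z = b \<oplus>\<^bsub>M\<^esub> \<zero>\<^bsub>M\<^esub>" by blast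
  then show ?thesis using B.a_subset by (metis M.r_zero subsetD)
qed

lemma homology_iso_surjD:
  assumes mods: "module R L" "module R M" "module R L'" "module R M'"
    and f: "f \<in> linear_maps R L M" and f': "f' \<in> linear_maps R L' M'" and a: "a \<in> linear_maps R M M'"
    and aB: "a ` f ` carrier L \<subseteq> f' ` carrier L'"
    and iso: "induced_on_classes M' (f' ` carrier L') a \<in> iso (homology L f M g N) (homology L' f' M' g' N')"
    and y: "y \<in> carrier M'" "g' y = \<zero>\<^bsub>N'\<^esub>"
  shows "\<exists>z\<in>carrier M. g z = \<zero>\<^bsub>N\<^esub> \<and> (\<exists>v\<in>carrier L'. y = a z \<oplus>\<^bsub>M'\<^esub> f' v)"
proof -
  interpret M: module R M by fact
  interpret M': module R M' by fact
  note B = linear_image_subgroup[OF mods(1,2) f] and B' = linear_image_subgroup[OF mods(3,4) f']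
  have ind: "induced_on_classes M' (f' ` carrier L') a (shift M (f ` carrier L) x) = shift M' (f' ` carrier L') (a x)"
    if "x \<in> carrier M" for x
    by (rule induced_on_classes_shift[OF M.abelian_group_axioms M'.abelian_group_axioms B B' _ _ aB that])
      (auto intro: linear_maps_closed[OF a] linear_maps_add[OF a])
  have "induced_on_classes M' (f' ` carrier L') a ` carrier (homology L f M g N) = carrier (homology L' f' M' g' N')"
    using iso by (simp add: iso_def bij_betw_def)
  then have "shift M' (f' ` carrier L') y \<in> induced_on_classes M' (f' ` carrier L') a ` carrier (homology L f M g N)"
    using y by (simp add: carrier_homology)
  then obtain z where z: "z \<in> carrier M" "g z = \<zero>\<^bsub>N\<^esub>"
    and eq: "shift M' (f' ` carrier L') y = shift M' (f' ` carrier L') (a z)"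
    unfolding carrier_homology using ind by auto
  obtain v where v: "v \<in> carrier L'" "y = f' v \<oplus>\<^bsub>M'\<^esub> a z"
    using shift_eqD[OF M'.abelian_group_axioms B' y(1) eq] by blast
  then have "y = a z \<oplus>\<^bsub>M'\<^esub> f' v"
    using linear_maps_closed[OF a z(1)] linear_maps_closed[OF f' v(1)] by (simp add: M'.a_comm)
  then show ?thesis using z v(1) by blast
qed

section \<open>The module form\<close>

text \<open>Common form of the two characteristics; the cochain version is obtained by negating the
  indices.\<close>

definition alternating_sum :: "(int \<Rightarrow> nat) \<Rightarrow> int \<Rightarrow> int" where
  "alternating_sum r i = (\<Sum>j\<in>{j. j < i \<and> r j \<noteq> 0}. (- 1) ^ nat (i - j - 1) * int (r j))"

lemma alternating_sum_low:
  assumes "\<And>j. j < N \<Longrightarrow> r j = 0" "i \<le> N" shows "alternating_sum r i = 0"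
proof -
  have "{j. j < i \<and> r j \<noteq> 0} = {}" using assms by force
  then show ?thesis by (simp add: alternating_sum_def)
qed

text \<open>The lower bound makes the index set finite, without which the sum would take the default
  value zero. Raising \<open>i\<close> by one flips every sign and adds \<open>r i\<close>.\<close>

lemma alternating_sum_step:
  assumes "\<And>j. j < N \<Longrightarrow> r j = 0"
  shows "alternating_sum r (i + 1) = int (r i) - alternating_sum r i"
proof -
  let ?S = "{j. j < i \<and> r j \<noteq> 0}"
  have "?S \<subseteq> {N..<i}" using assms by (auto simp: not_less[symmetric])
  then have fin: "finite ?S" by (rule finite_subset) simp
  have sub: "?S \<subseteq> insert i ?S" by blast
  have "alternating_sum r (i + 1) = (\<Sum>j\<in>insert i ?S. (- 1) ^ nat (i + 1 - j - 1) * int (r j))"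
    unfolding alternating_sum_def by (rule sum.mono_neutral_left) (use fin in auto)
  also have "\<dots> = int (r i) + (\<Sum>j\<in>?S. (- 1) ^ nat (i + 1 - j - 1) * int (r j))"
    using fin by simp
  also have "(\<Sum>j\<in>?S. (- 1) ^ nat (i + 1 - j - 1) * int (r j)) = (\<Sum>j\<in>?S. - ((- 1) ^ nat (i - j - 1) * int (r j)))"
  proof (rule sum.cong)
    fix j assume "j \<in> ?S"
    then have "j < i" by simp
    then have "nat (i + 1 - j - 1) = Suc (nat (i - j - 1))" by arith
    then show "(- 1) ^ nat (i + 1 - j - 1) * int (r j) = - ((- 1) ^ nat (i - j - 1) * int (r j))" by simp
  qed simp
  also have "\<dots> = - alternating_sum r i" by (simp add: alternating_sum_def sum_negf)
  finally show ?thesis by simp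
qed

lemma chain_chi_eq: "chain_chi R F = alternating_sum (\<lambda>j. free_rank R (F j))"
  by (simp add: fun_eq_iff chain_chi_def alternating_sum_def)

lemma free_rank_trivial:
  assumes "module R M" "carrier M = {\<zero>\<^bsub>M\<^esub>}" shows "free_rank R M = 0"
proof -
  interpret M: module R M by fact
  have "module_basis R M 0 b" for b unfolding module_basis_def using assms(2) by (auto simp: PiE_empty_domain)
  then have "\<exists>b. module_basis R M 0 b" by blast
  then show ?thesis unfolding free_rank_def by (rule Least_eq_0)
qed

context complex_map
begin

text \<open>By induction: the defects of the basis elements are cycles, and acyclicity in the form
  \<open>exact\<close> makes them boundaries.\<close>

lemma contraction_exists:
  assumes L: "0 < L"
    and exact: "\<And>n x y. Suc n < L \<Longrightarrow> (x, y) \<in> carrier (cone (Suc n)) \<Longrightarrow> cone_d n (x, y) = \<zero>\<^bsub>cone n\<^esub> \<Longrightarrow>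
      \<exists>w\<in>carrier (cone (Suc (Suc n))). cone_d (Suc n) w = (x, y)"
    and n: "n < L"
  shows "\<exists>S. contraction S (Suc n)"
  using n
proof (induction n)
  case 0
  then show ?case using contraction_base L by (metis One_nat_def Suc_leI)
next
  case (Suc n)
  then obtain S where S: "contraction S (Suc n)" by auto
  have "free_finite_rank R (F (Suc n))" "free_finite_rank R (F' (Suc (Suc n)))"
    using Suc.prems by (auto intro!: free free')
  then obtain b \<beta> c \<gamma> where b: "dual_basis (F (Suc n)) (rk (Suc n)) b \<beta>"
    and c: "dual_basis (F' (Suc (Suc n))) (rk' (Suc (Suc n))) c \<gamma>"
    by (metis free_dual_basis)
  have "module R (F (Suc n))" "module R (F' (Suc (Suc n)))" using Suc.prems by (auto intro!: mod mod')
  then interpret M: module R "F (Suc n)" + N: module R "F' (Suc (Suc n))" .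
  have "\<exists>T. contraction (S(Suc n := T)) (Suc (Suc n))"
  proof (rule contraction_extend[OF S Suc.prems b c])
    fix t assume "t \<in> (\<lambda>k. (b k, \<zero>\<^bsub>F' (Suc (Suc n))\<^esub>)) ` {..<rk (Suc n)} \<union>
        (\<lambda>k. (\<zero>\<^bsub>F (Suc n)\<^esub>, c k)) ` {..<rk' (Suc (Suc n))}"
    then have t: "t \<in> carrier (cone (Suc n))"
      using dual_basis_mem[OF b] dual_basis_mem[OF c] by (auto simp: carrier_cone)
    note z = cone_defect_cycle[OF S Suc_lessD[OF Suc.prems] t]
    obtain x y where xy: "t \<oplus>\<^bsub>cone (Suc n)\<^esub> (\<ominus>\<^bsub>cone (Suc n)\<^esub> S n (cone_d n t)) = (x, y)" by fastforce
    show "\<exists>w\<in>carrier (cone (Suc (Suc n))).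
        cone_d (Suc n) w = t \<oplus>\<^bsub>cone (Suc n)\<^esub> (\<ominus>\<^bsub>cone (Suc n)\<^esub> S n (cone_d n t))"
      using exact[OF Suc.prems, of x y] z unfolding xy by blast
  qed
  then show ?case by blast
qed

end

lemma chain_Fitt_quasi_iso:
  fixes R :: "'r ring" and F :: "int \<Rightarrow> ('r, 'b) module" and F' :: "int \<Rightarrow> ('r, 'c) module"
  assumes R: "cring R" and FC: "free_chain_complex R F d" and bF: "chain_bounded_above F"
    and FC': "free_chain_complex R F' d'" and bF': "chain_bounded_above F'"
    and qi: "chain_quasi_iso R F d F' d' a"
  shows "chain_Fitt R F d k i = chain_Fitt R F' d' k i"
proof -
  interpret comm_base_ring R by (simp add: comm_base_ring_def R)
  have free: "free_finite_rank R (F i)" and lin: "d i \<in> linear_maps R (F i) (F (i - 1))"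
    and dd: "x \<in> carrier (F i) \<Longrightarrow> d (i - 1) (d i x) = \<zero>\<^bsub>F (i - 2)\<^esub>" for i x
    using FC by (auto simp: free_chain_complex_def)
  have free': "free_finite_rank R (F' i)" and lin': "d' i \<in> linear_maps R (F' i) (F' (i - 1))"
    and dd': "x \<in> carrier (F' i) \<Longrightarrow> d' (i - 1) (d' i x) = \<zero>\<^bsub>F' (i - 2)\<^esub>" for i x
    using FC' by (auto simp: free_chain_complex_def)
  have a: "a i \<in> linear_maps R (F i) (F' i)" and ad: "x \<in> carrier (F i) \<Longrightarrow> a (i - 1) (d i x) = d' i (a i x)"
    and iso: "induced_on_classes (F' i) (d' (i + 1) ` carrier (F' (i + 1))) (a i)
            \<in> iso (chain_homology F d i) (chain_homology F' d' i)" for i x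
    using qi by (auto simp: chain_quasi_iso_def chain_map_def)
  have mod: "module R (F i)" and mod': "module R (F' i)" for i
    using free free' by (auto simp: free_finite_rank_def)
  obtain N where N: "\<And>j. j < N \<Longrightarrow> carrier (F j) = {\<zero>\<^bsub>F j\<^esub>}" using bF by (auto simp: chain_bounded_above_def)
  obtain N' where N': "\<And>j. j < N' \<Longrightarrow> carrier (F' j) = {\<zero>\<^bsub>F' j\<^esub>}" using bF' by (auto simp: chain_bounded_above_def)
  \<comment> \<open>\<open>A\<close> is the degree with index zero. The offset 3 puts the indices 0
    and 1 below both bounds, as the cone requires, and makes \<open>n\<close> at least 2, whereas
    the comparison needs \<open>n\<close> nonzero.\<close>
  define A where "A = min (min N N') i - 3"
  define n where "n = nat (i - A - 1)"
  have n: "n \<noteq> 0" "A + int n = i - 1" "A + int (Suc n) = i" by (auto simp: n_def A_def)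
  have AN: "A + 2 < N" "A + 2 < N'" by (auto simp: A_def)
  have s1: "A + int (Suc m) - 1 = A + int m" and s2: "A + int (Suc (Suc m)) - 2 = A + int m"
    and s3: "A + int (Suc m) + 1 = A + int (Suc (Suc m))" for m by auto
  interpret cm: complex_map R "\<lambda>m. F (A + int m)" "\<lambda>m. d (A + int (Suc m))"
    "\<lambda>m. F' (A + int m)" "\<lambda>m. d' (A + int (Suc m))" "\<lambda>m. a (A + int m)" "Suc n"
  proof unfold_locales
    fix m x
    show "d (A + int (Suc m)) \<in> linear_maps R (F (A + int (Suc m))) (F (A + int m))"
      using lin[of "A + int (Suc m)"] unfolding s1 .
    show "d' (A + int (Suc m)) \<in> linear_maps R (F' (A + int (Suc m))) (F' (A + int m))"
      using lin'[of "A + int (Suc m)"] unfolding s1 .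
    show "d (A + int (Suc m)) (d (A + int (Suc (Suc m))) x) = \<zero>\<^bsub>F (A + int m)\<^esub>"
      if "x \<in> carrier (F (A + int (Suc (Suc m))))"
      using dd[OF that] unfolding s1 s2 .
    show "a (A + int m) (d (A + int (Suc m)) x) = d' (A + int (Suc m)) (a (A + int (Suc m)) x)"
      if "x \<in> carrier (F (A + int (Suc m)))"
      using ad[OF that] unfolding s1 .
  next
    fix m y
    show "d' (A + int (Suc m)) (d' (A + int (Suc (Suc m))) y) = \<zero>\<^bsub>F' (A + int m)\<^esub>"
      if "y \<in> carrier (F' (A + int (Suc (Suc m))))"
      using dd'[OF that] unfolding s1 s2 .
  qed (use free free' a N N' AN in auto)
  have aB: "a (A + int m) ` d (A + int (Suc m)) ` carrier (F (A + int (Suc m))) \<subseteq>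
      d' (A + int (Suc m)) ` carrier (F' (A + int (Suc m)))" for m
    using ad[of _ "A + int (Suc m)", unfolded s1] linear_maps_closed[OF a] by fastforce
  have dl: "d (A + int (Suc m)) \<in> linear_maps R (F (A + int (Suc m))) (F (A + int m))"
    "d' (A + int (Suc m)) \<in> linear_maps R (F' (A + int (Suc m))) (F' (A + int m))" for m
    using lin[of "A + int (Suc m)"] lin'[of "A + int (Suc m)"] unfolding s1 by auto
  have iso': "induced_on_classes (F' (A + int (Suc m))) (d' (A + int (Suc (Suc m))) ` carrier (F' (A + int (Suc (Suc m))))) (a (A + int (Suc m)))
      \<in> iso (homology (F (A + int (Suc (Suc m)))) (d (A + int (Suc (Suc m)))) (F (A + int (Suc m))) (d (A + int (Suc m))) (F (A + int m)))
         (homology (F' (A + int (Suc (Suc m)))) (d' (A + int (Suc (Suc m)))) (F' (A + int (Suc m))) (d' (A + int (Suc m))) (F' (A + int m)))" for m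
    using iso[of "A + int (Suc m)"] unfolding chain_homology_def s1 s3 .
  have "\<exists>S. cm.contraction S (Suc n)"
  proof (rule cm.contraction_exists)
    fix m x y
    assume m: "Suc m < Suc n" and xy: "(x, y) \<in> carrier (cm.cone (Suc m))"
      and z: "cm.cone_d m (x, y) = \<zero>\<^bsub>cm.cone m\<^esub>"
    have x: "x \<in> carrier (F (A + int (Suc m)))" and y: "y \<in> carrier (F' (A + int (Suc (Suc m))))"
      using xy by (auto simp: cm.carrier_cone)
    have m': "m < Suc n" using m by simp
    note zz = cm.cone_d_eq_zeroD[OF m' x y z]
    interpret H: module R "F' (A + int (Suc (Suc m)))" by (rule mod')
    \<comment> \<open>Injectivity on homology in the degree of \<open>x\<close>: its image is the
      boundary of \<open>- y\<close>. Surjectivity is used afterwards, one degree higher, for the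
      cycle \<open>y + a w\<close>.\<close>
    have "x \<in> d (A + int (Suc (Suc m))) ` carrier (F (A + int (Suc (Suc m))))"
    proof (rule homology_iso_injD[OF mod mod mod' mod' dl(1) dl(2) a aB iso' x zz(1)])
      show "d (A + int (Suc m)) \<zero>\<^bsub>F (A + int (Suc m))\<^esub> = \<zero>\<^bsub>F (A + int m)\<^esub>"
        by (rule linear_maps_zero[OF mod mod dl(1)])
      show "a (A + int (Suc m)) x \<in> d' (A + int (Suc (Suc m))) ` carrier (F' (A + int (Suc (Suc m))))"
        unfolding zz(2) by (rule imageI, rule H.a_inv_closed[OF y])
    qed
    then obtain w where w: "w \<in> carrier (F (A + int (Suc (Suc m))))" "d (A + int (Suc (Suc m))) w = x" by blast
    have yw: "y \<oplus>\<^bsub>F' (A + int (Suc (Suc m)))\<^esub> a (A + int (Suc (Suc m))) w \<in> carrier (F' (A + int (Suc (Suc m))))"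
      by (rule H.a_closed[OF y linear_maps_closed[OF a w(1)]])
    from homology_iso_surjD[OF mod mod mod' mod' dl(1) dl(2) a aB iso' yw zz(3)[OF w]]
    obtain z v where zv: "z \<in> carrier (F (A + int (Suc (Suc m))))"
      "d (A + int (Suc (Suc m))) z = \<zero>\<^bsub>F (A + int (Suc m))\<^esub>"
      "v \<in> carrier (F' (A + int (Suc (Suc (Suc m)))))"
      "y \<oplus>\<^bsub>F' (A + int (Suc (Suc m)))\<^esub> a (A + int (Suc (Suc m))) w =
        a (A + int (Suc (Suc m))) z \<oplus>\<^bsub>F' (A + int (Suc (Suc m)))\<^esub> d' (A + int (Suc (Suc (Suc m)))) v"
      by blast
    show "\<exists>w\<in>carrier (cm.cone (Suc (Suc m))). cm.cone_d (Suc m) w = (x, y)"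
      by (rule cm.cone_d_eqI[OF m y w zv])
  qed simp_all
  then obtain S where S: "cm.contraction S (Suc n)" ..
  have r0: "free_rank R (F j) = 0" if "j < N" for j by (rule free_rank_trivial[OF mod N[OF that]])
  have r0': "free_rank R (F' j) = 0" if "j < N'" for j by (rule free_rank_trivial[OF mod' N'[OF that]])
  have s4: "A + int (Suc m) = A + int m + 1" for m by simp
  have chi: "chain_chi R F (A + int 0) = 0" "chain_chi R F (A + int (Suc m)) = int (free_rank R (F (A + int m))) - chain_chi R F (A + int m)" for m
    unfolding chain_chi_eq s4
    by (rule alternating_sum_low[of N], rule r0, use AN in auto) (rule alternating_sum_step, rule r0)
  have chi': "chain_chi R F' (A + int 0) = 0" "chain_chi R F' (A + int (Suc m)) = int (free_rank R (F' (A + int m))) - chain_chi R F' (A + int m)" for m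
    unfolding chain_chi_eq s4
    by (rule alternating_sum_low[of N'], rule r0', use AN in auto) (rule alternating_sum_step, rule r0')
  have "minor_ideal R (F (A + int (Suc n))) (F (A + int n)) (d (A + int (Suc n))) (chain_chi R F (A + int (Suc n)) - k) =
    minor_ideal R (F' (A + int (Suc n))) (F' (A + int n)) (d' (A + int (Suc n))) (chain_chi R F' (A + int (Suc n)) - k)"
    by (rule cm.minor_ideal_eq[OF n(1) lessI S, where \<chi> = "\<lambda>m. chain_chi R F (A + int m)" and \<chi>' = "\<lambda>m. chain_chi R F' (A + int m)"])
      (use chi chi' in auto)
  then show ?thesis unfolding chain_Fitt_def n(2,3) .
qed

section \<open>Sheafification\<close>

lemma germ_self:
  "openin T U \<Longrightarrow> x \<in> U \<Longrightarrow> s \<in> F U \<Longrightarrow> (U, s) \<in> germ T F \<rho> x U s"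
  unfolding germ_def by blast

lemma germ_eqI:
  assumes F: "is_presheaf T F \<rho>" and U: "openin T U" "s \<in> F U" and V: "openin T V" "t \<in> F V"
    and W: "openin T W" "x \<in> W" "W \<subseteq> U \<inter> V" and eq: "\<rho> U W s = \<rho> V W t"
  shows "germ T F \<rho> x U s = germ T F \<rho> x V t"
proof -
  have sub: "germ T F \<rho> x U s \<subseteq> germ T F \<rho> x V t"
    if U: "openin T U" "s \<in> F U" and V: "openin T V" "t \<in> F V"
      and W: "W \<subseteq> U \<inter> V" and eq: "\<rho> U W s = \<rho> V W t" for U V s t
  proof
    fix p assume "p \<in> germ T F \<rho> x U s"
    then obtain V' r W' where p: "p = (V', r)" "openin T V'" "x \<in> V'" "r \<in> F V'"
      "openin T W'" "x \<in> W'" "W' \<subseteq> U \<inter> V'" "\<rho> U W' s = \<rho> V' W' r"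
      unfolding germ_def by (cases p) auto
    have I: "openin T (W \<inter> W')" using assms(6) p(5) by (rule openin_Int)
    have tr: "\<rho> Q (W \<inter> W') (\<rho> P Q u) = \<rho> P (W \<inter> W') u"
      if "openin T P" "openin T Q" "Q \<subseteq> P" "W \<inter> W' \<subseteq> Q" "u \<in> F P" for P Q u
      using F that I by (simp add: is_presheaf_def)
    have "\<rho> V (W \<inter> W') t = \<rho> W (W \<inter> W') (\<rho> V W t)"
      by (rule tr[symmetric]) (use V W assms(6) in auto)
    also have "\<dots> = \<rho> W (W \<inter> W') (\<rho> U W s)" by (simp only: eq)
    also have "\<dots> = \<rho> U (W \<inter> W') s" by (rule tr) (use U W assms(6) in auto)
    also have "\<dots> = \<rho> W' (W \<inter> W') (\<rho> U W' s)" by (rule tr[symmetric]) (use U p in auto)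
    also have "\<dots> = \<rho> W' (W \<inter> W') (\<rho> V' W' r)" by (simp only: p)
    also have "\<dots> = \<rho> V' (W \<inter> W') r" by (rule tr) (use p in auto)
    finally have e: "\<rho> V (W \<inter> W') t = \<rho> V' (W \<inter> W') r" .
    have "x \<in> W \<inter> W'" "W \<inter> W' \<subseteq> V \<inter> V'" using assms(7) W p by auto
    then have "\<exists>W. openin T W \<and> x \<in> W \<and> W \<subseteq> V \<inter> V' \<and> \<rho> V W t = \<rho> V' W r" using e I by (intro exI[of _ "W \<inter> W'"]) simp
    then show "p \<in> germ T F \<rho> x V t" using p(2-4) by (simp add: germ_def p(1))
  qed
  show ?thesis
    using sub[OF U V W(3) eq] sub[OF V U _ eq[symmetric]] W(3) by blast
qed

lemma germ_in_sheafification: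
  assumes "openin T U" "s \<in> F U"
  shows "(\<lambda>x\<in>U. germ T F \<rho> x U s) \<in> sheafification T F \<rho> U"
proof -
  let ?\<sigma> = "\<lambda>x\<in>U. germ T F \<rho> x U s"
  have "\<forall>x\<in>U. \<exists>V s. openin T V \<and> x \<in> V \<and> V \<subseteq> U \<and> s \<in> F V \<and> (\<forall>y\<in>V. ?\<sigma> y = germ T F \<rho> y V s)"
  proof
    fix x assume "x \<in> U"
    then show "\<exists>V s. openin T V \<and> x \<in> V \<and> V \<subseteq> U \<and> s \<in> F V \<and> (\<forall>y\<in>V. ?\<sigma> y = germ T F \<rho> y V s)"
      using assms by (intro exI[of _ U] exI[of _ s]) simp
  qed
  then show ?thesis unfolding sheafification_def by simp
qed

definition presheaf_map ::
  "'p topology \<Rightarrow> ('p set \<Rightarrow> 's set) \<Rightarrow> ('p set \<Rightarrow> 'p set \<Rightarrow> 's \<Rightarrow> 's) \<Rightarrow>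
   ('p set \<Rightarrow> 't set) \<Rightarrow> ('p set \<Rightarrow> 'p set \<Rightarrow> 't \<Rightarrow> 't) \<Rightarrow> ('p set \<Rightarrow> 's \<Rightarrow> 't) \<Rightarrow> bool" where
  "presheaf_map T F \<rho> F' \<rho>' \<phi> \<longleftrightarrow> is_presheaf T F \<rho> \<and> is_presheaf T F' \<rho>' \<and>
     (\<forall>V. openin T V \<longrightarrow> (\<forall>s\<in>F V. \<phi> V s \<in> F' V)) \<and>
     (\<forall>V V'. openin T V \<and> openin T V' \<and> V' \<subseteq> V \<longrightarrow> (\<forall>s\<in>F V. \<phi> V' (\<rho> V V' s) = \<rho>' V V' (\<phi> V s)))"

lemma presheaf_mapD:
  assumes "presheaf_map T F \<rho> F' \<rho>' \<phi>"
  shows "is_presheaf T F \<rho>" "is_presheaf T F' \<rho>'"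
    "openin T V \<Longrightarrow> s \<in> F V \<Longrightarrow> \<phi> V s \<in> F' V"
    "openin T V \<Longrightarrow> openin T V' \<Longrightarrow> V' \<subseteq> V \<Longrightarrow> s \<in> F V \<Longrightarrow> \<phi> V' (\<rho> V V' s) = \<rho>' V V' (\<phi> V s)"
  using assms unfolding presheaf_map_def by blast+

text \<open>The union in \<open>sheafification_map\<close> runs over all representatives of a germ.
  By naturality all of its members are the same germ, and since a germ has a representative the
  union equals it.\<close>

lemma sheafification_map_germ:
  assumes pm: "presheaf_map T F \<rho> F' \<rho>' \<phi>"
    and V: "openin T V" "x \<in> V" "s \<in> F V" and \<sigma>: "\<sigma> x = germ T F \<rho> x V s" and U: "x \<in> U"
  shows "sheafification_map T F' \<rho>' \<phi> U \<sigma> x = germ T F' \<rho>' x V (\<phi> V s)"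
proof -
  note F' = presheaf_mapD(2)[OF pm] and \<phi> = presheaf_mapD(3)[OF pm] and nat = presheaf_mapD(4)[OF pm]
  have "germ T F' \<rho>' x V' (\<phi> V' t) = germ T F' \<rho>' x V (\<phi> V s)" if mem: "(V', t) \<in> \<sigma> x" for V' t
  proof -
    obtain W where W: "openin T V'" "t \<in> F V'" "openin T W" "x \<in> W" "W \<subseteq> V \<inter> V'" "\<rho> V W s = \<rho> V' W t"
      using mem unfolding \<sigma> germ_def by auto
    have "\<rho>' V' W (\<phi> V' t) = \<phi> W (\<rho> V' W t)" by (rule nat[symmetric]) (use W in auto)
    also have "\<dots> = \<phi> W (\<rho> V W s)" by (simp only: W)
    also have "\<dots> = \<rho>' V W (\<phi> V s)" by (rule nat) (use V W in auto)
    finally have e: "\<rho>' V' W (\<phi> V' t) = \<rho>' V W (\<phi> V s)" .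
    have "W \<subseteq> V' \<inter> V" using W(5) by blast
    then show ?thesis
      by (rule germ_eqI[OF F' W(1) \<phi>[OF W(1,2)] V(1) \<phi>[OF V(1,3)] W(3,4) _ e])
  qed
  then have "(\<Union>(V', t)\<in>\<sigma> x. germ T F' \<rho>' x V' (\<phi> V' t)) = (\<Union>q\<in>\<sigma> x. germ T F' \<rho>' x V (\<phi> V s))"
    by (intro SUP_cong refl) (simp only: split_paired_all prod.case)
  moreover have "(V, s) \<in> \<sigma> x" unfolding \<sigma> using germ_self[of T V x s F \<rho>] V by blast
  ultimately have "(\<Union>(V', t)\<in>\<sigma> x. germ T F' \<rho>' x V' (\<phi> V' t)) = germ T F' \<rho>' x V (\<phi> V s)"
    using UN_constant[of "germ T F' \<rho>' x V (\<phi> V s)" "\<sigma> x"] by (metis empty_iff)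
  then show ?thesis using U by (simp add: sheafification_map_def)
qed

text \<open>Injectivity of the map of sheaves does not make the map of presheaves injective; it
  identifies the germs of \<open>s\<close> and \<open>t\<close>, which gives equality near
  \<open>x\<close>.\<close>

lemma sheafification_map_injD:
  assumes pm: "presheaf_map T F \<rho> F' \<rho>' \<phi>"
    and inj: "inj_on (sheafification_map T F' \<rho>' \<phi> U) (sheafification T F \<rho> U)"
    and U: "openin T U" "x \<in> U" and s: "s \<in> F U" and t: "t \<in> F U" and eq: "\<phi> U s = \<phi> U t"
  shows "\<exists>W. openin T W \<and> x \<in> W \<and> W \<subseteq> U \<and> \<rho> U W s = \<rho> U W t"
proof -
  let ?\<sigma> = "\<lambda>s. \<lambda>x\<in>U. germ T F \<rho> x U s"
  have "sheafification_map T F' \<rho>' \<phi> U (?\<sigma> s) = sheafification_map T F' \<rho>' \<phi> U (?\<sigma> t)"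
  proof (rule extensionalityI[of _ U])
    fix y assume y: "y \<in> U"
    have *: "sheafification_map T F' \<rho>' \<phi> U (?\<sigma> r) y = germ T F' \<rho>' y U (\<phi> U r)" if "r \<in> F U" for r
      using sheafification_map_germ[of T F \<rho> F' \<rho>' \<phi> U y r "?\<sigma> r" U, OF pm U(1) y that restrict_apply'[OF y] y] .
    show "sheafification_map T F' \<rho>' \<phi> U (?\<sigma> s) y = sheafification_map T F' \<rho>' \<phi> U (?\<sigma> t) y"
      unfolding *[OF s] *[OF t] eq ..
  qed (simp_all add: sheafification_map_def)
  then have "?\<sigma> s = ?\<sigma> t"
    by (rule inj_onD[OF inj _ germ_in_sheafification[of T U s F \<rho>, OF U(1) s] germ_in_sheafification[of T U t F \<rho>, OF U(1) t]])
  then have "germ T F \<rho> x U s = germ T F \<rho> x U t" using fun_cong[of "?\<sigma> s" "?\<sigma> t" x]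
    unfolding restrict_apply'[OF U(2)] by blast
  then have "(U, t) \<in> germ T F \<rho> x U s" using germ_self[of T U x t F \<rho>, OF U t] by simp
  then show ?thesis unfolding germ_def by auto
qed

text \<open>A preimage in the sheafification is a section of the presheaf only near
  \<open>x\<close>, and its image has the germ of \<open>t\<close> there; one further shrinking
  turns equal germs into equal sections.\<close>

lemma sheafification_map_surjD:
  assumes pm: "presheaf_map T F \<rho> F' \<rho>' \<phi>"
    and surj: "sheafification_map T F' \<rho>' \<phi> U ` sheafification T F \<rho> U = sheafification T F' \<rho>' U"
    and U: "openin T U" "x \<in> U" and t: "t \<in> F' U"
  shows "\<exists>V s. openin T V \<and> x \<in> V \<and> V \<subseteq> U \<and> s \<in> F V \<and> \<phi> V s = \<rho>' U V t"
proof -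
  let ?\<tau> = "\<lambda>x\<in>U. germ T F' \<rho>' x U t"
  have "?\<tau> \<in> sheafification T F' \<rho>' U" by (rule germ_in_sheafification[of T U t F' \<rho>', OF U(1) t])
  then have "?\<tau> \<in> sheafification_map T F' \<rho>' \<phi> U ` sheafification T F \<rho> U" by (simp only: surj)
  then obtain \<sigma> where \<sigma>: "?\<tau> = sheafification_map T F' \<rho>' \<phi> U \<sigma>" "\<sigma> \<in> sheafification T F \<rho> U" by (rule imageE)
  have "\<exists>V s. openin T V \<and> x \<in> V \<and> V \<subseteq> U \<and> s \<in> F V \<and> (\<forall>y\<in>V. \<sigma> y = germ T F \<rho> y V s)"
    using \<sigma>(2) U(2) by (simp add: sheafification_def)
  then obtain V s where V: "openin T V" "x \<in> V" "V \<subseteq> U" "s \<in> F V" "\<sigma> x = germ T F \<rho> x V s" by auto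
  have "germ T F' \<rho>' x V (\<phi> V s) = ?\<tau> x"
    using sheafification_map_germ[of T F \<rho> F' \<rho>' \<phi> V x s \<sigma> U, OF pm V(1,2,4,5) U(2)] unfolding \<sigma>(1) ..
  then have "germ T F' \<rho>' x V (\<phi> V s) = germ T F' \<rho>' x U t" unfolding restrict_apply'[OF U(2)] .
  then have "(U, t) \<in> germ T F' \<rho>' x V (\<phi> V s)" using germ_self[of T U x t F' \<rho>', OF U t] by simp
  then obtain W where W: "openin T W" "x \<in> W" "W \<subseteq> V \<inter> U" "\<rho>' V W (\<phi> V s) = \<rho>' U W t"
    unfolding germ_def by auto
  have "\<rho> V W s \<in> F W" using presheaf_mapD(1)[OF pm] V(1,4) W(1,3) unfolding is_presheaf_def by (simp add: Pi_iff)
  moreover have "\<phi> W (\<rho> V W s) = \<rho>' U W t" using presheaf_mapD(4)[OF pm, OF V(1) W(1) _ V(4)] W(3,4) by simp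
  ultimately show ?thesis using W by blast
qed

section \<open>Cohomology sheaves\<close>

locale sheaf_complex =
  fixes Z :: "('p, 'a) ringed_space" and E :: "int \<Rightarrow> ('p, 'a, 'e) module_sheaf"
    and \<delta> :: "int \<Rightarrow> 'p set \<Rightarrow> 'e \<Rightarrow> 'e"
  assumes complex: "locally_free_complex Z E \<delta>"
begin

lemma modules: "sheaf_of_modules Z (E i)"
  using complex unfolding locally_free_complex_def locally_free_def by blast

lemma mod: "open_in Z U \<Longrightarrow> module (sections Z U) (msections (E i) U)"
  using modules[of i, unfolded sheaf_of_modules_def, THEN conjunct2, THEN conjunct1, rule_format] .

lemma presheaf: "is_presheaf (base Z) (\<lambda>U. carrier (msections (E i) U)) (mres (E i))"
  using modules[of i, unfolded sheaf_of_modules_def is_sheaf_def] by (elim conjE)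

lemma mres_closed: "open_in Z U \<Longrightarrow> open_in Z V \<Longrightarrow> V \<subseteq> U \<Longrightarrow> s \<in> carrier (msections (E i) U) \<Longrightarrow>
    mres (E i) U V s \<in> carrier (msections (E i) V)"
  using presheaf[of i, unfolded is_presheaf_def, THEN conjunct1, rule_format, of U V] by (auto dest: funcset_mem)

lemma mres_same: "open_in Z U \<Longrightarrow> s \<in> carrier (msections (E i) U) \<Longrightarrow> mres (E i) U U s = s"
  using presheaf[of i, unfolded is_presheaf_def, THEN conjunct2, THEN conjunct1, rule_format] .

lemma mres_trans: "open_in Z U \<Longrightarrow> open_in Z V \<Longrightarrow> open_in Z W \<Longrightarrow> W \<subseteq> V \<Longrightarrow> V \<subseteq> U \<Longrightarrow>
    s \<in> carrier (msections (E i) U) \<Longrightarrow> mres (E i) V W (mres (E i) U V s) = mres (E i) U W s"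
  by (rule presheaf[of i, unfolded is_presheaf_def, THEN conjunct2, THEN conjunct2, rule_format]) (intro conjI)

lemma mres_add: "open_in Z U \<Longrightarrow> open_in Z V \<Longrightarrow> V \<subseteq> U \<Longrightarrow> x \<in> carrier (msections (E i) U) \<Longrightarrow>
    y \<in> carrier (msections (E i) U) \<Longrightarrow>
    mres (E i) U V (x \<oplus>\<^bsub>msections (E i) U\<^esub> y) = mres (E i) U V x \<oplus>\<^bsub>msections (E i) V\<^esub> mres (E i) U V y"
  by (rule modules[of i, unfolded sheaf_of_modules_def, THEN conjunct2, THEN conjunct2, rule_format, THEN conjunct1, rule_format])
    (intro conjI)

lemma mres_smult: "open_in Z U \<Longrightarrow> open_in Z V \<Longrightarrow> V \<subseteq> U \<Longrightarrow> r \<in> carrier (sections Z U) \<Longrightarrow>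
    x \<in> carrier (msections (E i) U) \<Longrightarrow>
    mres (E i) U V (r \<odot>\<^bsub>msections (E i) U\<^esub> x) = res Z U V r \<odot>\<^bsub>msections (E i) V\<^esub> mres (E i) U V x"
  by (rule modules[of i, unfolded sheaf_of_modules_def, THEN conjunct2, THEN conjunct2, rule_format, THEN conjunct2, rule_format])
    (intro conjI)

lemma d_morphism: "sheaf_morphism Z (E i) (E (i + 1)) (\<delta> i)"
  using complex unfolding locally_free_complex_def by blast

lemma d_linear: "open_in Z U \<Longrightarrow> \<delta> i U \<in> linear_maps (sections Z U) (msections (E i) U) (msections (E (i + 1)) U)"
  using d_morphism[of i, unfolded sheaf_morphism_def, THEN conjunct1, rule_format] .

lemma d_linear': "open_in Z U \<Longrightarrow> \<delta> (i - 1) U \<in> linear_maps (sections Z U) (msections (E (i - 1)) U) (msections (E i) U)"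
  using d_linear[of U "i - 1"] by simp

lemma d_res: "open_in Z U \<Longrightarrow> open_in Z V \<Longrightarrow> V \<subseteq> U \<Longrightarrow> x \<in> carrier (msections (E i) U) \<Longrightarrow>
    \<delta> i V (mres (E i) U V x) = mres (E (i + 1)) U V (\<delta> i U x)"
  by (rule d_morphism[of i, unfolded sheaf_morphism_def, THEN conjunct2, rule_format]) (intro conjI)

lemma dd: "open_in Z U \<Longrightarrow> x \<in> carrier (msections (E i) U) \<Longrightarrow> \<delta> (i + 1) U (\<delta> i U x) = \<zero>\<^bsub>msections (E (i + 2)) U\<^esub>"
  using complex[unfolded locally_free_complex_def, THEN conjunct2, THEN conjunct2, rule_format] .

lemma mres_zero:
  assumes "open_in Z U" "open_in Z V" "V \<subseteq> U"
  shows "mres (E i) U V \<zero>\<^bsub>msections (E i) U\<^esub> = \<zero>\<^bsub>msections (E i) V\<^esub>"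
proof -
  interpret U: module "sections Z U" "msections (E i) U" by (rule mod) fact
  interpret V: module "sections Z V" "msections (E i) V" by (rule mod) fact
  let ?z = "mres (E i) U V \<zero>\<^bsub>msections (E i) U\<^esub>"
  have z: "?z \<in> carrier (msections (E i) V)" using assms by (intro mres_closed) auto
  have "?z \<oplus>\<^bsub>msections (E i) V\<^esub> ?z = ?z"
    using mres_add[OF assms, of "\<zero>\<^bsub>msections (E i) U\<^esub>" i "\<zero>\<^bsub>msections (E i) U\<^esub>"] by simp
  then show ?thesis using V.add.r_cancel_one[OF z z] by simp
qed

definition cocycles :: "int \<Rightarrow> 'p set \<Rightarrow> 'e set" where
  "cocycles i U = {z \<in> carrier (msections (E i) U). \<delta> i U z = \<zero>\<^bsub>msections (E (i + 1)) U\<^esub>}"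

lemma cohomology_presheaf_eq:
  "cohomology_presheaf E \<delta> i U = shift (msections (E i) U) (coboundaries E \<delta> i U) ` cocycles i U"
  by (simp add: cohomology_presheaf_def carrier_homology coboundaries_def cocycles_def)

lemma coboundaries_subgroup: "open_in Z U \<Longrightarrow> additive_subgroup (coboundaries E \<delta> i U) (msections (E i) U)"
  unfolding coboundaries_def by (rule linear_image_subgroup[OF mod mod d_linear'])

lemma abelian: "open_in Z U \<Longrightarrow> abelian_group (msections (E i) U)"
  using mod[of U i] by (rule module.axioms(2))

lemma mres_coboundaries:
  assumes "open_in Z U" "open_in Z V" "V \<subseteq> U"
  shows "mres (E i) U V ` coboundaries E \<delta> i U \<subseteq> coboundaries E \<delta> i V"
proof -
  have "mres (E i) U V (\<delta> (i - 1) U x) \<in> coboundaries E \<delta> i V" if "x \<in> carrier (msections (E (i - 1)) U)" for x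
  proof (unfold coboundaries_def, rule image_eqI)
    show "mres (E i) U V (\<delta> (i - 1) U x) = \<delta> (i - 1) V (mres (E (i - 1)) U V x)"
      using d_res[OF assms that] by simp
  qed (rule mres_closed[OF assms that])
  then show ?thesis unfolding coboundaries_def[of E \<delta> i U] by auto
qed

lemma mres_cocycles:
  assumes "open_in Z U" "open_in Z V" "V \<subseteq> U" "z \<in> cocycles i U"
  shows "mres (E i) U V z \<in> cocycles i V"
proof -
  have z: "z \<in> carrier (msections (E i) U)" "\<delta> i U z = \<zero>\<^bsub>msections (E (i + 1)) U\<^esub>" using assms(4) by (auto simp: cocycles_def)
  show ?thesis
    using d_res[OF assms(1-3) z(1)] mres_closed[OF assms(1-3) z(1)] mres_zero[OF assms(1-3), of "i + 1"] z(2)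
    by (simp add: cocycles_def)
qed

lemma cohomology_res_shift:
  assumes "open_in Z U" "open_in Z V" "V \<subseteq> U" "z \<in> carrier (msections (E i) U)"
  shows "cohomology_res E \<delta> i U V (shift (msections (E i) U) (coboundaries E \<delta> i U) z) =
    shift (msections (E i) V) (coboundaries E \<delta> i V) (mres (E i) U V z)"
  unfolding cohomology_res_def
  by (rule induced_on_classes_shift[OF abelian abelian coboundaries_subgroup coboundaries_subgroup
        mres_closed mres_add mres_coboundaries assms(4)])
    (use assms in auto)

lemma cohomology_is_presheaf: "is_presheaf (base Z) (cohomology_presheaf E \<delta> i) (cohomology_res E \<delta> i)"
  unfolding is_presheaf_def
proof (intro conjI allI impI ballI)
  have c: "z \<in> cocycles i U \<Longrightarrow> z \<in> carrier (msections (E i) U)" for z U by (simp add: cocycles_def)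
  show "cohomology_res E \<delta> i U V \<in> cohomology_presheaf E \<delta> i U \<rightarrow> cohomology_presheaf E \<delta> i V"
    if o: "open_in Z U \<and> open_in Z V \<and> V \<subseteq> U" for U V
  proof
    fix s assume "s \<in> cohomology_presheaf E \<delta> i U"
    then obtain z where z: "s = shift (msections (E i) U) (coboundaries E \<delta> i U) z" "z \<in> cocycles i U"
      unfolding cohomology_presheaf_eq by blast
    then show "cohomology_res E \<delta> i U V s \<in> cohomology_presheaf E \<delta> i V"
      using cohomology_res_shift[of U V z i] mres_cocycles[of U V z i] c[OF z(2)] o
      by (simp add: cohomology_presheaf_eq)
  qed
  show "cohomology_res E \<delta> i U U s = s" if o: "open_in Z U" and s: "s \<in> cohomology_presheaf E \<delta> i U" for U s
  proof -
    obtain z where z: "s = shift (msections (E i) U) (coboundaries E \<delta> i U) z" "z \<in> carrier (msections (E i) U)"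
      using s c unfolding cohomology_presheaf_eq by blast
    then show ?thesis using o cohomology_res_shift[of U U z i] mres_same[of U z i] by simp
  qed
  show "cohomology_res E \<delta> i V W (cohomology_res E \<delta> i U V s) = cohomology_res E \<delta> i U W s"
    if o: "open_in Z U \<and> open_in Z V \<and> open_in Z W \<and> W \<subseteq> V \<and> V \<subseteq> U"
      and s: "s \<in> cohomology_presheaf E \<delta> i U" for U V W s
  proof -
    obtain z where z: "s = shift (msections (E i) U) (coboundaries E \<delta> i U) z" "z \<in> carrier (msections (E i) U)"
      using s c unfolding cohomology_presheaf_eq by blast
    have "W \<subseteq> U" using o by blast
    then show ?thesis
      using o z(2) mres_closed[of U V z i] mres_trans[of U V W z i]
      unfolding z(1) by (simp add: cohomology_res_shift)
  qed
qed

end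

locale sheaf_quasi_iso = E: sheaf_complex Z E \<delta> + W: sheaf_complex Z W \<delta>'
  for Z :: "('p, 'a) ringed_space" and E :: "int \<Rightarrow> ('p, 'a, 'e) module_sheaf" and \<delta>
    and W :: "int \<Rightarrow> ('p, 'a, 'w) module_sheaf" and \<delta>' +
  fixes \<alpha> :: "int \<Rightarrow> 'p set \<Rightarrow> 'e \<Rightarrow> 'w"
  assumes quasi_iso: "cochain_quasi_iso Z E \<delta> W \<delta>' \<alpha>"
begin

lemma a_map: "cochain_map Z E \<delta> W \<delta>' \<alpha>"
  using quasi_iso by (simp add: cochain_quasi_iso_def)

lemma a_morphism: "sheaf_morphism Z (E i) (W i) (\<alpha> i)"
  using a_map unfolding cochain_map_def by blast

lemma a_linear: "open_in Z U \<Longrightarrow> \<alpha> i U \<in> linear_maps (sections Z U) (msections (E i) U) (msections (W i) U)"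
  using a_morphism[of i, unfolded sheaf_morphism_def, THEN conjunct1, rule_format] .

lemma a_res: "open_in Z U \<Longrightarrow> open_in Z V \<Longrightarrow> V \<subseteq> U \<Longrightarrow> x \<in> carrier (msections (E i) U) \<Longrightarrow>
    \<alpha> i V (mres (E i) U V x) = mres (W i) U V (\<alpha> i U x)"
  by (rule a_morphism[of i, unfolded sheaf_morphism_def, THEN conjunct2, rule_format]) (intro conjI)

lemma a_d: "open_in Z U \<Longrightarrow> x \<in> carrier (msections (E i) U) \<Longrightarrow> \<alpha> (i + 1) U (\<delta> i U x) = \<delta>' i U (\<alpha> i U x)"
  using a_map[unfolded cochain_map_def, THEN conjunct2, rule_format] .

lemma a_coboundaries:
  assumes "open_in Z U" shows "\<alpha> i U ` coboundaries E \<delta> i U \<subseteq> coboundaries W \<delta>' i U"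
proof -
  have "\<alpha> i U (\<delta> (i - 1) U x) \<in> coboundaries W \<delta>' i U" if "x \<in> carrier (msections (E (i - 1)) U)" for x
    
  proof (unfold coboundaries_def, rule image_eqI)
    show "\<alpha> i U (\<delta> (i - 1) U x) = \<delta>' (i - 1) U (\<alpha> (i - 1) U x)" using a_d[OF assms that] by simp
  qed (rule linear_maps_closed[OF a_linear[OF assms] that])
  then show ?thesis unfolding coboundaries_def[of E \<delta> i U] by auto
qed

lemma a_cocycles:
  assumes U: "open_in Z U" and z: "z \<in> E.cocycles i U" shows "\<alpha> i U z \<in> W.cocycles i U"
proof -
  have zc: "z \<in> carrier (msections (E i) U)" using z by (simp add: E.cocycles_def)
  have "\<delta>' i U (\<alpha> i U z) = \<alpha> (i + 1) U \<zero>\<^bsub>msections (E (i + 1)) U\<^esub>"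
    using a_d[OF U zc] z by (simp add: E.cocycles_def)
  also have "\<dots> = \<zero>\<^bsub>msections (W (i + 1)) U\<^esub>" by (rule linear_maps_zero[OF E.mod[OF U] W.mod[OF U] a_linear[OF U]])
  finally show ?thesis using linear_maps_closed[OF a_linear[OF U] zc] by (simp add: W.cocycles_def)
qed

abbreviation class_map :: "int \<Rightarrow> 'p set \<Rightarrow> 'e set \<Rightarrow> 'w set" where
  "class_map i V \<equiv> induced_on_classes (msections (W i) V) (coboundaries W \<delta>' i V) (\<alpha> i V)"

lemma class_map_shift:
  assumes U: "open_in Z U" and z: "z \<in> carrier (msections (E i) U)"
  shows "class_map i U (shift (msections (E i) U) (coboundaries E \<delta> i U) z) =
    shift (msections (W i) U) (coboundaries W \<delta>' i U) (\<alpha> i U z)"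
  by (rule induced_on_classes_shift[OF E.abelian W.abelian E.coboundaries_subgroup W.coboundaries_subgroup
        linear_maps_closed[OF a_linear[OF U]] linear_maps_add[OF a_linear[OF U]] a_coboundaries z])
    (use U in auto)

lemma class_map_closed:
  assumes U: "open_in Z U" and s: "s \<in> cohomology_presheaf E \<delta> i U"
  shows "class_map i U s \<in> cohomology_presheaf W \<delta>' i U"
proof -
  obtain z where z: "s = shift (msections (E i) U) (coboundaries E \<delta> i U) z" "z \<in> E.cocycles i U"
    using s unfolding E.cohomology_presheaf_eq by blast
  then have "z \<in> carrier (msections (E i) U)" by (simp add: E.cocycles_def)
  then show ?thesis unfolding z(1) class_map_shift[OF U \<open>z \<in> carrier _\<close>] W.cohomology_presheaf_eq
    using a_cocycles[OF U z(2)] by blast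
qed

lemma class_map_res:
  assumes o: "open_in Z U" "open_in Z V" "V \<subseteq> U" and s: "s \<in> cohomology_presheaf E \<delta> i U"
  shows "class_map i V (cohomology_res E \<delta> i U V s) = cohomology_res W \<delta>' i U V (class_map i U s)"
proof -
  obtain z where z: "s = shift (msections (E i) U) (coboundaries E \<delta> i U) z" "z \<in> carrier (msections (E i) U)"
    using s unfolding E.cohomology_presheaf_eq E.cocycles_def by blast
  show ?thesis
    unfolding z(1) E.cohomology_res_shift[OF o z(2)] class_map_shift[OF o(1) z(2)]
      class_map_shift[OF o(2) E.mres_closed[OF o z(2)]]
      W.cohomology_res_shift[OF o linear_maps_closed[OF a_linear[OF o(1)] z(2)]] a_res[OF o z(2)] ..
qed

lemma class_map_presheaf_map:
  "presheaf_map (base Z) (cohomology_presheaf E \<delta> i) (cohomology_res E \<delta> i)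
     (cohomology_presheaf W \<delta>' i) (cohomology_res W \<delta>' i) (class_map i)"
  unfolding presheaf_map_def
  using E.cohomology_is_presheaf W.cohomology_is_presheaf class_map_closed class_map_res by blast

text \<open>The classes of \<open>z\<close> and of zero have the same image over \<open>U\<close>,
  so they agree on some neighbourhood of \<open>x\<close>, where \<open>z\<close> is then a
  coboundary.\<close>

lemma local_injective:
  assumes U: "open_in Z U" "x \<in> U" and z: "z \<in> E.cocycles i U" and az: "\<alpha> i U z \<in> coboundaries W \<delta>' i U"
  shows "\<exists>V. open_in Z V \<and> x \<in> V \<and> V \<subseteq> U \<and> mres (E i) U V z \<in> coboundaries E \<delta> i V"
proof -
  interpret MU: abelian_group "msections (E i) U" by (rule E.abelian[OF U(1)])
  interpret NU: abelian_group "msections (W i) U" by (rule W.abelian[OF U(1)])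
  let ?sh = "shift (msections (E i) U) (coboundaries E \<delta> i U)"
  let ?o = "\<zero>\<^bsub>msections (E i) U\<^esub>"
  have zc: "z \<in> carrier (msections (E i) U)" using z by (simp add: E.cocycles_def)
  have 0: "?o \<in> E.cocycles i U"
    using linear_maps_zero[OF E.mod[OF U(1)] E.mod[OF U(1)] E.d_linear[OF U(1)]] by (simp add: E.cocycles_def)
  have a0: "\<alpha> i U ?o = \<zero>\<^bsub>msections (W i) U\<^esub>"
    by (rule linear_maps_zero[OF E.mod[OF U(1)] W.mod[OF U(1)] a_linear[OF U(1)]])
  have azc: "\<alpha> i U z \<in> carrier (msections (W i) U)" by (rule linear_maps_closed[OF a_linear[OF U(1)] zc])
  have eq: "class_map i U (?sh z) = class_map i U (?sh ?o)"
    unfolding class_map_shift[OF U(1) zc] class_map_shift[OF U(1) MU.zero_closed] a0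
    using shift_absorb[OF W.abelian[OF U(1)] W.coboundaries_subgroup[OF U(1)] NU.zero_closed az] azc by simp
  have inj: "inj_on (sheafification_map (base Z) (cohomology_presheaf W \<delta>' i) (cohomology_res W \<delta>' i) (class_map i) U)
      (sheafification (base Z) (cohomology_presheaf E \<delta> i) (cohomology_res E \<delta> i) U)"
    using quasi_iso[unfolded cochain_quasi_iso_def, THEN conjunct2, rule_format, OF U(1), of i] by (simp add: bij_betw_def)
  have mem: "?sh z \<in> cohomology_presheaf E \<delta> i U" "?sh ?o \<in> cohomology_presheaf E \<delta> i U"
    unfolding E.cohomology_presheaf_eq using z 0 by auto
  from sheafification_map_injD[OF class_map_presheaf_map inj U mem eq]
  obtain V where V: "open_in Z V" "x \<in> V" "V \<subseteq> U"
    "cohomology_res E \<delta> i U V (?sh z) = cohomology_res E \<delta> i U V (?sh ?o)" by blast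
  note o = U(1) V(1,3)
  interpret MV: abelian_group "msections (E i) V" by (rule E.abelian[OF V(1)])
  interpret BV: additive_subgroup "coboundaries E \<delta> i V" "msections (E i) V" by (rule E.coboundaries_subgroup[OF V(1)])
  have "shift (msections (E i) V) (coboundaries E \<delta> i V) (mres (E i) U V z) =
      shift (msections (E i) V) (coboundaries E \<delta> i V) \<zero>\<^bsub>msections (E i) V\<^esub>"
    using V(4) unfolding E.cohomology_res_shift[OF o zc] E.cohomology_res_shift[OF o MU.zero_closed] E.mres_zero[OF o] .
  from shift_eqD[OF E.abelian[OF V(1)] E.coboundaries_subgroup[OF V(1)] E.mres_closed[OF o zc] this]
  obtain b where b: "b \<in> coboundaries E \<delta> i V" "mres (E i) U V z = b \<oplus>\<^bsub>msections (E i) V\<^esub> \<zero>\<^bsub>msections (E i) V\<^esub>"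
    by blast
  then have "mres (E i) U V z \<in> coboundaries E \<delta> i V" using BV.a_subset by (metis MV.r_zero subsetD)
  then show ?thesis using V by blast
qed

text \<open>Near \<open>x\<close> the class of \<open>y\<close> comes from the class of a cocycle;
  equality of the two cosets supplies the correction \<open>v\<close>.\<close>

lemma local_surjective:
  assumes U: "open_in Z U" "x \<in> U" and y: "y \<in> W.cocycles i U"
  shows "\<exists>V z v. open_in Z V \<and> x \<in> V \<and> V \<subseteq> U \<and> z \<in> E.cocycles i V \<and> v \<in> carrier (msections (W (i - 1)) V) \<and>
    mres (W i) U V y = \<alpha> i V z \<oplus>\<^bsub>msections (W i) V\<^esub> \<delta>' (i - 1) V v"
proof -
  let ?sh = "\<lambda>U. shift (msections (W i) U) (coboundaries W \<delta>' i U)"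
  have yc: "y \<in> carrier (msections (W i) U)" using y by (simp add: W.cocycles_def)
  have surj: "sheafification_map (base Z) (cohomology_presheaf W \<delta>' i) (cohomology_res W \<delta>' i) (class_map i) U `
      sheafification (base Z) (cohomology_presheaf E \<delta> i) (cohomology_res E \<delta> i) U =
      sheafification (base Z) (cohomology_presheaf W \<delta>' i) (cohomology_res W \<delta>' i) U"
    using quasi_iso[unfolded cochain_quasi_iso_def, THEN conjunct2, rule_format, OF U(1), of i] by (simp add: bij_betw_def)
  have "?sh U y \<in> cohomology_presheaf W \<delta>' i U" unfolding W.cohomology_presheaf_eq using y by blast
  from sheafification_map_surjD[OF class_map_presheaf_map surj U this]
  obtain V s where V: "open_in Z V" "x \<in> V" "V \<subseteq> U" and s: "s \<in> cohomology_presheaf E \<delta> i V"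
    and eq: "class_map i V s = cohomology_res W \<delta>' i U V (?sh U y)" by blast
  note o = U(1) V(1,3)
  interpret NV: abelian_group "msections (W i) V" by (rule W.abelian[OF V(1)])
  obtain z where z: "s = shift (msections (E i) V) (coboundaries E \<delta> i V) z" "z \<in> E.cocycles i V"
    using s unfolding E.cohomology_presheaf_eq by blast
  have zc: "z \<in> carrier (msections (E i) V)" using z(2) by (simp add: E.cocycles_def)
  have "?sh V (mres (W i) U V y) = ?sh V (\<alpha> i V z)"
    using eq unfolding z(1) class_map_shift[OF V(1) zc] W.cohomology_res_shift[OF o yc] by simp
  from shift_eqD[OF W.abelian[OF V(1)] W.coboundaries_subgroup[OF V(1)] W.mres_closed[OF o yc] this]
  obtain v where v: "v \<in> carrier (msections (W (i - 1)) V)"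
    "mres (W i) U V y = \<delta>' (i - 1) V v \<oplus>\<^bsub>msections (W i) V\<^esub> \<alpha> i V z"
    unfolding coboundaries_def by blast
  have "mres (W i) U V y = \<alpha> i V z \<oplus>\<^bsub>msections (W i) V\<^esub> \<delta>' (i - 1) V v"
    unfolding v(2)
    using linear_maps_closed[OF W.d_linear'[OF V(1)] v(1)] linear_maps_closed[OF a_linear[OF V(1)] zc] by (rule NV.a_comm)
  then show ?thesis using V z(2) v(1) by blast
qed

end

section \<open>Ranks and restriction\<close>

text \<open>Splitting off the \<open>m\<close> elements of one basis shows that the determinants of
  size \<open>m\<close> generate the unit ideal. If the other basis had fewer than \<open>m\<close>
  elements, all these determinants would vanish, which is impossible in a nonzero ring.\<close>

lemma (in comm_base_ring) module_basis_length_le: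
  assumes M: "module R M" and b: "module_basis R M n b" and c: "module_basis R M m c" and ne: "\<one> \<noteq> \<zero>"
  shows "m \<le> n"
proof (rule ccontr)
  assume "\<not> m \<le> n"
  then have mn: "n < m" by simp
  interpret M: module R M by fact
  obtain \<beta> where \<beta>: "dual_basis M n b \<beta>" by (rule dual_basis_of_module_basis[OF M b])
  obtain \<gamma> where \<gamma>: "dual_basis M m c \<gamma>" by (rule dual_basis_of_module_basis[OF M c])
  have "det_ideal M (carrier M) (0 + int m) = det_ideal M {s \<in> carrier M. \<forall>k<m. \<gamma> k s = \<zero>} 0"
    by (rule det_ideal_split[OF M order_refl dual_basis_mem[OF \<gamma>] dual_basis_functional[OF \<gamma>] dual_basis_dual[OF \<gamma>]])
      (use dual_basis_mem[OF \<gamma>] in auto)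
  then have 1: "det_ideal M (carrier M) (int m) = carrier R" by (simp add: det_ideal_def)
  have bc: "\<beta> i (b j) \<in> carrier R" if "i < n" "j < n" for i j
    by (rule functional_closed[OF dual_basis_functional[OF \<beta> that(1)] dual_basis_mem[OF \<beta> that(2)]])
  have "n < m \<or> n < m" using mn by simp
  note large = ring_det_submatrix_large[of n n "\<lambda>i j. \<beta> i (b j)" m, OF bc this]
  have "det_values M ((\<lambda>x. x) ` carrier M) m \<subseteq> {\<zero>}"
    by (rule det_values_subset_ideal[OF M M linear_maps_id \<beta> \<beta> zeroideal refl]) (use large in simp)
  then have "Idl (det_values M (carrier M) m) \<subseteq> {\<zero>}" by (intro genideal_minimal[OF zeroideal]) simp
  then have "carrier R \<subseteq> {\<zero>}" using 1 det_ideal_of_nat[of "carrier M" M m] by simp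
  then show False using ne by auto
qed

lemma module_basis_cong:
  assumes M: "module R M" and b: "module_basis R M n b" and eq: "\<And>k. k < n \<Longrightarrow> b k = c k"
  shows "module_basis R M n c"
proof -
  interpret M: module R M by fact
  have bc: "b k \<in> carrier M" if "k < n" for k using b that by (simp add: module_basis_def)
  have "(\<Oplus>\<^bsub>M\<^esub>i\<in>{..<n}. f i \<odot>\<^bsub>M\<^esub> b i) = (\<Oplus>\<^bsub>M\<^esub>i\<in>{..<n}. f i \<odot>\<^bsub>M\<^esub> c i)"
    if f: "f \<in> {..<n} \<rightarrow>\<^sub>E carrier R" for f
  proof (rule M.finsum_cong')
    have "f i \<odot>\<^bsub>M\<^esub> c i \<in> carrier M" if "i < n" for i
      using PiE_mem[OF f, of i] bc[OF that] eq[OF that] that by simp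
    then show "(\<lambda>i. f i \<odot>\<^bsub>M\<^esub> c i) \<in> {..<n} \<rightarrow> carrier M" by simp
  qed (simp_all add: eq)
  then have eqv: "(f \<in> {..<n} \<rightarrow>\<^sub>E carrier R \<and> x = (\<Oplus>\<^bsub>M\<^esub>i\<in>{..<n}. f i \<odot>\<^bsub>M\<^esub> b i)) \<longleftrightarrow>
      (f \<in> {..<n} \<rightarrow>\<^sub>E carrier R \<and> x = (\<Oplus>\<^bsub>M\<^esub>i\<in>{..<n}. f i \<odot>\<^bsub>M\<^esub> c i))" for f x
    by auto
  have "\<forall>x\<in>carrier M. \<exists>!f. f \<in> {..<n} \<rightarrow>\<^sub>E carrier R \<and> x = (\<Oplus>\<^bsub>M\<^esub>i\<in>{..<n}. f i \<odot>\<^bsub>M\<^esub> c i)"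
    using b[unfolded module_basis_def, THEN conjunct2] unfolding eqv .
  moreover have "\<forall>i<n. c i \<in> carrier M" using bc eq by simp
  ultimately show ?thesis by (simp only: module_basis_def)
qed

lemma ring_det_hom:
  assumes R: "cring R" and S: "cring S" and \<rho>: "\<rho> \<in> ring_hom R S"
    and A: "\<And>i j. i < t \<Longrightarrow> j < t \<Longrightarrow> A i j \<in> carrier R"
  shows "\<rho> (ring_det R t A) = ring_det S t (\<lambda>i j. \<rho> (A i j))"
proof -
  interpret R: comm_base_ring R by (simp add: comm_base_ring_def R)
  interpret S: comm_base_ring S by (simp add: comm_base_ring_def S)
  interpret h: ring_hom_cring R S \<rho> using \<rho> by unfold_locales
  have "\<rho> (ring_det R t A) = (\<Oplus>\<^bsub>S\<^esub>\<pi>\<in>{\<pi>. \<pi> permutes {..<t}}. \<rho> (R.det_term t A \<pi>))"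
  proof -
    have "R.det_term t A \<in> {\<pi>. \<pi> permutes {..<t}} \<rightarrow> carrier R"
      by (auto intro!: R.det_term_closed A)
    from h.hom_finsum[OF this] show ?thesis by (simp add: R.ring_det_alt comp_def)
  qed
  also have "\<dots> = (\<Oplus>\<^bsub>S\<^esub>\<pi>\<in>{\<pi>. \<pi> permutes {..<t}}. S.det_term t (\<lambda>i j. \<rho> (A i j)) \<pi>)"
  proof (rule S.finsum_cong')
    show "S.det_term t (\<lambda>i j. \<rho> (A i j)) \<in> {\<pi>. \<pi> permutes {..<t}} \<rightarrow> carrier S"
      by (auto intro!: S.det_term_closed A)
    fix \<pi> assume "\<pi> \<in> {\<pi>. \<pi> permutes {..<t}}"
    then have p: "\<pi> permutes {..<t}" by simp
    have in': "\<pi> k < t" if "k < t" for k using that permutes_in_image[OF p] by auto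
    have f: "(\<lambda>i. A i (\<pi> i)) \<in> {..<t} \<rightarrow> carrier R" using A in' by auto
    have "\<rho> (\<Otimes>\<^bsub>R\<^esub>i\<in>{..<t}. A i (\<pi> i)) = (\<Otimes>\<^bsub>S\<^esub>i\<in>{..<t}. \<rho> (A i (\<pi> i)))"
      using h.hom_finprod[OF f] by (simp add: comp_def)
    then show "\<rho> (R.det_term t A \<pi>) = S.det_term t (\<lambda>i j. \<rho> (A i j)) \<pi>"
      using R.finprod_closed[OF f] by (simp add: R.det_term_def S.det_term_def)
  qed simp
  finally show ?thesis by (simp only: S.ring_det_alt)
qed

text \<open>Restriction of sections is semilinear along \<open>res\<close>. Viewing its target as a
  module over the larger open set makes it linear, so that it can be compared with other linear maps
  on a basis.\<close>

definition restrict_scalars :: "('s \<Rightarrow> 'r) \<Rightarrow> ('r, 'b) module \<Rightarrow> ('s, 'b) module" where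
  "restrict_scalars \<rho> N = \<lparr>carrier = carrier N, monoid.mult = monoid.mult N, one = one N,
     ring.zero = ring.zero N, ring.add = ring.add N, smult = (\<lambda>r x. \<rho> r \<odot>\<^bsub>N\<^esub> x)\<rparr>"

lemma restrict_scalars_simps [simp]:
  "carrier (restrict_scalars \<rho> N) = carrier N" "\<zero>\<^bsub>restrict_scalars \<rho> N\<^esub> = \<zero>\<^bsub>N\<^esub>"
  "x \<oplus>\<^bsub>restrict_scalars \<rho> N\<^esub> y = x \<oplus>\<^bsub>N\<^esub> y" "r \<odot>\<^bsub>restrict_scalars \<rho> N\<^esub> x = \<rho> r \<odot>\<^bsub>N\<^esub> x"
  "\<ominus>\<^bsub>restrict_scalars \<rho> N\<^esub> x = \<ominus>\<^bsub>N\<^esub> x"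
  by (simp_all add: restrict_scalars_def a_inv_def m_inv_def)

lemma module_restrict_scalars:
  assumes R: "cring R" and \<rho>: "\<rho> \<in> ring_hom R S" and N: "module S N"
  shows "module R (restrict_scalars \<rho> N)"
proof -
  interpret R: cring R by fact
  interpret N: module S N by fact
  have c: "\<rho> r \<in> carrier S" if "r \<in> carrier R" for r using ring_hom_closed[OF \<rho> that] .
  show ?thesis
  proof (rule moduleI[OF R])
    show "abelian_group (restrict_scalars \<rho> N)"
    proof (rule abelian_groupI)
      fix x assume x: "x \<in> carrier (restrict_scalars \<rho> N)"
      show "\<exists>y\<in>carrier (restrict_scalars \<rho> N). y \<oplus>\<^bsub>restrict_scalars \<rho> N\<^esub> x = \<zero>\<^bsub>restrict_scalars \<rho> N\<^esub>"
        by (rule bexI[of _ "\<ominus>\<^bsub>N\<^esub> x"]) (use x in \<open>simp_all add: N.l_neg\<close>)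
    qed (simp_all add: N.add.m_ac)
  qed (simp_all add: c ring_hom_add[OF \<rho>] ring_hom_mult[OF \<rho>] ring_hom_one[OF \<rho>]
      N.smult_l_distr N.smult_r_distr N.smult_assoc1)
qed

lemma linear_maps_restrict_scalars:
  assumes \<rho>: "\<rho> \<in> ring_hom R S" and \<phi>: "\<phi> \<in> linear_maps S M N"
  shows "\<phi> \<in> linear_maps R (restrict_scalars \<rho> M) (restrict_scalars \<rho> N)"
  by (rule linear_mapsI)
    (simp_all add: linear_maps_closed[OF \<phi>] linear_maps_add[OF \<phi>] linear_maps_smult[OF \<phi>] ring_hom_closed[OF \<rho>])

section \<open>Integral ringed spaces and constancy of ranks\<close>

locale integral_space =
  fixes Z :: "('p, 'a) ringed_space"
  assumes ringed: "is_ringed_space Z"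
    and integral: "open_in Z U \<Longrightarrow> U \<noteq> {} \<Longrightarrow> domain (sections Z U)"
    and nonempty: "points Z \<noteq> {}"
begin

lemma sections_cring: "open_in Z U \<Longrightarrow> cring (sections Z U)"
  using ringed by (simp add: is_ringed_space_def)

lemma res_hom: "open_in Z U \<Longrightarrow> open_in Z V \<Longrightarrow> V \<subseteq> U \<Longrightarrow> res Z U V \<in> ring_hom (sections Z U) (sections Z V)"
  using ringed by (simp add: is_ringed_space_def)

lemma res_trans: "open_in Z U \<Longrightarrow> open_in Z V \<Longrightarrow> open_in Z W \<Longrightarrow> W \<subseteq> V \<Longrightarrow> V \<subseteq> U \<Longrightarrow>
    s \<in> carrier (sections Z U) \<Longrightarrow> res Z V W (res Z U V s) = res Z U W s"
  by (rule ringed[unfolded is_ringed_space_def is_sheaf_def is_presheaf_def, THEN conjunct1, THEN conjunct1,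
      THEN conjunct2, THEN conjunct2, rule_format]) (intro conjI)

lemma glue:
  assumes "\<And>U. U \<in> \<U> \<Longrightarrow> open_in Z U \<and> s U \<in> carrier (sections Z U)"
    and "\<And>U V. U \<in> \<U> \<Longrightarrow> V \<in> \<U> \<Longrightarrow> res Z U (U \<inter> V) (s U) = res Z V (U \<inter> V) (s V)"
  shows "\<exists>!t. t \<in> carrier (sections Z (\<Union>\<U>)) \<and> (\<forall>U\<in>\<U>. res Z (\<Union>\<U>) U t = s U)"
  by (rule ringed[unfolded is_ringed_space_def is_sheaf_def, THEN conjunct1, THEN conjunct2, rule_format])
    (use assms in blast)

text \<open>Over a disjoint union of nonempty open sets, the pairs (1, 0) and (0, 1) glue to two
  nonzero sections with product zero, contrary to integrality.\<close>

lemma irreducible: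
  assumes U: "open_in Z U" "U \<noteq> {}" and V: "open_in Z V" "V \<noteq> {}"
  shows "U \<inter> V \<noteq> {}"
proof
  assume disj: "U \<inter> V = {}"
  then have UV: "U \<noteq> V" using U by blast
  let ?X = "U \<union> V"
  have X: "open_in Z ?X" using U V by blast
  have em: "open_in Z {}" by simp
  \<comment> \<open>Glueing the empty family shows that there is only one section over the empty
    set, so sections over disjoint sets agree on the overlap automatically.\<close>
  have single: "s = t" if "s \<in> carrier (sections Z {})" "t \<in> carrier (sections Z {})" for s t
    using glue[of "{}"] that by auto
  have glue2: "\<exists>!t. t \<in> carrier (sections Z ?X) \<and> res Z ?X U t = p \<and> res Z ?X V t = q"
    if "p \<in> carrier (sections Z U)" "q \<in> carrier (sections Z V)" for p q
  proof -
    let ?s = "\<lambda>Q. if Q = U then p else q"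
    have "\<exists>!t. t \<in> carrier (sections Z (\<Union>{U, V})) \<and> (\<forall>Q\<in>{U, V}. res Z (\<Union>{U, V}) Q t = ?s Q)"
    proof (rule glue)
      fix P Q assume PQ: "P \<in> {U, V}" "Q \<in> {U, V}"
      have "res Z U {} p = res Z V {} q"
        using single ring_hom_closed[OF res_hom[OF U(1) em] that(1)] ring_hom_closed[OF res_hom[OF V(1) em] that(2)] by simp
      then show "res Z P (P \<inter> Q) (?s P) = res Z Q (P \<inter> Q) (?s Q)"
        using PQ UV disj by (auto simp: Int_commute)
    qed (use that U V in auto)
    then show ?thesis using UV by simp
  qed
  interpret dU: domain "sections Z U" by (rule integral[OF U])
  interpret dV: domain "sections Z V" by (rule integral[OF V])
  interpret dX: domain "sections Z ?X" by (rule integral[OF X]) (use U in simp)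
  note rU = res_hom[OF X U(1) Un_upper1] and rV = res_hom[OF X V(1) Un_upper2]
  have zU: "res Z ?X U \<zero>\<^bsub>sections Z ?X\<^esub> = \<zero>\<^bsub>sections Z U\<^esub>" by (rule ring_hom_zero[OF rU dX.ring_axioms dU.ring_axioms])
  have zV: "res Z ?X V \<zero>\<^bsub>sections Z ?X\<^esub> = \<zero>\<^bsub>sections Z V\<^esub>" by (rule ring_hom_zero[OF rV dX.ring_axioms dV.ring_axioms])
  obtain e where e: "e \<in> carrier (sections Z ?X)" "res Z ?X U e = \<one>\<^bsub>sections Z U\<^esub>" "res Z ?X V e = \<zero>\<^bsub>sections Z V\<^esub>"
    using glue2[OF dU.one_closed dV.zero_closed] by blast
  obtain f where f: "f \<in> carrier (sections Z ?X)" "res Z ?X U f = \<zero>\<^bsub>sections Z U\<^esub>" "res Z ?X V f = \<one>\<^bsub>sections Z V\<^esub>"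
    using glue2[OF dU.zero_closed dV.one_closed] by blast
  have "res Z ?X U (e \<otimes>\<^bsub>sections Z ?X\<^esub> f) = \<zero>\<^bsub>sections Z U\<^esub>" "res Z ?X V (e \<otimes>\<^bsub>sections Z ?X\<^esub> f) = \<zero>\<^bsub>sections Z V\<^esub>"
    using ring_hom_mult[OF rU e(1) f(1)] ring_hom_mult[OF rV e(1) f(1)] by (simp_all add: e f)
  then have "e \<otimes>\<^bsub>sections Z ?X\<^esub> f = \<zero>\<^bsub>sections Z ?X\<^esub>"
    using glue2[OF dU.zero_closed dV.zero_closed] zU zV e(1) f(1) dX.m_closed dX.zero_closed by blast
  then have "e = \<zero>\<^bsub>sections Z ?X\<^esub> \<or> f = \<zero>\<^bsub>sections Z ?X\<^esub>" using dX.integral[OF _ e(1) f(1)] by blast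
  then show False using e(2) f(3) zU zV dU.one_not_zero dV.one_not_zero by auto
qed

end

locale integral_sheaf_complex = integral_space Z + sheaf_complex Z E \<delta>
  for Z :: "('p, 'a) ringed_space" and E :: "int \<Rightarrow> ('p, 'a, 'e) module_sheaf" and \<delta>
begin

lemma trivialized_basis:
  assumes t: "trivialized_on Z (E i) V n"
  shows "\<exists>b. module_basis (sections Z V) (msections (E i) V) n b \<and>
    (\<forall>V'. open_in Z V' \<and> V' \<subseteq> V \<longrightarrow> module_basis (sections Z V') (msections (E i) V') n (\<lambda>k. mres (E i) V V' (b k)))"
proof -
  have V: "open_in Z V" using t by (simp add: trivialized_on_def)
  obtain b where b: "\<forall>k<n. b k \<in> carrier (msections (E i) V)"
    "\<forall>V'. open_in Z V' \<and> V' \<subseteq> V \<longrightarrow> module_basis (sections Z V') (msections (E i) V') n (\<lambda>k. mres (E i) V V' (b k))"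
    using t unfolding trivialized_on_def by blast
  have "module_basis (sections Z V) (msections (E i) V) n (\<lambda>k. mres (E i) V V (b k))" using b(2) V by simp
  then have "module_basis (sections Z V) (msections (E i) V) n b"
    by (rule module_basis_cong[OF mod[OF V]]) (use b(1) mres_same[OF V] in simp)
  then show ?thesis using b(2) by blast
qed

lemma trivialized_on_subset:
  assumes t: "trivialized_on Z (E i) V n" and V': "open_in Z V'" "V' \<subseteq> V"
  shows "trivialized_on Z (E i) V' n"
proof -
  have V: "open_in Z V" using t by (simp add: trivialized_on_def)
  obtain b where b: "module_basis (sections Z V) (msections (E i) V) n b"
    "\<And>V'. open_in Z V' \<Longrightarrow> V' \<subseteq> V \<Longrightarrow> module_basis (sections Z V') (msections (E i) V') n (\<lambda>k. mres (E i) V V' (b k))"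
    using trivialized_basis[OF t] by blast
  have bc: "b k \<in> carrier (msections (E i) V)" if "k < n" for k using b(1) that by (simp add: module_basis_def)
  have "module_basis (sections Z Q) (msections (E i) Q) n (\<lambda>k. mres (E i) V' Q (mres (E i) V V' (b k)))"
    if Q: "open_in Z Q" "Q \<subseteq> V'" for Q
    by (rule module_basis_cong[OF mod[OF Q(1)] b(2)[OF Q(1) order.trans[OF Q(2) V'(2)]]])
      (use mres_trans[OF V V'(1) Q(1,2) V'(2) bc] in simp)
  moreover have "\<forall>k<n. mres (E i) V V' (b k) \<in> carrier (msections (E i) V')"
    using mres_closed[OF V V' bc] by simp
  ultimately show ?thesis unfolding trivialized_on_def using V'(1)
    by (intro conjI exI[of _ "\<lambda>k. mres (E i) V V' (b k)"]) auto
qed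

text \<open>Two nonempty trivializing open sets meet, and over the intersection both ranks are
  lengths of bases over a domain.\<close>

lemma trivialized_rank_unique:
  assumes t: "trivialized_on Z (E i) V n" "V \<noteq> {}" and t': "trivialized_on Z (E i) V' n'" "V' \<noteq> {}"
  shows "n = n'"
proof -
  have V: "open_in Z V" "open_in Z V'" using t t' by (auto simp: trivialized_on_def)
  let ?Q = "V \<inter> V'"
  have Q: "open_in Z ?Q" using V by (rule openin_Int)
  interpret d: domain "sections Z ?Q" by (rule integral[OF Q irreducible[OF V(1) t(2) V(2) t'(2)]])
  interpret r: comm_base_ring "sections Z ?Q" by (simp add: comm_base_ring_def d.is_cring)
  obtain b where b: "module_basis (sections Z ?Q) (msections (E i) ?Q) n b"
    using trivialized_basis[OF trivialized_on_subset[OF t(1) Q]] by blast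
  obtain c where c: "module_basis (sections Z ?Q) (msections (E i) ?Q) n' c"
    using trivialized_basis[OF trivialized_on_subset[OF t'(1) Q]] by blast
  show ?thesis
    using r.module_basis_length_le[OF mod[OF Q] b c] r.module_basis_length_le[OF mod[OF Q] c b] by simp
qed

lemma locally_trivial: "x \<in> points Z \<Longrightarrow> \<exists>V n. x \<in> V \<and> trivialized_on Z (E i) V n"
  using complex unfolding locally_free_complex_def locally_free_def by blast

lemma sheaf_rank_eq:
  assumes t: "trivialized_on Z (E i) V n" "V \<noteq> {}"
  shows "sheaf_rank Z (E i) = n"
  unfolding sheaf_rank_def
proof (rule the_equality)
  show "\<forall>x\<in>points Z. \<exists>V. x \<in> V \<and> trivialized_on Z (E i) V n"
    using locally_trivial trivialized_rank_unique[OF t] by blast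
  fix n' assume "\<forall>x\<in>points Z. \<exists>V. x \<in> V \<and> trivialized_on Z (E i) V n'"
  then show "n' = n" using nonempty trivialized_rank_unique[OF _ _ t] by blast
qed

lemma free_of_trivialized:
  assumes t: "trivialized_on Z (E i) V n"
  shows "free_finite_rank (sections Z V) (msections (E i) V)"
proof -
  have V: "open_in Z V" using t by (simp add: trivialized_on_def)
  obtain b where "module_basis (sections Z V) (msections (E i) V) n b" using trivialized_basis[OF t] by blast
  then show ?thesis unfolding free_finite_rank_def using mod[OF V] by blast
qed

lemma free_rank_eq:
  assumes t: "trivialized_on Z (E i) V n" "V \<noteq> {}"
  shows "free_rank (sections Z V) (msections (E i) V) = sheaf_rank Z (E i)"
proof -
  have V: "open_in Z V" using t by (simp add: trivialized_on_def)
  interpret d: domain "sections Z V" by (rule integral[OF V t(2)])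
  interpret r: comm_base_ring "sections Z V" by (simp add: comm_base_ring_def d.is_cring)
  obtain b where b: "module_basis (sections Z V) (msections (E i) V) n b" using trivialized_basis[OF t(1)] by blast
  obtain c \<gamma> where c: "module_basis (sections Z V) (msections (E i) V) (free_rank (sections Z V) (msections (E i) V)) c"
    by (rule r.free_dual_basis[OF free_of_trivialized[OF t(1)]])
  show ?thesis
    using r.module_basis_length_le[OF mod[OF V] b c] r.module_basis_length_le[OF mod[OF V] c b] sheaf_rank_eq[OF t] by simp
qed

lemma finitely_many_trivialized:
  assumes "finite J" "open_in Z U" "x \<in> U"
  shows "\<exists>V. open_in Z V \<and> x \<in> V \<and> V \<subseteq> U \<and> (\<forall>j\<in>J. \<exists>n. trivialized_on Z (E j) V n)"
  using assms(1)
proof (induction rule: finite_induct)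
  case (insert j J)
  then obtain V where V: "open_in Z V" "x \<in> V" "V \<subseteq> U" "\<forall>j\<in>J. \<exists>n. trivialized_on Z (E j) V n" by blast
  have "x \<in> points Z" using assms openin_subset by blast
  then obtain V' n where V': "x \<in> V'" "trivialized_on Z (E j) V' n" using locally_trivial by blast
  have o: "open_in Z V'" using V'(2) by (simp add: trivialized_on_def)
  have Q: "open_in Z (V \<inter> V')" using V(1) o by (rule openin_Int)
  have "\<exists>n. trivialized_on Z (E k) (V \<inter> V') n" if "k \<in> insert j J" for k
    using that V(4) V'(2) trivialized_on_subset[OF _ Q] by blast
  moreover have "x \<in> V \<inter> V'" "V \<inter> V' \<subseteq> U" using V V' by auto
  ultimately show ?case using Q by blast
qed (use assms in auto)

lemma mres_semilinear:
  assumes "open_in Z V" "open_in Z V'" "V' \<subseteq> V"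
  shows "mres (E i) V V' \<in> linear_maps (sections Z V) (msections (E i) V) (restrict_scalars (res Z V V') (msections (E i) V'))"
  by (rule linear_mapsI) (simp_all add: mres_closed[OF assms] mres_add[OF assms] mres_smult[OF assms])

text \<open>With bases over \<open>V\<close> that restrict to bases over \<open>V'\<close>, the
  determinants of submatrices restrict to determinants of submatrices. The elements of the larger
  ring whose restriction lies in the target ideal form an ideal, which therefore contains all that
  these determinants generate.\<close>

lemma minor_ideal_restrict:
  assumes t: "trivialized_on Z (E i) V p" "trivialized_on Z (E (i + 1)) V q"
    and V': "open_in Z V'" "V' \<subseteq> V"
    and s: "s \<in> minor_ideal (sections Z V) (msections (E i) V) (msections (E (i + 1)) V) (\<delta> i V) m"
  shows "res Z V V' s \<in> minor_ideal (sections Z V') (msections (E i) V') (msections (E (i + 1)) V') (\<delta> i V') m"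
proof -
  have V: "open_in Z V" using t by (simp add: trivialized_on_def)
  note t' = trivialized_on_subset[OF t(1) V'] trivialized_on_subset[OF t(2) V']
  let ?R = "sections Z V" and ?R' = "sections Z V'" and ?\<rho> = "res Z V V'"
  let ?M = "msections (E i) V" and ?N = "msections (E (i + 1)) V"
  let ?M' = "msections (E i) V'" and ?N' = "msections (E (i + 1)) V'"
  interpret R: comm_base_ring ?R by (simp add: comm_base_ring_def sections_cring V)
  interpret R': comm_base_ring ?R' by (simp add: comm_base_ring_def sections_cring V')
  note \<rho> = res_hom[OF V V']
  interpret h: ring_hom_cring ?R ?R' ?\<rho> using \<rho> by unfold_locales
  note eq = R.minor_ideal_eq_det_ideal[OF free_of_trivialized[OF t(1)] free_of_trivialized[OF t(2)] d_linear[OF V]]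
  note eq' = R'.minor_ideal_eq_det_ideal[OF free_of_trivialized[OF t'(1)] free_of_trivialized[OF t'(2)] d_linear[OF V'(1)]]
  let ?S = "\<delta> i V ` carrier ?M" and ?S' = "\<delta> i V' ` carrier ?M'"
  have S: "?S \<subseteq> carrier ?N" using linear_maps_closed[OF d_linear[OF V]] by blast
  have S': "?S' \<subseteq> carrier ?N'" using linear_maps_closed[OF d_linear[OF V'(1)]] by blast
  obtain b where b: "module_basis ?R ?M p b" and bV': "module_basis ?R' ?M' p (\<lambda>k. mres (E i) V V' (b k))"
    using trivialized_basis[OF t(1)] V' by blast
  obtain c where c: "module_basis ?R ?N q c" and cV': "module_basis ?R' ?N' q (\<lambda>k. mres (E (i + 1)) V V' (c k))"
    using trivialized_basis[OF t(2)] V' by blast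
  obtain \<beta> where \<beta>: "R.dual_basis ?M p b \<beta>" by (rule R.dual_basis_of_module_basis[OF mod[OF V] b])
  obtain \<gamma> where \<gamma>: "R.dual_basis ?N q c \<gamma>" by (rule R.dual_basis_of_module_basis[OF mod[OF V] c])
  obtain \<beta>' where \<beta>': "R'.dual_basis ?M' p (\<lambda>k. mres (E i) V V' (b k)) \<beta>'"
    by (rule R'.dual_basis_of_module_basis[OF mod[OF V'(1)] bV'])
  obtain \<gamma>' where \<gamma>': "R'.dual_basis ?N' q (\<lambda>k. mres (E (i + 1)) V V' (c k)) \<gamma>'"
    by (rule R'.dual_basis_of_module_basis[OF mod[OF V'(1)] cV'])
  have bc: "b k \<in> carrier ?M" if "k < p" for k by (rule R.dual_basis_mem[OF \<beta> that])
  \<comment> \<open>Taking coordinates commutes with restriction: after restriction of scalars both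
    sides are linear in \<open>y\<close>, and they agree on the basis.\<close>
  have coord: "?\<rho> (\<gamma> k y) = \<gamma>' k (mres (E (i + 1)) V V' y)" if k: "k < q" and y: "y \<in> carrier ?N" for k y
  proof (rule R.dual_basis_eqI[OF mod[OF V] module_restrict_scalars[OF R.is_cring \<rho> R'.module_self] \<gamma> _ _ _ y])
    show "(\<lambda>y. ?\<rho> (\<gamma> k y)) \<in> linear_maps ?R ?N (restrict_scalars ?\<rho> (self_module ?R'))"
      using R.dual_basis_functional[OF \<gamma> k]
      by (intro linear_mapsI) (simp_all add: R.functional_closed R.functional_add R.functional_smult)
    show "(\<lambda>y. \<gamma>' k (mres (E (i + 1)) V V' y)) \<in> linear_maps ?R ?N (restrict_scalars ?\<rho> (self_module ?R'))"
      using R'.dual_basis_functional[OF \<gamma>' k] unfolding R'.functionals_def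
      by (intro linear_maps_comp[OF mres_semilinear[OF V V'] linear_maps_restrict_scalars[OF \<rho>]])
    show "?\<rho> (\<gamma> k (c l)) = \<gamma>' k (mres (E (i + 1)) V V' (c l))" if "l < q" for l
      using R.dual_basis_dual[OF \<gamma> k that] R'.dual_basis_dual[OF \<gamma>' k that] by simp
  qed
  have "?\<rho> s \<in> R'.det_ideal ?N' ?S' m" if "0 < m"
  proof -
    let ?J = "{r \<in> carrier ?R. ?\<rho> r \<in> R'.det_ideal ?N' ?S' m}"
    interpret I: ideal "R'.det_ideal ?N' ?S' m" ?R' by (rule R'.det_ideal_ideal[OF S'])
    have J: "ideal ?J ?R"
    proof (rule idealI)
      show "subgroup ?J (add_monoid ?R)"
        by (rule R.add.subgroupI) (auto intro: I.zero_closed I.a_closed)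
    qed (auto intro: I.I_l_closed I.I_r_closed R.ring_axioms)
    let ?A = "\<lambda>k l. \<gamma> k (\<delta> i V (b l))"
    have Ac: "?A k l \<in> carrier ?R" if "k < q" "l < p" for k l
      by (rule R.functional_closed[OF R.dual_basis_functional[OF \<gamma> that(1)] linear_maps_closed[OF d_linear[OF V] bc[OF that(2)]]])
    have A': "?\<rho> (?A k l) = \<gamma>' k (\<delta> i V' (mres (E i) V V' (b l)))" if "k < q" "l < p" for k l
      using coord[OF that(1) linear_maps_closed[OF d_linear[OF V] bc[OF that(2)]]] d_res[OF V V' bc[OF that(2)]] by simp
    have "R.det_values ?N ?S (nat m) \<subseteq> ?J"
    proof (rule R.det_values_subset_ideal[OF mod[OF V] mod[OF V] d_linear[OF V] \<beta> \<gamma> J refl])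
      fix r d assume rd: "r \<in> {..<nat m} \<rightarrow> {..<q}" "d \<in> {..<nat m} \<rightarrow> {..<p}"
      have cl: "?A (r k) (d l) \<in> carrier ?R" if "k < nat m" "l < nat m" for k l
        by (rule Ac) (use rd that in auto)
      have "?\<rho> (ring_det ?R (nat m) (\<lambda>k l. ?A (r k) (d l))) = ring_det ?R' (nat m) (\<lambda>k l. ?\<rho> (?A (r k) (d l)))"
        by (rule ring_det_hom[OF R.is_cring R'.is_cring \<rho> cl])
      also have "\<dots> \<in> R'.det_values ?N' ?S' (nat m)"
        by (rule R'.submatrix_det_in_det_values[OF \<beta>' \<gamma>' d_linear[OF V'(1)] A' rd])
      also have "\<dots> \<subseteq> R'.det_ideal ?N' ?S' m"
        using R'.genideal_self[OF R'.det_values_closed[OF S']] that by (simp add: R'.det_ideal_def)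
      finally show "ring_det ?R (nat m) (\<lambda>k l. ?A (r k) (d l)) \<in> ?J"
        using R.ring_det_closed[of "nat m" "\<lambda>k l. ?A (r k) (d l)"] cl by simp
    qed
    then have "R.det_ideal ?N ?S m \<subseteq> ?J"
      using R.genideal_minimal[OF J] that by (simp add: R.det_ideal_def)
    then show ?thesis using s unfolding eq by blast
  qed
  moreover have "?\<rho> s \<in> R'.det_ideal ?N' ?S' m" if "\<not> 0 < m"
    using s that unfolding eq by (simp add: R.det_ideal_def R'.det_ideal_def)
  ultimately show ?thesis unfolding eq' by blast
qed

end

section \<open>Local contractions\<close>

context integral_sheaf_complex
begin

lemma mres_a_inv:
  assumes V: "open_in Z V" "open_in Z V'" "V' \<subseteq> V" and x: "x \<in> carrier (msections (E i) V)"
  shows "mres (E i) V V' (\<ominus>\<^bsub>msections (E i) V\<^esub> x) = \<ominus>\<^bsub>msections (E i) V'\<^esub> mres (E i) V V' x"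
  using linear_maps_a_inv[OF mod[OF V(1)] module_restrict_scalars[OF sections_cring[OF V(1)] res_hom[OF V] mod[OF V(2)]]
      mres_semilinear[OF V] x] by simp

lemma trivialized_dual_bases:
  assumes t: "trivialized_on Z (E i) V0 n" and V: "open_in Z V" "V \<subseteq> V0" and V': "open_in Z V'" "V' \<subseteq> V"
  shows "\<exists>b \<beta> \<beta>'. comm_base_ring.dual_basis (sections Z V) (msections (E i) V) n b \<beta> \<and>
    comm_base_ring.dual_basis (sections Z V') (msections (E i) V') n (\<lambda>k. mres (E i) V V' (b k)) \<beta>'"
proof -
  interpret R: comm_base_ring "sections Z V" by (simp add: comm_base_ring_def sections_cring V)
  interpret R': comm_base_ring "sections Z V'" by (simp add: comm_base_ring_def sections_cring V')
  obtain b where b: "module_basis (sections Z V) (msections (E i) V) n b"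
    "module_basis (sections Z V') (msections (E i) V') n (\<lambda>k. mres (E i) V V' (b k))"
    using trivialized_basis[OF trivialized_on_subset[OF t V]] V' by blast
  obtain \<beta> where \<beta>: "R.dual_basis (msections (E i) V) n b \<beta>"
    by (rule R.dual_basis_of_module_basis[OF mod[OF V(1)] b(1)])
  obtain \<beta>' where \<beta>': "R'.dual_basis (msections (E i) V') n (\<lambda>k. mres (E i) V V' (b k)) \<beta>'"
    by (rule R'.dual_basis_of_module_basis[OF mod[OF V'(1)] b(2)])
  show ?thesis using \<beta> \<beta>' by blast
qed

lemma sheaf_rank_trivial:
  assumes "\<And>U. open_in Z U \<Longrightarrow> carrier (msections (E j) U) = {\<zero>\<^bsub>msections (E j) U\<^esub>}"
  shows "sheaf_rank Z (E j) = 0"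
proof -
  obtain x where "x \<in> points Z" using nonempty by blast
  then obtain V n where V: "x \<in> V" "trivialized_on Z (E j) V n" using locally_trivial by blast
  then have o: "open_in Z V" by (simp add: trivialized_on_def)
  have "V \<noteq> {}" using V(1) by blast
  then show ?thesis using free_rank_eq[OF V(2)] free_rank_trivial[OF mod[OF o] assms[OF o]] by simp
qed

lemma cochain_chi_eq: "cochain_chi Z E i = alternating_sum (\<lambda>j. sheaf_rank Z (E (- j))) (- i)"
  unfolding cochain_chi_def alternating_sum_def
  by (rule sum.reindex_bij_witness[of _ uminus uminus]) (auto simp: algebra_simps)

end

lemma common_neighbourhood:
  assumes "finite T" and V: "openin \<T> V" "x \<in> V"
    and ex: "\<And>t. t \<in> T \<Longrightarrow> \<exists>V'. openin \<T> V' \<and> x \<in> V' \<and> V' \<subseteq> V \<and> P t V'"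
    and mono: "\<And>t V' V''. openin \<T> V' \<Longrightarrow> V' \<subseteq> V \<Longrightarrow> P t V' \<Longrightarrow> openin \<T> V'' \<Longrightarrow> V'' \<subseteq> V' \<Longrightarrow> P t V''"
  shows "\<exists>V'. openin \<T> V' \<and> x \<in> V' \<and> V' \<subseteq> V \<and> (\<forall>t\<in>T. P t V')"
  using assms(1) ex
proof (induction T rule: finite_induct)
  case (insert t T)
  obtain V1 where V1: "openin \<T> V1" "x \<in> V1" "V1 \<subseteq> V" "\<forall>t\<in>T. P t V1" using insert by auto
  obtain V2 where V2: "openin \<T> V2" "x \<in> V2" "V2 \<subseteq> V" "P t V2" using insert.prems[of t] by auto
  have o: "openin \<T> (V1 \<inter> V2)" using V1(1) V2(1) by (rule openin_Int)
  have "P s (V1 \<inter> V2)" if "s \<in> T" for s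
    by (rule mono[OF V1(1,3) _ o]) (use V1(4) that in auto)
  moreover have "P t (V1 \<inter> V2)" by (rule mono[OF V2(1,3,4) o]) simp
  ultimately show ?case using o V1 V2 by (intro exI[of _ "V1 \<inter> V2"]) auto
qed (use V in auto)

text \<open>The chain index \<open>m\<close> stands for the cochain degree \<open>B - m\<close>, and
  vanishing from \<open>B - 1\<close> on covers the indices 0 and 1. All terms of the stretch are
  trivialized on one set \<open>V0\<close>, so every open subset of \<open>V0\<close> carries a pair
  of complexes of free modules to which the module case applies.\<close>

locale local_complexes =
  E: integral_sheaf_complex Z E \<delta> + W: integral_sheaf_complex Z W \<delta>' + sheaf_quasi_iso Z E \<delta> W \<delta>' \<alpha>
  for Z :: "('p, 'a) ringed_space" and E :: "int \<Rightarrow> ('p, 'a, 'e) module_sheaf" and \<delta>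
    and W :: "int \<Rightarrow> ('p, 'a, 'w) module_sheaf" and \<delta>' and \<alpha> +
  fixes B :: int and L :: nat and V0 :: "'p set"
  assumes zero_E: "B - 1 \<le> j \<Longrightarrow> open_in Z U \<Longrightarrow> carrier (msections (E j) U) = {\<zero>\<^bsub>msections (E j) U\<^esub>}"
    and zero_W: "B - 1 \<le> j \<Longrightarrow> open_in Z U \<Longrightarrow> carrier (msections (W j) U) = {\<zero>\<^bsub>msections (W j) U\<^esub>}"
    and trivial_E: "m \<le> Suc L \<Longrightarrow> \<exists>n. trivialized_on Z (E (B - int m)) V0 n"
    and trivial_W: "m \<le> Suc L \<Longrightarrow> \<exists>n. trivialized_on Z (W (B - int m)) V0 n"
begin

abbreviation "FE V m \<equiv> msections (E (B - int m)) V"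
abbreviation "FW V m \<equiv> msections (W (B - int m)) V"
abbreviation "dE V m \<equiv> \<delta> (B - int (Suc m)) V"
abbreviation "dW V m \<equiv> \<delta>' (B - int (Suc m)) V"
abbreviation "aV V m \<equiv> \<alpha> (B - int m) V"
abbreviation "coneV V \<equiv> complex_map.cone (FE V) (FW V)"
abbreviation "cone_dV V \<equiv> complex_map.cone_d (FE V) (dE V) (FW V) (dW V) (aV V)"
abbreviation "contractionV V \<equiv> complex_map.contraction (sections Z V) (FE V) (dE V) (FW V) (dW V) (aV V)"

text \<open>Normal form of the shifted degrees. Simplification of \<open>int (Suc m)\<close> is
  disabled next, so that the terms keep the shape that these equations rewrite.\<close>

lemma index: "B - int (Suc m) + 1 = B - int m" "B - int (Suc (Suc m)) + 2 = B - int m"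
  "B - int (Suc m) - 1 = B - int (Suc (Suc m))"
  by auto

declare of_nat_Suc [simp del]

lemma complex_map_at:
  assumes V: "open_in Z V" "V \<subseteq> V0"
  shows "complex_map (sections Z V) (FE V) (dE V) (FW V) (dW V) (aV V) L"
proof -
  interpret comm_base_ring "sections Z V" by (simp add: comm_base_ring_def E.sections_cring V)
  show ?thesis
  proof unfold_locales
    fix n
    show "free_finite_rank (sections Z V) (FE V n)" if "n \<le> Suc L"
      using trivial_E[OF that] E.free_of_trivialized[OF E.trivialized_on_subset[OF _ V]] by blast
    show "free_finite_rank (sections Z V) (FW V n)" if "n \<le> Suc L"
      using trivial_W[OF that] W.free_of_trivialized[OF W.trivialized_on_subset[OF _ V]] by blast
    show "dE V n \<in> linear_maps (sections Z V) (FE V (Suc n)) (FE V n)"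
      using E.d_linear[OF V(1), of "B - int (Suc n)"] unfolding index .
    show "dW V n \<in> linear_maps (sections Z V) (FW V (Suc n)) (FW V n)"
      using W.d_linear[OF V(1), of "B - int (Suc n)"] unfolding index .
    show "aV V n \<in> linear_maps (sections Z V) (FE V n) (FW V n)" by (rule a_linear[OF V(1)])
    show "dE V n (dE V (Suc n) x) = \<zero>\<^bsub>FE V n\<^esub>" if "x \<in> carrier (FE V (Suc (Suc n)))" for x
      using E.dd[OF V(1) that] unfolding index .
    show "dW V n (dW V (Suc n) y) = \<zero>\<^bsub>FW V n\<^esub>" if "y \<in> carrier (FW V (Suc (Suc n)))" for y
      using W.dd[OF V(1) that] unfolding index .
    show "aV V n (dE V n x) = dW V n (aV V (Suc n) x)" if "x \<in> carrier (FE V (Suc n))" for x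
      using a_d[OF V(1) that] unfolding index .
  qed (use zero_E[OF _ V(1)] zero_W[OF _ V(1)] in \<open>auto simp: of_nat_Suc\<close>)
qed

definition cone_res :: "'p set \<Rightarrow> 'p set \<Rightarrow> nat \<Rightarrow> 'e \<times> 'w \<Rightarrow> 'e \<times> 'w" where
  "cone_res V V' m z = (mres (E (B - int m)) V V' (fst z), mres (W (B - int (Suc m))) V V' (snd z))"

context
  fixes V V' assumes V: "open_in Z V" "V \<subseteq> V0" and V': "open_in Z V'" "V' \<subseteq> V"
begin

interpretation c: complex_map "sections Z V" "FE V" "dE V" "FW V" "dW V" "aV V" L
  by (rule complex_map_at[OF V])

interpretation c': complex_map "sections Z V'" "FE V'" "dE V'" "FW V'" "dW V'" "aV V'" L
  by (rule complex_map_at[OF V'(1) order.trans[OF V'(2) V(2)]])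

lemma cone_res_linear:
  "cone_res V V' m \<in> linear_maps (sections Z V) (coneV V m) (restrict_scalars (res Z V V') (coneV V' m))"
  by (rule linear_mapsI)
    (auto simp: cone_res_def c.cone_def c'.cone_def E.mres_closed[OF V(1) V'] W.mres_closed[OF V(1) V']
      E.mres_add[OF V(1) V'] W.mres_add[OF V(1) V'] E.mres_smult[OF V(1) V'] W.mres_smult[OF V(1) V'])

lemma cone_res_closed: "z \<in> carrier (coneV V m) \<Longrightarrow> cone_res V V' m z \<in> carrier (coneV V' m)"
  using linear_maps_closed[OF cone_res_linear] by fastforce

lemma cone_res_add: "y \<in> carrier (coneV V m) \<Longrightarrow> z \<in> carrier (coneV V m) \<Longrightarrow>
    cone_res V V' m (y \<oplus>\<^bsub>coneV V m\<^esub> z) = cone_res V V' m y \<oplus>\<^bsub>coneV V' m\<^esub> cone_res V V' m z"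
  using linear_maps_add[OF cone_res_linear] by fastforce

lemma cone_res_a_inv: "m \<le> L \<Longrightarrow> z \<in> carrier (coneV V m) \<Longrightarrow>
    cone_res V V' m (\<ominus>\<^bsub>coneV V m\<^esub> z) = \<ominus>\<^bsub>coneV V' m\<^esub> cone_res V V' m z"
  using linear_maps_a_inv[OF c.cone_mod module_restrict_scalars[OF c.is_cring E.res_hom[OF V(1) V'] c'.cone_mod] cone_res_linear]
  by simp

lemma cone_res_zero: "cone_res V V' m \<zero>\<^bsub>coneV V m\<^esub> = \<zero>\<^bsub>coneV V' m\<^esub>"
  by (simp add: cone_res_def c.cone_def c'.cone_def E.mres_zero[OF V(1) V'] W.mres_zero[OF V(1) V'])

lemma cone_res_d:
  assumes m: "m < L" and z: "z \<in> carrier (coneV V (Suc m))"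
  shows "cone_dV V' m (cone_res V V' (Suc m) z) = cone_res V V' m (cone_dV V m z)"
proof -
  obtain y w where yw: "z = (y, w)" "y \<in> carrier (FE V (Suc m))" "w \<in> carrier (FW V (Suc (Suc m)))"
    using z by (auto simp: c.carrier_cone)
  have dy: "dE V m y \<in> carrier (FE V m)" by (rule linear_maps_closed[OF c.d yw(2)]) (use m in simp)
  have ay: "aV V (Suc m) y \<in> carrier (FW V (Suc m))" by (rule linear_maps_closed[OF c.a yw(2)]) (use m in simp)
  have dw: "dW V (Suc m) w \<in> carrier (FW V (Suc m))" by (rule linear_maps_closed[OF c.d' yw(3)]) (use m in simp)
  have 1: "dE V' m (mres (E (B - int (Suc m))) V V' y) = mres (E (B - int m)) V V' (dE V m y)"
    using E.d_res[OF V(1) V' yw(2)] unfolding index .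
  have 2: "dW V' (Suc m) (mres (W (B - int (Suc (Suc m)))) V V' w) = mres (W (B - int (Suc m))) V V' (dW V (Suc m) w)"
    using W.d_res[OF V(1) V' yw(3)] unfolding index .
  show ?thesis
    unfolding c.cone_d_def c'.cone_d_def cone_res_def yw(1) fst_conv snd_conv 1 2 a_res[OF V(1) V' yw(2)]
      E.mres_a_inv[OF V(1) V' dy] W.mres_add[OF V(1) V' ay dw] ..
qed

text \<open>Sections over \<open>V'\<close> need not extend to \<open>V\<close>, so the maps cannot
  be restricted pointwise. They are prescribed on the restricted bases; the homotopy identity
  carries over to restricted sections, in particular to a basis over \<open>V'\<close>, and from
  there to everything by linearity.\<close>

lemma contraction_restrict:
  assumes S: "contractionV V S n" and n: "n \<le> L"
  shows "\<exists>S'. contractionV V' S' n \<and>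
    (\<forall>m<n. \<forall>z\<in>carrier (coneV V m). S' m (cone_res V V' m z) = cone_res V V' (Suc m) (S m z))"
proof -
  note \<rho> = E.res_hom[OF V(1) V']
  \<comment> \<open>A trivialization over \<open>V0\<close> gives bases over \<open>V\<close> whose
    restrictions are bases over \<open>V'\<close>; unrelated bases over the two sets would be of no
    use here.\<close>
  have gens: "\<exists>p b \<beta> \<beta>' q c \<gamma> \<gamma>'. c.dual_basis (FE V m) p b \<beta> \<and>
      c'.dual_basis (FE V' m) p (\<lambda>k. mres (E (B - int m)) V V' (b k)) \<beta>' \<and>
      c.dual_basis (FW V (Suc m)) q c \<gamma> \<and>
      c'.dual_basis (FW V' (Suc m)) q (\<lambda>k. mres (W (B - int (Suc m))) V V' (c k)) \<gamma>'"
    if m: "m \<le> L" for m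
  proof -
    obtain p where "trivialized_on Z (E (B - int m)) V0 p" using trivial_E[of m] m by auto
    from E.trivialized_dual_bases[OF this V V']
    obtain b \<beta> \<beta>' where 1: "c.dual_basis (FE V m) p b \<beta>"
      "c'.dual_basis (FE V' m) p (\<lambda>k. mres (E (B - int m)) V V' (b k)) \<beta>'" by blast
    obtain q where "trivialized_on Z (W (B - int (Suc m))) V0 q" using trivial_W[of "Suc m"] m by auto
    from W.trivialized_dual_bases[OF this V V']
    obtain c \<gamma> \<gamma>' where 2: "c.dual_basis (FW V (Suc m)) q c \<gamma>"
      "c'.dual_basis (FW V' (Suc m)) q (\<lambda>k. mres (W (B - int (Suc m))) V V' (c k)) \<gamma>'" by blast
    show ?thesis using 1 2 by blast
  qed
  have gen1: "(mres (E (B - int m)) V V' y, \<zero>\<^bsub>FW V' (Suc m)\<^esub>) = cone_res V V' m (y, \<zero>\<^bsub>FW V (Suc m)\<^esub>)" for m y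
    by (simp only: cone_res_def fst_conv snd_conv W.mres_zero[OF V(1) V'])
  have gen2: "(\<zero>\<^bsub>FE V' m\<^esub>, mres (W (B - int (Suc m))) V V' y) = cone_res V V' m (\<zero>\<^bsub>FE V m\<^esub>, y)" for m y
    by (simp only: cone_res_def fst_conv snd_conv E.mres_zero[OF V(1) V'])
  have mods: "module (sections Z V) (FE V m)" "module (sections Z V) (FW V m)"
    "module (sections Z V') (FE V' m)" "module (sections Z V') (FW V' m)" for m
    using V V' by (auto intro: E.mod W.mod)
  have zeros: "\<zero>\<^bsub>FE V m\<^esub> \<in> carrier (FE V m)" "\<zero>\<^bsub>FW V m\<^esub> \<in> carrier (FW V m)" for m
  proof -
    interpret M: module "sections Z V" "FE V m" by (rule mods)
    interpret N: module "sections Z V" "FW V m" by (rule mods)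
    show "\<zero>\<^bsub>FE V m\<^esub> \<in> carrier (FE V m)" "\<zero>\<^bsub>FW V m\<^esub> \<in> carrier (FW V m)" by (rule M.zero_closed, rule N.zero_closed)
  qed
  have ex: "\<exists>T. T \<in> linear_maps (sections Z V') (coneV V' m) (coneV V' (Suc m)) \<and>
      (\<forall>z\<in>carrier (coneV V m). T (cone_res V V' m z) = cone_res V V' (Suc m) (S m z))" if m: "m < n" for m
  proof -
    have mL: "m \<le> L" "Suc m \<le> L" using m n by auto
    have Sm: "S m \<in> linear_maps (sections Z V) (coneV V m) (coneV V (Suc m))" using S m by (simp add: c.contraction_def)
    obtain p b \<beta> \<beta>' q c \<gamma> \<gamma>' where b: "c.dual_basis (FE V m) p b \<beta>"
      and b': "c'.dual_basis (FE V' m) p (\<lambda>k. mres (E (B - int m)) V V' (b k)) \<beta>'"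
      and c: "c.dual_basis (FW V (Suc m)) q c \<gamma>"
      and c': "c'.dual_basis (FW V' (Suc m)) q (\<lambda>k. mres (W (B - int (Suc m))) V V' (c k)) \<gamma>'"
      using gens[OF mL(1)] by blast
    have bc: "(b k, \<zero>\<^bsub>FW V (Suc m)\<^esub>) \<in> carrier (coneV V m)" if "k < p" for k
      using c.dual_basis_mem[OF b that] zeros by (simp add: c.carrier_cone)
    have cc: "(\<zero>\<^bsub>FE V m\<^esub>, c k) \<in> carrier (coneV V m)" if "k < q" for k
      using c.dual_basis_mem[OF c that] zeros by (simp add: c.carrier_cone)
    define u where "u k = cone_res V V' (Suc m) (S m (b k, \<zero>\<^bsub>FW V (Suc m)\<^esub>))" for k
    define v where "v k = cone_res V V' (Suc m) (S m (\<zero>\<^bsub>FE V m\<^esub>, c k))" for k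
    have u: "u k \<in> carrier (coneV V' (Suc m))" if "k < p" for k
      unfolding u_def by (rule cone_res_closed[OF linear_maps_closed[OF Sm bc[OF that]]])
    have v: "v k \<in> carrier (coneV V' (Suc m))" if "k < q" for k
      unfolding v_def by (rule cone_res_closed[OF linear_maps_closed[OF Sm cc[OF that]]])
    obtain T where T: "T \<in> linear_maps (sections Z V') (prod_module (FE V' m) (FW V' (Suc m))) (coneV V' (Suc m))"
      "\<And>k. k < p \<Longrightarrow> T (mres (E (B - int m)) V V' (b k), \<zero>\<^bsub>FW V' (Suc m)\<^esub>) = u k"
      "\<And>k. k < q \<Longrightarrow> T (\<zero>\<^bsub>FE V' m\<^esub>, mres (W (B - int (Suc m))) V V' (c k)) = v k"
      using c'.prod_dual_basis_extension[OF mods(3,4) c'.cone_mod[OF mL(2)] b' c', of u v] u v by blast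
    have T1: "T \<in> linear_maps (sections Z V') (coneV V' m) (coneV V' (Suc m))" using T(1) by (simp only: c'.cone_def)
    have l1: "(\<lambda>z. T (cone_res V V' m z)) \<in> linear_maps (sections Z V) (prod_module (FE V m) (FW V (Suc m)))
        (restrict_scalars (res Z V V') (coneV V' (Suc m)))"
      unfolding c.cone_def[symmetric]
      by (rule linear_maps_comp[OF cone_res_linear linear_maps_restrict_scalars[OF \<rho> T1]])
    have l2: "(\<lambda>z. cone_res V V' (Suc m) (S m z)) \<in> linear_maps (sections Z V) (prod_module (FE V m) (FW V (Suc m)))
        (restrict_scalars (res Z V V') (coneV V' (Suc m)))"
      unfolding c.cone_def[symmetric] by (rule linear_maps_comp[OF Sm cone_res_linear])
    have "T (cone_res V V' m z) = cone_res V V' (Suc m) (S m z)" if z: "z \<in> carrier (coneV V m)" for z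
    proof (rule c.prod_dual_basis_eqI[OF mods(1,2)
        module_restrict_scalars[OF c.is_cring \<rho> c'.cone_mod[OF mL(2)]] b c l1 l2])
      show "T (cone_res V V' m (b k, \<zero>\<^bsub>FW V (Suc m)\<^esub>)) = cone_res V V' (Suc m) (S m (b k, \<zero>\<^bsub>FW V (Suc m)\<^esub>))" if "k < p" for k
        using T(2)[OF that] unfolding gen1 u_def .
      show "T (cone_res V V' m (\<zero>\<^bsub>FE V m\<^esub>, c k)) = cone_res V V' (Suc m) (S m (\<zero>\<^bsub>FE V m\<^esub>, c k))" if "k < q" for k
        using T(3)[OF that] unfolding gen2 v_def .
      show "z \<in> carrier (prod_module (FE V m) (FW V (Suc m)))" using z unfolding c.cone_def .
    qed
    with T1 show ?thesis by blast
  qed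
  have "\<forall>m. \<exists>T. m < n \<longrightarrow> T \<in> linear_maps (sections Z V') (coneV V' m) (coneV V' (Suc m)) \<and>
      (\<forall>z\<in>carrier (coneV V m). T (cone_res V V' m z) = cone_res V V' (Suc m) (S m z))" using ex by blast
  from choice[OF this] obtain S' where S': "\<And>m. m < n \<Longrightarrow> S' m \<in> linear_maps (sections Z V') (coneV V' m) (coneV V' (Suc m))"
    and comm: "\<And>m z. m < n \<Longrightarrow> z \<in> carrier (coneV V m) \<Longrightarrow> S' m (cone_res V V' m z) = cone_res V V' (Suc m) (S m z)"
    by blast
  have "cone_dV V' (Suc m) (S' (Suc m) x) \<oplus>\<^bsub>coneV V' (Suc m)\<^esub> S' m (cone_dV V' m x) = x"
    if m: "Suc m < n" and x: "x \<in> carrier (coneV V' (Suc m))" for m x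
  proof -
    have mL: "Suc m \<le> L" "Suc m < L" "m < L" "m < n" using m n by auto
    have Sm: "S m \<in> linear_maps (sections Z V) (coneV V m) (coneV V (Suc m))"
      and Ss: "S (Suc m) \<in> linear_maps (sections Z V) (coneV V (Suc m)) (coneV V (Suc (Suc m)))"
      using S m by (auto simp: c.contraction_def)
    obtain p b \<beta> \<beta>' q c \<gamma> \<gamma>' where b: "c.dual_basis (FE V (Suc m)) p b \<beta>"
      and b': "c'.dual_basis (FE V' (Suc m)) p (\<lambda>k. mres (E (B - int (Suc m))) V V' (b k)) \<beta>'"
      and c: "c.dual_basis (FW V (Suc (Suc m))) q c \<gamma>"
      and c': "c'.dual_basis (FW V' (Suc (Suc m))) q (\<lambda>k. mres (W (B - int (Suc (Suc m)))) V V' (c k)) \<gamma>'"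
      using gens[OF mL(1)] by blast
    \<comment> \<open>On a restricted section the identity is the restriction of the identity over
      \<open>V\<close>, since both the maps \<open>S'\<close> and the cone differentials commute
      with restriction.\<close>
    have main: "cone_dV V' (Suc m) (S' (Suc m) (cone_res V V' (Suc m) t)) \<oplus>\<^bsub>coneV V' (Suc m)\<^esub>
        S' m (cone_dV V' m (cone_res V V' (Suc m) t)) = cone_res V V' (Suc m) t"
      if t: "t \<in> carrier (coneV V (Suc m))" for t
    proof -
      have Dt: "cone_dV V m t \<in> carrier (coneV V m)" by (rule linear_maps_closed[OF c.cone_d_linear[OF mL(3)] t])
      have St: "S (Suc m) t \<in> carrier (coneV V (Suc (Suc m)))" by (rule linear_maps_closed[OF Ss t])
      have DSt: "cone_dV V (Suc m) (S (Suc m) t) \<in> carrier (coneV V (Suc m))"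
        by (rule linear_maps_closed[OF c.cone_d_linear[OF mL(2)] St])
      have SDt: "S m (cone_dV V m t) \<in> carrier (coneV V (Suc m))" by (rule linear_maps_closed[OF Sm Dt])
      have "cone_dV V (Suc m) (S (Suc m) t) \<oplus>\<^bsub>coneV V (Suc m)\<^esub> S m (cone_dV V m t) = t"
        using S m t by (simp add: c.contraction_def)
      then show ?thesis
        unfolding comm[OF m t] cone_res_d[OF mL(3) t] comm[OF mL(4) Dt] cone_res_d[OF mL(2) St]
          cone_res_add[OF DSt SDt, symmetric] by (rule arg_cong)
    qed
    have bc: "(b k, \<zero>\<^bsub>FW V (Suc (Suc m))\<^esub>) \<in> carrier (coneV V (Suc m))" if "k < p" for k
      using c.dual_basis_mem[OF b that] zeros by (simp add: c.carrier_cone)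
    have cc: "(\<zero>\<^bsub>FE V (Suc m)\<^esub>, c k) \<in> carrier (coneV V (Suc m))" if "k < q" for k
      using c.dual_basis_mem[OF c that] zeros by (simp add: c.carrier_cone)
    have l1: "(\<lambda>x. cone_dV V' (Suc m) (S' (Suc m) x) \<oplus>\<^bsub>coneV V' (Suc m)\<^esub> S' m (cone_dV V' m x)) \<in>
        linear_maps (sections Z V') (prod_module (FE V' (Suc m)) (FW V' (Suc (Suc m)))) (coneV V' (Suc m))"
      unfolding c'.cone_def[of "Suc m", symmetric]
      by (rule linear_maps_plus[OF c'.cone_mod[OF mL(1)] linear_maps_comp[OF S'[OF m] c'.cone_d_linear[OF mL(2)]]
          linear_maps_comp[OF c'.cone_d_linear[OF mL(3)] S'[OF mL(4)]]])
    have l2: "(\<lambda>x. x) \<in> linear_maps (sections Z V') (prod_module (FE V' (Suc m)) (FW V' (Suc (Suc m)))) (coneV V' (Suc m))"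
      unfolding c'.cone_def by (rule linear_maps_id)
    show ?thesis
    proof (rule c'.prod_dual_basis_eqI[OF mods(3,4) c'.cone_mod[OF mL(1)] b' c' l1 l2])
      show "x \<in> carrier (prod_module (FE V' (Suc m)) (FW V' (Suc (Suc m))))" using x unfolding c'.cone_def .
    qed (use main[OF bc] main[OF cc] in \<open>simp_all only: gen1 gen2\<close>)
  qed
  then have "contractionV V' S' n" unfolding c'.contraction_def using S' by blast
  with comm show ?thesis by blast
qed

end

lemma cone_res_trans:
  assumes "open_in Z V" "V \<subseteq> V0" "open_in Z V1" "V1 \<subseteq> V" "open_in Z V2" "V2 \<subseteq> V1" "z \<in> carrier (coneV V m)"
  shows "cone_res V1 V2 m (cone_res V V1 m z) = cone_res V V2 m z"
proof -
  interpret c: complex_map "sections Z V" "FE V" "dE V" "FW V" "dW V" "aV V" L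
    by (rule complex_map_at[OF assms(1,2)])
  show ?thesis
    using assms(7) E.mres_trans[OF assms(1,3,5,6,4)] W.mres_trans[OF assms(1,3,5,6,4)]
    by (auto simp: cone_res_def c.carrier_cone)
qed

text \<open>The argument for modules with two shrinkings: \<open>V1\<close> is where
  \<open>x\<close>-injectivity of cohomology classes yields a primitive of the first component,
  \<open>V2\<close> is where surjectivity represents the corrected second component.\<close>

lemma cone_locally_exact:
  assumes V: "open_in Z V" "V \<subseteq> V0" "x \<in> V" and m: "Suc m < L"
    and z: "z \<in> carrier (coneV V (Suc m))" "cone_dV V m z = \<zero>\<^bsub>coneV V m\<^esub>"
  shows "\<exists>V'. open_in Z V' \<and> x \<in> V' \<and> V' \<subseteq> V \<and>
    (\<exists>w\<in>carrier (coneV V' (Suc (Suc m))). cone_dV V' (Suc m) w = cone_res V V' (Suc m) z)"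
proof -
  have mL: "m < L" using m by simp
  let ?i = "B - int (Suc m)" and ?j = "B - int (Suc (Suc m))" and ?k = "B - int (Suc (Suc (Suc m)))"
  interpret c: complex_map "sections Z V" "FE V" "dE V" "FW V" "dW V" "aV V" L by (rule complex_map_at[OF V(1,2)])
  obtain y t where yt: "z = (y, t)" "y \<in> carrier (FE V (Suc m))" "t \<in> carrier (FW V (Suc (Suc m)))"
    using z(1) by (auto simp: c.carrier_cone)
  note zd = c.cone_d_eq_zeroD[OF mL yt(2,3) z(2)[unfolded yt(1)]]
  interpret GV: module "sections Z V" "FW V (Suc (Suc m))" by (rule W.mod[OF V(1)])
  have "y \<in> E.cocycles ?i V" using yt(2) zd(1) unfolding E.cocycles_def index by simp
  moreover have "aV V (Suc m) y \<in> coboundaries W \<delta>' ?i V"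
    unfolding coboundaries_def index zd(2) by (rule imageI, rule GV.a_inv_closed[OF yt(3)])
  ultimately obtain V1 where V1: "open_in Z V1" "x \<in> V1" "V1 \<subseteq> V"
    "mres (E ?i) V V1 y \<in> coboundaries E \<delta> ?i V1" using local_injective[OF V(1,3)] by blast
  have V10: "V1 \<subseteq> V0" using V1(3) V(2) by blast
  interpret c1: complex_map "sections Z V1" "FE V1" "dE V1" "FW V1" "dW V1" "aV V1" L by (rule complex_map_at[OF V1(1) V10])
  obtain w where w: "w \<in> carrier (FE V1 (Suc (Suc m)))" "dE V1 (Suc m) w = mres (E ?i) V V1 y"
    using V1(4) unfolding coboundaries_def index by (metis imageE)
  let ?y1 = "mres (E ?i) V V1 y" and ?t1 = "mres (W ?j) V V1 t"
  have yt1: "?y1 \<in> carrier (FE V1 (Suc m))" "?t1 \<in> carrier (FW V1 (Suc (Suc m)))"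
    using E.mres_closed[OF V(1) V1(1,3) yt(2)] W.mres_closed[OF V(1) V1(1,3) yt(3)] by auto
  \<comment> \<open>The restricted pair is again a cone cycle, so the corrected second component is
    seen to be a cocycle over \<open>V1\<close>.\<close>
  have "cone_dV V1 m (?y1, ?t1) = \<zero>\<^bsub>coneV V1 m\<^esub>"
    using cone_res_d[OF V(1,2) V1(1,3) mL z(1)] cone_res_zero[OF V(1,2) V1(1,3), of m] z(2)
    by (simp add: cone_res_def yt(1))
  note cyc = c1.cone_d_eq_zeroD(3)[OF mL yt1 this w]
  interpret G1: module "sections Z V1" "FW V1 (Suc (Suc m))" by (rule W.mod[OF V1(1)])
  have aw: "aV V1 (Suc (Suc m)) w \<in> carrier (FW V1 (Suc (Suc m)))" by (rule linear_maps_closed[OF a_linear[OF V1(1)] w(1)])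
  have "?t1 \<oplus>\<^bsub>FW V1 (Suc (Suc m))\<^esub> aV V1 (Suc (Suc m)) w \<in> W.cocycles ?j V1"
    unfolding W.cocycles_def index using cyc G1.a_closed[OF yt1(2) aw] by simp
  from local_surjective[OF V1(1,2) this]
  obtain V2 u v where V2: "open_in Z V2" "x \<in> V2" "V2 \<subseteq> V1" and u: "u \<in> E.cocycles ?j V2"
    and v: "v \<in> carrier (FW V2 (Suc (Suc (Suc m))))"
    and eq: "mres (W ?j) V1 V2 (?t1 \<oplus>\<^bsub>FW V1 (Suc (Suc m))\<^esub> aV V1 (Suc (Suc m)) w) =
      aV V2 (Suc (Suc m)) u \<oplus>\<^bsub>FW V2 (Suc (Suc m))\<^esub> dW V2 (Suc (Suc m)) v"
    unfolding index by blast
  have V20: "V2 \<subseteq> V0" and V2V: "V2 \<subseteq> V" using V2(3) V10 V1(3) by auto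
  interpret c2: complex_map "sections Z V2" "FE V2" "dE V2" "FW V2" "dW V2" "aV V2" L by (rule complex_map_at[OF V2(1) V20])
  have u': "u \<in> carrier (FE V2 (Suc (Suc m)))" "dE V2 (Suc m) u = \<zero>\<^bsub>FE V2 (Suc m)\<^esub>"
    using u unfolding E.cocycles_def index by auto
  let ?w2 = "mres (E ?j) V1 V2 w"
  have w2: "?w2 \<in> carrier (FE V2 (Suc (Suc m)))" by (rule E.mres_closed[OF V1(1) V2(1,3) w(1)])
  have dw2: "dE V2 (Suc m) ?w2 = mres (E ?i) V V2 y"
    using E.d_res[OF V1(1) V2(1,3) w(1)] E.mres_trans[OF V(1) V1(1) V2(1,3) V1(3) yt(2)] unfolding index w(2) by simp
  have t2: "mres (W ?j) V V2 t \<in> carrier (FW V2 (Suc (Suc m)))" by (rule W.mres_closed[OF V(1) V2(1) V2V yt(3)])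
  have "mres (W ?j) V V2 t \<oplus>\<^bsub>FW V2 (Suc (Suc m))\<^esub> aV V2 (Suc (Suc m)) ?w2 =
      aV V2 (Suc (Suc m)) u \<oplus>\<^bsub>FW V2 (Suc (Suc m))\<^esub> dW V2 (Suc (Suc m)) v"
    using eq unfolding W.mres_add[OF V1(1) V2(1,3) yt1(2) aw] a_res[OF V1(1) V2(1,3) w(1)]
      W.mres_trans[OF V(1) V1(1) V2(1,3) V1(3) yt(3)] .
  from c2.cone_d_eqI[OF m t2 w2 dw2 u' v this]
  show ?thesis using V2(1,2) V2V by (intro exI[of _ V2]) (simp add: cone_res_def yt(1))
qed

text \<open>The defects of the basis elements bound on neighbourhoods that depend on the element; on
  a common one the lower part of the contraction is restricted before the next map is
  chosen.\<close>

lemma contraction_locally_extends: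
  assumes V: "open_in Z V" "V \<subseteq> V0" "x \<in> V" and m: "Suc m < L" and S: "contractionV V S (Suc m)"
  shows "\<exists>V' S'. open_in Z V' \<and> x \<in> V' \<and> V' \<subseteq> V \<and> contractionV V' S' (Suc (Suc m))"
proof -
  have mL: "m < L" "Suc m \<le> L" "Suc (Suc m) \<le> Suc L" using m by auto
  let ?C = "coneV V (Suc m)"
  interpret c: complex_map "sections Z V" "FE V" "dE V" "FW V" "dW V" "aV V" L by (rule complex_map_at[OF V(1,2)])
  interpret C: module "sections Z V" ?C by (rule c.cone_mod[OF mL(2)])
  interpret M: module "sections Z V" "FE V (Suc m)" by (rule E.mod[OF V(1)])
  interpret N: module "sections Z V" "FW V (Suc (Suc m))" by (rule W.mod[OF V(1)])
  obtain p where p: "trivialized_on Z (E (B - int (Suc m))) V0 p" using trivial_E[of "Suc m"] mL by auto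
  obtain q where q: "trivialized_on Z (W (B - int (Suc (Suc m)))) V0 q" using trivial_W[OF mL(3)] by blast
  obtain b where b: "module_basis (sections Z V) (FE V (Suc m)) p b"
    "\<forall>V'. open_in Z V' \<and> V' \<subseteq> V \<longrightarrow> module_basis (sections Z V') (FE V' (Suc m)) p (\<lambda>k. mres (E (B - int (Suc m))) V V' (b k))"
    using E.trivialized_basis[OF E.trivialized_on_subset[OF p V(1,2)]] by blast
  obtain c where c: "module_basis (sections Z V) (FW V (Suc (Suc m))) q c"
    "\<forall>V'. open_in Z V' \<and> V' \<subseteq> V \<longrightarrow> module_basis (sections Z V') (FW V' (Suc (Suc m))) q (\<lambda>k. mres (W (B - int (Suc (Suc m)))) V V' (c k))"
    using W.trivialized_basis[OF W.trivialized_on_subset[OF q V(1,2)]] by blast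
  define T where "T = (\<lambda>k. (b k, \<zero>\<^bsub>FW V (Suc (Suc m))\<^esub>)) ` {..<p} \<union> (\<lambda>k. (\<zero>\<^bsub>FE V (Suc m)\<^esub>, c k)) ` {..<q}"
  have T: "finite T" "T \<subseteq> carrier ?C" using b(1) c(1) M.zero_closed N.zero_closed
    by (auto simp: T_def c.carrier_cone module_basis_def)
  define defect where "defect t = t \<oplus>\<^bsub>?C\<^esub> (\<ominus>\<^bsub>?C\<^esub> S m (cone_dV V m t))" for t
  have def: "defect t \<in> carrier ?C" "cone_dV V m (defect t) = \<zero>\<^bsub>coneV V m\<^esub>" if "t \<in> T" for t
    using c.cone_defect_cycle[OF S mL(1) subsetD[OF T(2) that]] unfolding defect_def by auto
  let ?P = "\<lambda>t V'. \<exists>w\<in>carrier (coneV V' (Suc (Suc m))). cone_dV V' (Suc m) w = cone_res V V' (Suc m) (defect t)"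
  \<comment> \<open>The premise \<open>t \<in> T\<close> is repeated inside the property: stability
    under shrinking uses that the defect of \<open>t\<close> is a section of the cone over
    \<open>V\<close>, which is known for members of \<open>T\<close>.\<close>
  have "\<exists>V'. open_in Z V' \<and> x \<in> V' \<and> V' \<subseteq> V \<and> (\<forall>t\<in>T. t \<in> T \<longrightarrow> ?P t V')"
  proof (rule common_neighbourhood[OF T(1) V(1,3)])
    show "\<exists>V'. open_in Z V' \<and> x \<in> V' \<and> V' \<subseteq> V \<and> (t \<in> T \<longrightarrow> ?P t V')" if "t \<in> T" for t
      using cone_locally_exact[OF V m def[OF that]] by blast
    fix t V' V''
    assume V': "open_in Z V'" "V' \<subseteq> V" and P: "t \<in> T \<longrightarrow> ?P t V'" and V'': "open_in Z V''" "V'' \<subseteq> V'"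
    have V'0: "V' \<subseteq> V0" using V' V(2) by blast
    show "t \<in> T \<longrightarrow> ?P t V''"
    proof
      assume t: "t \<in> T"
      then obtain w where w: "w \<in> carrier (coneV V' (Suc (Suc m)))" "cone_dV V' (Suc m) w = cone_res V V' (Suc m) (defect t)"
        using P by blast
      have "cone_dV V'' (Suc m) (cone_res V' V'' (Suc (Suc m)) w) = cone_res V V'' (Suc m) (defect t)"
        unfolding cone_res_d[OF V'(1) V'0 V'' m w(1)] w(2)
        by (rule cone_res_trans[OF V(1,2) V' V'' def(1)[OF t]])
      then show "?P t V''" using cone_res_closed[OF V'(1) V'0 V'' w(1)] by blast
    qed
  qed
  then obtain V' where V': "open_in Z V'" "x \<in> V'" "V' \<subseteq> V" and P: "\<And>t. t \<in> T \<Longrightarrow> ?P t V'" by blast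
  have V'0: "V' \<subseteq> V0" using V' V(2) by blast
  note VV = V(1,2) V'(1,3)
  interpret c': complex_map "sections Z V'" "FE V'" "dE V'" "FW V'" "dW V'" "aV V'" L by (rule complex_map_at[OF V'(1) V'0])
  obtain S' where S': "contractionV V' S' (Suc m)"
    and comm: "\<And>l z. l < Suc m \<Longrightarrow> z \<in> carrier (coneV V l) \<Longrightarrow> S' l (cone_res V V' l z) = cone_res V V' (Suc l) (S l z)"
    using contraction_restrict[OF VV S mL(2)] by blast
  obtain \<beta> where \<beta>: "c'.dual_basis (FE V' (Suc m)) p (\<lambda>k. mres (E (B - int (Suc m))) V V' (b k)) \<beta>"
    using c'.dual_basis_of_module_basis[OF E.mod[OF V'(1)] b(2)[rule_format, OF conjI[OF V'(1,3)]]] by blast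
  obtain \<gamma> where \<gamma>: "c'.dual_basis (FW V' (Suc (Suc m))) q (\<lambda>k. mres (W (B - int (Suc (Suc m)))) V V' (c k)) \<gamma>"
    using c'.dual_basis_of_module_basis[OF W.mod[OF V'(1)] c(2)[rule_format, OF conjI[OF V'(1,3)]]] by blast
  have "\<exists>U. c'.contraction (S'(Suc m := U)) (Suc (Suc m))"
  proof (rule c'.contraction_extend[OF S' m \<beta> \<gamma>])
    fix t' assume "t' \<in> (\<lambda>k. (mres (E (B - int (Suc m))) V V' (b k), \<zero>\<^bsub>FW V' (Suc (Suc m))\<^esub>)) ` {..<p} \<union>
        (\<lambda>k. (\<zero>\<^bsub>FE V' (Suc m)\<^esub>, mres (W (B - int (Suc (Suc m)))) V V' (c k))) ` {..<q}"
    then have "t' \<in> cone_res V V' (Suc m) ` T"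
      unfolding T_def image_Un image_image cone_res_def fst_conv snd_conv E.mres_zero[OF V(1) V'(1,3)] W.mres_zero[OF V(1) V'(1,3)] .
    then obtain t where t: "t' = cone_res V V' (Suc m) t" "t \<in> T" by blast
    have tc: "t \<in> carrier ?C" using t(2) T(2) by blast
    have Dt: "cone_dV V m t \<in> carrier (coneV V m)" by (rule linear_maps_closed[OF c.cone_d_linear[OF mL(1)] tc])
    have "S m \<in> linear_maps (sections Z V) (coneV V m) ?C" using S by (simp add: c.contraction_def)
    from linear_maps_closed[OF this Dt] have SDt: "S m (cone_dV V m t) \<in> carrier ?C" .
    \<comment> \<open>The defect formed over \<open>V'\<close> with the restricted contraction is
      the restriction of the defect over \<open>V\<close>, whose primitive is already at
      hand.\<close>
    have "cone_res V V' (Suc m) (defect t) =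
        t' \<oplus>\<^bsub>coneV V' (Suc m)\<^esub> (\<ominus>\<^bsub>coneV V' (Suc m)\<^esub> S' m (cone_dV V' m t'))"
      unfolding defect_def t(1) cone_res_add[OF VV tc C.a_inv_closed[OF SDt]] cone_res_a_inv[OF VV mL(2) SDt]
        cone_res_d[OF VV mL(1) tc] comm[OF lessI Dt] ..
    then show "\<exists>w\<in>carrier (coneV V' (Suc (Suc m))). cone_dV V' (Suc m) w =
        t' \<oplus>\<^bsub>coneV V' (Suc m)\<^esub> (\<ominus>\<^bsub>coneV V' (Suc m)\<^esub> S' m (cone_dV V' m t'))"
      using P[OF t(2)] by simp
  qed
  then show ?thesis using V' by blast
qed

text \<open>Each new degree shrinks the neighbourhood once. A full contraction could require
  infinitely many shrinkings; stopping at \<open>n\<close> keeps an open set.\<close>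

lemma contraction_locally_exists:
  assumes V0: "open_in Z V0" "x \<in> V0" and n: "n < L"
  shows "\<exists>V S. open_in Z V \<and> x \<in> V \<and> V \<subseteq> V0 \<and> contractionV V S (Suc n)"
  using n
proof (induction n)
  case 0
  interpret c: complex_map "sections Z V0" "FE V0" "dE V0" "FW V0" "dW V0" "aV V0" L
    by (rule complex_map_at[OF V0(1) order_refl])
  have "1 \<le> L" using 0 by simp
  from c.contraction_base[OF this] show ?case using V0 by blast
next
  case (Suc n)
  then obtain V S where V: "open_in Z V" "x \<in> V" "V \<subseteq> V0" "contractionV V S (Suc n)" by auto
  from contraction_locally_extends[OF V(1,3,2) Suc.prems V(4)]
  obtain V' S' where "open_in Z V'" "x \<in> V'" "V' \<subseteq> V" "contractionV V' S' (Suc (Suc n))" by blast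
  then show ?case using V(3) by blast
qed

end

section \<open>The sheaf form\<close>

locale bounded_quasi_iso =
  E: integral_sheaf_complex Z E \<delta> + W: integral_sheaf_complex Z W \<delta>' + sheaf_quasi_iso Z E \<delta> W \<delta>' \<alpha>
  for Z :: "('p, 'a) ringed_space" and E :: "int \<Rightarrow> ('p, 'a, 'e) module_sheaf" and \<delta>
    and W :: "int \<Rightarrow> ('p, 'a, 'w) module_sheaf" and \<delta>' and \<alpha> +
  assumes bounded_E: "cochain_bounded_above Z E" and bounded_W: "cochain_bounded_above Z W"
begin

lemma minor_ideals_agree_locally:
  assumes U: "open_in Z U" "x \<in> U"
  shows "\<exists>V. open_in Z V \<and> x \<in> V \<and> V \<subseteq> U \<and>
    (\<forall>j\<in>{i, i + 1}. (\<exists>n. trivialized_on Z (E j) V n) \<and> (\<exists>n. trivialized_on Z (W j) V n)) \<and>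
    minor_ideal (sections Z V) (msections (E i) V) (msections (E (i + 1)) V) (\<delta> i V) (cochain_chi Z E i - k) =
    minor_ideal (sections Z V) (msections (W i) V) (msections (W (i + 1)) V) (\<delta>' i V) (cochain_chi Z W i - k)"
proof -
  obtain N where N: "\<And>j U. N < j \<Longrightarrow> open_in Z U \<Longrightarrow> carrier (msections (E j) U) = {\<zero>\<^bsub>msections (E j) U\<^esub>}"
    using bounded_E unfolding cochain_bounded_above_def by blast
  obtain N' where N': "\<And>j U. N' < j \<Longrightarrow> open_in Z U \<Longrightarrow> carrier (msections (W j) U) = {\<zero>\<^bsub>msections (W j) U\<^esub>}"
    using bounded_W unfolding cochain_bounded_above_def by blast
  \<comment> \<open>\<open>B\<close> is the cochain degree with index zero. The offset 3 places
    \<open>B - 1\<close> beyond both bounds and makes \<open>n\<close> at least 2.\<close>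
  define B where "B = max (max N N') i + 3"
  define n where "n = nat (B - 1 - i)"
  have n: "n \<noteq> 0" "B - int n = i + 1" "B - int (Suc n) = i" by (auto simp: n_def B_def)
  have B: "N < B - 1" "N' < B - 1" by (auto simp: B_def)
  \<comment> \<open>The stretch has \<open>L = Suc n\<close> and its terms reach index
    \<open>Suc L\<close>.\<close>
  let ?J = "(\<lambda>m. B - int m) ` {..Suc (Suc n)}"
  obtain V1 where V1: "open_in Z V1" "x \<in> V1" "V1 \<subseteq> U" "\<forall>j\<in>?J. \<exists>n. trivialized_on Z (E j) V1 n"
    using E.finitely_many_trivialized[of ?J U x] U by auto
  obtain V0 where V0: "open_in Z V0" "x \<in> V0" "V0 \<subseteq> V1" "\<forall>j\<in>?J. \<exists>n. trivialized_on Z (W j) V0 n"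
    using W.finitely_many_trivialized[of ?J V1 x] V1 by auto
  have tE: "\<exists>p. trivialized_on Z (E (B - int m)) V0 p" if "m \<le> Suc (Suc n)" for m
    using V1(4) E.trivialized_on_subset[OF _ V0(1,3)] that by blast
  have tW: "\<exists>p. trivialized_on Z (W (B - int m)) V0 p" if "m \<le> Suc (Suc n)" for m
    using V0(4) that by blast
  interpret l: local_complexes Z E \<delta> W \<delta>' \<alpha> B "Suc n" V0
    by unfold_locales (use N N' B tE tW in auto)
  obtain V S where V: "open_in Z V" "x \<in> V" "V \<subseteq> V0"
    and S: "l.contractionV V S (Suc n)"
    using l.contraction_locally_exists[OF V0(1,2) lessI] by blast
  interpret c: complex_map "sections Z V" "l.FE V" "l.dE V" "l.FW V" "l.dW V" "l.aV V" "Suc n"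
    by (rule l.complex_map_at[OF V(1,3)])
  have ne: "V \<noteq> {}" using V(2) by blast
  have tE': "\<exists>p. trivialized_on Z (E (B - int m)) V p" if "m \<le> Suc (Suc n)" for m
    using tE[OF that] E.trivialized_on_subset[OF _ V(1,3)] by blast
  have tW': "\<exists>p. trivialized_on Z (W (B - int m)) V p" if "m \<le> Suc (Suc n)" for m
    using tW[OF that] W.trivialized_on_subset[OF _ V(1,3)] by blast
  have rk: "c.rk m = sheaf_rank Z (E (B - int m))" if "m \<le> Suc (Suc n)" for m
    using tE'[OF that] E.free_rank_eq[OF _ ne] by blast
  have rk': "c.rk' m = sheaf_rank Z (W (B - int m))" if "m \<le> Suc (Suc n)" for m
    using tW'[OF that] W.free_rank_eq[OF _ ne] by blast
  \<comment> \<open>The comparison asks for the recursion at every index, while the ranks over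
    \<open>V\<close> are known to be the sheaf ranks only in the trivialized stretch. So \<chi> and
    \<chi>' are defined by the recursion and identified with the characteristics of the sheaves up
    to \<open>Suc n\<close>.\<close>
  define \<chi> \<chi>' where "\<chi> = rec_nat 0 (\<lambda>m c. int (c.rk m) - c)" and "\<chi>' = rec_nat 0 (\<lambda>m c. int (c.rk' m) - c)"
  have \<chi>: "\<chi> 0 = 0" "\<chi> (Suc m) = int (c.rk m) - \<chi> m" and \<chi>': "\<chi>' 0 = 0" "\<chi>' (Suc m) = int (c.rk' m) - \<chi>' m" for m
    by (simp_all add: \<chi>_def \<chi>'_def)
  \<comment> \<open>An index below \<open>2 - B\<close> is the negative of a cochain degree of at
    least \<open>B - 1\<close>, where the sheaf is zero.\<close>
  have r0: "sheaf_rank Z (E (- j)) = 0" if "j < 2 - B" for j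
    by (rule E.sheaf_rank_trivial, rule N) (use that B in auto)
  have r0': "sheaf_rank Z (W (- j)) = 0" if "j < 2 - B" for j
    by (rule W.sheaf_rank_trivial, rule N') (use that B in auto)
  have index: "- (B - int (Suc m)) = - (B - int m) + 1" for m by simp
  have chi: "\<chi> m = cochain_chi Z E (B - int m)" if "m \<le> Suc n" for m
    using that
  proof (induction m)
    case 0
    have "alternating_sum (\<lambda>j. sheaf_rank Z (E (- j))) (- (B - int 0)) = 0"
      by (rule alternating_sum_low[of "2 - B"], rule r0) auto
    then show ?case by (simp add: E.cochain_chi_eq \<chi>)
  next
    case (Suc m)
    have "alternating_sum (\<lambda>j. sheaf_rank Z (E (- j))) (- (B - int m) + 1) =
        int (sheaf_rank Z (E (- (- (B - int m))))) - alternating_sum (\<lambda>j. sheaf_rank Z (E (- j))) (- (B - int m))"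
      by (rule alternating_sum_step[of "2 - B"], rule r0)
    then show ?case
      using Suc rk[of m] unfolding E.cochain_chi_eq index \<chi>(2) by simp
  qed
  have chi': "\<chi>' m = cochain_chi Z W (B - int m)" if "m \<le> Suc n" for m
    using that
  proof (induction m)
    case 0
    have "alternating_sum (\<lambda>j. sheaf_rank Z (W (- j))) (- (B - int 0)) = 0"
      by (rule alternating_sum_low[of "2 - B"], rule r0') auto
    then show ?case by (simp add: W.cochain_chi_eq \<chi>')
  next
    case (Suc m)
    have "alternating_sum (\<lambda>j. sheaf_rank Z (W (- j))) (- (B - int m) + 1) =
        int (sheaf_rank Z (W (- (- (B - int m))))) - alternating_sum (\<lambda>j. sheaf_rank Z (W (- j))) (- (B - int m))"
      by (rule alternating_sum_step[of "2 - B"], rule r0')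
    then show ?case
      using Suc rk'[of m] unfolding W.cochain_chi_eq index \<chi>'(2) by simp
  qed
  have "minor_ideal (sections Z V) (l.FE V (Suc n)) (l.FE V n) (l.dE V n) (\<chi> (Suc n) - k) =
      minor_ideal (sections Z V) (l.FW V (Suc n)) (l.FW V n) (l.dW V n) (\<chi>' (Suc n) - k)"
    by (rule c.minor_ideal_eq[OF n(1) lessI S \<chi> \<chi>'])
  then have eq: "minor_ideal (sections Z V) (msections (E i) V) (msections (E (i + 1)) V) (\<delta> i V) (cochain_chi Z E i - k) =
    minor_ideal (sections Z V) (msections (W i) V) (msections (W (i + 1)) V) (\<delta>' i V) (cochain_chi Z W i - k)"
    unfolding chi[OF order_refl] chi'[OF order_refl] n(2,3) .
  have "(\<exists>p. trivialized_on Z (E j) V p) \<and> (\<exists>p. trivialized_on Z (W j) V p)" if "j \<in> {i, i + 1}" for j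
    using tE'[of n] tE'[of "Suc n"] tW'[of n] tW'[of "Suc n"] that unfolding n(2,3) by auto
  with eq show ?thesis using V V0(3) V1(3) by (intro exI[of _ V]) auto
qed

text \<open>A section belongs to the ideal sheaf if each point has a neighbourhood on which it lies
  in the ideal of minors. Such a neighbourhood for one complex is shrunk to one where the two ideals
  coincide; membership survives because ideals of minors restrict to ideals of minors.\<close>

lemma cochain_Fitt_eq:
  assumes U: "open_in Z U"
  shows "cochain_Fitt Z E \<delta> k i U = cochain_Fitt Z W \<delta>' k i U"
proof -
  let ?mE = "cochain_chi Z E i - k" and ?mW = "cochain_chi Z W i - k"
  let ?IE = "\<lambda>V. minor_ideal (sections Z V) (msections (E i) V) (msections (E (i + 1)) V) (\<delta> i V) ?mE"
  let ?IW = "\<lambda>V. minor_ideal (sections Z V) (msections (W i) V) (msections (W (i + 1)) V) (\<delta>' i V) ?mW"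
  have "(\<exists>V. x \<in> V \<and> V \<subseteq> U \<and> (\<exists>n. trivialized_on Z (E i) V n) \<and> (\<exists>n. trivialized_on Z (E (i + 1)) V n) \<and> res Z U V s \<in> ?IE V) \<longleftrightarrow>
      (\<exists>V. x \<in> V \<and> V \<subseteq> U \<and> (\<exists>n. trivialized_on Z (W i) V n) \<and> (\<exists>n. trivialized_on Z (W (i + 1)) V n) \<and> res Z U V s \<in> ?IW V)"
    if s: "s \<in> carrier (sections Z U)" and x: "x \<in> U" for s x
  proof
    assume "\<exists>V. x \<in> V \<and> V \<subseteq> U \<and> (\<exists>n. trivialized_on Z (E i) V n) \<and> (\<exists>n. trivialized_on Z (E (i + 1)) V n) \<and> res Z U V s \<in> ?IE V"
    then obtain V p q where V: "x \<in> V" "V \<subseteq> U" "trivialized_on Z (E i) V p" "trivialized_on Z (E (i + 1)) V q" "res Z U V s \<in> ?IE V"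
      by blast
    have o: "open_in Z V" using V(3) by (simp add: trivialized_on_def)
    obtain V' where V': "open_in Z V'" "x \<in> V'" "V' \<subseteq> V" "\<exists>n. trivialized_on Z (W i) V' n" "\<exists>n. trivialized_on Z (W (i + 1)) V' n"
      "?IE V' = ?IW V'" using minor_ideals_agree_locally[OF o V(1), of i k] by auto
    have "res Z V V' (res Z U V s) \<in> ?IE V'" by (rule E.minor_ideal_restrict[OF V(3,4) V'(1,3) V(5)])
    then have "res Z U V' s \<in> ?IW V'" unfolding E.res_trans[OF U o V'(1,3) V(2) s] V'(6) .
    then show "\<exists>V. x \<in> V \<and> V \<subseteq> U \<and> (\<exists>n. trivialized_on Z (W i) V n) \<and> (\<exists>n. trivialized_on Z (W (i + 1)) V n) \<and> res Z U V s \<in> ?IW V"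
      using V'(2-5) V(2) by (intro exI[of _ V']) auto
  next
    assume "\<exists>V. x \<in> V \<and> V \<subseteq> U \<and> (\<exists>n. trivialized_on Z (W i) V n) \<and> (\<exists>n. trivialized_on Z (W (i + 1)) V n) \<and> res Z U V s \<in> ?IW V"
    then obtain V p q where V: "x \<in> V" "V \<subseteq> U" "trivialized_on Z (W i) V p" "trivialized_on Z (W (i + 1)) V q" "res Z U V s \<in> ?IW V"
      by blast
    have o: "open_in Z V" using V(3) by (simp add: trivialized_on_def)
    obtain V' where V': "open_in Z V'" "x \<in> V'" "V' \<subseteq> V" "\<exists>n. trivialized_on Z (E i) V' n" "\<exists>n. trivialized_on Z (E (i + 1)) V' n"
      "?IE V' = ?IW V'" using minor_ideals_agree_locally[OF o V(1), of i k] by auto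
    have "res Z V V' (res Z U V s) \<in> ?IW V'" by (rule W.minor_ideal_restrict[OF V(3,4) V'(1,3) V(5)])
    then have "res Z U V' s \<in> ?IE V'" unfolding E.res_trans[OF U o V'(1,3) V(2) s] V'(6) .
    then show "\<exists>V. x \<in> V \<and> V \<subseteq> U \<and> (\<exists>n. trivialized_on Z (E i) V n) \<and> (\<exists>n. trivialized_on Z (E (i + 1)) V n) \<and> res Z U V s \<in> ?IE V"
      using V'(2-5) V(2) by (intro exI[of _ V']) auto
  qed
  then show ?thesis unfolding cochain_Fitt_def minor_ideal_sheaf_def by (intro Collect_cong conj_cong ball_cong refl) auto
qed

end

theorem theorem4p2:
  fixes R :: "'r ring"
    and F :: "int \<Rightarrow> ('r, 'b) module" and d :: "int \<Rightarrow> 'b \<Rightarrow> 'b"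
    and F' :: "int \<Rightarrow> ('r, 'c) module" and d' :: "int \<Rightarrow> 'c \<Rightarrow> 'c"
    and a :: "int \<Rightarrow> 'b \<Rightarrow> 'c"
    and K :: "'k ring" and Z :: "('p, 'a) ringed_space"
    and f :: "'p \<Rightarrow> 'k set" and h :: "'k set set \<Rightarrow> ('k set \<Rightarrow> ('k \<times> 'k) set) \<Rightarrow> 'a"
    and E :: "int \<Rightarrow> ('p, 'a, 'e) module_sheaf" and \<delta> :: "int \<Rightarrow> 'p set \<Rightarrow> 'e \<Rightarrow> 'e"
    and W :: "int \<Rightarrow> ('p, 'a, 'w) module_sheaf" and \<delta>' :: "int \<Rightarrow> 'p set \<Rightarrow> 'w \<Rightarrow> 'w"
    and \<alpha> :: "int \<Rightarrow> 'p set \<Rightarrow> 'e \<Rightarrow> 'w"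
  shows
    "(cring R \<and> noetherian_ring R \<and>
      free_chain_complex R F d \<and> chain_bounded_above F \<and>
      free_chain_complex R F' d' \<and> chain_bounded_above F' \<and>
      chain_quasi_iso R F d F' d' a \<longrightarrow>
        (\<forall>i k. chain_Fitt R F d k i = chain_Fitt R F' d' k i))
     \<and>
     (projective_variety K Z f h \<and>
      locally_free_complex Z E \<delta> \<and> cochain_bounded_above Z E \<and>
      locally_free_complex Z W \<delta>' \<and> cochain_bounded_above Z W \<and>
      cochain_quasi_iso Z E \<delta> W \<delta>' \<alpha> \<longrightarrow>
        (\<forall>i k U. open_in Z U \<longrightarrow> cochain_Fitt Z E \<delta> k i U = cochain_Fitt Z W \<delta>' k i U))"
proof (intro conjI impI allI; elim conjE)
  fix i k
  assume "cring R" "free_chain_complex R F d" "chain_bounded_above F"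
    "free_chain_complex R F' d'" "chain_bounded_above F'" "chain_quasi_iso R F d F' d' a"
  then show "chain_Fitt R F d k i = chain_Fitt R F' d' k i" by (rule chain_Fitt_quasi_iso)
next
  fix i k U
  assume var: "projective_variety K Z f h"
    and E: "locally_free_complex Z E \<delta>" "cochain_bounded_above Z E"
    and W: "locally_free_complex Z W \<delta>'" "cochain_bounded_above Z W"
    and qi: "cochain_quasi_iso Z E \<delta> W \<delta>' \<alpha>" and U: "open_in Z U"
  have "integral_scheme Z" using var by (simp add: projective_variety_def variety_def)
  then have "integral_space Z"
    by (auto simp: integral_scheme_def is_scheme_def intro!: integral_space.intro)
  then interpret bounded_quasi_iso Z E \<delta> W \<delta>' \<alpha>
    using E W qi
    by (simp add: bounded_quasi_iso_def bounded_quasi_iso_axioms_def integral_sheaf_complex_def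
        sheaf_complex_def sheaf_quasi_iso_def sheaf_quasi_iso_axioms_def)
  show "cochain_Fitt Z E \<delta> k i U = cochain_Fitt Z W \<delta>' k i U" by (rule cochain_Fitt_eq[OF U])
qed

end
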